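(* Let $F$ be a field of characteristic zero and let $\mathcal V$ be a variety of associative $F$-algebras. Let $\mathcal L=\{A_1,A_1^*\}$ and $\mathcal Q=\{A_2,A_4,A_4^*,A_5,A_6\}$ be the families of matrix algebras over $F$ defined in the context. Then $\mathcal V$ has quadratic codimension growth if and only if $\mathcal V$ is generated by an algebra of the form $$N\oplus\bigoplus_{M\in\mathcal S}M,$$ where $N$ is a nilpotent $F$-algebra and $\mathcal S\subseteq\mathcal L\cup\mathcal Q$ satisfies $\mathcal S\cap\mathcal Q\neq\emptyset$.
   Context: All algebras are associative $F$-algebras, not necessarily unital; the zero algebra is allowed as a nilpotent algebra. Let $F\langle X\rangle$ be the free associative algebra on $X=\{x_1,x_2,\dots\}$ (polynomials without constant term, since algebras need not be unital). $\operatorname{Id}(A)$ denotes the ideal of polynomial identities of an algebra $A$, i.e. the $f(x_1,\dots,x_n)\in F\langle X\rangle$ with $f(a_1,\dots,a_n)=0$ for all $a_i\in A$. A variety is the class of all algebras satisfying a given set of polynomial identities; the variety generated by $A$ is $\operatorname{var}(A)=\{B\mid \operatorname{Id}(A)\subseteq\operatorname{Id}(B)\}$. For $n\ge1$, $P_n$ is the space of multilinear polynomials in $x_1,\dots,x_n$ and $c_n(A)=\dim_F P_n/(P_n\cap\operatorname{Id}(A))$. If $\mathcal V=\operatorname{var}(A)$, put $c_n(\mathcal V)=c_n(A)$. The codimension growth is of degree $d$ if there are constants $a,b>0$ and $n_0$ with $an^d\le c_n\le bn^d$ for all $n\ge n_0$; it is quadratic if $d=2$. Model algebras ($e_{ij}$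 are matrix units). Inside upper triangular $2\times2$ matrices: $A_1=Fe_{11}+Fe_{12}$, $A_1^*=Fe_{22}+Fe_{12}$. Inside upper triangular $3\times 3$ matrices: $A_2=F(e_{11}+e_{22}+e_{33})+Fe_{12}+Fe_{13}+Fe_{23}$, $A_4=Fe_{11}+Fe_{12}+Fe_{13}+Fe_{23}$, $A_4^*=Fe_{33}+Fe_{12}+Fe_{13}+Fe_{23}$, $A_5=Fe_{22}+Fe_{12}+Fe_{13}+Fe_{23}$, $A_6=F(e_{11}+e_{33})+Fe_{12}+Fe_{13}+Fe_{23}$. *)

theory Defs
  imports "HOL-Library.Poly_Mapping" "Jordan_Normal_Form.Matrix"
begin

text \<open>
  Algebras over the field of a type class are records of type \<open>('f, 'a) module\<close> of HOL-Algebra.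
  They need not be unital: the record field \<open>one\<close> carries no meaning and is never used.
\<close>

locale assoc_algebra = abelian_group A for A :: "('f::field, 'a) module" (structure) +
  assumes mult_closed: "\<lbrakk>x \<in> carrier A; y \<in> carrier A\<rbrakk> \<Longrightarrow> x \<otimes> y \<in> carrier A"
    and mult_assoc: "\<lbrakk>x \<in> carrier A; y \<in> carrier A; z \<in> carrier A\<rbrakk> \<Longrightarrow> (x \<otimes> y) \<otimes> z = x \<otimes> (y \<otimes> z)"
    and mult_l_distr: "\<lbrakk>x \<in> carrier A; y \<in> carrier A; z \<in> carrier A\<rbrakk> \<Longrightarrow> (x \<oplus> y) \<otimes> z = x \<otimes> z \<oplus> y \<otimes> z"
    and mult_r_distr: "\<lbrakk>x \<in> carrier A; y \<in> carrier A; z \<in> carrier A\<rbrakk> \<Longrightarrow> z \<otimes> (x \<oplus> y) = z \<otimes> x \<oplus> z \<otimes> y"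
    and scale_closed: "x \<in> carrier A \<Longrightarrow> c \<odot>\<^bsub>A\<^esub> x \<in> carrier A"
    and scale_l_distr: "x \<in> carrier A \<Longrightarrow> (c + d) \<odot>\<^bsub>A\<^esub> x = (c \<odot>\<^bsub>A\<^esub> x) \<oplus> (d \<odot>\<^bsub>A\<^esub> x)"
    and scale_r_distr: "\<lbrakk>x \<in> carrier A; y \<in> carrier A\<rbrakk> \<Longrightarrow> c \<odot>\<^bsub>A\<^esub> (x \<oplus> y) = (c \<odot>\<^bsub>A\<^esub> x) \<oplus> (c \<odot>\<^bsub>A\<^esub> y)"
    and scale_scale: "x \<in> carrier A \<Longrightarrow> (c * d) \<odot>\<^bsub>A\<^esub> x = c \<odot>\<^bsub>A\<^esub> (d \<odot>\<^bsub>A\<^esub> x)"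
    and scale_one: "x \<in> carrier A \<Longrightarrow> 1 \<odot>\<^bsub>A\<^esub> x = x"
    and scale_mult_left: "\<lbrakk>x \<in> carrier A; y \<in> carrier A\<rbrakk> \<Longrightarrow> (c \<odot>\<^bsub>A\<^esub> x) \<otimes> y = c \<odot>\<^bsub>A\<^esub> (x \<otimes> y)"
    and scale_mult_right: "\<lbrakk>x \<in> carrier A; y \<in> carrier A\<rbrakk> \<Longrightarrow> x \<otimes> (c \<odot>\<^bsub>A\<^esub> y) = c \<odot>\<^bsub>A\<^esub> (x \<otimes> y)"

text \<open>
  The product of a nonempty list of elements. The value at the empty list is a dummy: for lack of a
  unit there is no empty product.
\<close>

fun list_mult :: "('f, 'a) module \<Rightarrow> 'a list \<Rightarrow> 'a" where
  "list_mult A [] = \<zero>\<^bsub>A\<^esub>"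
| "list_mult A [x] = x"
| "list_mult A (x # y # ys) = x \<otimes>\<^bsub>A\<^esub> list_mult A (y # ys)"

definition nilpotent_algebra :: "('f::field, 'a) module \<Rightarrow> bool" where
  "nilpotent_algebra A \<longleftrightarrow> assoc_algebra A \<and>
     (\<exists>k\<ge>1. \<forall>xs. length xs = k \<and> set xs \<subseteq> carrier A \<longrightarrow> list_mult A xs = \<zero>\<^bsub>A\<^esub>)"


section \<open>Polynomial identities and codimensions\<close>

text \<open>
  A noncommutative polynomial is a finitely supported family of coefficients indexed by words; the
  letter \<open>i\<close> of a word stands for the variable \<open>x\<^sub>i\<^sub>+\<^sub>1\<close>. The elements of the free algebra are
  those with zero coefficient at the empty word.
\<close>

type_synonym 'f nc_poly = "nat list \<Rightarrow>\<^sub>0 'f"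

definition free_algebra :: "'f::zero nc_poly set" where
  "free_algebra = {f. Poly_Mapping.lookup f [] = 0}"

definition poly_eval :: "('f::zero, 'a) module \<Rightarrow> (nat \<Rightarrow> 'a) \<Rightarrow> 'f nc_poly \<Rightarrow> 'a" where
  "poly_eval A a f = (\<Oplus>\<^bsub>A\<^esub>w\<in>Poly_Mapping.keys f. Poly_Mapping.lookup f w \<odot>\<^bsub>A\<^esub> list_mult A (map a w))"

definition identities :: "('f::field, 'a) module \<Rightarrow> 'f nc_poly set" where
  "identities A = {f \<in> free_algebra. \<forall>a. range a \<subseteq> carrier A \<longrightarrow> poly_eval A a f = \<zero>\<^bsub>A\<^esub>}"

definition multilinear_polys :: "nat \<Rightarrow> 'f::zero nc_poly set" where
  "multilinear_polys n = {f \<in> free_algebra. \<forall>w\<in>Poly_Mapping.keys f. distinct w \<and> set w = {..<n}}"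

definition scale_poly :: "'f::field \<Rightarrow> 'f nc_poly \<Rightarrow> 'f nc_poly" where
  "scale_poly c f = Poly_Mapping.map ((*) c) f"

text \<open>
  \<open>B\<close> is a finite set of representatives of the elements of a basis of the quotient space \<open>U / W\<close>
  (for subspaces \<open>W \<subseteq> U\<close>); distinct elements of \<open>B\<close> then lie in distinct cosets.
\<close>

definition quotient_basis :: "'f::field nc_poly set \<Rightarrow> 'f nc_poly set \<Rightarrow> 'f nc_poly set \<Rightarrow> bool" where
  "quotient_basis U W B \<longleftrightarrow> finite B \<and> B \<subseteq> U \<and>
     (\<forall>u\<in>U. \<exists>c. u - (\<Sum>b\<in>B. scale_poly (c b) b) \<in> W) \<and>
     (\<forall>c. (\<Sum>b\<in>B. scale_poly (c b) b) \<in> W \<longrightarrow> (\<forall>b\<in>B. c b = 0))"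

definition quotient_dim :: "'f::field nc_poly set \<Rightarrow> 'f nc_poly set \<Rightarrow> nat" where
  "quotient_dim U W = (THE d. \<exists>B. quotient_basis U W B \<and> card B = d)"

definition codim :: "('f::field, 'a) module \<Rightarrow> nat \<Rightarrow> nat" where
  "codim A n = quotient_dim (multilinear_polys n) (multilinear_polys n \<inter> identities A)"

definition growth_of_degree :: "nat \<Rightarrow> (nat \<Rightarrow> nat) \<Rightarrow> bool" where
  "growth_of_degree d c \<longleftrightarrow> (\<exists>a b :: real. \<exists>n\<^sub>0. a > 0 \<and> b > 0 \<and>
     (\<forall>n\<ge>n\<^sub>0. a * real n ^ d \<le> real (c n) \<and> real (c n) \<le> b * real n ^ d))"


section \<open>Varieties\<close>

text \<open>
  Varieties are classes of algebras whose carriers are sets over a fixed type \<open>'u\<close>. This is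
  adequate when \<open>'u\<close> is large enough to contain a copy of the free algebra: then every variety
  contains its relatively free algebra (up to isomorphism), and so is generated by one of its
  members and determines its identities. The generating algebra of \<open>variety_gen\<close> may have a carrier
  of any type.
\<close>

definition is_variety :: "('f::field, 'u) module set \<Rightarrow> bool" where
  "is_variety V \<longleftrightarrow> (\<exists>\<Sigma> \<subseteq> free_algebra. V = {B. assoc_algebra B \<and> \<Sigma> \<subseteq> identities B})"

definition variety_gen :: "('f::field, 'a) module \<Rightarrow> ('f, 'u) module set" where
  "variety_gen A = {B. assoc_algebra B \<and> identities A \<subseteq> identities B}"

definition codim_variety :: "('f::field, 'u) module set \<Rightarrow> nat \<Rightarrow> nat" where
  "codim_variety V n =
     (THE c. \<exists>A :: ('f, 'u) module. assoc_algebra A \<and> V = variety_gen A \<and> c = codim A n)"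

definition quadratic_growth :: "('f::field, 'u) module set \<Rightarrow> bool" where
  "quadratic_growth V \<longleftrightarrow> growth_of_degree 2 (codim_variety V)"


section \<open>Direct sums\<close>

definition direct_sum2 :: "('f, 'a) module \<Rightarrow> ('f, 'b) module \<Rightarrow> ('f, 'a \<times> 'b) module" where
  "direct_sum2 A B =
     \<lparr>carrier = carrier A \<times> carrier B,
      mult = (\<lambda>(x, y) (x', y'). (x \<otimes>\<^bsub>A\<^esub> x', y \<otimes>\<^bsub>B\<^esub> y')),
      one = (\<one>\<^bsub>A\<^esub>, \<one>\<^bsub>B\<^esub>),
      zero = (\<zero>\<^bsub>A\<^esub>, \<zero>\<^bsub>B\<^esub>),
      add = (\<lambda>(x, y) (x', y'). (x \<oplus>\<^bsub>A\<^esub> x', y \<oplus>\<^bsub>B\<^esub> y')),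
      smult = (\<lambda>c (x, y). (c \<odot>\<^bsub>A\<^esub> x, c \<odot>\<^bsub>B\<^esub> y))\<rparr>"

text \<open>The direct sum of a finite set of algebras, indexed by the algebras themselves.\<close>

definition direct_sum_set ::
    "('f, 'a) module set \<Rightarrow> ('f, ('f, 'a) module \<Rightarrow> 'a) module" where
  "direct_sum_set S =
     \<lparr>carrier = (\<Pi>\<^sub>E M\<in>S. carrier M),
      mult = (\<lambda>f g. \<lambda>M\<in>S. f M \<otimes>\<^bsub>M\<^esub> g M),
      one = (\<lambda>M\<in>S. \<one>\<^bsub>M\<^esub>),
      zero = (\<lambda>M\<in>S. \<zero>\<^bsub>M\<^esub>),
      add = (\<lambda>f g. \<lambda>M\<in>S. f M \<oplus>\<^bsub>M\<^esub> g M),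
      smult = (\<lambda>c f. \<lambda>M\<in>S. c \<odot>\<^bsub>M\<^esub> f M)\<rparr>"


section \<open>The model algebras\<close>

text \<open>Matrix units, with rows and columns numbered from 1.\<close>

definition mat_unit :: "nat \<Rightarrow> nat \<Rightarrow> nat \<Rightarrow> 'f::field mat" where
  "mat_unit n i j = mat n n (\<lambda>(r, s). if r + 1 = i \<and> s + 1 = j then 1 else 0)"

abbreviation "e2 \<equiv> mat_unit 2"
abbreviation "e3 \<equiv> mat_unit 3"

definition matrix_algebra :: "nat \<Rightarrow> 'f::field mat set \<Rightarrow> ('f, 'f mat) module" where
  "matrix_algebra n C = (module_mat TYPE('f) n n)\<lparr>carrier := C\<rparr>"

definition A1 :: "('f::field, 'f mat) module" where
  "A1 = matrix_algebra 2 {a \<cdot>\<^sub>m e2 1 1 + b \<cdot>\<^sub>m e2 1 2 | a b. True}"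

definition A1_star :: "('f::field, 'f mat) module" where
  "A1_star = matrix_algebra 2 {a \<cdot>\<^sub>m e2 2 2 + b \<cdot>\<^sub>m e2 1 2 | a b. True}"

definition A2 :: "('f::field, 'f mat) module" where
  "A2 = matrix_algebra 3
     {a \<cdot>\<^sub>m (e3 1 1 + e3 2 2 + e3 3 3) + b \<cdot>\<^sub>m e3 1 2 + c \<cdot>\<^sub>m e3 1 3 + d \<cdot>\<^sub>m e3 2 3 | a b c d. True}"

definition A4 :: "('f::field, 'f mat) module" where
  "A4 = matrix_algebra 3
     {a \<cdot>\<^sub>m e3 1 1 + b \<cdot>\<^sub>m e3 1 2 + c \<cdot>\<^sub>m e3 1 3 + d \<cdot>\<^sub>m e3 2 3 | a b c d. True}"

definition A4_star :: "('f::field, 'f mat) module" where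
  "A4_star = matrix_algebra 3
     {a \<cdot>\<^sub>m e3 3 3 + b \<cdot>\<^sub>m e3 1 2 + c \<cdot>\<^sub>m e3 1 3 + d \<cdot>\<^sub>m e3 2 3 | a b c d. True}"

definition A5 :: "('f::field, 'f mat) module" where
  "A5 = matrix_algebra 3
     {a \<cdot>\<^sub>m e3 2 2 + b \<cdot>\<^sub>m e3 1 2 + c \<cdot>\<^sub>m e3 1 3 + d \<cdot>\<^sub>m e3 2 3 | a b c d. True}"

definition A6 :: "('f::field, 'f mat) module" where
  "A6 = matrix_algebra 3
     {a \<cdot>\<^sub>m (e3 1 1 + e3 3 3) + b \<cdot>\<^sub>m e3 1 2 + c \<cdot>\<^sub>m e3 1 3 + d \<cdot>\<^sub>m e3 2 3 | a b c d. True}"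

definition linear_family :: "('f::field, 'f mat) module set" where
  "linear_family = {A1, A1_star}"

definition quadratic_family :: "('f::field, 'f mat) module set" where
  "quadratic_family = {A2, A4, A4_star, A5, A6}"

end

theory Submission
  imports Defs "HOL-Combinatorics.Permutations"
begin

text \<open>
  Work dually: a T-ideal \<open>T\<close> is determined by the functions \<open>\<phi>\<close> on words that vanish on it. If the
  codimensions are bounded by a quadratic polynomial, counting characters of commuting pair swaps
  forces products of six (skew and symmetric) letter exchanges, and then of three skew ones, to
  annihilate every such \<open>\<phi>\<close> on long words. Symmetrizing over all letters but two then shows that a
  multilinear \<open>f\<close> of large degree lies in \<open>T\<close> as soon as it does after identifying all letters but
  any two. On words with only two distinguished letters the three skew exchanges make \<open>\<phi>\<close> affine up to
  boundary terms, whose coefficients are paired with elementary statistics of the words of \<open>f\<close> (first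
  or last letter, first or last two letters, outer letters, adjacent letters, order of two letters).
  Each statistic is exactly what one model algebra sees, and it is killed by \<open>T\<close> as soon as \<open>T\<close> is not
  contained in the identities of that model. Hence in large degrees \<open>T\<close> is the intersection of the
  identities of the models containing it, one of which is quadratic since otherwise the growth would be
  at most linear, and the low degrees are supplied by a nilpotent quotient of the free algebra. The
  converse is a count of the statistics.
\<close>

section \<open>Letter exchanges\<close>

text \<open>For at least six letters, three disjoint skew exchanges annihilate exactly those
  irreducible modules of the symmetric group whose diagram has at most two boxes below the first
  row, and symmetrizing over all letters but two detects each of these. Below, sums over exchanges
  replace this theory.

  Counting characters only excludes joint eigenfunctions with at least three signs of each kind. The
  unwanted remaining case, almost all signs skew, falls to substitution: exchanging two blocks of
  two letters is a product of two letter exchanges, so two skew signs multiply to a symmetric one.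

  As there is no unit, only nonempty words may be substituted for letters. The ends of a word and
  the gap between two letters therefore cannot be cleared by deleting letters, and boundary terms
  survive in the affine formula; they are what the models without a unit see.

  Passing to functionals on words reduces statements about T-ideals to linear relations between
  values at single words, over any field of characteristic zero.\<close>

definition dm :: "nat => nat => ((nat => 'x) => 'v::ab_group_add) => (nat => 'x) => 'v" where
 "dm i j F = (%c. F c - F (c o transpose i j))"

definition dp :: "nat => nat => ((nat => 'x) => 'v::ab_group_add) => (nat => 'x) => 'v" where
 "dp i j F = (%c. F c + F (c o transpose i j))"

definition sym_over :: "nat set => ((nat => 'x) => 'v::comm_monoid_add) => (nat => 'x) => 'v" where
 "sym_over C F = (%c. \<Sum>p | p permutes C. F (c o p))"

definition skew3_vanish :: "nat set => ((nat => 'x) => 'v::ab_group_add) => bool" where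
 "skew3_vanish A F \<longleftrightarrow> (\<forall>i1 j1 i2 j2 i3 j3 c. {i1, j1, i2, j2, i3, j3} \<subseteq> A -->
   distinct [i1, j1, i2, j2, i3, j3] --> dm i1 j1 (dm i2 j2 (dm i3 j3 F)) c = 0)"

lemma skew3_vanishD:
 "skew3_vanish A F ==> {i1, j1, i2, j2, i3, j3} \<subseteq> A ==> distinct [i1, j1, i2, j2, i3, j3] ==>
  dm i1 j1 (dm i2 j2 (dm i3 j3 F)) c = 0"
 unfolding skew3_vanish_def by blast

lemma comp_transpose_permutes:
 assumes "p permutes A"
 shows "transpose i j o p = p o transpose (inv_into UNIV p i) (inv_into UNIV p j)"
proof
 fix x
 show "(transpose i j o p) x = (p o transpose (inv_into UNIV p i) (inv_into UNIV p j)) x"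
  by (auto simp: transpose_def permutes_inverses[OF assms])
qed

lemma dm_permute:
 assumes "p permutes A"
 shows "dm i j (%c. F (c o p)) = (%c. dm (inv_into UNIV p i) (inv_into UNIV p j) F (c o p))"
 unfolding dm_def by (simp add: comp_assoc comp_transpose_permutes[OF assms])

lemma skew3_vanish_permute:
 assumes "p permutes A" "skew3_vanish A F"
 shows "skew3_vanish A (%c. F (c o p))"
 unfolding skew3_vanish_def
proof (intro allI impI)
 fix i1 j1 i2 j2 i3 j3 c
 assume s: "{i1, j1, i2, j2, i3, j3} \<subseteq> A" "distinct [i1, j1, i2, j2, i3, j3]"
 have ip: "inv_into UNIV p permutes A" using assms(1) by (rule permutes_inv)
 have m: "inv_into UNIV p x \<in> A" if "x \<in> A" for x using that ip by (simp add: permutes_in_image)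
 have d: "inv_into UNIV p x = inv_into UNIV p y \<longleftrightarrow> x = y" for x y
  using permutes_inj[OF ip] by (simp add: inj_eq)
 have "dm i1 j1 (dm i2 j2 (dm i3 j3 (%c. F (c o p)))) c
  = dm (inv_into UNIV p i1) (inv_into UNIV p j1) (dm (inv_into UNIV p i2) (inv_into UNIV p j2) (dm (inv_into UNIV p i3) (inv_into UNIV p j3) F)) (c o p)"
  by (simp add: dm_permute[OF assms(1)])
 also have "\<dots> = 0"
  by (rule skew3_vanishD[OF assms(2)]) (use s m d in auto)
 finally show "dm i1 j1 (dm i2 j2 (dm i3 j3 (%c. F (c o p)))) c = 0" .
qed

lemma dm_sum: "dm i j (%c. \<Sum>x\<in>X. F x c) = (%c. \<Sum>x\<in>X. dm i j (F x) c)"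
 unfolding dm_def by (simp add: sum_subtractf)

lemma skew3_vanish_sum:
 "(\<And>x. x \<in> X ==> skew3_vanish A (F x)) ==> skew3_vanish A (%c. \<Sum>x\<in>X. F x c)"
 unfolding skew3_vanish_def dm_sum by (auto intro!: sum.neutral)

lemma skew3_vanish_sym_over:
 assumes "skew3_vanish A F" "C \<subseteq> A"
 shows "skew3_vanish A (sym_over C F)"
 unfolding sym_over_def
 by (rule skew3_vanish_sum, rule skew3_vanish_permute)
   (use assms permutes_subset in blast)+

text \<open>The transpositions of \<open>b\<close> with the elements of \<open>C\<close>, together
  with the identity, represent the cosets of the permutations of \<open>C\<close>. So the vanishing
  of a symmetrization over one more letter becomes a balance equation for the smaller one.\<close>

lemma sym_over_insert:
 fixes F :: "(nat => 'x) => 'v::ab_group_add"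
 assumes "finite C" "b ~: C" "sym_over (insert b C) F c = 0"
 shows "(\<Sum>k\<in>C. sym_over C F (c o transpose b k)) = - sym_over C F c"
proof -
 have "sym_over (insert b C) F c
   = (\<Sum>k\<in>insert b C. \<Sum>q | q permutes C. F (c o (transpose b k o q)))"
  unfolding sym_over_def by (rule sum_over_permutations_insert[OF assms(1,2)])
 also have "\<dots> = sym_over C F c + (\<Sum>k\<in>C. sym_over C F (c o transpose b k))"
  using assms(1,2) by (simp add: sym_over_def comp_assoc)
 finally show ?thesis using assms(3) by (simp add: add_eq_0_iff)
qed

section \<open>Balanced functions: relations between exchanges outside a symmetrized set\<close>

lemma transpose_comp_shared:
 "b ~= b' ==> b ~= k ==> b' ~= k ==>
  transpose b k o transpose b' k = transpose b' k o transpose b b'"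
 by (rule ext) (auto simp: transpose_def)

lemma transpose_comp_disjoint:
 "distinct [a, b, c, d] ==> transpose a b o transpose c d = transpose c d o transpose a b"
 by (rule ext) (auto simp: transpose_def)

text \<open>The case to keep in mind is \<open>Y = sym_over C F\<close>, where all symmetrizations
  of \<open>F\<close> over one more letter vanish; \<open>bal\<close> is then
  \<open>sym_over_insert\<close>.\<close>

locale balanced_function =
 fixes A C :: "nat set" and Y :: "(nat => 'x) => 'f::field_char_0"
 assumes finC: "finite C" and CA: "C \<subseteq> A"
  and skew: "skew3_vanish A Y"
  and bal: "b \<in> A - C ==> (\<Sum>k\<in>C. Y (c o transpose b k)) = - Y c"
begin

lemma bal_perm:
 assumes "s permutes (A - C)" "b \<in> A - C"
 shows "(\<Sum>k\<in>C. Y (c o transpose b k o s)) = - Y (c o s)"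
proof -
 have b': "inv_into UNIV s b \<in> A - C" using assms permutes_inv permutes_in_image by metis
 have k': "inv_into UNIV s k = k" if "k \<in> C" for k
  using that assms(1) by (metis DiffD2 permutes_inv permutes_not_in)
 have "Y (c o transpose b k o s) = Y (c o s o transpose (inv_into UNIV s b) k)" if "k \<in> C" for k
  using comp_transpose_permutes[OF assms(1), of b k] k'[OF that] by (simp add: comp_assoc)
 then show ?thesis using bal[OF b', of "c o s"] by simp
qed

lemma bal2:
 assumes s: "s permutes (A - C)" and b: "b1 \<in> A - C" "b2 \<in> A - C" "b1 ~= b2"
 shows "(\<Sum>k1\<in>C. \<Sum>k2\<in>C - {k1}. Y (c o transpose b1 k1 o transpose b2 k2 o s))
   = Y (c o s) + Y (c o transpose b1 b2 o s)"
proof -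
 have "(\<Sum>k2\<in>C - {k1}. Y (c o transpose b1 k1 o transpose b2 k2 o s))
   = - Y (c o transpose b1 k1 o s) - Y (c o transpose b2 k1 o (transpose b1 b2 o s))"
  if "k1 \<in> C" for k1
 proof -
  have t: "transpose b1 k1 o transpose b2 k1 = transpose b2 k1 o transpose b1 b2"
   using b that by (intro transpose_comp_shared) auto
  have e: "c o transpose b1 k1 o transpose b2 k1 o s
    = c o transpose b2 k1 o (transpose b1 b2 o s)"
   using t by (metis comp_assoc)
  show ?thesis
   using bal_perm[OF s b(2), of "c o transpose b1 k1"] that finC e
   by (simp add: sum_diff1)
 qed
 then have "(\<Sum>k1\<in>C. \<Sum>k2\<in>C - {k1}. Y (c o transpose b1 k1 o transpose b2 k2 o s))
  = - (\<Sum>k1\<in>C. Y (c o transpose b1 k1 o s))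
   - (\<Sum>k1\<in>C. Y (c o transpose b2 k1 o (transpose b1 b2 o s)))"
  by (simp add: sum_subtractf sum_negf)
 moreover have "transpose b1 b2 o s permutes (A - C)"
  using s b permutes_compose permutes_swap_id by metis
 ultimately show ?thesis
  using bal_perm[OF s b(1), of c] bal_perm[of "transpose b1 b2 o s" b2 c] b
  by (simp add: comp_assoc)
qed

text \<open>Exchange \<open>b1\<close>, \<open>b2\<close>, \<open>b3\<close> with distinct
  \<open>k1\<close>, \<open>k2\<close>, \<open>k3\<close> in \<open>C\<close> and sum the resulting
  eight-term relation over all such triples. The balance equation removes every \<open>k\<close>,
  and what is left is an element of the group algebra of the permutations of \<open>b1\<close>,
  \<open>b2\<close>, \<open>b3\<close> that annihilates \<open>Y\<close>.\<close>

lemma triple_sum_relation: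
 assumes b: "b1 \<in> A - C" "b2 \<in> A - C" "b3 \<in> A - C" "b1 ~= b2" "b1 ~= b3" "b2 ~= b3"
 defines "N \<equiv> (of_nat (card C) :: 'f)"
 shows "(N^3 - 4*N + 1) * Y c
  + (N - 1) * (Y (c o transpose b1 b2) + Y (c o transpose b1 b3) + Y (c o transpose b2 b3))
  + Y (c o transpose b2 b3 o transpose b1 b3) + Y (c o transpose b1 b3 o transpose b2 b3) = 0"
proof -
 let ?t1 = "transpose b1" and ?t2 = "transpose b2" and ?t3 = "transpose b3"
 let ?s12 = "transpose b1 b2" and ?s13 = "transpose b1 b3" and ?s23 = "transpose b2 b3"
 have idp: "id permutes (A - C)" by (rule permutes_id)
 have s13: "?s13 permutes (A - C)" and s23: "?s23 permutes (A - C)"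
  using b by (auto intro: permutes_swap_id)
 have z: "Y c - Y (c o ?t1 k1) - Y (c o ?t2 k2) - Y (c o ?t3 k3)
   + Y (c o ?t1 k1 o ?t2 k2) + Y (c o ?t1 k1 o ?t3 k3) + Y (c o ?t2 k2 o ?t3 k3)
   - Y (c o ?t1 k1 o ?t2 k2 o ?t3 k3) = 0"
  if "k1 \<in> C" "k2 \<in> C - {k1}" "k3 \<in> C - {k1, k2}" for k1 k2 k3
 proof -
  have "dm b1 k1 (dm b2 k2 (dm b3 k3 Y)) c = 0"
   by (rule skew3_vanishD[OF skew]) (use b that CA in auto)
  then show ?thesis unfolding dm_def by (simp add: comp_assoc algebra_simps)
 qed
 have c1: "of_nat (card (C - {k1})) = N - 1" if "k1 \<in> C" for k1
  using that finC unfolding N_def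
  by (metis One_nat_def Suc_pred card_Diff_singleton card_gt_0_iff empty_iff of_nat_Suc add_diff_cancel_left')
 have c2: "of_nat (card (C - {k1, k2})) = N - 2" if "k1 \<in> C" "k2 \<in> C - {k1}" for k1 k2
 proof -
  have "card (C - {k1}) = Suc (card (C - {k1, k2}))"
   using that finC by (metis Diff_insert2 Suc_pred card_Diff_singleton card_gt_0_iff empty_iff finite_Diff One_nat_def)
  then show ?thesis using c1[OF that(1)] by (simp add: algebra_simps)
 qed
 \<comment> \<open>The sum over \<open>k3\<close> alone. It runs over \<open>C - {k1, k2}\<close>,
   so balance leaves correction terms with \<open>k3 = k1\<close> and \<open>k3 = k2\<close>; there
   two transpositions share a letter and are rewritten by
   \<open>transpose_comp_shared\<close>.\<close>
 have inner: "(N - 2) * Y c - (N - 2) * Y (c o ?t1 k1) - (N - 2) * Y (c o ?t2 k2)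
   + (Y c + Y (c o ?t3 k1) + Y (c o ?t3 k2))
   + (N - 2) * Y (c o ?t1 k1 o ?t2 k2)
   + (- Y (c o ?t1 k1) - Y (c o ?t3 k1 o ?s13) - Y (c o ?t1 k1 o ?t3 k2))
   + (- Y (c o ?t2 k2) - Y (c o ?t3 k2 o ?s23) - Y (c o ?t2 k2 o ?t3 k1))
   - (- Y (c o ?t1 k1 o ?t2 k2) - Y (c o ?t2 k2 o ?t3 k1 o ?s13) - Y (c o ?t1 k1 o ?t3 k2 o ?s23)) = 0"
  if k: "k1 \<in> C" "k2 \<in> C - {k1}" for k1 k2
 proof -
  let ?D = "C - {k1, k2}"
  have S: "(\<Sum>k3\<in>?D. Y (d o ?t3 k3)) = - Y d - Y (d o ?t3 k1) - Y (d o ?t3 k2)" for d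
  proof -
   have "(\<Sum>k3\<in>C. Y (d o ?t3 k3)) = Y (d o ?t3 k1) + (Y (d o ?t3 k2) + (\<Sum>k3\<in>?D. Y (d o ?t3 k3)))"
    using k finC by (metis (no_types, lifting) Diff_insert2 finite_Diff sum.remove)
   then show ?thesis using bal[OF b(3), of d] by (simp add: algebra_simps)
  qed
  have e1: "?t1 k1 o ?t3 k1 = ?t3 k1 o ?s13" "?t2 k2 o ?t3 k2 = ?t3 k2 o ?s23"
   using b k by (auto intro!: transpose_comp_shared)
  have e2: "?t1 k1 o ?t2 k2 = ?t2 k2 o ?t1 k1"
   using b k by (intro transpose_comp_disjoint) auto
  have f1: "d o ?t1 k1 o ?t3 k1 = d o ?t3 k1 o ?s13" "d o ?t2 k2 o ?t3 k2 = d o ?t3 k2 o ?s23" for d :: "nat => 'x"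
   using e1 by (simp_all only: comp_assoc)
  have f2: "c o ?t1 k1 o ?t2 k2 o ?t3 k1 = c o ?t2 k2 o ?t3 k1 o ?s13"
   using e2 f1(1)[of "c o ?t2 k2"] by (metis comp_assoc)
  have "0 = (\<Sum>k3\<in>?D. Y c - Y (c o ?t1 k1) - Y (c o ?t2 k2) - Y (c o ?t3 k3)
   + Y (c o ?t1 k1 o ?t2 k2) + Y (c o ?t1 k1 o ?t3 k3) + Y (c o ?t2 k2 o ?t3 k3)
   - Y (c o ?t1 k1 o ?t2 k2 o ?t3 k3))"
   using z[OF k] by simp
  also have "\<dots> = (N - 2) * Y c - (N - 2) * Y (c o ?t1 k1) - (N - 2) * Y (c o ?t2 k2)
   - (\<Sum>k3\<in>?D. Y (c o ?t3 k3)) + (N - 2) * Y (c o ?t1 k1 o ?t2 k2)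
   + (\<Sum>k3\<in>?D. Y (c o ?t1 k1 o ?t3 k3)) + (\<Sum>k3\<in>?D. Y (c o ?t2 k2 o ?t3 k3))
   - (\<Sum>k3\<in>?D. Y (c o ?t1 k1 o ?t2 k2 o ?t3 k3))"
   by (simp add: sum_subtractf sum.distrib c2[OF k]) (simp add: algebra_simps)
  finally show ?thesis unfolding S f1 f2 by (simp add: algebra_simps)
 qed
 have L1: "(\<Sum>k1\<in>C. \<Sum>k2\<in>C - {k1}. Y (c o transpose b k1 o s)) = (N - 1) * - Y (c o s)"
  if "b \<in> A - C" "s permutes (A - C)" for b s
 proof -
  have "(\<Sum>k1\<in>C. \<Sum>k2\<in>C - {k1}. Y (c o transpose b k1 o s))
   = (\<Sum>k1\<in>C. (N - 1) * Y (c o transpose b k1 o s))"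
   by (intro sum.cong refl) (simp only: sum_constant c1)
  then show ?thesis
   using bal_perm[OF that(2,1), of c] by (metis sum_distrib_left)
 qed
 have sw: "(\<Sum>k1\<in>C. \<Sum>k2\<in>C - {k1}. g k1 k2) = (\<Sum>k1\<in>C. \<Sum>k2\<in>C - {k1}. g k2 k1)" for g :: "nat => nat => 'f"
 proof -
  have "(\<Sum>k1\<in>C. \<Sum>k2\<in>C - {k1}. g k1 k2) = (\<Sum>k1\<in>C. \<Sum>k2\<in>{k2\<in>C. k2 ~= k1}. g k1 k2)"
   by (intro sum.cong) auto
  also have "\<dots> = (\<Sum>k2\<in>C. \<Sum>k1\<in>{k1\<in>C. k2 ~= k1}. g k1 k2)"
   by (rule sum.swap_restrict[OF finC finC])
  also have "\<dots> = (\<Sum>k1\<in>C. \<Sum>k2\<in>C - {k1}. g k2 k1)"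
   by (intro sum.cong) auto
  finally show ?thesis .
 qed
 have L2: "(\<Sum>k1\<in>C. \<Sum>k2\<in>C - {k1}. Y (c o transpose b k2 o s)) = (N - 1) * - Y (c o s)"
  if "b \<in> A - C" "s permutes (A - C)" for b s
  using L1[OF that] by (subst sw) simp
 note l1 = L1[OF _ idp, unfolded comp_id] L2[OF _ idp, unfolded comp_id]
 have b32: "(\<Sum>k1\<in>C. \<Sum>k2\<in>C - {k1}. Y (c o ?t2 k2 o ?t3 k1 o s)) = Y (c o s) + Y (c o ?s23 o s)"
  if "s permutes (A - C)" for s
  using bal2[OF that b(2,3,6), of c] by (subst sw) simp
 have cst: "(\<Sum>k1\<in>C. \<Sum>k2\<in>C - {k1}. x) = N * (N - 1) * x" for x :: 'f
 proof -
  have "(\<Sum>k1\<in>C. \<Sum>k2\<in>C - {k1}. x) = (\<Sum>k1\<in>C. (N - 1) * x)"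
   by (intro sum.cong refl) (simp only: sum_constant c1)
  then show ?thesis by (simp add: N_def)
 qed
 have "0 = (\<Sum>k1\<in>C. \<Sum>k2\<in>C - {k1}. (N - 2) * Y c - (N - 2) * Y (c o ?t1 k1) - (N - 2) * Y (c o ?t2 k2)
   + (Y c + Y (c o ?t3 k1) + Y (c o ?t3 k2))
   + (N - 2) * Y (c o ?t1 k1 o ?t2 k2)
   + (- Y (c o ?t1 k1) - Y (c o ?t3 k1 o ?s13) - Y (c o ?t1 k1 o ?t3 k2))
   + (- Y (c o ?t2 k2) - Y (c o ?t3 k2 o ?s23) - Y (c o ?t2 k2 o ?t3 k1))
   - (- Y (c o ?t1 k1 o ?t2 k2) - Y (c o ?t2 k2 o ?t3 k1 o ?s13) - Y (c o ?t1 k1 o ?t3 k2 o ?s23)))"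
  using inner by simp
 also have "\<dots> = N * (N - 1) * ((N - 2) * Y c) - (N - 2) * ((N - 1) * - Y c) - (N - 2) * ((N - 1) * - Y c)
   + (N * (N - 1) * Y c + (N - 1) * - Y c + (N - 1) * - Y c)
   + (N - 2) * (Y c + Y (c o ?s12))
   + (- ((N - 1) * - Y c) - (N - 1) * - Y (c o ?s13) - (Y c + Y (c o ?s13)))
   + (- ((N - 1) * - Y c) - (N - 1) * - Y (c o ?s23) - (Y c + Y (c o ?s23)))
   - (- (Y c + Y (c o ?s12)) - (Y (c o ?s13) + Y (c o ?s23 o ?s13)) - (Y (c o ?s23) + Y (c o ?s13 o ?s23)))"
  using bal2[OF idp b(1,2,4), of c] bal2[OF idp b(1,3,5), of c] b32[OF idp] b32[OF s13]
   bal2[OF s23 b(1,3,5), of c]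
  by (simp add: sum_subtractf sum.distrib sum_negf l1(1)[OF b(1)] l1(1)[OF b(3)] l1(2)[OF b(2)] l1(2)[OF b(3)] cst L1[OF b(3) s13] L2[OF b(3) s23]
    sum_distrib_left[symmetric] del: sum_constant)
 finally show ?thesis by (simp add: algebra_simps power3_eq_cube)
qed

text \<open>The group algebra element of \<open>triple_sum_relation\<close> acts by
  \<open>(N-1)N(N+1)\<close> on the trivial, by \<open>(N-1)(N-2)(N+3)\<close> on the sign and by
  \<open>(N-2)N(N+2)\<close> on the two-dimensional representation of the permutations of three
  letters. For \<open>N >= 3\<close> none of these is zero, so the element is invertible.\<close>

lemma vanish_large:
 assumes b: "b1 \<in> A - C" "b2 \<in> A - C" "b3 \<in> A - C" "b1 ~= b2" "b1 ~= b3" "b2 ~= b3"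
  and N3: "card C \<ge> 3"
 shows "Y c = 0"
proof -
 define N where "N = (of_nat (card C) :: 'f)"
 let ?s12 = "transpose b1 b2" and ?s13 = "transpose b1 b3" and ?s23 = "transpose b2 b3"
 let ?r = "?s23 o ?s13" and ?q = "?s13 o ?s23"
 note rel = triple_sum_relation[OF b, folded N_def]
 have g: "?s12 o ?s12 = id" "?s13 o ?s13 = id" "?s23 o ?s23 = id"
  "?s12 o ?s13 = ?q" "?s12 o ?s23 = ?r" "?s13 o ?s12 = ?r" "?s23 o ?s12 = ?q"
  "?r o ?s12 = ?s13" "?r o ?s13 = ?s23" "?r o ?s23 = ?s12"
  "?q o ?s12 = ?s23" "?q o ?s13 = ?s12" "?q o ?s23 = ?s13"
  "?s12 o ?r = ?s23" "?s12 o ?q = ?s13" "?s13 o ?r = ?s12"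
  "?s13 o ?q = ?s23" "?s23 o ?r = ?s13" "?s23 o ?q = ?s12"
  "?r o ?r = ?q" "?q o ?q = ?r" "?r o ?q = id" "?q o ?r = id"
  using b by (auto simp: fun_eq_iff transpose_def)
 have rel': "(N^3 - 4*N + 1) * Y (c o p)
  + (N - 1) * (Y (c o (p o ?s12)) + Y (c o (p o ?s13)) + Y (c o (p o ?s23)))
  + Y (c o (p o ?r)) + Y (c o (p o ?q)) = 0" for p
  using rel[of "c o p"] by (simp only: comp_assoc)
 define v w1 w2 u1 u2 u3 where "v = Y c" and "w1 = Y (c o ?r)" and "w2 = Y (c o ?q)"
  and "u1 = Y (c o ?s12)" and "u2 = Y (c o ?s13)" and "u3 = Y (c o ?s23)"
 note defs = v_def[symmetric] w1_def[symmetric] w2_def[symmetric]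
  u1_def[symmetric] u2_def[symmetric] u3_def[symmetric]
 let ?a = "N^3 - 4*N + 1"
 have E: "?a * v + (N - 1) * (u1 + u2 + u3) + w1 + w2 = 0"
  using rel'[of id] by (simp add: defs)
 have E1: "?a * w1 + (N - 1) * (u1 + u2 + u3) + v + w2 = 0"
  using rel'[of ?r] unfolding g comp_id defs by (simp add: algebra_simps)
 have E2: "?a * w2 + (N - 1) * (u1 + u2 + u3) + v + w1 = 0"
  using rel'[of ?q] unfolding g comp_id defs by (simp add: algebra_simps)
 have O1: "?a * u1 + (N - 1) * (v + w1 + w2) + u2 + u3 = 0"
  using rel'[of ?s12] unfolding g comp_id defs by (simp add: algebra_simps)
 have O2: "?a * u2 + (N - 1) * (v + w1 + w2) + u1 + u3 = 0"
  using rel'[of ?s13] unfolding g comp_id defs by (simp add: algebra_simps)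
 have O3: "?a * u3 + (N - 1) * (v + w1 + w2) + u1 + u2 = 0"
  using rel'[of ?s23] unfolding g comp_id defs by (simp add: algebra_simps)
 obtain m where m: "card C = m + 3" using N3 by (metis add.commute le_Suc_ex)
 have Nm: "N = of_nat m + 3" by (simp add: N_def m)
 \<comment> \<open>The sums over the even and the odd permutations: \<open>e + d\<close> is the
   trivial component, \<open>e - d\<close> the sign component. Once both vanish, the equation
   \<open>E\<close> for \<open>v\<close> reduces to the third eigenvalue.\<close>
 define e where "e = v + w1 + w2" define d where "d = u1 + u2 + u3"
 have s1: "(N^3 - 4*N + 3) * e + 3 * (N - 1) * d = 0"
  using E E1 E2 unfolding e_def d_def by (simp add: algebra_simps) Groebner_Basis.algebra
 have s2: "(N^3 - 4*N + 3) * d + 3 * (N - 1) * e = 0"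
  using O1 O2 O3 unfolding e_def d_def by (simp add: algebra_simps) Groebner_Basis.algebra
 have n1: "N^3 - N = of_nat ((m + 2) * (m + 3) * (m + 4))"
  unfolding Nm by (simp add: algebra_simps power3_eq_cube)
 have n2: "N^3 - 7*N + 6 = of_nat ((m + 2) * (m + 1) * (m + 6))"
  unfolding Nm by (simp add: algebra_simps power3_eq_cube)
 have n3: "N^3 - 4*N = of_nat ((m + 3) * (m + 1) * (m + 5))"
  unfolding Nm by (simp add: algebra_simps power3_eq_cube)
 have "(N^3 - N) * (e + d) = 0" using s1 s2 by (simp add: algebra_simps) Groebner_Basis.algebra
 moreover have "(N^3 - 7*N + 6) * (e - d) = 0" using s1 s2 by (simp add: algebra_simps) Groebner_Basis.algebra
 moreover have "N^3 - N ~= 0" "N^3 - 7*N + 6 ~= 0" "N^3 - 4*N ~= 0"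
  unfolding n1 n2 n3 by (simp_all only: of_nat_eq_0_iff) auto
 ultimately have "e + d = 0" "e - d = 0" by simp_all
 then have "2 * e = 0" by (simp add: algebra_simps)
 then have "e = 0" "d = 0" using \<open>e + d = 0\<close> by simp_all
 have "(N^3 - 4*N) * v + (N - 1) * d + e = 0"
  using E unfolding e_def d_def by (simp add: algebra_simps)
 then have "v = 0" using \<open>e = 0\<close> \<open>d = 0\<close> \<open>N^3 - 4*N ~= 0\<close> by simp
 then show ?thesis by (simp add: v_def)
qed

text \<open>For \<open>N = 2\<close> the eigenvalues at the sign and the two-dimensional
  representation vanish, so three exchanges into \<open>C\<close> say too little. Instead the third
  exchange is taken outside \<open>C\<close>, between \<open>b3\<close> and \<open>b4\<close>, and
  the other two are summed over both ways of pairing \<open>b1\<close>, \<open>b2\<close> with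
  \<open>k\<close>, \<open>l\<close>.\<close>

lemma invariant_of_card_2:
 assumes b: "b1 \<in> A - C" "b2 \<in> A - C" "b3 \<in> A - C" "b4 \<in> A - C" "distinct [b1, b2, b3, b4]"
  and N2: "C = {k, l}" "k ~= l"
 shows "Y (c o transpose b3 b4) = Y c"
proof -
 define Z where "Z = dm b3 b4 Y"
 have kl: "k \<in> A" "l \<in> A" using CA N2 by auto
 have v2: "Z c - Z (c o transpose b1 p) - Z (c o transpose b2 q)
   + Z (c o transpose b1 p o transpose b2 q) = 0" if "(p = k & q = l) \<or> (p = l & q = k)" for p q c
 proof -
  have "dm b1 p (dm b2 q (dm b3 b4 Y)) c = 0"
   by (rule skew3_vanishD[OF skew]) (use b that kl N2 in auto)
  then show ?thesis unfolding Z_def[symmetric] unfolding dm_def by (simp add: algebra_simps)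
 qed
 have s34: "transpose b3 b4 permutes (A - C)" using b by (auto intro: permutes_swap_id)
 have ba: "Z (c o transpose b k) + Z (c o transpose b l) = - Z c" if "b \<in> {b1, b2}" for b c
 proof -
  have bA: "b \<in> A - C" using that b by auto
  have "Y (c o transpose b k) + Y (c o transpose b l) = - Y c" for c
   using bal[OF bA, of c] N2 by simp
  moreover have "Y (c o transpose b k o transpose b3 b4) + Y (c o transpose b l o transpose b3 b4)
   = - Y (c o transpose b3 b4)"
   using bal_perm[OF s34 bA, of c] N2 by simp
  ultimately show ?thesis unfolding Z_def dm_def
   by (simp add: algebra_simps)
 qed
 have t: "transpose b1 p o transpose b2 p = transpose b2 p o transpose b1 b2" if "p \<in> {k, l}" for p
  using that b N2 by (intro transpose_comp_shared) auto
 \<comment> \<open>Applied at \<open>c\<close> and at \<open>c o transpose b1 b2\<close>, this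
   relation gives \<open>24 * Z c = 0\<close>.\<close>
 have s12: "5 * Z c + Z (c o transpose b1 b2) = 0" for c
 proof -
  let ?a = "%p. c o transpose b1 p" and ?b = "%p. c o transpose b2 p"
  have tt: "c o transpose b1 p o transpose b2 p = c o transpose b2 p o transpose b1 b2" if "p \<in> {k, l}" for p
   using t[OF that] by (simp only: comp_assoc)
  have x1: "Z (?a k o transpose b2 l) = - Z (?a k) - Z (?b k o transpose b1 b2)"
   using ba[of b2 "?a k"] tt[of k] by (simp add: algebra_simps)
  have x2: "Z (?a l o transpose b2 k) = - Z (?a l) - Z (?b l o transpose b1 b2)"
   using ba[of b2 "?a l"] tt[of l] by (simp add: algebra_simps)
  have cm: "transpose b2 p o transpose b1 b2 = transpose b1 b2 o transpose b1 p" if "p \<in> {k, l}" for p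
   using that b N2 by (auto simp: fun_eq_iff transpose_def)
  have x3: "Z (?b k o transpose b1 b2) + Z (?b l o transpose b1 b2) = - Z (c o transpose b1 b2)"
   using ba[of b1 "c o transpose b1 b2"] cm[of k] cm[of l] by (simp add: comp_assoc)
  show ?thesis
   using v2[of k l c] v2[of l k c] x1 x2 x3 ba[of b1 c] ba[of b2 c] by simp Groebner_Basis.algebra
 qed
 have "5 * Z (c o transpose b1 b2) + Z c = 0"
  using s12[of "c o transpose b1 b2"] by (simp add: comp_assoc)
 with s12[of c] have "24 * Z c = 0" by Groebner_Basis.algebra
 then show ?thesis by (simp add: Z_def dm_def)
qed

end

lemma sym_over_commute:
 fixes F :: "(nat => 'x) => 'v::ab_group_add"
 assumes "C \<inter> E = {}"
 shows "sym_over E (sym_over C F) c = sym_over C (sym_over E F) c"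
proof -
 have "p o q = q o p" if "p permutes E" "q permutes C" for p q
 proof
  fix x
  consider "x \<in> E" | "x \<in> C" | "x ~: E" "x ~: C" by blast
  then show "(p o q) x = (q o p) x"
   using assms permutes_in_image[OF that(1)] permutes_in_image[OF that(2)]
    permutes_not_in[OF that(1)] permutes_not_in[OF that(2)]
   by cases (metis IntI comp_apply empty_iff)+
 qed
 then have "sym_over E (sym_over C F) c = (\<Sum>p | p permutes E. \<Sum>q | q permutes C. F (c o q o p))"
  unfolding sym_over_def by (intro sum.cong refl) (metis comp_assoc mem_Collect_eq)
 also have "\<dots> = sym_over C (sym_over E F) c"
  unfolding sym_over_def by (rule sum.swap)
 finally show ?thesis .
qed

lemma sym_over_invariant:
 fixes Y :: "(nat => 'x) => 'f::field_char_0"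
 assumes "finite E" and "\<And>a b c. a \<in> E ==> b \<in> E ==> Y (c o transpose a b) = Y c"
 shows "sym_over E Y c = fact (card E) * Y c"
proof -
 have "Y (c o p) = Y c" if "p permutes E" for p c
  using that assms(1)
 proof (induction p arbitrary: c rule: permutes_induct)
  case id
  then show ?case by simp
 next
  case (swap a b p)
  then show ?case using assms(2) by (metis comp_assoc)
 qed
 then show ?thesis
  unfolding sym_over_def using card_permutations[OF refl assms(1)] by simp
qed

lemma obtain_distinct:
 assumes "k <= card S"
 obtains xs where "set xs \<subseteq> S" "distinct xs" "length xs = k"
proof -
 obtain T where T: "T \<subseteq> S" "card T = k" "finite T"
  using obtain_subset_with_card_n[OF assms] by metis
 then obtain xs where "set xs = T" "distinct xs" using finite_distinct_list by metis
 with T show ?thesis using that distinct_card by metis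
qed

text \<open>\<open>skew\<close> leaves only irreducibles with at most two boxes below the first row,
  and each of these contains a nonzero vector fixed by the permutations of \<open>card A - 2\<close>
  letters, which \<open>sym\<close> forbids. The elementary form is a descent: from vanishing
  symmetrizations over sets of size \<open>j + 1\<close> to those of size \<open>j\<close>, down to
  singletons.\<close>

lemma vanish_of_sym_over:
 fixes F :: "(nat => 'x) => 'f::field_char_0"
 assumes A: "finite A" "card A \<ge> 6" and skew: "skew3_vanish A F"
  and sym: "\<And>C c. C \<subseteq> A ==> card C = card A - 2 ==> sym_over C F c = 0"
 shows "F c = 0"
proof -
 have main: "\<forall>C c. C \<subseteq> A --> card C = j --> sym_over C F c = 0" if "1 <= j" "j <= card A - 2" for j
  using that(2,1)
 proof (induction j rule: inc_induct)
  case base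
  then show ?case using sym by blast
 next
  case (step j)
  show ?case
  proof (intro allI impI)
   fix C and c :: "nat => 'x"
   assume C: "C \<subseteq> A" "card C = j"
   have fC: "finite C" using C A finite_subset by blast
   have cAC: "card (A - C) = card A - j" using C fC by (simp add: card_Diff_subset)
   have IH: "sym_over D F c = 0" if "D \<subseteq> A" "card D = Suc j" for D c
    using step that by simp
   have bal: "balanced_function A C (sym_over C F)"
   proof
    fix b and c :: "nat => 'x"
    assume "b \<in> A - C"
    then show "(\<Sum>k\<in>C. sym_over C F (c o transpose b k)) = - sym_over C F c"
     using C fC by (intro sym_over_insert IH) auto
   qed (use C fC skew3_vanish_sym_over skew in auto)
   consider "j = 1" | "j = 2" | "3 <= j" using step by linarith
   then show "sym_over C F c = 0"
   proof cases
    case 1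
    \<comment> \<open>Vanishing over two-element sets makes \<open>F\<close> alternating, and then
      three skew exchanges multiply \<open>F\<close> by 8.\<close>
    have neg: "F (c o transpose x y) = - F c" if "x \<in> A" "y \<in> A" "x ~= y" for x y c
    proof -
     have "sym_over (insert x {y}) F c = 0" using that 1 by (intro IH) auto
     from sym_over_insert[OF _ _ this] that show ?thesis
      by (simp add: sym_over_def)
    qed
    obtain xs where xs: "set xs \<subseteq> A" "distinct xs" "length xs = 6"
     using obtain_distinct[OF A(2)] .
    then obtain i1 j1 i2 j2 i3 j3 where "xs = [i1, j1, i2, j2, i3, j3]"
     by (auto simp: numeral_eq_Suc length_Suc_conv)
    with xs have s: "{i1, j1, i2, j2, i3, j3} \<subseteq> A" "distinct [i1, j1, i2, j2, i3, j3]" by auto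
    have "8 * F c = dm i1 j1 (dm i2 j2 (dm i3 j3 F)) c"
     using s neg unfolding dm_def by simp
    also have "\<dots> = 0" using skew3_vanishD[OF skew s] .
    finally have "F c = 0" by simp
    moreover have "sym_over C F c = F c"
     using C 1 by (auto simp: card_1_singleton_iff sym_over_def)
    ultimately show ?thesis by simp
   next
    case 2
    then obtain k l where kl: "C = {k, l}" "k ~= l" using C(2) by (auto simp: card_2_iff)
    have inv: "sym_over C F (c o transpose a b) = sym_over C F c" if ab: "a \<in> A - C" "b \<in> A - C" for a b c
    proof (cases "a = b")
     case False
     \<comment> \<open>Here six letters are needed: two in \<open>C\<close>, the two exchanged ones
       and two more outside.\<close>
     have "card (A - C - {a, b}) \<ge> 2" using cAC A ab False 2 by (simp add: card_Diff_subset)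
     then obtain xs where "set xs \<subseteq> A - C - {a, b}" "distinct xs" "length xs = 2"
      using obtain_distinct by metis
     then obtain b1 b2 where "b1 \<in> A - C - {a, b}" "b2 \<in> A - C - {a, b}" "b1 ~= b2"
      by (auto simp: numeral_eq_Suc length_Suc_conv)
     then show ?thesis
      using ab False by (intro balanced_function.invariant_of_card_2[OF bal _ _ ab _ kl, of b1 b2]) auto
    qed simp
    have "card (A - C) \<ge> 3" using cAC A 2 by simp
    then obtain E where E: "E \<subseteq> A - C" "card E = 3" "finite E"
     using obtain_subset_with_card_n by metis
    \<comment> \<open>\<open>sym_over C F\<close> is invariant outside \<open>C\<close>, so
      symmetrizing over three outer letters multiplies it by 6. In the other order this starts with
      a symmetrization of \<open>F\<close> over three letters, already known to vanish.\<close>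
    have "6 * sym_over C F c = sym_over E (sym_over C F) c"
    proof -
     have "sym_over C F (d o transpose a b) = sym_over C F d" if "a \<in> E" "b \<in> E" for a b d
      using inv that E by blast
     from sym_over_invariant[OF E(3) this, of c] E(2) show ?thesis by (simp add: fact_numeral)
    qed
    also have "\<dots> = sym_over C (sym_over E F) c"
     using E by (intro sym_over_commute) auto
    also have "\<dots> = 0"
    proof -
     have "sym_over E F d = 0" for d using E 2 by (intro IH) auto
     then show ?thesis unfolding sym_over_def[of C] by simp
    qed
    finally show ?thesis by simp
   next
    case 3
    have "card (A - C) \<ge> 3" using cAC step by linarith
    then obtain xs where "set xs \<subseteq> A - C" "distinct xs" "length xs = 3"
     using obtain_distinct by metis
    then obtain b1 b2 b3 where "b1 \<in> A - C" "b2 \<in> A - C" "b3 \<in> A - C" "b1 ~= b2" "b1 ~= b3" "b2 ~= b3"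
     by (auto simp: numeral_eq_Suc length_Suc_conv)
    then show ?thesis using balanced_function.vanish_large[OF bal] 3 C by simp
   qed
  qed
 qed
 obtain a where "a \<in> A" using A by fastforce
 then have "sym_over {a} F c = 0" using main[of 1] A by simp
 then show ?thesis by (simp add: sym_over_def)
qed

section \<open>Words with two distinguished letters\<close>

text \<open>\<open>W\<close> lists names of slots, and \<open>c\<close> fills them with words. The
  fillings are nonempty because substitution into a nonunital algebra cannot erase a variable; that
  they may be longer than one letter is used constantly below.\<close>

definition skew3_words :: "nat => (nat list => 'v::ab_group_add) => bool" where
 "skew3_words n0 \<phi> \<longleftrightarrow> (\<forall>W c i1 j1 i2 j2 i3 j3. distinct W --> n0 <= length W -->
   {i1, j1, i2, j2, i3, j3} \<subseteq> set W --> distinct [i1, j1, i2, j2, i3, j3] --> (\<forall>x. c x ~= []) -->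
   dm i1 j1 (dm i2 j2 (dm i3 j3 (%c. \<phi> (concat (map c W))))) c = 0)"

lemma skew3_wordsD:
 assumes "skew3_words n0 \<phi>" "distinct W" "n0 <= length W"
  "{i1, j1, i2, j2, i3, j3} \<subseteq> set W" "distinct [i1, j1, i2, j2, i3, j3]" "\<And>x. c x ~= []"
 shows "dm i1 j1 (dm i2 j2 (dm i3 j3 (%c. \<phi> (concat (map c W))))) c = 0"
 using assms(1)[unfolded skew3_words_def, rule_format, OF assms(2-5)] assms(6) by simp

text \<open>The letters of the fixed words \<open>x0\<close>, ..., \<open>x6\<close> become further
  slots holding one letter each. The six exchanged slots are named 0 to 5, hence the shift by 6 in
  the names of the others.\<close>

lemma skew3_slots:
 fixes s :: "nat => nat list"
 assumes K: "skew3_words n0 \<phi>"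
  and len: "n0 <= 6 + length (x0 @ x1 @ x2 @ x3 @ x4 @ x5 @ x6)"
  and ne: "\<And>i. s i ~= []"
  and idx: "{i1, j1, i2, j2, i3, j3} = {0, 1, 2, 3, 4, 5}" "distinct [i1, j1, i2, j2, i3, j3]"
 shows "dm i1 j1 (dm i2 j2 (dm i3 j3 (%s. \<phi> (x0 @ s 0 @ x1 @ s 1 @ x2 @ s 2 @ x3 @ s 3 @ x4 @ s 4 @ x5 @ s 5 @ x6)))) s = 0"
proof -
 define ctx where "ctx = x0 @ x1 @ x2 @ x3 @ x4 @ x5 @ x6"
 define g where "g s = (%x. if x < 6 then s x else [ctx ! (x - 6)])" for s :: "nat => nat list"
 define l0 l1 l2 l3 l4 l5 l6 where "l0 = 6 + length x0" and "l1 = l0 + length x1" and "l2 = l1 + length x2"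
  and "l3 = l2 + length x3" and "l4 = l3 + length x4" and "l5 = l4 + length x5" and "l6 = l5 + length x6"
 note l = l0_def l1_def l2_def l3_def l4_def l5_def l6_def
 define W where "W = [6..<l0] @ [0] @ [l0..<l1] @ [1] @ [l1..<l2] @ [2] @ [l2..<l3] @ [3] @ [l3..<l4] @ [4]
   @ [l4..<l5] @ [5] @ [l5..<l6]"
 have seg: "concat (map (g s) [6 + length p..<6 + length p + length x]) = x"
  if "ctx = p @ x @ q" for p x q s
 proof -
  have "concat (map (g s) [6 + length p..<6 + length p + length x])
   = concat (map (%i. [ctx ! (i - 6)]) [6 + length p..<6 + length p + length x])"
   by (intro arg_cong[of _ _ concat] map_cong) (auto simp: g_def)
  also have "\<dots> = map (%i. ctx ! (i - 6)) [6 + length p..<6 + length p + length x]"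
   by (rule concat_map_singleton)
  also have "\<dots> = x"
   by (rule nth_equalityI) (simp_all add: that nth_append del: upt_Suc)
  finally show ?thesis .
 qed
 have W: "concat (map (g s) W) = x0 @ s 0 @ x1 @ s 1 @ x2 @ s 2 @ x3 @ s 3 @ x4 @ s 4 @ x5 @ s 5 @ x6" for s
  using seg[of "[]" x0 "x1 @ x2 @ x3 @ x4 @ x5 @ x6" s]
   seg[of x0 x1 "x2 @ x3 @ x4 @ x5 @ x6" s]
   seg[of "x0 @ x1" x2 "x3 @ x4 @ x5 @ x6" s]
   seg[of "x0 @ x1 @ x2" x3 "x4 @ x5 @ x6" s]
   seg[of "x0 @ x1 @ x2 @ x3" x4 "x5 @ x6" s]
   seg[of "x0 @ x1 @ x2 @ x3 @ x4" x5 "x6" s]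
   seg[of "x0 @ x1 @ x2 @ x3 @ x4 @ x5" x6 "[]" s]
  unfolding W_def l ctx_def by (simp add: add.assoc) (simp add: g_def)
 have gt: "g (s o transpose i j) = g s o transpose i j" if "i < 6" "j < 6" for i j s
  using that by (auto simp: g_def fun_eq_iff transpose_def)
 have dmg: "dm i j (%s. H (g s)) = (%s. dm i j H (g s))" if "i < 6" "j < 6" for i j and H :: "(nat => nat list) => 'a"
  unfolding dm_def gt[OF that] ..
 have lt6: "x < 6" if "x \<in> {i1, j1, i2, j2, i3, j3}" for x
  using that unfolding idx(1) by auto
 have lt: "i1 < 6" "j1 < 6" "i2 < 6" "j2 < 6" "i3 < 6" "j3 < 6" by (rule lt6, simp)+
 have "dm i1 j1 (dm i2 j2 (dm i3 j3 (%s. \<phi> (concat (map (g s) W))))) s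
   = dm i1 j1 (dm i2 j2 (dm i3 j3 (%c. \<phi> (concat (map c W))))) (g s)"
  unfolding dmg[OF lt(5,6), of "%c. \<phi> (concat (map c W))"]
   dmg[OF lt(3,4), of "dm i3 j3 (%c. \<phi> (concat (map c W)))"]
   dmg[OF lt(1,2), of "dm i2 j2 (dm i3 j3 (%c. \<phi> (concat (map c W))))"] ..
 also have "\<dots> = 0"
 proof (rule skew3_wordsD[OF K _ _ _ idx(2)])
  show "distinct W" unfolding W_def l by auto
  show "n0 <= length W" using len unfolding W_def l by simp
  show "{i1, j1, i2, j2, i3, j3} \<subseteq> set W" unfolding idx(1) W_def by auto
  show "g s x ~= []" for x using ne by (simp add: g_def)
 qed
 finally show ?thesis unfolding W .
qed

definition tw :: "nat => nat list" where "tw k = replicate k 0"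

lemma tw_0 [simp]: "tw 0 = []" and tw_add: "tw k @ tw l = tw (k + l)"
 and tw_add2: "tw k @ (tw l @ r) = tw (k + l) @ r" and tw_eq_Nil [simp]: "tw k = [] \<longleftrightarrow> k = 0"
 by (auto simp: tw_def replicate_add)

definition wP :: "nat => nat => nat => nat list" where "wP k l m = tw k @ 1 # tw l @ 2 # tw m"
definition wQ :: "nat => nat => nat => nat list" where "wQ k l m = tw k @ 2 # tw l @ 1 # tw m"

definition slots :: "nat list => nat list => nat list => nat list => nat list => nat list => nat => nat list" where
 "slots s0 s1 s2 s3 s4 s5 = (%i. if i = 0 then s0 else if i = 1 then s1 else if i = 2 then s2
   else if i = 3 then s3 else if i = 4 then s4 else s5)"

lemma skew3_slots':
 assumes K: "skew3_words n0 \<phi>"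
  and len: "n0 <= 6 + length (x0 @ x1 @ x2 @ x3 @ x4 @ x5 @ x6)"
  and ne: "s0 ~= []" "s1 ~= []" "s2 ~= []" "s3 ~= []" "s4 ~= []" "s5 ~= []"
  and idx: "set [i1, j1, i2, j2, i3, j3] = set [0, 1, 2, 3, 4, 5]" "distinct [i1, j1, i2, j2, i3, j3]"
 shows "dm i1 j1 (dm i2 j2 (dm i3 j3 (%s. \<phi> (x0 @ s 0 @ x1 @ s 1 @ x2 @ s 2 @ x3 @ s 3 @ x4 @ s 4 @ x5 @ s 5 @ x6))))
  (slots s0 s1 s2 s3 s4 s5) = 0"
 by (rule skew3_slots[OF K len _ _ idx(2)]) (use ne idx(1) in \<open>simp_all add: slots_def\<close>)

text \<open>\<open>N\<close> is the number of letters 0. The first two families concern the mixed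
  second difference of \<open>P\<close> in \<open>(k, m)\<close>: it vanishes for
  \<open>k >= 2\<close>, and its value at \<open>k = 1\<close> equals the one at
  \<open>k = 2\<close>. The third links the edge \<open>m = 0\<close> of \<open>P\<close> with the
  edge \<open>k = 0\<close> of \<open>Q\<close>. The fourth is the only one that reaches
  \<open>l = 0\<close>.\<close>

definition exchange_relations :: "nat => (nat => nat => nat => 'f::field_char_0) => (nat => nat => nat => 'f) => bool" where
 "exchange_relations N P Q \<longleftrightarrow>
  (\<forall>k y w. N = k + y + w + 5 -->
    P (k+2) (y+3) w - P (k+3) (y+2) w - P (k+2) (y+2) (w+1) + P (k+3) (y+1) (w+1) = 0) &
  (\<forall>k y w. N = k + y + w + 5 -->
    P (k+1) (y+4) w - P (k+2) (y+3) w - P (k+1) (y+3) (w+1) + P (k+2) (y+2) (w+1)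
    = P (k+2) (y+3) w - P (k+3) (y+2) w - P (k+2) (y+2) (w+1) + P (k+3) (y+1) (w+1)) &
  (\<forall>z l j. N = j + z + l + 4 --> j \<in> {1, 2} -->
    P (j+3+z) (l+1) 0 - P (j+2+z) (l+2) 0 = Q 0 (z+3) (l+1+j) - Q 0 (z+2) (l+2+j)) &
  (\<forall>k z. N = k + 7 + z -->
    P (k+1) 0 (z+6) - Q (k+2) 1 (z+4) - P (k+1) 4 (z+2) + P (k+4) 1 (z+2)
    = P (k+2) 0 (z+5) - Q (k+3) 1 (z+3) - P (k+2) 4 (z+1) + P (k+5) 1 (z+1))"

lemma numeral_Suc: "n + 3 = Suc (Suc (Suc n))" "n + 4 = Suc (Suc (Suc (Suc n)))"
 "n + 5 = Suc (Suc (Suc (Suc (Suc n))))" "n + 6 = Suc (Suc (Suc (Suc (Suc (Suc n)))))"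
  "tw 4 = tw (Suc (Suc (Suc (Suc 0))))"
 by (simp_all add: eval_nat_numeral)

lemma exchange_relations_words:
 assumes K: "skew3_words n0 \<phi>" and N: "n0 <= N"
 shows "exchange_relations N (%k l m. \<phi> (wP k l m)) (%k l m. \<phi> (wQ k l m) :: 'f::field_char_0)"
 unfolding exchange_relations_def
proof (intro conjI allI impI)
 fix k y w
 assume n: "N = k + y + w + 5"
 \<comment> \<open>Exchanging the blocks 00 and 0 in slots 1 and 3 cancels the terms with the letter
   1 in front of both and leaves a unit step of that letter; slots 4 and 5 give the unit step of the
   letter 2.\<close>
 have "dm 0 2 (dm 4 5 (dm 1 3 (%s. \<phi> (tw k @ s 0 @ [] @ s 1 @ [] @ s 2 @ [] @ s 3 @ tw y @ s 4 @ [] @ s 5 @ tw w))))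
  (slots [1] (tw 2) (tw 1) (tw 1) [2] (tw 1)) = 0"
  by (rule skew3_slots'[OF K]) (use N n in \<open>auto simp: tw_def\<close>)
 then show "\<phi> (wP (k+2) (y+3) w) - \<phi> (wP (k+3) (y+2) w) - \<phi> (wP (k+2) (y+2) (w+1))
   + \<phi> (wP (k+3) (y+1) (w+1)) = 0"
  by (simp add: dm_def slots_def transpose_def tw_add tw_add2 wP_def algebra_simps numeral_Suc)
next
 fix k y w
 assume n: "N = k + y + w + 5"
 have "dm 1 2 (dm 4 5 (dm 0 3 (%s. \<phi> (tw k @ s 0 @ [] @ s 1 @ [] @ s 2 @ [] @ s 3 @ tw y @ s 4 @ [] @ s 5 @ tw w))))
  (slots (tw 1) [1] (tw 1) (tw 2) [2] (tw 1)) = 0"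
  by (rule skew3_slots'[OF K]) (use N n in \<open>auto simp: tw_def\<close>)
 then show "\<phi> (wP (k+1) (y+4) w) - \<phi> (wP (k+2) (y+3) w) - \<phi> (wP (k+1) (y+3) (w+1)) + \<phi> (wP (k+2) (y+2) (w+1))
    = \<phi> (wP (k+2) (y+3) w) - \<phi> (wP (k+3) (y+2) w) - \<phi> (wP (k+2) (y+2) (w+1)) + \<phi> (wP (k+3) (y+1) (w+1))"
  by (simp add: dm_def slots_def transpose_def tw_add tw_add2 wP_def algebra_simps numeral_Suc)
next
 fix z l j
 assume n: "N = j + z + l + 4" and j: "j \<in> {1, 2 :: nat}"
 \<comment> \<open>The exchange of slots 5 and 0 carries the letter 2 from the very end to the very
   front, which turns values of \<open>P\<close> into values of \<open>Q\<close>. The block length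
   \<open>j\<close> is free so that two such relations can be compared later.\<close>
 have "dm 5 0 (dm 3 1 (dm 4 2 (%s. \<phi> ([] @ s 0 @ [] @ s 1 @ [] @ s 2 @ tw z @ s 3 @ [] @ s 4 @ tw l @ s 5 @ []))))
  (slots (tw j) (tw 1) (tw 2) [1] (tw 1) [2]) = 0"
  by (rule skew3_slots'[OF K]) (use N n j in \<open>auto simp: tw_def\<close>)
 then show "\<phi> (wP (j+3+z) (l+1) 0) - \<phi> (wP (j+2+z) (l+2) 0) = \<phi> (wQ 0 (z+3) (l+1+j)) - \<phi> (wQ 0 (z+2) (l+2+j))"
  by (simp add: dm_def slots_def transpose_def tw_add tw_add2 wP_def wQ_def algebra_simps numeral_Suc)
next
 fix k z
 assume n: "N = k + 7 + z"
 \<comment> \<open>The letters 1 and 2 start in neighbouring slots, so both unmoved they give a word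
   with \<open>l = 0\<close>.\<close>
 have "dm 1 3 (dm 2 4 (dm 0 5 (%s. \<phi> (tw k @ s 0 @ [] @ s 1 @ [] @ s 2 @ tw 1 @ s 3 @ tw 1 @ s 4 @ [] @ s 5 @ tw z))))
  (slots (tw 1) [1] [2] (tw 1) (tw 1) (tw 2)) = 0"
  by (rule skew3_slots'[OF K]) (use N n in \<open>auto simp: tw_def\<close>)
 then show "\<phi> (wP (k+1) 0 (z+6)) - \<phi> (wQ (k+2) 1 (z+4)) - \<phi> (wP (k+1) 4 (z+2)) + \<phi> (wP (k+4) 1 (z+2))
    = \<phi> (wP (k+2) 0 (z+5)) - \<phi> (wQ (k+3) 1 (z+3)) - \<phi> (wP (k+2) 4 (z+1)) + \<phi> (wP (k+5) 1 (z+1))"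
  by (simp add: dm_def slots_def transpose_def tw_add tw_add2 wP_def wQ_def algebra_simps numeral_Suc)
qed

lemma skew3_words_comp:
 fixes \<phi> :: "nat list => 'v::ab_group_add" and rW :: "nat list => nat list"
 assumes K: "skew3_words n0 \<phi>"
  and R: "\<And>c W. r (concat (map c W)) = concat (map (%x. r' (c x)) (rW W))"
  and rW: "\<And>W. distinct W ==> distinct (rW W)" "\<And>W. set (rW W) = set W" "\<And>W. length (rW W) = length W"
  and r': "\<And>x. x ~= [] ==> r' x ~= []"
 shows "skew3_words n0 (%w. \<phi> (r w))"
 unfolding skew3_words_def R
proof (intro allI impI)
 fix W :: "nat list" and c :: "nat => nat list" and i1 j1 i2 j2 i3 j3
 assume a: "distinct W" "n0 <= length W" "{i1, j1, i2, j2, i3, j3} \<subseteq> set W"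
  "distinct [i1, j1, i2, j2, i3, j3]" "\<forall>x. c x ~= []"
 define H where "H c = \<phi> (concat (map c (rW W)))" for c
 have d: "dm i j (%c. F (%x. r' (c x))) = (%c. dm i j F (%x. r' (c x)))" for i j and F :: "(nat => nat list) => 'v"
  unfolding dm_def comp_def ..
 have "dm i1 j1 (dm i2 j2 (dm i3 j3 H)) (%x. r' (c x)) = 0"
  unfolding H_def by (rule skew3_wordsD[OF K]) (use a rW r' in auto)
 then show "dm i1 j1 (dm i2 j2 (dm i3 j3 (%c. \<phi> (concat (map (%x. r' (c x)) (rW W)))))) c = 0"
  using d[of i3 j3 H] d[of i2 j2 "dm i3 j3 H"] d[of i1 j1 "dm i2 j2 (dm i3 j3 H)"]
  by (simp add: H_def)
qed

lemma skew3_words_rev: "skew3_words n0 \<phi> ==> skew3_words n0 (%w. \<phi> (rev w))"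
 by (rule skew3_words_comp[where r' = rev and rW = rev]) (auto simp: rev_concat rev_map comp_def)

lemma skew3_words_map: "skew3_words n0 \<phi> ==> skew3_words n0 (%w. \<phi> (map f w))"
 by (rule skew3_words_comp[where r' = "map f" and rW = id]) (auto simp: map_concat comp_def)

lemma rev_tw [simp]: "rev (tw k) = tw k" by (simp add: tw_def)

lemma rev_wP: "rev (wP k l m) = wQ m l k" and rev_wQ: "rev (wQ k l m) = wP m l k"
 by (simp_all add: wP_def wQ_def)

lemma swap_wP: "map (transpose 1 2) (wP k l m) = wQ k l m"
 and swap_wQ: "map (transpose 1 2) (wQ k l m) = wP k l m"
 by (simp_all add: wP_def wQ_def tw_def transpose_def)

text \<open>Renaming the letters 1 and 2 exchanges \<open>P\<close> and \<open>Q\<close>; reversing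
  words exchanges \<open>P\<close> and \<open>Q\<close> and also \<open>k\<close> and
  \<open>m\<close>. Both preserve \<open>skew3_words\<close>, so every relation holds in four
  versions.\<close>

lemma exchange_relations_all:
 fixes \<phi> :: "nat list => 'f::field_char_0"
 assumes K: "skew3_words n0 \<phi>" and N: "n0 <= N"
 defines "P \<equiv> %k l m. \<phi> (wP k l m)" and "Q \<equiv> %k l m. \<phi> (wQ k l m)"
 shows "exchange_relations N P Q" "exchange_relations N Q P"
  "exchange_relations N (%k l m. Q m l k) (%k l m. P m l k)"
  "exchange_relations N (%k l m. P m l k) (%k l m. Q m l k)"
 using exchange_relations_words[OF K N]
  exchange_relations_words[OF skew3_words_map[OF K, of "transpose 1 2"] N]
  exchange_relations_words[OF skew3_words_rev[OF K] N]
  exchange_relations_words[OF skew3_words_map[OF skew3_words_rev[OF K], of "transpose 1 2"] N]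
 by (simp_all only: P_def Q_def rev_wP rev_wQ swap_wP swap_wQ)

section \<open>Solutions of the exchange relations: affine functions with boundary
  corrections\<close>

definition boundary_affine :: "nat => (nat => nat => nat => 'f::field_char_0) => 'f => 'f => 'f => 'f => 'f => 'f => 'f => 'f => 'f => 'f => 'f => bool" where
 "boundary_affine N P c \<nu> \<eta> u0 u1 v0 v1 \<kappa> \<alpha> \<beta> \<gamma> \<longleftrightarrow>
  (\<forall>k l m. k + l + m = N --> P k l m = c + of_nat k * \<nu> + of_nat m * \<eta>
   + of_bool (k = 0) * u0 + of_bool (k = 1) * u1 + of_bool (m = 0) * v0 + of_bool (m = 1) * v1
   + of_bool (l = 0) * \<kappa> + of_bool (k = 0 & l = 0) * \<alpha> + of_bool (m = 0 & l = 0) * \<beta>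
   + of_bool (k = 0 & m = 0) * \<gamma>)"

locale exchange_function =
 fixes N :: nat and P Q :: "nat => nat => nat => 'f::field_char_0"
 assumes N12: "N \<ge> 12"
  and rel: "exchange_relations N P Q" and rel_swap: "exchange_relations N Q P"
  and rel_rev: "exchange_relations N (%k l m. Q m l k) (%k l m. P m l k)"
  and rel_rev_swap: "exchange_relations N (%k l m. P m l k) (%k l m. Q m l k)"
begin

definition p where "p k m = P k (N - k - m) m"
definition q where "q k m = Q k (N - k - m) m"

lemma cell_zero_aux:
 assumes "exchange_relations N R S" "k \<ge> 2 \<or> (k = 1 & m + 5 <= N)" "k + m + 3 <= N"
 shows "R k (N - k - m) m - R (k+1) (N - (k+1) - m) m - R k (N - k - (m+1)) (m+1)
   + R (k+1) (N - (k+1) - (m+1)) (m+1) = 0"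
proof -
 have C1: "R k (N - k - m) m - R (k+1) (N - (k+1) - m) m - R k (N - k - (m+1)) (m+1)
   + R (k+1) (N - (k+1) - (m+1)) (m+1) = 0" if "k \<ge> 2" "k + m + 3 <= N" for k
 proof -
  define k' y where "k' = k - 2" and "y = N - (k' + m + 5)"
  then have k': "k = k' + 2" and y: "N = k' + y + m + 5" using that by auto
  have "N - k - m = y + 3" "N - (k+1) - m = y + 2" "N - k - (m+1) = y + 2" "N - (k+1) - (m+1) = y + 1" "k + 1 = k' + 3"
   using k' y by auto
  then show ?thesis using assms(1)[unfolded exchange_relations_def, THEN conjunct1, rule_format, OF y] k' by (simp add: numeral_Suc)
 qed
 show ?thesis
 proof (cases "k \<ge> 2")
  case True
  then show ?thesis using C1 assms(3) by blast
 next
  case False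
  then have k: "k = 1" "m + 5 <= N" using assms(2) by auto
  define y where "y = N - (m + 5)"
  then have y: "N = 0 + y + m + 5" using k by auto
  have e: "N - k - m = y + 4" "N - (k+1) - m = y + 3" "N - k - (m+1) = y + 3" "N - (k+1) - (m+1) = y + 2"
   "N - 2 - m = y + 3" "N - (2+1) - m = y + 2" "N - 2 - (m+1) = y + 2" "N - (2+1) - (m+1) = y + 1"
   using k y by auto
  have A: "R 1 (y+4) m - R 2 (y+3) m - R 1 (y+3) (m+1) + R 2 (y+2) (m+1)
    = R 2 (y+3) m - R 3 (y+2) m - R 2 (y+2) (m+1) + R 3 (y+1) (m+1)"
   using assms(1)[unfolded exchange_relations_def, THEN conjunct2, THEN conjunct1, rule_format, OF y]
   by (simp only: add_0)
  have "2 + m + 3 <= N" "2 + 1 = (3::nat)" using y by auto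
  then have B: "R 2 (y+3) m - R 3 (y+2) m - R 2 (y+2) (m+1) + R 3 (y+1) (m+1) = 0"
   using C1[of 2, unfolded e] by simp
  show ?thesis unfolding e unfolding k(1) one_add_one unfolding A by (rule B)
 qed
qed

text \<open>On the triangle of pairs \<open>(k, m)\<close> with \<open>l >= 1\<close> every unit
  cell is flat, except possibly the one at the corner \<open>k = m = 0\<close>. Cells with larger
  \<open>k\<close> come from the relations for \<open>P\<close>, the remaining ones from the version
  with \<open>k\<close> and \<open>m\<close> exchanged. So \<open>p\<close> is a function of
  \<open>k\<close> plus a function of \<open>m\<close>, apart from its value at the corner.\<close>

lemma cell_zero:
 assumes "k + m + 3 <= N" "k ~= 0 \<or> m ~= 0"
 shows "p (k+1) (m+1) = p (k+1) m + p k (m+1) - p k m"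
proof -
 have "p k m - p (k+1) m - p k (m+1) + p (k+1) (m+1) = 0"
 proof (cases "k \<ge> 2 \<or> (k = 1 & m + 5 <= N)")
  case True
  then show ?thesis using cell_zero_aux[OF rel True assms(1)] by (simp add: p_def)
 next
  case False
  then have c: "m \<ge> 2 \<or> (m = 1 & k + 5 <= N)" using assms N12 by auto
  have e: "N - i - j = N - j - i" for i j :: nat by simp
  show ?thesis using cell_zero_aux[OF rel_rev_swap c] assms(1)
   by (simp add: p_def add.commute e[of "Suc k"] e[of k] algebra_simps)
 qed
 then show ?thesis by (simp add: algebra_simps)
qed

lemma p_step: "1 <= k ==> k + 1 + m + 1 <= N ==> p (k+1) m - p k m = p (k+1) 0 - p k 0"
proof (induction m)
 case (Suc m)
 then show ?case using cell_zero[of k m] by simp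
qed simp

lemma p_add: "1 <= k ==> k + m + 1 <= N ==> p k m = p k 0 + p 1 m - p 1 0"
proof (induction k rule: dec_induct)
 case (step k)
 then have "p k m = p k 0 + p 1 m - p 1 0" "p (k+1) m - p k m = p (k+1) 0 - p k 0"
  using p_step[of k m] by auto
 then show ?case unfolding Suc_eq_plus1 by Groebner_Basis.algebra
qed simp

lemma p_row0: "1 <= m ==> m + 2 <= N ==> p 0 m - p 1 m = p 0 1 - p 1 1"
proof (induction m rule: dec_induct)
 case (step m)
 then have "p 0 m - p 1 m = p 0 1 - p 1 1" "p 1 (m+1) = p 1 m + p 0 (m+1) - p 0 m"
  using cell_zero[of 0 m] by auto
 then show ?case unfolding Suc_eq_plus1 by Groebner_Basis.algebra
qed simp

end

lemma numeral_Suc': "3 + n = Suc (Suc (Suc n))" "4 + n = Suc (Suc (Suc (Suc n)))"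
 "5 + n = Suc (Suc (Suc (Suc (Suc n))))" "6 + n = Suc (Suc (Suc (Suc (Suc (Suc n)))))"
 by simp_all

text \<open>With \<open>j = 1\<close> and with \<open>j = 2\<close> the same step of
  \<open>r\<close> equals steps of \<open>s\<close> at two neighbouring places. Comparing the two at
  neighbouring \<open>k\<close> shows that the steps of \<open>r\<close>, and hence those of
  \<open>s\<close>, are constant.\<close>

lemma slope_aux:
 fixes R S :: "nat => nat => nat => 'f::field_char_0"
 assumes rel: "exchange_relations N R S"
 defines "r \<equiv> %k. R k (N - k) 0" and "s \<equiv> %m. S 0 (N - m) m"
 shows "3 <= k ==> k + 2 <= N ==> r (k+1) - r k = r 4 - r 3"
  and "2 <= m ==> m + 3 <= N ==> s m - s (m+1) = r 4 - r 3"
proof -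
 have E: "R (j+3+z) (l+1) 0 - R (j+2+z) (l+2) 0 = S 0 (z+3) (l+1+j) - S 0 (z+2) (l+2+j)"
  if "N = j + z + l + 4" "j \<in> {1, 2}" for j z l
  using rel that unfolding exchange_relations_def by blast
 have e1: "r (k+1) - r k = s (N - k) - s (N - k + 1)" if "3 <= k" "k + 2 <= N" for k
 proof -
  define z l where "z = k - 3" and "l = N - k - 2"
  then have zl: "k = z + 3" "N = z + l + 5" using that by auto
  show ?thesis using E[of 1 z l] unfolding r_def s_def zl by (simp add: numeral_Suc numeral_Suc')
 qed
 have e2: "r (k+1) - r k = s (N - k + 1) - s (N - k + 2)" if "4 <= k" "k + 2 <= N" for k
 proof -
  define z l where "z = k - 4" and "l = N - k - 2"
  then have zl: "k = z + 4" "N = z + l + 6" using that by auto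
  show ?thesis using E[of 2 z l] unfolding r_def s_def zl by (simp add: numeral_Suc numeral_Suc')
 qed
 have R: "r (k+1) - r k = r 4 - r 3" if "3 <= k" "k + 2 <= N" for k
  using that
 proof (induction k rule: dec_induct)
  case (step k)
  have "N - (k+1) + 1 = N - k" "N - (k+1) + 2 = N - k + 1" using step.prems by auto
  then show ?case using e2[of "k+1"] e1[of k] step by simp
 qed simp
 show "r (k+1) - r k = r 4 - r 3" if "3 <= k" "k + 2 <= N" using R that by blast
 show "s m - s (m+1) = r 4 - r 3" if "2 <= m" "m + 3 <= N"
  using e1[of "N - m"] R[of "N - m"] that by simp
qed

context exchange_function
begin

definition \<nu> where "\<nu> = p 4 0 - p 3 0"
definition \<eta> where "\<eta> = p 0 4 - p 0 3"

text \<open>Each edge of \<open>P\<close> is tied to an edge of \<open>Q\<close>, once as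
  \<open>r\<close> and once as \<open>s\<close> in \<open>slope_aux\<close>, so the four edges have
  only two slopes up to sign. The value \<open>k = 2\<close>, which the first part of
  \<open>slope_aux\<close> misses, is supplied by the second.\<close>

lemma p_slope: "2 <= k ==> k + 2 <= N ==> p (k+1) 0 - p k 0 = \<nu>"
 and q_slope: "2 <= k ==> k + 2 <= N ==> q 0 (k+1) - q 0 k = - \<nu>"
 and p_slope': "2 <= k ==> k + 2 <= N ==> p 0 (k+1) - p 0 k = \<eta>"
 and q_slope': "2 <= k ==> k + 2 <= N ==> q (k+1) 0 - q k 0 = - \<eta>"
proof -
 note pq = p_def q_def
 have a1: "p (k+1) 0 - p k 0 = \<nu>" if "3 <= k" "k + 2 <= N" for k
  using slope_aux(1)[OF rel that] unfolding pq \<nu>_def by simp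
 have a2: "q 0 m - q 0 (m+1) = \<nu>" if "2 <= m" "m + 3 <= N" for m
  using slope_aux(2)[OF rel that] unfolding pq \<nu>_def by simp
 have b1: "q 0 (k+1) - q 0 k = q 0 4 - q 0 3" if "3 <= k" "k + 2 <= N" for k
  using slope_aux(1)[OF rel_rev that] unfolding pq by simp
 have b2: "p m 0 - p (m+1) 0 = q 0 4 - q 0 3" if "2 <= m" "m + 3 <= N" for m
  using slope_aux(2)[OF rel_rev that] unfolding pq by simp
 have c2: "p 0 m - p 0 (m+1) = q 4 0 - q 3 0" if "2 <= m" "m + 3 <= N" for m
  using slope_aux(2)[OF rel_swap that] unfolding pq by simp
 have c1: "q (k+1) 0 - q k 0 = q 4 0 - q 3 0" if "3 <= k" "k + 2 <= N" for k
  using slope_aux(1)[OF rel_swap that] unfolding pq by simp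
 have d1: "p 0 (k+1) - p 0 k = \<eta>" if "3 <= k" "k + 2 <= N" for k
  using slope_aux(1)[OF rel_rev_swap that] unfolding pq \<eta>_def by simp
 have d2: "q m 0 - q (m+1) 0 = \<eta>" if "2 <= m" "m + 3 <= N" for m
  using slope_aux(2)[OF rel_rev_swap that] unfolding pq \<eta>_def by simp
 have n: "q 0 4 - q 0 3 = - \<nu>" "q 4 0 - q 3 0 = - \<eta>"
  using b2[of 3] a1[of 3] c2[of 3] d1[of 3] N12 by (simp_all add: algebra_simps)
 have k23: "k = 2 \<or> 3 <= k" if "2 <= k" for k :: nat using that by linarith
 show "p (k+1) 0 - p k 0 = \<nu>" if "2 <= k" "k + 2 <= N"
  using k23[OF that(1)] a1[of k] b2[of k] n that N12 by (auto simp: algebra_simps)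
 show "q 0 (k+1) - q 0 k = - \<nu>" if "2 <= k" "k + 2 <= N"
  using k23[OF that(1)] b1[of k] a2[of k] n that N12 by (auto simp: algebra_simps)
 show "p 0 (k+1) - p 0 k = \<eta>" if "2 <= k" "k + 2 <= N"
  using k23[OF that(1)] d1[of k] c2[of k] n that N12 by (auto simp: algebra_simps)
 show "q (k+1) 0 - q k 0 = - \<eta>" if "2 <= k" "k + 2 <= N"
  using k23[OF that(1)] c1[of k] d2[of k] n that N12 by (auto simp: algebra_simps)
qed

end

lemma slope_sum:
 fixes f :: "nat => 'f::field_char_0"
 assumes "\<And>k. a <= k ==> k < b ==> f (k+1) - f k = t"
 shows "a <= k ==> k <= b ==> f k = f a + of_nat (k - a) * t"
proof (induction k rule: dec_induct)
 case (step k)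
 then have "f (k+1) = f k + t" using assms[of k] by (simp add: algebra_simps)
 then show ?case using step by (simp add: algebra_simps Suc_diff_le)
qed simp

context exchange_function
begin

lemma swapped: "exchange_function N Q P"
 by unfold_locales (rule N12 rel_swap rel rel_rev_swap rel_rev)+

definition p0 where "p0 k = P k 0 (N - k)"

text \<open>In the fourth family of relations all terms but two have \<open>l >= 1\<close>, where
  additivity and the edge slopes are known already. Inserting these leaves a recursion along
  \<open>l = 0\<close>.\<close>

lemma p0_step:
 assumes "1 <= k" "k + 6 <= N"
 shows "p0 k - p0 (k+1) = p k 0 - p (k+1) 0 + \<eta>"
proof -
 interpret s: exchange_function N Q P by (rule swapped)
 have sq: "s.p = q" "s.q = p" by (simp_all add: fun_eq_iff s.p_def s.q_def p_def q_def)
 define k' z where "k' = k - 1" and "z = N - k - 6"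
 then have kz: "k = k' + 1" "N = k' + 7 + z" using assms by auto
 have "P (k'+1) 0 (z+6) - Q (k'+2) 1 (z+4) - P (k'+1) 4 (z+2) + P (k'+4) 1 (z+2)
    = P (k'+2) 0 (z+5) - Q (k'+3) 1 (z+3) - P (k'+2) 4 (z+1) + P (k'+5) 1 (z+1)"
  using rel kz(2) unfolding exchange_relations_def by blast
 then have main: "p0 k - q (k+1) (z+4) - p k (z+2) + p (k+3) (z+2)
   = p0 (k+1) - q (k+2) (z+3) - p (k+1) (z+1) + p (k+4) (z+1)"
  unfolding p0_def p_def q_def unfolding kz by (simp add: numeral_Suc numeral_Suc')
 have P1: "p k (z+2) = p k 0 + p 1 (z+2) - p 1 0" "p (k+3) (z+2) = p (k+3) 0 + p 1 (z+2) - p 1 0"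
  "p (k+1) (z+1) = p (k+1) 0 + p 1 (z+1) - p 1 0" "p (k+4) (z+1) = p (k+4) 0 + p 1 (z+1) - p 1 0"
  by (rule p_add; use kz in simp)+
 have Q1: "q (k+1) (z+4) = q (k+1) 0 + q 1 (z+4) - q 1 0" "q (k+2) (z+3) = q (k+2) 0 + q 1 (z+3) - q 1 0"
  by (rule s.p_add[unfolded sq]; use kz in simp)+
 have "q 0 (z+4) - q 1 (z+4) = q 0 1 - q 1 1" "q 0 (z+3) - q 1 (z+3) = q 0 1 - q 1 1"
  by (rule s.p_row0[unfolded sq]; use kz in simp)+
 moreover have "q 0 (z+4) - q 0 (z+3) = - \<nu>" using q_slope[of "z+3"] kz by (simp add: numeral_Suc numeral_Suc')
 moreover have "q (k+2) 0 - q (k+1) 0 = - \<eta>" using q_slope'[of "k+1"] kz by simp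
 moreover have "p (k+4) 0 - p (k+3) 0 = \<nu>" using p_slope[of "k+3"] kz by (simp add: numeral_Suc numeral_Suc')
 ultimately show ?thesis using main P1 Q1 by Groebner_Basis.algebra
qed

lemma rev_swapped: "exchange_function N (%k l m. P m l k) (%k l m. Q m l k)"
 by unfold_locales (rule N12 rel_swap rel rel_rev_swap rel_rev)+

lemma p0_step':
 assumes "1 <= m" "m + 6 <= N"
 shows "p0 (N - m) - p0 (N - m - 1) = p 0 m - p 0 (m+1) + \<nu>"
proof -
 interpret s: exchange_function N "%k l m. P m l k" "%k l m. Q m l k" by (rule rev_swapped)
 have e: "N - k - m = N - m - k" for k m by simp
 have sp: "s.p k m = p m k" for k m unfolding s.p_def p_def e[of k m] ..
 have "s.\<eta> = \<nu>" unfolding s.\<eta>_def \<nu>_def sp ..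
 then show ?thesis
  using s.p0_step[OF assms] assms unfolding s.p0_def p0_def sp by simp
qed

text \<open>The constants are fitted to the values at the corners and next to the edges. Then
  \<open>p_add\<close>, \<open>p_row0\<close> and the slopes give every value with
  \<open>l >= 1\<close>, and the two recursions along \<open>l = 0\<close> give the rest, offset by
  one constant \<open>\<kappa>\<close>.\<close>

lemma boundary_form:
 "\<exists>c u0 u1 v0 v1 \<kappa> \<alpha> \<beta> \<gamma>. boundary_affine N P c \<nu> \<eta> u0 u1 v0 v1 \<kappa> \<alpha> \<beta> \<gamma>"
proof -
 define g where "g = p 2 0 - 2 * \<nu>"
 define u1 where "u1 = p 1 0 - g - \<nu>"
 define v1 where "v1 = p 0 1 - p 0 2 + \<eta>"
 define \<delta> where "\<delta> = p 0 1 - p 1 1"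
 define c where "c = g - 2 * \<eta> + p 0 2 - \<delta> - p 1 0"
 define v0 where "v0 = g - c"
 define u0 where "u0 = p 0 2 - 2 * \<eta> - c"
 define \<gamma> where "\<gamma> = p 0 0 - c - u0 - v0"
 define \<kappa> where "\<kappa> = p0 2 - c - 2 * \<nu> - \<eta> * of_nat (N - 2)"
 define \<alpha> where "\<alpha> = p0 0 - (c + \<eta> * of_nat N + u0 + \<kappa>)"
 define \<beta> where "\<beta> = p0 N - (c + \<nu> * of_nat N + v0 + \<kappa>)"
 have G: "p k 0 = g + of_nat k * \<nu> + of_bool (k = 1) * u1" if "1 <= k" "k + 1 <= N" for k
 proof (cases "k = 1")
  case False
  then have "p k 0 = p 2 0 + of_nat (k - 2) * \<nu>"
   using that by (intro slope_sum[where b = "N - 1"] p_slope) auto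
  then show ?thesis using False that by (simp add: g_def of_nat_diff algebra_simps)
 qed (simp add: u1_def)
 have H: "p 0 m = p 0 2 + of_nat m * \<eta> - 2 * \<eta> + of_bool (m = 1) * v1" if "1 <= m" "m + 1 <= N" for m
 proof (cases "m = 1")
  case False
  then have "p 0 m = p 0 2 + of_nat (m - 2) * \<eta>"
   using that by (intro slope_sum[where b = "N - 1"] p_slope') auto
  then show ?thesis using False that by (simp add: of_nat_diff algebra_simps)
 qed (simp add: v1_def)
 have inner: "p k m = c + of_nat k * \<nu> + of_nat m * \<eta> + of_bool (k = 1) * u1 + of_bool (m = 1) * v1"
  if "1 <= k" "1 <= m" "k + m + 1 <= N" for k m
 proof -
  have "p k m = p k 0 + p 1 m - p 1 0" using that by (intro p_add) auto
  moreover have "p 0 m - p 1 m = \<delta>" unfolding \<delta>_def using that by (intro p_row0) auto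
  moreover have "p k 0 = g + of_nat k * \<nu> + of_bool (k = 1) * u1" using that by (intro G) auto
  moreover have "p 0 m = p 0 2 + of_nat m * \<eta> - 2 * \<eta> + of_bool (m = 1) * v1" using that by (intro H) auto
  ultimately show ?thesis unfolding c_def by Groebner_Basis.algebra
 qed
 have edge: "p0 k = c + of_nat k * \<nu> + of_nat (N - k) * \<eta> + of_bool (k = 1) * u1
   + of_bool (N - k = 1) * v1 + \<kappa>" if "1 <= k" "k + 1 <= N" for k
 proof -
  define f where "f k = p0 k - of_nat k * \<nu> - of_nat (N - k) * \<eta> - of_bool (k = 1) * u1
   - of_bool (N - k = 1) * v1" for k
  \<comment> \<open>\<open>p0_step\<close> stops six places before the right end and
    \<open>p0_step'\<close> six places before the left end; \<open>N >= 12\<close> lets the two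
    cover all steps between them.\<close>
  have st: "f (k+1) - f k = 0" if k: "1 <= k" "k < N - 1" for k
  proof (cases "k + 6 <= N")
   case True
   have "of_nat (N - k) = of_nat (N - (k+1)) + (1::'f)"
    using k by (simp add: of_nat_diff)
   moreover have "N - k ~= 1" "N - (k+1) ~= 1" using True by auto
   ultimately show ?thesis
    using p0_step[OF k(1) True] G[of k] G[of "k+1"] k unfolding f_def
    by (simp add: algebra_simps)
  next
   case False
   define m where "m = N - (k + 1)"
   have m: "1 <= m" "m + 6 <= N" "N - m = k + 1" "N - m - 1 = k" "N - k = m + 1" "N - (k+1) = m" "k ~= 1"
    using k False N12 by (auto simp: m_def)
   have "p0 (k+1) - p0 k = p 0 m - p 0 (m+1) + \<nu>" using p0_step'[OF m(1,2)] m by simp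
   moreover have "p 0 m = p 0 2 + of_nat m * \<eta> - 2 * \<eta> + of_bool (m = 1) * v1" using m by (intro H) auto
   moreover have "p 0 (m+1) = p 0 2 + of_nat (m+1) * \<eta> - 2 * \<eta> + of_bool (m+1 = 1) * v1"
    using m by (intro H) auto
   moreover have "of_bool (m+1 = 1) = (0::'f)" "of_bool (k = 1) = (0::'f)" "of_bool (k+1 = 1) = (0::'f)"
    "of_nat (m+1) = of_nat m + (1::'f)" "of_nat (k+1) = of_nat k + (1::'f)" using m k by auto
   ultimately show ?thesis unfolding f_def m(5,6) by Groebner_Basis.algebra
  qed
  have "f k = f 1 + of_nat (k - 1) * 0"
   using that by (intro slope_sum[where b = "N - 1"] st) auto
  moreover have "f 2 = f 1 + of_nat (2 - 1) * 0"
   using N12 by (intro slope_sum[where b = "N - 1"] st) auto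
  moreover have "N - 2 ~= 1" using N12 by simp
  then have "f 2 = \<kappa> + c" unfolding f_def \<kappa>_def by (simp add: algebra_simps)
  ultimately have "f k = \<kappa> + c" by simp
  then show ?thesis unfolding f_def by (simp add: algebra_simps)
 qed
 have "boundary_affine N P c \<nu> \<eta> u0 u1 v0 v1 \<kappa> \<alpha> \<beta> \<gamma>"
  unfolding boundary_affine_def
 proof (intro allI impI)
  fix k l m
  assume klm: "k + l + m = N"
  have pl: "P k l m = p k m" using klm by (auto simp: p_def)
  have p0': "P k l m = p0 k" if "l = 0" using klm that by (auto simp: p0_def)
  consider "l = 0" "k = 0" | "l = 0" "m = 0" | "l = 0" "k \<ge> 1" "m \<ge> 1"
   | "l \<ge> 1" "k = 0" "m = 0" | "l \<ge> 1" "k = 0" "m \<ge> 1" | "l \<ge> 1" "k \<ge> 1" "m = 0"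
   | "l \<ge> 1" "k \<ge> 1" "m \<ge> 1" by linarith
  then show "P k l m = c + of_nat k * \<nu> + of_nat m * \<eta>
   + of_bool (k = 0) * u0 + of_bool (k = 1) * u1 + of_bool (m = 0) * v0 + of_bool (m = 1) * v1
   + of_bool (l = 0) * \<kappa> + of_bool (k = 0 & l = 0) * \<alpha> + of_bool (m = 0 & l = 0) * \<beta>
   + of_bool (k = 0 & m = 0) * \<gamma>"
  proof cases
   case 1
   then show ?thesis using p0' klm N12 by (simp add: \<alpha>_def)
  next
   case 2
   then show ?thesis using p0' klm N12 by (simp add: \<beta>_def)
  next
   case 3
   then show ?thesis using p0' edge[of k] klm by (auto simp: algebra_simps)
  next
   case 4
   then show ?thesis using pl by (simp add: \<gamma>_def)
  next
   case 5
   then show ?thesis using pl H[of m] klm by (simp add: u0_def)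
  next
   case 6
   then show ?thesis using pl G[of k] klm by (simp add: v0_def)
  next
   case 7
   then show ?thesis using pl inner[of k m] klm by simp
  qed
 qed
 then show ?thesis by blast
qed

end

text \<open>Besides the shape of \<open>P\<close> and \<open>Q\<close> it matters that the slopes of
  \<open>Q\<close> are those of \<open>P\<close> with opposite sign and exchanged roles: this lets
  the contributions of the two orders of a pair of letters be combined in
  \<open>bulk_zero\<close>.\<close>

lemma two_letter_form:
 fixes \<phi> :: "nat list => 'f::field_char_0"
 assumes K: "skew3_words n0 \<phi>" and N: "n0 <= N" "12 <= N"
 obtains c \<nu> \<eta> u0 u1 v0 v1 \<kappa> \<alpha> \<beta> \<gamma> c' u0' u1' v0' v1' \<kappa>' \<alpha>' \<beta>' \<gamma>' where
  "boundary_affine N (%k l m. \<phi> (wP k l m)) c \<nu> \<eta> u0 u1 v0 v1 \<kappa> \<alpha> \<beta> \<gamma>"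
  "boundary_affine N (%k l m. \<phi> (wQ k l m)) c' (- \<eta>) (- \<nu>) u0' u1' v0' v1' \<kappa>' \<alpha>' \<beta>' \<gamma>'"
proof -
 let ?P = "%k l m. \<phi> (wP k l m)" and ?Q = "%k l m. \<phi> (wQ k l m)"
 interpret e: exchange_function N ?P ?Q
  using exchange_relations_all[OF K N(1)] N(2) by unfold_locales
 interpret s: exchange_function N ?Q ?P by (rule e.swapped)
 have "s.p = e.q" by (simp add: fun_eq_iff s.p_def e.q_def)
 then have "s.\<nu> = - e.\<eta>" "s.\<eta> = - e.\<nu>"
  unfolding s.\<nu>_def s.\<eta>_def using e.q_slope'[of 3] e.q_slope[of 3] N(2) by simp_all
 then obtain c' u0' u1' v0' v1' \<kappa>' \<alpha>' \<beta>' \<gamma>' where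
  2: "boundary_affine N ?Q c' (- e.\<eta>) (- e.\<nu>) u0' u1' v0' v1' \<kappa>' \<alpha>' \<beta>' \<gamma>'"
  using s.boundary_form by auto
 obtain c u0 u1 v0 v1 \<kappa> \<alpha> \<beta> \<gamma> where
  1: "boundary_affine N ?P c e.\<nu> e.\<eta> u0 u1 v0 v1 \<kappa> \<alpha> \<beta> \<gamma>"
  using e.boundary_form by auto
 show ?thesis by (rule that[OF 1 2])
qed

section \<open>Coefficients of a two-letter functional\<close>

definition bef :: "nat => nat => nat list => bool" where
 "bef i j w \<longleftrightarrow> (\<exists>u v z. w = u @ i # v @ j # z)"

text \<open>When every letter \<open>x\<close> is replaced by \<open>e x\<close> copies of 0, this
  is the number of zeros in front of \<open>i\<close>; \<open>m_of\<close> is the number behind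
  \<open>j\<close>.\<close>

definition k_of :: "(nat => nat) => nat => nat list => nat" where
 "k_of e i w = sum_list (map e (takeWhile (%x. x ~= i) w))"

definition m_of :: "(nat => nat) => nat => nat list => nat" where
 "m_of e j w = k_of e j (rev w)"

lemma k_of_split: "i ~: set u ==> k_of e i (u @ i # v) = sum_list (map e u)"
 by (induction u) (auto simp: k_of_def)

lemma m_of_split: "j ~: set z ==> m_of e j (v @ j # z) = sum_list (map e z)"
 using k_of_split[of j "rev z" e "rev v"] by (simp add: m_of_def rev_map[symmetric] sum_list_rev)

lemma bef_cases:
 assumes "i \<in> set w" "j \<in> set w" "i ~= j"
 shows "bef i j w \<or> bef j i w"
proof -
 obtain u v where w: "w = u @ i # v" using assms(1) split_list by metis
 consider "j \<in> set u" | "j \<in> set v" using assms w by auto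
 then show ?thesis
 proof cases
  case 1
  then obtain u1 u2 where "u = u1 @ j # u2" using split_list by metis
  then have "w = u1 @ j # u2 @ i # v" using w by simp
  then show ?thesis unfolding bef_def by blast
 next
  case 2
  then obtain u1 u2 where "v = u1 @ j # u2" using split_list by metis
  then have "w = u @ i # u1 @ j # u2" using w by simp
  then show ?thesis unfolding bef_def by blast
 qed
qed

lemma bef_not_bef: "distinct w ==> bef i j w ==> \<not> bef j i w"
proof
 assume d: "distinct w" and "bef i j w" "bef j i w"
 then obtain u v z u' v' z' where w: "w = u @ i # v @ j # z" "w = u' @ j # v' @ i # z'"
  unfolding bef_def by blast
 have d': "distinct (u @ i # v @ j # z)" "distinct (u' @ j # v' @ i # z')"
  using d by (simp_all only: w[symmetric])
 then have ni: "i ~: set u" "i ~: set (u' @ j # v')" "j ~: set u'" "j ~: set (u @ i # v)" by auto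
 have "length u = k_of (%_. 1) i w" "length (u' @ j # v') = k_of (%_. 1) i w"
  using w k_of_split[OF ni(1), of "%_. 1" "v @ j # z"] k_of_split[OF ni(2), of "%_. 1" z']
  by (auto simp: sum_list_triv)
 moreover have "length (u @ i # v) = k_of (%_. 1) j w" "length u' = k_of (%_. 1) j w"
  using w k_of_split[OF ni(3), of "%_. 1" "v' @ i # z'"] k_of_split[OF ni(4), of "%_. 1" z]
  by (auto simp: sum_list_triv)
 ultimately show False by simp
qed

definition two_sub :: "nat => nat list => nat => nat list => (nat => nat) => nat => nat list" where
 "two_sub i a j b e = (%x. if x = i then a else if x = j then b else tw (e x))"

lemma concat_tw: "concat (map (%x. tw (e x)) u) = tw (sum_list (map e u))"
 by (induction u) (auto simp: tw_add)

lemma two_sub_avoid: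
 "i ~: set u ==> j ~: set u ==> concat (map (two_sub i a j b e) u) = tw (sum_list (map e u))"
 unfolding concat_tw[symmetric] by (intro arg_cong[of _ _ concat] map_cong) (auto simp: two_sub_def)

text \<open>The correction terms of \<open>boundary_affine\<close> with \<open>l = 0\<close>
  rewritten as \<open>k + m = N\<close>, so that only \<open>k\<close> and \<open>m\<close>
  occur.\<close>

definition boundary_part :: "nat => 'f::field_char_0 => 'f => 'f => 'f => 'f => 'f => 'f => 'f => nat => nat => 'f" where
 "boundary_part N u0 u1 v0 v1 \<kappa> \<alpha> \<beta> \<gamma> k m =
   of_bool (k = 0) * u0 + of_bool (k = 1) * u1 + of_bool (m = 0) * v0 + of_bool (m = 1) * v1
   + of_bool (k + m = N) * \<kappa> + of_bool (k = 0 & k + m = N) * \<alpha> + of_bool (m = 0 & k + m = N) * \<beta>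
   + of_bool (k = 0 & m = 0) * \<gamma>"

lemma boundary_affine_part:
 assumes "boundary_affine N P c \<nu> \<eta> u0 u1 v0 v1 \<kappa> \<alpha> \<beta> \<gamma>" "k + l + m = N"
 shows "P k l m = c + of_nat k * \<nu> + of_nat m * \<eta> + boundary_part N u0 u1 v0 v1 \<kappa> \<alpha> \<beta> \<gamma> k m"
proof -
 have "l = 0 \<longleftrightarrow> k + m = N" using assms(2) by auto
 then show ?thesis using assms unfolding boundary_affine_def boundary_part_def by simp
qed

text \<open>\<open>K\<close> and \<open>g\<close> stand for the words and the coefficients of a
  multilinear polynomial in the letters \<open>X\<close>, so that the combinatorics can be done
  before the free algebra is set up.\<close>

locale two_letter_functional =
 fixes \<phi> :: "nat list => 'f::field_char_0" and N :: nat
  and c \<nu> \<eta> u0 u1 v0 v1 \<kappa> \<alpha> \<beta> \<gamma> c' u0' u1' v0' v1' \<kappa>' \<alpha>' \<beta>' \<gamma>' :: 'f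
  and K :: "nat list set" and g :: "nat list => 'f" and X :: "nat set"
 assumes formP: "boundary_affine N (%k l m. \<phi> (wP k l m)) c \<nu> \<eta> u0 u1 v0 v1 \<kappa> \<alpha> \<beta> \<gamma>"
  and formQ: "boundary_affine N (%k l m. \<phi> (wQ k l m)) c' (- \<eta>) (- \<nu>) u0' u1' v0' v1' \<kappa>' \<alpha>' \<beta>' \<gamma>'"
  and finK: "finite K" and K: "w \<in> K ==> distinct w & set w = X"
begin

abbreviation bdP where "bdP \<equiv> boundary_part N u0 u1 v0 v1 \<kappa> \<alpha> \<beta> \<gamma>"
abbreviation bdQ where "bdQ \<equiv> boundary_part N u0' u1' v0' v1' \<kappa>' \<alpha>' \<beta>' \<gamma>'"

definition wsum :: "(nat list => 'f) => 'f" where "wsum h = (\<Sum>w\<in>K. g w * h w)"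

definition cnt :: "(nat list => bool) => 'f" where "cnt S = wsum (%w. of_bool (S w))"

lemma wsum_add: "wsum (%w. h w + h' w) = wsum h + wsum h'"
 and wsum_diff: "wsum (%w. h w - h' w) = wsum h - wsum h'"
 and wsum_mult: "wsum (%w. h w * x) = wsum h * x"
 by (simp_all add: wsum_def sum.distrib sum_subtractf algebra_simps sum_distrib_left)

lemma wsum_cong: "(\<And>w. w \<in> K ==> h w = h' w) ==> wsum h = wsum h'"
 unfolding wsum_def by (intro sum.cong) auto

lemma wsum_0 [simp]: "wsum (%w. 0) = 0" by (simp add: wsum_def)

lemma word_split:
 assumes "w \<in> K" "bef i j w"
 obtains u v z where "w = u @ i # v @ j # z" "i ~: set u" "j ~: set u" "i ~: set v" "j ~: set v"
  "i ~: set z" "j ~: set z"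
 using assms K[of w] unfolding bef_def by fastforce

lemma weight_sum:
 assumes "w \<in> K" "w = u @ i # v @ j # z" "i ~= j"
 shows "sum_list (map e u) + sum_list (map e v) + sum_list (map e z) = (\<Sum>x\<in>X - {i, j}. e x)"
proof -
 have "distinct (u @ v @ z)" "set (u @ v @ z) = X - {i, j}" using K[OF assms(1)] assms(2) by auto
 then have "sum_list (map e (u @ v @ z)) = (\<Sum>x\<in>X - {i, j}. e x)"
  by (metis sum_list_distinct_conv_sum_set)
 then show ?thesis by (simp add: add.assoc)
qed

text \<open>There are six paddings: \<open>r\<close>, \<open>s\<close> around the whole word,
  \<open>r1\<close>, \<open>r2\<close> around the image of \<open>i\<close>, and \<open>s1\<close>,
  \<open>s2\<close> around that of \<open>j\<close>. If \<open>i\<close> comes first, then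
  \<open>r2\<close> and \<open>s1\<close> go into the gap between the letters 1 and 2; if
  \<open>j\<close> comes first, then \<open>s2\<close> and \<open>r1\<close> do. This asymmetry is
  what later separates the two orders.\<close>

lemma word_value:
 assumes "w \<in> K" "bef i j w" "i ~= j"
  and N: "N = r + s + r1 + r2 + s1 + s2 + (\<Sum>x\<in>X - {i, j}. e x)"
 shows "\<phi> (tw r @ concat (map (two_sub i (tw r1 @ 1 # tw r2) j (tw s1 @ 2 # tw s2) e) w) @ tw s)
   = c + of_nat (r + k_of e i w + r1) * \<nu> + of_nat (s2 + m_of e j w + s) * \<eta>
    + bdP (r + k_of e i w + r1) (s2 + m_of e j w + s)" (is "?L1 = ?R1")
  and "\<phi> (tw r @ concat (map (two_sub j (tw s1 @ 1 # tw s2) i (tw r1 @ 2 # tw r2) e) w) @ tw s)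
   = c' + of_nat (r + k_of e i w + r1) * (- \<eta>) + of_nat (s2 + m_of e j w + s) * (- \<nu>)
    + bdQ (r + k_of e i w + r1) (s2 + m_of e j w + s)" (is "?L2 = ?R2")
proof -
 obtain u v z where w: "w = u @ i # v @ j # z" and a: "i ~: set u" "j ~: set u" "i ~: set v" "j ~: set v"
  "i ~: set z" "j ~: set z" using word_split[OF assms(1,2)] .
 define ku kv kz where "ku = sum_list (map e u)" and "kv = sum_list (map e v)" and "kz = sum_list (map e z)"
 have k: "k_of e i w = ku" "m_of e j w = kz"
  using w a k_of_split[of i u e "v @ j # z"] m_of_split[of j z e "u @ i # v"]
  by (simp_all add: ku_def kz_def)
 have n: "(r + ku + r1) + (r2 + kv + s1) + (s2 + kz + s) = N"
  using weight_sum[OF assms(1) w assms(3), of e] N by (simp add: ku_def kv_def kz_def)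
 have "tw r @ concat (map (two_sub i (tw r1 @ 1 # tw r2) j (tw s1 @ 2 # tw s2) e) w) @ tw s
   = wP (r + ku + r1) (r2 + kv + s1) (s2 + kz + s)"
  using a assms(3) unfolding w ku_def kv_def kz_def wP_def
  by (simp add: two_sub_avoid tw_add tw_add2) (simp add: two_sub_def tw_add tw_add2 add_ac)
 then show "?L1 = ?R1"
  using boundary_affine_part[OF formP n] unfolding k by simp
 have "tw r @ concat (map (two_sub j (tw s1 @ 1 # tw s2) i (tw r1 @ 2 # tw r2) e) w) @ tw s
   = wQ (r + ku + r1) (r2 + kv + s1) (s2 + kz + s)"
  using a assms(3) unfolding w ku_def kv_def kz_def wQ_def
  by (simp add: two_sub_avoid tw_add tw_add2) (simp add: two_sub_def tw_add tw_add2 add_ac)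
 then show "?L2 = ?R2"
  using boundary_affine_part[OF formQ n] unfolding k by simp
qed

context
 fixes i j :: nat and e :: "nat => nat"
 assumes ij: "i \<in> X" "j \<in> X" "i ~= j"
begin

definition "ordP = cnt (bef i j)"
definition "ordQ = cnt (bef j i)"
text \<open>The share of the affine part that does not depend on the six paddings.\<close>

definition "bulk = c * ordP + \<nu> * wsum (%w. of_bool (bef i j w) * of_nat (k_of e i w))
 + \<eta> * wsum (%w. of_bool (bef i j w) * of_nat (m_of e j w)) + c' * ordQ
 - \<eta> * wsum (%w. of_bool (bef j i w) * of_nat (k_of e j w))
 - \<nu> * wsum (%w. of_bool (bef j i w) * of_nat (m_of e i w))"

definition boundary :: "nat => nat => nat => nat => nat => nat => 'f" where
 "boundary r s r1 r2 s1 s2 =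
  wsum (%w. of_bool (bef i j w) * bdP (r + k_of e i w + r1) (s2 + m_of e j w + s))
  + wsum (%w. of_bool (bef j i w) * bdQ (r + k_of e j w + s1) (r2 + m_of e i w + s))"

lemma value_formula:
 assumes N: "N = r + s + r1 + r2 + s1 + s2 + (\<Sum>x\<in>X - {i, j}. e x)"
 shows "wsum (%w. \<phi> (tw r @ concat (map (two_sub i (tw r1 @ 1 # tw r2) j (tw s1 @ 2 # tw s2) e) w) @ tw s))
   = bulk + \<nu> * of_nat (r + r1) * ordP + \<eta> * of_nat (s2 + s) * ordP
    - \<eta> * of_nat (r + s1) * ordQ - \<nu> * of_nat (r2 + s) * ordQ + boundary r s r1 r2 s1 s2"
proof -
 have "wsum (%w. \<phi> (tw r @ concat (map (two_sub i (tw r1 @ 1 # tw r2) j (tw s1 @ 2 # tw s2) e) w) @ tw s))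
  = wsum (%w. of_bool (bef i j w) * c + of_bool (bef i j w) * of_nat (k_of e i w) * \<nu>
    + of_bool (bef i j w) * (of_nat (r + r1) * \<nu>)
    + of_bool (bef i j w) * of_nat (m_of e j w) * \<eta> + of_bool (bef i j w) * (of_nat (s2 + s) * \<eta>)
    + of_bool (bef i j w) * bdP (r + k_of e i w + r1) (s2 + m_of e j w + s)
    + of_bool (bef j i w) * c' - of_bool (bef j i w) * of_nat (k_of e j w) * \<eta>
    - of_bool (bef j i w) * (of_nat (r + s1) * \<eta>)
    - of_bool (bef j i w) * of_nat (m_of e i w) * \<nu> - of_bool (bef j i w) * (of_nat (r2 + s) * \<nu>)
    + of_bool (bef j i w) * bdQ (r + k_of e j w + s1) (r2 + m_of e i w + s))"
 proof (rule wsum_cong)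
  fix w assume w: "w \<in> K"
  show "\<phi> (tw r @ concat (map (two_sub i (tw r1 @ 1 # tw r2) j (tw s1 @ 2 # tw s2) e) w) @ tw s)
   = of_bool (bef i j w) * c + of_bool (bef i j w) * of_nat (k_of e i w) * \<nu>
    + of_bool (bef i j w) * (of_nat (r + r1) * \<nu>)
    + of_bool (bef i j w) * of_nat (m_of e j w) * \<eta> + of_bool (bef i j w) * (of_nat (s2 + s) * \<eta>)
    + of_bool (bef i j w) * bdP (r + k_of e i w + r1) (s2 + m_of e j w + s)
    + of_bool (bef j i w) * c' - of_bool (bef j i w) * of_nat (k_of e j w) * \<eta>
    - of_bool (bef j i w) * (of_nat (r + s1) * \<eta>)
    - of_bool (bef j i w) * of_nat (m_of e i w) * \<nu> - of_bool (bef j i w) * (of_nat (r2 + s) * \<nu>)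
    + of_bool (bef j i w) * bdQ (r + k_of e j w + s1) (r2 + m_of e i w + s)"
  proof (cases "bef i j w")
   case True
   then have "\<not> bef j i w" using bef_not_bef K w by blast
   then show ?thesis
    using True word_value(1)[OF w True ij(3) N] by (simp add: algebra_simps)
  next
   case False
   then have b: "bef j i w" using bef_cases[of i w j] K[OF w] ij by blast
   have N': "N = r + s + s1 + s2 + r1 + r2 + (\<Sum>x\<in>X - {j, i}. e x)"
    using N by (simp add: insert_commute)
   show ?thesis
    using False b word_value(2)[OF w b ij(3)[symmetric] N'] by (simp add: algebra_simps)
  qed
 qed
 then show ?thesis
  unfolding bulk_def boundary_def ordP_def ordQ_def cnt_def
  unfolding wsum_add wsum_diff wsum_mult by (simp add: algebra_simps)
qed

end

end

section \<open>Isolating single coefficients by a choice of paddings\<close>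

definition adjw :: "nat => nat => nat list => bool" where "adjw i j w \<longleftrightarrow> (\<exists>u z. w = u @ i # j # z)"
definition endsw :: "nat => nat => nat list => bool" where "endsw i j w \<longleftrightarrow> (\<exists>u. w = u @ [i, j])"
definition startsw :: "nat => nat => nat list => bool" where "startsw i j w \<longleftrightarrow> (\<exists>z. w = i # j # z)"
definition outerw :: "nat => nat => nat list => bool" where "outerw i j w \<longleftrightarrow> hd w = i & last w = j"

lemma boundary_part_bulk:
 "2 <= k ==> 2 <= m ==> boundary_part N u0 u1 v0 v1 \<kappa> \<alpha> \<beta> \<gamma> k m = of_bool (k + m = N) * \<kappa>"
 by (simp add: boundary_part_def)

lemma boundary_part_right:
 "2 <= k ==> boundary_part N u0 u1 v0 v1 \<kappa> \<alpha> \<beta> \<gamma> k m = of_bool (m = 0) * v0 + of_bool (m = 1) * v1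
   + of_bool (k + m = N) * \<kappa> + of_bool (m = 0 & k + m = N) * \<beta>"
 by (simp add: boundary_part_def)

lemma boundary_part_left:
 "2 <= m ==> boundary_part N u0 u1 v0 v1 \<kappa> \<alpha> \<beta> \<gamma> k m = of_bool (k = 0) * u0 + of_bool (k = 1) * u1
   + of_bool (k + m = N) * \<kappa> + of_bool (k = 0 & k + m = N) * \<alpha>"
 by (simp add: boundary_part_def)

context two_letter_functional
begin

lemma word_weights:
 assumes "w \<in> K" "bef i j w" "i ~= j"
 obtains u v z where "w = u @ i # v @ j # z" "k_of e i w = sum_list (map e u)"
  "m_of e j w = sum_list (map e z)"
  "k_of e i w + sum_list (map e v) + m_of e j w = (\<Sum>x\<in>X - {i, j}. e x)"
  "i ~: set u" "j ~: set u" "i ~: set v" "j ~: set v" "i ~: set z" "j ~: set z"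
proof -
 obtain u v z where w: "w = u @ i # v @ j # z" and a: "i ~: set u" "j ~: set u" "i ~: set v" "j ~: set v"
  "i ~: set z" "j ~: set z" using word_split[OF assms(1,2)] .
 have "k_of e i w = sum_list (map e u)" "m_of e j w = sum_list (map e z)"
  using w a k_of_split[of i u e "v @ j # z"] m_of_split[of j z e "u @ i # v"] by simp_all
 then show ?thesis using that[OF w] a weight_sum[OF assms(1) w assms(3), of e] by simp
qed

lemma weights_le:
 "w \<in> K ==> bef i j w ==> i ~= j ==> k_of e i w + m_of e j w <= (\<Sum>x\<in>X - {i, j}. e x)"
 by (erule word_weights[of w i j e]) auto

lemma hd_bef: "w \<in> K ==> i \<in> X ==> j \<in> X ==> i ~= j ==> hd w = i ==> bef i j w"
proof -
 assume a: "w \<in> K" "i \<in> X" "j \<in> X" "i ~= j" "hd w = i"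
 then obtain w' where w: "w = i # w'" using K[of w] by (cases w) auto
 then have "j \<in> set w'" using a K[of w] by auto
 then obtain v z where "w' = v @ j # z" using split_list by metis
 then have "w = [] @ i # v @ j # z" using w by simp
 then show ?thesis unfolding bef_def by blast
qed

lemma last_bef: "w \<in> K ==> i \<in> X ==> j \<in> X ==> i ~= j ==> last w = j ==> bef i j w"
proof -
 assume a: "w \<in> K" "i \<in> X" "j \<in> X" "i ~= j" "last w = j"
 then obtain w' where w: "w = w' @ [j]" using K[of w] by (cases w rule: rev_cases) auto
 then have "i \<in> set w'" using a K[of w] by auto
 then obtain v z where "w' = v @ i # z" using split_list by metis
 then have "w = v @ i # z @ j # []" using w by simp
 then show ?thesis unfolding bef_def by blast
qed

lemma adjw_bef: "adjw i j w ==> bef i j w"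
 unfolding adjw_def bef_def by (metis append_Nil)

lemma k_of_eq_0:
 assumes "w \<in> K" "bef i j w" "i ~= j" "\<And>x. e x \<ge> 1"
 shows "k_of e i w = 0 \<longleftrightarrow> hd w = i"
proof (rule word_weights[OF assms(1-3), of e])
 fix u v z assume *: "w = u @ i # v @ j # z" "k_of e i w = sum_list (map e u)" "i ~: set u"
 have "e x ~= 0" for x using assms(4)[of x] by simp
 with * show ?thesis by (cases u) auto
qed

lemma m_of_eq_0:
 assumes "w \<in> K" "bef i j w" "i ~= j" "\<And>x. e x \<ge> 1"
 shows "m_of e j w = 0 \<longleftrightarrow> last w = j"
proof (rule word_weights[OF assms(1-3), of e])
 fix u v z assume *: "w = u @ i # v @ j # z" "m_of e j w = sum_list (map e z)" "j ~: set z"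
 have "e x ~= 0" for x using assms(4)[of x] by simp
 with * show ?thesis by (cases z rule: rev_cases) auto
qed

lemma adjw_iff:
 assumes "w \<in> K" "bef i j w" "i ~= j" "\<And>x. e x \<ge> 1"
 shows "k_of e i w + m_of e j w = (\<Sum>x\<in>X - {i, j}. e x) \<longleftrightarrow> adjw i j w"
proof (rule word_weights[OF assms(1-3), of e])
 fix u v z assume *: "w = u @ i # v @ j # z"
  "k_of e i w + sum_list (map e v) + m_of e j w = (\<Sum>x\<in>X - {i, j}. e x)"
  "i ~: set u" "i ~: set v" "i ~: set z" "j ~: set v"
 have pos: "e x ~= 0" for x using assms(4)[of x] by simp
 have "k_of e i w + m_of e j w = (\<Sum>x\<in>X - {i, j}. e x) \<longleftrightarrow> sum_list (map e v) = 0"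
  using *(2) by linarith
 also have "\<dots> \<longleftrightarrow> v = []" using pos by (cases v) auto
 also have "\<dots> \<longleftrightarrow> adjw i j w"
 proof
  assume "adjw i j w"
  then obtain u' z' where u': "w = u' @ i # j # z'" unfolding adjw_def by blast
  then have "i ~: set u'" using K[OF assms(1)] by auto
  then have "v @ j # z = j # z'"
   using * u' assms(3) append_Cons_eq_iff[of i u "v @ j # z" u' "j # z'"] by simp
  then show "v = []" using *(6) by (cases v) auto
 qed (use *(1) in \<open>auto simp: adjw_def\<close>)
 finally show ?thesis .
qed

end

text \<open>The situation of an element of the T-ideal: all its substitution instances are
  annihilated. Weights up to 2 use at most \<open>2 * card X\<close> zeros, so at least 20 remain to
  be distributed among the paddings.\<close>

locale killed_functional = two_letter_functional +
 assumes vanish: "(\<And>x. s x ~= []) ==> wsum (%w. \<phi> (u @ concat (map s w) @ v)) = 0"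
  and large: "N \<ge> 2 * card X + 20" and finX: "finite X"
begin

lemma weight_bound:
 assumes "\<And>x. e x <= 2"
 shows "(\<Sum>x\<in>X - {i, j}. e x) + 20 <= N"
proof -
 have "(\<Sum>x\<in>X - {i, j}. e x) <= (\<Sum>x\<in>X - {i, j}. 2)" using assms by (intro sum_mono)
 also have "\<dots> <= 2 * card X" using finX by (simp add: card_mono)
 finally show ?thesis using large by simp
qed

lemma value_zero:
 assumes ij: "i \<in> X" "j \<in> X" "i ~= j" and e: "\<And>x. 1 <= e x"
  and N: "N = r + s + r1 + r2 + s1 + s2 + (\<Sum>x\<in>X - {i, j}. e x)"
 shows "bulk i j e + \<nu> * of_nat (r + r1) * ordP i j + \<eta> * of_nat (s2 + s) * ordP i j
    - \<eta> * of_nat (r + s1) * ordQ i j - \<nu> * of_nat (r2 + s) * ordQ i j + boundary i j e r s r1 r2 s1 s2 = 0"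
 unfolding value_formula[OF ij N, symmetric]
proof (rule vanish)
 show "two_sub i (tw r1 @ 1 # tw r2) j (tw s1 @ 2 # tw s2) e x ~= []" for x
  using e[of x] by (auto simp: two_sub_def)
qed

text \<open>\<open>r\<close> and \<open>s\<close> keep both letters at distance at least 2 from the
  ends. The gap is nonempty in either order: it contains \<open>r2\<close> zeros if \<open>i\<close>
  comes first and \<open>r1\<close> zeros if \<open>j\<close> does.\<close>

lemma boundary_generic:
 assumes ij: "i \<in> X" "j \<in> X" "i ~= j"
  and N: "N = r + s + r1 + r2 + s1 + s2 + (\<Sum>x\<in>X - {i, j}. e x)"
  and p: "2 <= r" "2 <= s" "1 <= r1" "1 <= r2"
 shows "boundary i j e r s r1 r2 s1 s2 = 0"
proof -
 have "bdP (r + k_of e i w + r1) (s2 + m_of e j w + s) = 0" if "w \<in> K" "bef i j w" for w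
  using weights_le[OF that ij(3), of e] p N by (simp add: boundary_part_def)
 moreover have "bdQ (r + k_of e j w + s1) (r2 + m_of e i w + s) = 0" if "w \<in> K" "bef j i w" for w
  using weights_le[OF that ij(3)[symmetric], of e] p N by (simp add: boundary_part_def insert_commute)
 ultimately have "wsum (%w. of_bool (bef i j w) * bdP (r + k_of e i w + r1) (s2 + m_of e j w + s)) = wsum (%w. 0)"
  "wsum (%w. of_bool (bef j i w) * bdQ (r + k_of e j w + s1) (r2 + m_of e i w + s)) = wsum (%w. 0)"
  by (auto intro!: wsum_cong simp del: wsum_0)
 then show ?thesis unfolding boundary_def[OF ij] by simp
qed

text \<open>As long as the boundary terms vanish, the value is linear in the paddings. Moving one
  zero at a time between the paddings separates the four products, and then \<open>bulk\<close> is
  all that remains.\<close>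

lemma order_kill:
 assumes ij: "i \<in> X" "j \<in> X" "i ~= j" and e: "\<And>x. 1 <= e x" "\<And>x. e x <= 2"
 shows "\<nu> * ordP i j = 0" "\<eta> * ordP i j = 0" "\<nu> * ordQ i j = 0" "\<eta> * ordQ i j = 0" "bulk i j e = 0"
proof -
 define T where "T = N - (\<Sum>x\<in>X - {i, j}. e x) - 20"
 have N: "N = T + 20 + (\<Sum>x\<in>X - {i, j}. e x)" using weight_bound[where e = e and i = i and j = j] e(2) by (simp add: T_def)
 define A B C D where "A = \<nu> * ordP i j" and "B = \<eta> * ordP i j" and "C = \<eta> * ordQ i j" and "D = \<nu> * ordQ i j"
 have Z: "bulk i j e + of_nat (r + r1) * A + of_nat (s2 + s) * B - of_nat (r + s1) * C - of_nat (r2 + s) * D = 0"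
  if "r + s + r1 + r2 + s1 + s2 = T + 20" "2 <= r" "2 <= s" "1 <= r1" "1 <= r2" for r s r1 r2 s1 s2
 proof -
  have n: "N = r + s + r1 + r2 + s1 + s2 + (\<Sum>x\<in>X - {i, j}. e x)" using that N by simp
  show ?thesis using value_zero[where e = e, OF ij e(1) n] boundary_generic[OF ij n that(2-5)]
   by (simp add: A_def B_def C_def D_def mult_ac)
 qed
 \<comment> \<open>Five distributions of the same total \<open>T + 20\<close>. Compared with the
   first, they change the numbers of zeros that multiply \<open>A\<close>, \<open>B\<close>,
   \<open>C\<close>, \<open>D\<close> by one unit at a time, up to products already known to
   vanish.\<close>
 have eqs: "bulk i j e + of_nat (T + 12) * A + of_nat 4 * B - of_nat (T + 12) * C - of_nat 4 * D = 0"
  "bulk i j e + of_nat (T + 12) * A + of_nat 4 * B - of_nat (T + 11) * C - of_nat 4 * D = 0"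
  "bulk i j e + of_nat (T + 11) * A + of_nat 4 * B - of_nat (T + 12) * C - of_nat 4 * D = 0"
  "bulk i j e + of_nat (T + 11) * A + of_nat 5 * B - of_nat (T + 11) * C - of_nat 4 * D = 0"
  "bulk i j e + of_nat (T + 11) * A + of_nat 4 * B - of_nat (T + 11) * C - of_nat 5 * D = 0"
  using Z[of "T + 10" 2 2 2 2 2] Z[of "T + 9" 2 3 2 2 2] Z[of "T + 9" 2 2 2 3 2] Z[of "T + 9" 2 2 2 2 3]
   Z[of "T + 9" 2 2 3 2 2] by (simp_all add: add.commute)
 have t: "of_nat (T + 12) = of_nat T + (12::'a)" "of_nat (T + 11) = of_nat T + (11::'a)"
  "of_nat 4 = (4::'a)" "of_nat 5 = (5::'a)" by simp_all
 have C0: "C = 0" using eqs(1,2) unfolding t by Groebner_Basis.algebra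
 have A0: "A = 0" using eqs(1,3) unfolding t by Groebner_Basis.algebra
 have B0: "B = 0" using eqs(1,4) A0 C0 unfolding t by Groebner_Basis.algebra
 have D0: "D = 0" using eqs(1,5) A0 C0 unfolding t by Groebner_Basis.algebra
 show "\<nu> * ordP i j = 0" "\<eta> * ordP i j = 0" "\<nu> * ordQ i j = 0" "\<eta> * ordQ i j = 0" "bulk i j e = 0"
  using A0 B0 C0 D0 eqs(1) unfolding A_def[symmetric] B_def[symmetric] C_def[symmetric] D_def[symmetric]
  by simp_all
qed

lemma boundary_zero:
 assumes ij: "i \<in> X" "j \<in> X" "i ~= j" and e: "\<And>x. 1 <= e x" "\<And>x. e x <= 2"
  and N: "N = r + s + r1 + r2 + s1 + s2 + (\<Sum>x\<in>X - {i, j}. e x)"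
 shows "boundary i j e r s r1 r2 s1 s2 = 0"
 using value_zero[where e = e, OF ij e(1) N] order_kill[where e = e, OF ij e] by Groebner_Basis.algebra

lemma boundary_two:
 assumes ij: "i \<in> X" "j \<in> X" "i ~= j"
 shows "\<exists>T. N = T + 20 + (\<Sum>x\<in>X - {i, j}. 2)"
proof
 have "(\<Sum>x\<in>X - {i, j}. 2) + 20 <= N" by (rule weight_bound) simp
 then show "N = (N - ((\<Sum>x\<in>X - {i, j}. 2) + 20)) + 20 + (\<Sum>x\<in>X - {i, j}. 2)" by linarith
qed

text \<open>Weight 2 for all letters makes the numbers of zeros even; without extra padding they are
  never 1, so \<open>u1\<close> and \<open>v1\<close> stay invisible while the other coefficients
  are isolated.\<close>

lemma even_weights: "k_of (%_. 2) i w ~= 1" "m_of (%_. 2) j w ~= 1"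
 "Suc 0 ~= k_of (%_. 2) i w" "Suc 0 ~= m_of (%_. 2) j w"
proof -
 have "even (k_of (%_. 2) i w)" for i w by (simp add: k_of_def sum_list_triv)
 then have "k_of (%_. 2) i w ~= Suc 0" for i w by (metis odd_one One_nat_def)
 then show "k_of (%_. 2) i w ~= 1" "m_of (%_. 2) j w ~= 1"
  "Suc 0 ~= k_of (%_. 2) i w" "Suc 0 ~= m_of (%_. 2) j w" by (metis One_nat_def m_of_def)+
qed

lemma part_adj:
 assumes "w \<in> K" "i ~= j" "2 <= r + r1" "2 <= s2 + s" "N = r + s + r1 + s2 + (\<Sum>x\<in>X - {i, j}. 2)"
 shows "of_bool (bef i j w) * bdP (r + k_of (%_. 2) i w + r1) (s2 + m_of (%_. 2) j w + s)
   = of_bool (adjw i j w) * \<kappa>"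
proof (cases "bef i j w")
 case True
 have "(r + k_of (%_. 2) i w + r1) + (s2 + m_of (%_. 2) j w + s) = N \<longleftrightarrow> adjw i j w"
  using adjw_iff[OF assms(1) True assms(2), of "%_. 2"] assms(5) by auto
 then show ?thesis using True assms(3,4) by (subst boundary_part_bulk) auto
qed (use adjw_bef in auto)

lemma part_last:
 assumes "w \<in> K" "i \<in> X" "j \<in> X" "i ~= j" "2 <= r + r1" "r + r1 + (\<Sum>x\<in>X - {i, j}. 2) < N"
 shows "of_bool (bef i j w) * bdP (r + k_of (%_. 2) i w + r1) (0 + m_of (%_. 2) j w + 0)
   = of_bool (last w = j) * v0"
proof (cases "bef i j w")
 case True
 have "(r + k_of (%_. 2) i w + r1) + m_of (%_. 2) j w ~= N"
  using weights_le[OF assms(1) True assms(4), of "%_. 2"] assms(6) by auto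
 then show ?thesis
  using True assms(5) even_weights(2)[of j w] m_of_eq_0[OF assms(1) True assms(4), of "%_. 2"]
  by (subst boundary_part_right) auto
qed (use last_bef[OF assms(1-4)] in auto)

lemma part_first:
 assumes "w \<in> K" "i \<in> X" "j \<in> X" "i ~= j" "2 <= s2 + s" "s2 + s + (\<Sum>x\<in>X - {i, j}. 2) < N"
 shows "of_bool (bef i j w) * bdP (0 + k_of (%_. 2) i w + 0) (s2 + m_of (%_. 2) j w + s)
   = of_bool (hd w = i) * u0"
proof (cases "bef i j w")
 case True
 have "k_of (%_. 2) i w + (s2 + m_of (%_. 2) j w + s) ~= N"
  using weights_le[OF assms(1) True assms(4), of "%_. 2"] assms(6) by auto
 then show ?thesis
  using True assms(5) even_weights(1)[of i w] k_of_eq_0[OF assms(1) True assms(4), of "%_. 2"]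
  by (subst boundary_part_left) auto
qed (use hd_bef[OF assms(1-4)] in auto)

lemma partQ_zero:
 assumes "w \<in> K" "i ~= j" "2 <= r + s1" "2 <= r2 + s" "r + s1 + r2 + s + (\<Sum>x\<in>X - {i, j}. e x) < N"
 shows "of_bool (bef j i w) * bdQ (r + k_of e j w + s1) (r2 + m_of e i w + s) = 0"
proof (cases "bef j i w")
 case True
 have "(r + k_of e j w + s1) + (r2 + m_of e i w + s) ~= N"
  using weights_le[OF assms(1) True assms(2)[symmetric], of e] assms(5) by (auto simp: insert_commute)
 then show ?thesis using True assms(3,4) by (subst boundary_part_bulk) auto
qed auto

text \<open>With \<open>r2 = s1 = 0\<close> the gap is empty exactly when \<open>j\<close> follows
  \<open>i\<close> immediately. The paddings \<open>r1 = s2 = 2\<close> keep the gap open in the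
  other order, and both ends are padded.\<close>

lemma adj_kill:
 assumes ij: "i \<in> X" "j \<in> X" "i ~= j"
 shows "\<kappa> * cnt (adjw i j) = 0"
proof -
 obtain T where N: "N = T + 20 + (\<Sum>x\<in>X - {i, j}. 2)" using boundary_two[OF ij] by blast
 have "0 = boundary i j (%_. 2) (T + 14) 2 2 0 0 2"
  by (rule boundary_zero[OF ij, symmetric]) (use N in auto)
 also have "\<dots> = wsum (%w. of_bool (adjw i j w) * \<kappa>) + wsum (%w. 0)"
  unfolding boundary_def[OF ij]
  using N ij
  by (intro arg_cong2[where f = "(+)", OF wsum_cong[OF part_adj] wsum_cong[OF partQ_zero]]) auto
 finally show ?thesis unfolding cnt_def by (metis wsum_mult wsum_0 add_0_right mult.commute)
qed

text \<open>With \<open>s2 = s = 0\<close> nothing follows the image of \<open>j\<close>, so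
  \<open>m = 0\<close> happens exactly for words ending in \<open>j\<close>. In the other order
  \<open>r2 = 2\<close> keeps the letters away from the end, and the gap is open in both
  orders.\<close>

lemma last_kill:
 assumes ij: "i \<in> X" "j \<in> X" "i ~= j"
 shows "v0 * cnt (%w. last w = j) = 0"
proof -
 obtain T where N: "N = T + 20 + (\<Sum>x\<in>X - {i, j}. 2)" using boundary_two[OF ij] by blast
 have "0 = boundary i j (%_. 2) (T + 16) 0 1 2 1 0"
  by (rule boundary_zero[OF ij, symmetric]) (use N in auto)
 also have "\<dots> = wsum (%w. of_bool (last w = j) * v0) + wsum (%w. 0)"
  unfolding boundary_def[OF ij]
  using N ij
  by (intro arg_cong2[where f = "(+)", OF wsum_cong[OF part_last] wsum_cong[OF partQ_zero]]) auto
 finally show ?thesis unfolding cnt_def by (metis wsum_mult wsum_0 add_0_right mult.commute)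
qed

lemma first_kill:
 assumes ij: "i \<in> X" "j \<in> X" "i ~= j"
 shows "u0 * cnt (%w. hd w = i) = 0"
proof -
 obtain T where N: "N = T + 20 + (\<Sum>x\<in>X - {i, j}. 2)" using boundary_two[OF ij] by blast
 have "0 = boundary i j (%_. 2) 0 (T + 16) 0 1 2 1"
  by (rule boundary_zero[OF ij, symmetric]) (use N in auto)
 also have "\<dots> = wsum (%w. of_bool (hd w = i) * u0) + wsum (%w. 0)"
  unfolding boundary_def[OF ij]
  using N ij
  by (intro arg_cong2[where f = "(+)", OF wsum_cong[OF part_first] wsum_cong[OF partQ_zero]]) auto
 finally show ?thesis unfolding cnt_def by (metis wsum_mult wsum_0 add_0_right mult.commute)
qed

end

definition wcount :: "nat list set => (nat list => 'f::field_char_0) => (nat list => bool) => 'f" where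
 "wcount K g S = (\<Sum>w\<in>K. g w * of_bool (S w))"

definition coefficients_killed :: "nat list set => (nat list => 'f::field_char_0) => nat set =>
  'f => 'f => 'f => 'f => 'f => 'f => 'f => 'f => bool" where
 "coefficients_killed K g X u0 u1 v0 v1 \<kappa> \<alpha> \<beta> \<gamma> \<longleftrightarrow>
  (\<forall>i\<in>X. \<forall>j\<in>X. i ~= j -->
   u0 * wcount K g (%w. hd w = i) = 0 & u1 * wcount K g (startsw i j) = 0 &
   v0 * wcount K g (%w. last w = i) = 0 & v1 * wcount K g (endsw i j) = 0 &
   \<kappa> * wcount K g (adjw i j) = 0 & \<alpha> * wcount K g (startsw i j) = 0 &
   \<beta> * wcount K g (endsw i j) = 0 & \<gamma> * wcount K g (outerw i j) = 0)"

context two_letter_functional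
begin

lemma cnt_wcount: "cnt = wcount K g"
 by (simp add: fun_eq_iff cnt_def wsum_def wcount_def)

lemma cnt_times: "wsum (%w. of_bool (S w) * x) = x * cnt S"
 unfolding cnt_def wsum_mult by (rule mult.commute)

lemma endsw_split:
 assumes "w \<in> K" "w = y @ j # z"
 shows "endsw j h w \<longleftrightarrow> z = [h]"
proof
 assume "endsw j h w"
 then obtain y' where y': "w = y' @ j # [h]" unfolding endsw_def by auto
 have "distinct w" using K assms by blast
 then have "distinct (y @ j # z)" by (simp only: assms(2))
 then have "j ~: set y" "j ~: set z" by auto
 then show "z = [h]" using y' assms(2) append_Cons_eq_iff[of j y z y' "[h]"] by simp
qed (use assms in \<open>auto simp: endsw_def\<close>)

lemma startsw_split:
 assumes "w \<in> K" "w = y @ i # z"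
 shows "startsw h i w \<longleftrightarrow> y = [h]"
proof
 assume "startsw h i w"
 then obtain z' where z': "w = [h] @ i # z'" unfolding startsw_def by auto
 have "distinct w" using K assms by blast
 then have "distinct (y @ i # z)" by (simp only: assms(2))
 then have "i ~: set y" "i ~: set z" by auto
 then show "y = [h]" using z' assms(2) append_Cons_eq_iff[of i y z "[h]" z'] by simp
qed (use assms in \<open>auto simp: startsw_def\<close>)

lemma endsw_bef: "w \<in> K ==> i \<in> X ==> i ~= j ==> i ~= h ==> endsw j h w ==> bef i j w"
proof -
 assume a: "w \<in> K" "i \<in> X" "i ~= j" "i ~= h" "endsw j h w"
 then obtain y where y: "w = y @ [j, h]" unfolding endsw_def by auto
 then have "i \<in> set y" using K[of w] a by auto
 then obtain u v where "y = u @ i # v" using split_list by metis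
 then have "w = u @ i # v @ j # [h]" using y by simp
 then show ?thesis unfolding bef_def by blast
qed

lemma startsw_bef: "w \<in> K ==> j \<in> X ==> j ~= h ==> j ~= i ==> startsw h i w ==> bef i j w"
proof -
 assume a: "w \<in> K" "j \<in> X" "j ~= h" "j ~= i" "startsw h i w"
 then obtain y where y: "w = h # i # y" unfolding startsw_def by auto
 then have "j \<in> set y" using K[of w] a by auto
 then obtain u v where "y = u @ j # v" using split_list by metis
 then have "w = [h] @ i # u @ j # v" using y by simp
 then show ?thesis unfolding bef_def by blast
qed

lemma sum_list_eq_1_iff:
 assumes "\<And>x::nat. e x \<ge> (1::nat)"
 shows "sum_list (map e z) = 1 \<longleftrightarrow> (\<exists>x. z = [x] & e x = 1)"
proof -
 have p: "e x ~= 0" "e x + (e y + r) ~= 1" for x y r using assms[of x] assms[of y] by simp_all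
 show ?thesis
 proof (cases z)
  case (Cons a z')
  then show ?thesis using p by (cases z') auto
 qed simp
qed

lemma m_of_eq_1:
 assumes "w \<in> K" "bef i j w" "i ~= j" "\<And>x. e x \<ge> 1"
 shows "m_of e j w = 1 \<longleftrightarrow> (\<exists>h. e h = 1 & endsw j h w)"
proof (rule word_weights[OF assms(1-3), of e])
 fix u v z assume *: "w = u @ i # v @ j # z" "m_of e j w = sum_list (map e z)"
 then have "endsw j h w \<longleftrightarrow> z = [h]" for h using endsw_split[OF assms(1), of "u @ i # v" j z] by simp
 then show ?thesis using sum_list_eq_1_iff[of e z] assms(4) *(2) by auto
qed

lemma k_of_eq_1:
 assumes "w \<in> K" "bef i j w" "i ~= j" "\<And>x. e x \<ge> 1"
 shows "k_of e i w = 1 \<longleftrightarrow> (\<exists>h. e h = 1 & startsw h i w)"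
proof (rule word_weights[OF assms(1-3), of e])
 fix u v z assume *: "w = u @ i # v @ j # z" "k_of e i w = sum_list (map e u)"
 then have "startsw h i w \<longleftrightarrow> u = [h]" for h using startsw_split[OF assms(1), of u i "v @ j # z"] by simp
 then show ?thesis using sum_list_eq_1_iff[of e u] assms(4) *(2) by auto
qed

lemma endsw_iff: "w \<in> K ==> endsw i j w \<longleftrightarrow> last w = j & adjw i j w"
proof
 assume w: "w \<in> K" and "last w = j & adjw i j w"
 then obtain u z where u: "last w = j" "w = u @ i # j # z" unfolding adjw_def by blast
 have "z = []" using K[OF w] u by (cases z rule: rev_cases) auto
 then show "endsw i j w" using u by (simp add: endsw_def)
qed (auto simp: endsw_def adjw_def)

lemma startsw_iff: "w \<in> K ==> startsw i j w \<longleftrightarrow> hd w = i & adjw i j w"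
proof
 assume w: "w \<in> K" and "hd w = i & adjw i j w"
 then obtain u z where u: "hd w = i" "w = u @ i # j # z" unfolding adjw_def by blast
 have "u = []" using K[OF w] u by (cases u) auto
 then show "startsw i j w" using u by (simp add: startsw_def)
qed (auto simp: startsw_def adjw_def intro: exI[of _ "[]"])

end

context killed_functional
begin

text \<open>Only \<open>h\<close> gets weight 1, so \<open>m = 1\<close> singles out the words
  ending in \<open>j\<close> and then \<open>h\<close>. The paddings are those of
  \<open>last_kill\<close>, whose coefficient appears too and is already dead.\<close>

lemma ends_kill:
 assumes ij: "i \<in> X" "j \<in> X" "i ~= j" and h: "h ~= i" "h ~= j"
 shows "v1 * cnt (endsw j h) = 0"
proof -
 define e where "e = (%x. if x = h then 1 else 2 :: nat)"
 have e: "1 <= e x" "e x <= 2" "e x = 1 \<longleftrightarrow> x = h" for x by (auto simp: e_def)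
 define T where "T = N - ((\<Sum>x\<in>X - {i, j}. e x) + 20)"
 have N: "N = T + 20 + (\<Sum>x\<in>X - {i, j}. e x)" using weight_bound[of e i j] e by (simp add: T_def)
 have "0 = boundary i j e (T + 16) 0 1 2 1 0"
  by (rule boundary_zero[OF ij e(1,2), symmetric]) (use N in simp)
 also have "\<dots> = wsum (%w. of_bool (last w = j) * v0 + of_bool (endsw j h w) * v1) + wsum (%w. 0)"
  unfolding boundary_def[OF ij]
 proof (intro arg_cong2[where f = "(+)", OF wsum_cong wsum_cong[OF partQ_zero]])
  fix w assume w: "w \<in> K"
  show "of_bool (bef i j w) * bdP (T + 16 + k_of e i w + 1) (0 + m_of e j w + 0)
   = of_bool (last w = j) * v0 + of_bool (endsw j h w) * v1"
  proof (cases "bef i j w")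
   case True
   have "T + 16 + k_of e i w + 1 + m_of e j w ~= N"
    using weights_le[OF w True ij(3), of e] N by simp
   then show ?thesis using True m_of_eq_0[OF w True ij(3), of e] m_of_eq_1[OF w True ij(3), of e] e
    by (subst boundary_part_right) auto
  next
   case False
   then show ?thesis using last_bef[OF w ij] endsw_bef[OF w ij(1,3) h(1)[symmetric]] by auto
  qed
 qed (use N ij in auto)
 finally have "0 = v0 * cnt (%w. last w = j) + v1 * cnt (endsw j h)"
  unfolding wsum_add cnt_times by simp
 then show ?thesis using last_kill[OF ij] by simp
qed

lemma starts_kill:
 assumes ij: "i \<in> X" "j \<in> X" "i ~= j" and h: "h ~= i" "h ~= j"
 shows "u1 * cnt (startsw h i) = 0"
proof -
 define e where "e = (%x. if x = h then 1 else 2 :: nat)"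
 have e: "1 <= e x" "e x <= 2" "e x = 1 \<longleftrightarrow> x = h" for x by (auto simp: e_def)
 define T where "T = N - ((\<Sum>x\<in>X - {i, j}. e x) + 20)"
 have N: "N = T + 20 + (\<Sum>x\<in>X - {i, j}. e x)" using weight_bound[of e i j] e by (simp add: T_def)
 have "0 = boundary i j e 0 (T + 16) 0 1 2 1"
  by (rule boundary_zero[OF ij e(1,2), symmetric]) (use N in simp)
 also have "\<dots> = wsum (%w. of_bool (hd w = i) * u0 + of_bool (startsw h i w) * u1) + wsum (%w. 0)"
  unfolding boundary_def[OF ij]
 proof (intro arg_cong2[where f = "(+)", OF wsum_cong wsum_cong[OF partQ_zero]])
  fix w assume w: "w \<in> K"
  show "of_bool (bef i j w) * bdP (0 + k_of e i w + 0) (1 + m_of e j w + (T + 16))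
   = of_bool (hd w = i) * u0 + of_bool (startsw h i w) * u1"
  proof (cases "bef i j w")
   case True
   have "k_of e i w + (1 + m_of e j w + (T + 16)) ~= N"
    using weights_le[OF w True ij(3), of e] N by simp
   then show ?thesis using True k_of_eq_0[OF w True ij(3), of e] k_of_eq_1[OF w True ij(3), of e] e
    by (subst boundary_part_left) auto
  next
   case False
   then show ?thesis using hd_bef[OF w ij] startsw_bef[OF w ij(2) h(2)[symmetric] ij(3)[symmetric]] by auto
  qed
 qed (use N ij in auto)
 finally have "0 = u0 * cnt (%w. hd w = i) + u1 * cnt (startsw h i)"
  unfolding wsum_add cnt_times by simp
 then show ?thesis using first_kill[OF ij] by simp
qed

text \<open>To see \<open>l = 0\<close> and \<open>m = 0\<close> together, the gap and the right end
  must both be free of padding. Then words ending in \<open>i\<close> contribute through the other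
  order with coefficient \<open>v0'\<close>, which is why \<open>Q\<close> is assumed.\<close>

lemma last_two_kill:
 assumes ij: "i \<in> X" "j \<in> X" "i ~= j" and Q: "v0' * cnt (%w. last w = i) = 0"
 shows "\<beta> * cnt (endsw i j) = 0"
proof -
 obtain T where N: "N = T + 20 + (\<Sum>x\<in>X - {i, j}. 2)" using boundary_two[OF ij] by blast
 have "0 = boundary i j (%_. 2) (T + 19) 0 1 0 0 0"
  by (rule boundary_zero[OF ij, symmetric]) (use N in auto)
 also have "\<dots> = wsum (%w. of_bool (last w = j) * v0 + of_bool (adjw i j w) * \<kappa> + of_bool (endsw i j w) * \<beta>)
   + wsum (%w. of_bool (last w = i) * v0')"
  unfolding boundary_def[OF ij]
 proof (intro arg_cong2[where f = "(+)", OF wsum_cong wsum_cong])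
  fix w assume w: "w \<in> K"
  show "of_bool (bef i j w) * bdP (T + 19 + k_of (%_. 2) i w + 1) (0 + m_of (%_. 2) j w + 0)
   = of_bool (last w = j) * v0 + of_bool (adjw i j w) * \<kappa> + of_bool (endsw i j w) * \<beta>"
  proof (cases "bef i j w")
   case True
   have "T + 19 + k_of (%_. 2) i w + 1 + m_of (%_. 2) j w = N \<longleftrightarrow> adjw i j w"
    using adjw_iff[OF w True ij(3), of "%_. 2"] N by auto
   then show ?thesis using True m_of_eq_0[OF w True ij(3), of "%_. 2"] even_weights(2)[of j w] endsw_iff[OF w]
    by (subst boundary_part_right) auto
  next
   case False
   then show ?thesis using last_bef[OF w ij] adjw_bef[of i j w] endsw_iff[OF w] by auto
  qed
  show "of_bool (bef j i w) * bdQ (T + 19 + k_of (%_. 2) j w + 0) (0 + m_of (%_. 2) i w + 0)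
   = of_bool (last w = i) * v0'"
  proof (cases "bef j i w")
   case True
   have "T + 19 + k_of (%_. 2) j w + m_of (%_. 2) i w ~= N"
    using weights_le[OF w True ij(3)[symmetric], of "%_. 2"] N by (simp add: insert_commute)
   then show ?thesis using True m_of_eq_0[OF w True ij(3)[symmetric], of "%_. 2"] even_weights(2)[of i w]
    by (subst boundary_part_right) auto
  next
   case False
   then show ?thesis using last_bef[OF w ij(2,1)] ij(3) by auto
  qed
 qed
 finally have "0 = v0 * cnt (%w. last w = j) + \<kappa> * cnt (adjw i j) + \<beta> * cnt (endsw i j) + v0' * cnt (%w. last w = i)"
  unfolding wsum_add cnt_times .
 then show ?thesis using last_kill[OF ij] adj_kill[OF ij] Q by simp
qed

lemma first_two_kill:
 assumes ij: "i \<in> X" "j \<in> X" "i ~= j" and Q: "u0' * cnt (%w. hd w = j) = 0"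
 shows "\<alpha> * cnt (startsw i j) = 0"
proof -
 obtain T where N: "N = T + 20 + (\<Sum>x\<in>X - {i, j}. 2)" using boundary_two[OF ij] by blast
 have "0 = boundary i j (%_. 2) 0 (T + 19) 0 0 0 1"
  by (rule boundary_zero[OF ij, symmetric]) (use N in auto)
 also have "\<dots> = wsum (%w. of_bool (hd w = i) * u0 + of_bool (adjw i j w) * \<kappa> + of_bool (startsw i j w) * \<alpha>)
   + wsum (%w. of_bool (hd w = j) * u0')"
  unfolding boundary_def[OF ij]
 proof (intro arg_cong2[where f = "(+)", OF wsum_cong wsum_cong])
  fix w assume w: "w \<in> K"
  show "of_bool (bef i j w) * bdP (0 + k_of (%_. 2) i w + 0) (1 + m_of (%_. 2) j w + (T + 19))
   = of_bool (hd w = i) * u0 + of_bool (adjw i j w) * \<kappa> + of_bool (startsw i j w) * \<alpha>"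
  proof (cases "bef i j w")
   case True
   have "k_of (%_. 2) i w + (1 + m_of (%_. 2) j w + (T + 19)) = N \<longleftrightarrow> adjw i j w"
    using adjw_iff[OF w True ij(3), of "%_. 2"] N by auto
   then show ?thesis using True k_of_eq_0[OF w True ij(3), of "%_. 2"] even_weights(1)[of i w] startsw_iff[OF w]
    by (subst boundary_part_left) auto
  next
   case False
   then show ?thesis using hd_bef[OF w ij] adjw_bef[of i j w] startsw_iff[OF w] by auto
  qed
  show "of_bool (bef j i w) * bdQ (0 + k_of (%_. 2) j w + 0) (0 + m_of (%_. 2) i w + (T + 19))
   = of_bool (hd w = j) * u0'"
  proof (cases "bef j i w")
   case True
   have "k_of (%_. 2) j w + (m_of (%_. 2) i w + (T + 19)) ~= N"
    using weights_le[OF w True ij(3)[symmetric], of "%_. 2"] N by (simp add: insert_commute)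
   then show ?thesis using True k_of_eq_0[OF w True ij(3)[symmetric], of "%_. 2"] even_weights(1)[of j w]
    by (subst boundary_part_left) auto
  next
   case False
   then show ?thesis using hd_bef[OF w ij(2,1)] ij(3) by auto
  qed
 qed
 finally have "0 = u0 * cnt (%w. hd w = i) + \<kappa> * cnt (adjw i j) + \<alpha> * cnt (startsw i j) + u0' * cnt (%w. hd w = j)"
  unfolding wsum_add cnt_times .
 then show ?thesis using first_kill[OF ij] adj_kill[OF ij] Q by simp
qed

text \<open>For \<open>k = m = 0\<close> to be possible all padding has to sit between the two
  letters, in \<open>r2\<close> and \<open>s1\<close>. In the opposite order the same padding lies
  outside, the gap closes for adjacent letters, and \<open>\<kappa>'\<close> enters.\<close>

lemma outer_kill:
 assumes ij: "i \<in> X" "j \<in> X" "i ~= j" and Q: "\<kappa>' * cnt (adjw j i) = 0"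
 shows "\<gamma> * cnt (outerw i j) = 0"
proof -
 obtain T where N: "N = T + 20 + (\<Sum>x\<in>X - {i, j}. 2)" using boundary_two[OF ij] by blast
 have "0 = boundary i j (%_. 2) 0 0 0 (T + 18) 2 0"
  by (rule boundary_zero[OF ij, symmetric]) (use N in auto)
 also have "\<dots> = wsum (%w. of_bool (hd w = i) * u0 + of_bool (last w = j) * v0 + of_bool (outerw i j w) * \<gamma>)
   + wsum (%w. of_bool (adjw j i w) * \<kappa>')"
  unfolding boundary_def[OF ij]
 proof (intro arg_cong2[where f = "(+)", OF wsum_cong wsum_cong])
  fix w assume w: "w \<in> K"
  show "of_bool (bef i j w) * bdP (0 + k_of (%_. 2) i w + 0) (0 + m_of (%_. 2) j w + 0)
   = of_bool (hd w = i) * u0 + of_bool (last w = j) * v0 + of_bool (outerw i j w) * \<gamma>"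
  proof (cases "bef i j w")
   case True
   have "k_of (%_. 2) i w + m_of (%_. 2) j w ~= N"
    using weights_le[OF w True ij(3), of "%_. 2"] N by auto
   then show ?thesis
    using True k_of_eq_0[OF w True ij(3), of "%_. 2"] m_of_eq_0[OF w True ij(3), of "%_. 2"]
     even_weights(1)[of i w] even_weights(2)[of j w]
    unfolding boundary_part_def outerw_def by auto
  next
   case False
   then show ?thesis using hd_bef[OF w ij] last_bef[OF w ij] by (auto simp: outerw_def)
  qed
  show "of_bool (bef j i w) * bdQ (0 + k_of (%_. 2) j w + 2) (T + 18 + m_of (%_. 2) i w + 0)
   = of_bool (adjw j i w) * \<kappa>'"
  proof (cases "bef j i w")
   case True
   have "k_of (%_. 2) j w + 2 + (T + 18 + m_of (%_. 2) i w) = N \<longleftrightarrow> adjw j i w"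
    using adjw_iff[OF w True ij(3)[symmetric], of "%_. 2"] N by (auto simp: insert_commute)
   then show ?thesis using True by (subst boundary_part_bulk) auto
  next
   case False
   then show ?thesis using adjw_bef[of j i w] by auto
  qed
 qed
 finally have "0 = u0 * cnt (%w. hd w = i) + v0 * cnt (%w. last w = j) + \<gamma> * cnt (outerw i j) + \<kappa>' * cnt (adjw j i)"
  unfolding wsum_add cnt_times .
 then show ?thesis using first_kill[OF ij] last_kill[OF ij] Q by simp
qed

text \<open>Renaming the letters 1 and 2 inside the functional exchanges \<open>P\<close> and
  \<open>Q\<close>. All statements on unprimed coefficients thus hold for the primed ones, which
  also provides the extra hypotheses of \<open>last_two_kill\<close>, \<open>first_two_kill\<close>
  and \<open>outer_kill\<close>.\<close>

lemma swapped:
 "killed_functional (%w. \<phi> (map (transpose 1 2) w)) N c' (- \<eta>) (- \<nu>) u0' u1' v0' v1' \<kappa>' \<alpha>' \<beta>' \<gamma>'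
   c u0 u1 v0 v1 \<kappa> \<alpha> \<beta> \<gamma> K g X"
proof (unfold_locales)
 show "boundary_affine N (%k l m. \<phi> (map (transpose 1 2) (wP k l m))) c' (- \<eta>) (- \<nu>) u0' u1' v0' v1' \<kappa>' \<alpha>' \<beta>' \<gamma>'"
  using formQ by (simp only: swap_wP)
 show "boundary_affine N (%k l m. \<phi> (map (transpose 1 2) (wQ k l m))) c (- (- \<nu>)) (- (- \<eta>)) u0 u1 v0 v1 \<kappa> \<alpha> \<beta> \<gamma>"
  using formP by (simp only: swap_wQ minus_minus)
 fix s :: "nat => nat list" and u v
 assume "\<And>x. s x ~= []"
 then have "wsum (%w. \<phi> (map (transpose 1 2) u @ concat (map (%x. map (transpose 1 2) (s x)) w) @ map (transpose 1 2) v)) = 0"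
  by (intro vanish) simp
 then show "wsum (%w. \<phi> (map (transpose 1 2) (u @ concat (map s w) @ v))) = 0"
  by (simp add: map_concat comp_def)
qed (use finK K large finX in auto)

text \<open>\<open>starts_kill\<close> and \<open>ends_kill\<close> involve the two letters at one
  end and a third letter as the other distinguished one; hence \<open>card X >= 3\<close>.\<close>

lemma coefficients_killed:
 assumes "card X \<ge> 3"
 shows "coefficients_killed K g X u0 u1 v0 v1 \<kappa> \<alpha> \<beta> \<gamma>"
proof -
 interpret s: killed_functional "%w. \<phi> (map (transpose 1 2) w)" N c' "- \<eta>" "- \<nu>" u0' u1' v0' v1' \<kappa>' \<alpha>' \<beta>' \<gamma>'
   c u0 u1 v0 v1 \<kappa> \<alpha> \<beta> \<gamma> K g X by (rule swapped)
 have third: "\<exists>h. h \<in> X & h ~= i & h ~= j" for i j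
 proof (rule ccontr)
  assume "\<not> ?thesis"
  then have "X \<subseteq> {i, j}" by blast
  then have "card X <= card {i, j}" by (intro card_mono) auto
  also have "\<dots> <= 2" by (simp add: card_insert_if)
  finally show False using assms by simp
 qed
 show ?thesis
  unfolding coefficients_killed_def cnt_wcount[symmetric]
 proof (intro ballI impI conjI)
  fix i j assume ij: "i \<in> X" "j \<in> X" "i ~= j"
  obtain h where h: "h \<in> X" "h ~= i" "h ~= j" using third by blast
  show "u0 * cnt (%w. hd w = i) = 0" by (rule first_kill[OF ij])
  show "u1 * cnt (startsw i j) = 0" using starts_kill[of j h i] ij h by auto
  show "v0 * cnt (%w. last w = i) = 0" using last_kill[of j i] ij by auto
  show "v1 * cnt (endsw i j) = 0" using ends_kill[of h i j] ij h by auto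
  show "\<kappa> * cnt (adjw i j) = 0" by (rule adj_kill[OF ij])
  show "\<alpha> * cnt (startsw i j) = 0" using first_two_kill[OF ij] s.first_kill[of j i] ij by auto
  show "\<beta> * cnt (endsw i j) = 0" using last_two_kill[OF ij] s.last_kill[of j i] ij by auto
  show "\<gamma> * cnt (outerw i j) = 0" using outer_kill[OF ij] s.adj_kill[of j i] ij by auto
 qed
qed

lemma coefficients_killed':
 "card X \<ge> 3 ==> coefficients_killed K g X u0' u1' v0' v1' \<kappa>' \<alpha>' \<beta>' \<gamma>'"
 by (rule killed_functional.coefficients_killed[OF swapped])

text \<open>When the slopes are gone, \<open>bulk\<close> is \<open>c * ordP + c' * ordQ\<close>.
  Together with the swapped functional this is a symmetric linear system for \<open>c\<close> and
  \<open>c'\<close>, which forces \<open>c = c'\<close> as soon as the two counts differ.\<close>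

lemma order_killed:
 assumes ij: "i \<in> X" "j \<in> X" "i ~= j" and nz: "wcount K g (bef i j) ~= 0"
 shows "\<nu> = 0" "\<eta> = 0" "c * wcount K g (bef i j) + c' * wcount K g (bef j i) = 0"
  "c' * wcount K g (bef i j) + c * wcount K g (bef j i) = 0"
proof -
 interpret s: killed_functional "%w. \<phi> (map (transpose 1 2) w)" N c' "- \<eta>" "- \<nu>" u0' u1' v0' v1' \<kappa>' \<alpha>' \<beta>' \<gamma>'
   c u0 u1 v0 v1 \<kappa> \<alpha> \<beta> \<gamma> K g X by (rule swapped)
 have k: "\<nu> * ordP i j = 0" "\<eta> * ordP i j = 0" "bulk i j (%_. 1) = 0" "s.bulk i j (%_. 1) = 0"
  using order_kill[OF ij, of "%_. 1"] s.order_kill[OF ij, of "%_. 1"] by auto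
 show z: "\<nu> = 0" "\<eta> = 0" using k nz unfolding ordP_def[OF ij] cnt_wcount by auto
 show "c * wcount K g (bef i j) + c' * wcount K g (bef j i) = 0"
  using k(3) z unfolding bulk_def[OF ij] ordP_def[OF ij] ordQ_def[OF ij] cnt_wcount by simp
 show "c' * wcount K g (bef i j) + c * wcount K g (bef j i) = 0"
  using k(4) z unfolding s.bulk_def[OF ij] s.ordP_def[OF ij] s.ordQ_def[OF ij] cnt_wcount by simp
qed

end

section \<open>Vanishing on polynomials whose statistics vanish\<close>

context two_letter_functional
begin

lemma position_sum:
 assumes w: "w \<in> K" and X: "finite X" "i \<in> X"
 shows "k_of (%_. 1) i w = (\<Sum>h\<in>X - {i}. of_bool (bef h i w))"
  and "k_of (%_. 1) i w + m_of (%_. 1) i w + 1 = card X"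
proof -
 have d: "distinct w" "set w = X" using K[OF w] by auto
 then obtain u v where uv: "w = u @ i # v" using X split_list by metis
 have ni: "i ~: set u" "i ~: set v" using d uv by auto
 have k: "k_of (%_. 1) i w = length u" and m: "m_of (%_. 1) i w = length v"
  using k_of_split[OF ni(1), of "%_. 1" v] m_of_split[OF ni(2), of "%_. 1" u] uv by (simp_all add: sum_list_triv)
 have "card X = length w" using d distinct_card by metis
 then show "k_of (%_. 1) i w + m_of (%_. 1) i w + 1 = card X" using k m uv by simp
 have "bef h i w \<longleftrightarrow> h \<in> set u" if h: "h \<in> X - {i}" for h
 proof
  assume "h \<in> set u"
  then obtain a b where "u = a @ h # b" using split_list by metis
  then have "w = a @ h # b @ i # v" using uv by simp
  then show "bef h i w" unfolding bef_def by blast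
 next
  assume "bef h i w"
  then have nb: "\<not> bef i h w" using bef_not_bef d by blast
  show "h \<in> set u"
  proof (rule ccontr)
   assume "h ~: set u"
   then have "h \<in> set v" using h uv d by auto
   then obtain a b where "v = a @ h # b" using split_list by metis
   then have "w = u @ i # a @ h # b" using uv by simp
   then show False using nb unfolding bef_def by blast
  qed
 qed
 then have "(\<Sum>h\<in>X - {i}. of_bool (bef h i w)) = (\<Sum>h\<in>X - {i}. of_bool (h \<in> set u) :: nat)"
  by (intro sum.cong) auto
 also have "\<dots> = card ((X - {i}) \<inter> set u)" using X by (simp add: sum_of_bool_eq Int_def)
 also have "(X - {i}) \<inter> set u = set u" using d uv ni by auto
 also have "card (set u) = length u" using d uv by (simp add: distinct_card)
 finally show "k_of (%_. 1) i w = (\<Sum>h\<in>X - {i}. of_bool (bef h i w))" using k by simp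
qed

lemma wsum_sum: "wsum (%w. \<Sum>h\<in>H. h' h w) = (\<Sum>h\<in>H. wsum (h' h))"
 unfolding wsum_def sum_distrib_left by (rule sum.swap)

text \<open>The number of letters in front of \<open>i\<close> is a sum of order indicators, so
  vanishing order counts make the mean positions vanish as well, and with them all parts of
  \<open>bulk\<close>. In the other alternative \<open>bulk\<close> is \<open>c\<close> times the
  total of the coefficients.\<close>

lemma bulk_zero:
 assumes X: "finite X" and ij: "i \<in> X" "j \<in> X" "i ~= j"
  and tot: "wcount K g (%w. True) = 0"
  and ord: "(\<forall>i\<in>X. \<forall>j\<in>X. i ~= j --> wcount K g (bef i j) = 0) \<or> (\<nu> = 0 & \<eta> = 0 & c = c')"
 shows "bulk i j (%_. 1) = 0"
 using ord
proof
 assume o: "\<forall>i\<in>X. \<forall>j\<in>X. i ~= j --> wcount K g (bef i j) = 0"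
 have o': "cnt (bef i j) = 0" if "i \<in> X" "j \<in> X" "i ~= j" for i j using o that by (simp add: cnt_wcount)
 have pos: "wsum (%w. of_nat (k_of (%_. 1) i w)) = 0" if "i \<in> X" for i
 proof -
  have "wsum (%w. of_nat (k_of (%_. 1) i w)) = wsum (%w. \<Sum>h\<in>X - {i}. of_bool (bef h i w))"
   by (rule wsum_cong) (simp only: position_sum(1)[OF _ X that] of_nat_sum of_nat_of_bool)
  also have "\<dots> = (\<Sum>h\<in>X - {i}. cnt (bef h i))" unfolding wsum_sum cnt_def ..
  also have "\<dots> = 0" using o' that by (intro sum.neutral) auto
  finally show ?thesis .
 qed
 \<comment> \<open>On words with \<open>j\<close> before \<open>i\<close>, the number of letters
   behind \<open>i\<close> is \<open>card X - 1\<close> minus the number in front. The opposite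
   signs of the slopes of \<open>P\<close> and \<open>Q\<close> turn the difference into the full
   position of \<open>i\<close>, up to a multiple of an order count.\<close>
 have key: "wsum (%w. of_bool (bef i j w) * of_nat (k_of (%_. 1) i w))
   - wsum (%w. of_bool (bef j i w) * of_nat (m_of (%_. 1) i w)) = 0"
  if ij: "i \<in> X" "j \<in> X" "i ~= j" for i j
 proof -
  have "wsum (%w. of_bool (bef i j w) * of_nat (k_of (%_. 1) i w))
   - wsum (%w. of_bool (bef j i w) * of_nat (m_of (%_. 1) i w))
   = wsum (%w. of_bool (bef i j w) * of_nat (k_of (%_. 1) i w)
     - of_bool (bef j i w) * of_nat (m_of (%_. 1) i w))" by (simp add: wsum_diff)
  also have "\<dots> = wsum (%w. of_nat (k_of (%_. 1) i w) - of_bool (bef j i w) * (of_nat (card X) - 1))"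
  proof (rule wsum_cong)
   fix w assume w: "w \<in> K"
   have "of_nat (k_of (%_. 1) i w + m_of (%_. 1) i w + 1) = (of_nat (card X) :: 'f)"
    using position_sum(2)[OF w X ij(1)] by simp
   moreover have "bef i j w \<longleftrightarrow> \<not> bef j i w"
    using bef_not_bef[of w j i] bef_cases[of i w j] K[OF w] ij by auto
   ultimately show "of_bool (bef i j w) * of_nat (k_of (%_. 1) i w) - of_bool (bef j i w) * of_nat (m_of (%_. 1) i w)
     = of_nat (k_of (%_. 1) i w) - of_bool (bef j i w) * (of_nat (card X) - (1::'f))"
    by (cases "bef j i w") (auto simp: algebra_simps)
  qed
  also have "\<dots> = 0"
   using pos[OF ij(1)] o'[OF ij(2,1)] ij(3) unfolding wsum_diff cnt_times by simp
  finally show ?thesis .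
 qed
 show ?thesis
  using key[OF ij] key[OF ij(2,1)] ij(3) o'[OF ij] o'[OF ij(2,1)]
  unfolding bulk_def[OF ij] ordP_def[OF ij] ordQ_def[OF ij] by simp
next
 assume z: "\<nu> = 0 & \<eta> = 0 & c = c'"
 have "ordP i j + ordQ i j = wsum (%w. of_bool (bef i j w) + of_bool (bef j i w))"
  by (simp add: ordP_def[OF ij] ordQ_def[OF ij] cnt_def wsum_add)
 also have "\<dots> = wsum (%w. of_bool True)"
 proof (rule wsum_cong)
  fix w assume w: "w \<in> K"
  show "of_bool (bef i j w) + of_bool (bef j i w) = (of_bool True :: 'f)"
   using bef_not_bef[of w j i] bef_cases[of i w j] K[OF w] ij by auto
 qed
 also have "\<dots> = 0" using tot by (simp add: wcount_def wsum_def)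
 finally have "c * ordP i j + c * ordQ i j = 0" by (metis distrib_left mult_zero_right)
 then show ?thesis using z unfolding bulk_def[OF ij] by simp
qed

text \<open>With all weights 1 and no padding, every boundary condition is a statement about the
  word: \<open>k = 1\<close> means that exactly one letter \<open>h\<close> precedes
  \<open>i\<close>, whence the sums over \<open>h\<close> of the two-letter statistics.\<close>

lemma boundary_part_vanish:
 assumes ij: "i \<in> X" "j \<in> X" "i ~= j" and X: "finite X" and N: "N = (\<Sum>x\<in>X - {i, j}. 1)"
  and dead: "coefficients_killed K g X u0 u1 v0 v1 \<kappa> \<alpha> \<beta> \<gamma>"
 shows "wsum (%w. of_bool (bef i j w) * bdP (k_of (%_. 1) i w) (m_of (%_. 1) j w)) = 0"
proof -
 have dead': "u0 * cnt (%w. hd w = i) = 0" "u1 * cnt (startsw i j) = 0"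
   "v0 * cnt (%w. last w = i) = 0" "v1 * cnt (endsw i j) = 0"
   "\<kappa> * cnt (adjw i j) = 0" "\<alpha> * cnt (startsw i j) = 0"
   "\<beta> * cnt (endsw i j) = 0" "\<gamma> * cnt (outerw i j) = 0" if "i \<in> X" "j \<in> X" "i ~= j" for i j
  using dead that unfolding coefficients_killed_def cnt_wcount by blast+
 have "wsum (%w. of_bool (bef i j w) * bdP (k_of (%_. 1) i w) (m_of (%_. 1) j w))
  = wsum (%w. of_bool (hd w = i) * u0 + (\<Sum>h\<in>X - {i, j}. of_bool (startsw h i w) * u1)
    + of_bool (last w = j) * v0 + (\<Sum>h\<in>X - {i, j}. of_bool (endsw j h w) * v1)
    + of_bool (adjw i j w) * \<kappa> + of_bool (startsw i j w) * \<alpha> + of_bool (endsw i j w) * \<beta>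
    + of_bool (outerw i j w) * \<gamma>)"
 proof (rule wsum_cong)
  fix w assume w: "w \<in> K"
  note [simp] = X
  have single: "(\<Sum>h\<in>X - {i, j}. of_bool (S h w) * x) = of_bool (\<exists>h\<in>X - {i, j}. S h w) * x"
   if "\<And>h h'. S h w ==> S h' w ==> h = h'" for S :: "nat => nat list => bool" and x :: 'f
  proof (cases "\<exists>h\<in>X - {i, j}. S h w")
   case True
   then obtain h where h: "h \<in> X - {i, j}" "S h w" by blast
   have "(\<Sum>h\<in>X - {i, j}. of_bool (S h w) * x) = (\<Sum>h'\<in>X - {i, j}. if h' = h then x else 0)"
    using that h by (intro sum.cong) auto
   also have "\<dots> = x" using h X by simp
   finally show ?thesis using True by simp
  qed (auto intro: sum.neutral)
  have s1: "(\<Sum>h\<in>X - {i, j}. of_bool (startsw h i w) * u1) = of_bool (\<exists>h\<in>X - {i, j}. startsw h i w) * u1"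
   by (rule single) (auto simp: startsw_def)
  have s2: "(\<Sum>h\<in>X - {i, j}. of_bool (endsw j h w) * v1) = of_bool (\<exists>h\<in>X - {i, j}. endsw j h w) * v1"
   by (rule single[where S = "%h. endsw j h"]) (auto simp: endsw_def)
  show "of_bool (bef i j w) * bdP (k_of (%_. 1) i w) (m_of (%_. 1) j w)
   = of_bool (hd w = i) * u0 + (\<Sum>h\<in>X - {i, j}. of_bool (startsw h i w) * u1)
    + of_bool (last w = j) * v0 + (\<Sum>h\<in>X - {i, j}. of_bool (endsw j h w) * v1)
    + of_bool (adjw i j w) * \<kappa> + of_bool (startsw i j w) * \<alpha> + of_bool (endsw i j w) * \<beta>
    + of_bool (outerw i j w) * \<gamma>"
  proof (cases "bef i j w")
   case True
   have dw: "distinct w" "set w = X" using K[OF w] by auto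
   have e1: "k_of (%_. 1) i w = 0 \<longleftrightarrow> hd w = i" "m_of (%_. 1) j w = 0 \<longleftrightarrow> last w = j"
    "k_of (%_. 1) i w + m_of (%_. 1) j w = N \<longleftrightarrow> adjw i j w"
    using k_of_eq_0[OF w True ij(3), of "%_. 1"] m_of_eq_0[OF w True ij(3), of "%_. 1"]
     adjw_iff[OF w True ij(3), of "%_. 1"] N by auto
   have nj: "\<not> startsw j i w"
    using True bef_not_bef[OF dw(1) True] unfolding startsw_def bef_def by (metis append_Nil)
   have ni: "\<not> endsw j i w"
   proof
    assume "endsw j i w"
    then have "\<exists>u. w = u @ j # [] @ i # []" unfolding endsw_def by auto
    then show False using bef_not_bef[OF dw(1) True] unfolding bef_def by blast
   qed
   have "k_of (%_. 1) i w = 1 \<longleftrightarrow> (\<exists>h. startsw h i w)"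
    using k_of_eq_1[OF w True ij(3), of "%_. 1"] by simp
   also have "\<dots> \<longleftrightarrow> (\<exists>h\<in>X - {i, j}. startsw h i w)"
    using nj dw unfolding startsw_def by fastforce
   finally have e2: "k_of (%_. 1) i w = 1 \<longleftrightarrow> (\<exists>h\<in>X - {i, j}. startsw h i w)" .
   have "m_of (%_. 1) j w = 1 \<longleftrightarrow> (\<exists>h. endsw j h w)"
    using m_of_eq_1[OF w True ij(3), of "%_. 1"] by simp
   also have "\<dots> \<longleftrightarrow> (\<exists>h\<in>X - {i, j}. endsw j h w)"
    using ni dw unfolding endsw_def by fastforce
   finally have e3: "m_of (%_. 1) j w = 1 \<longleftrightarrow> (\<exists>h\<in>X - {i, j}. endsw j h w)" .
   show ?thesis unfolding s1 s2 boundary_part_def e1 e2 e3 startsw_iff[OF w, of i j] endsw_iff[OF w, of i j] outerw_def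
    using True by simp
  next
   case False
   have f: "\<not> hd w = i" "\<not> last w = j" "\<not> adjw i j w"
    using False hd_bef[OF w ij] last_bef[OF w ij] adjw_bef by auto
   have "\<not> startsw h i w" if "h \<in> X - {i, j}" for h
    using False startsw_bef[OF w ij(2), of h i] that ij(3) by auto
   moreover have "\<not> endsw j h w" if "h \<in> X - {i, j}" for h
    using False endsw_bef[OF w ij(1), of j h] that ij(3) by auto
   ultimately show ?thesis unfolding s1 s2 startsw_iff[OF w, of i j] endsw_iff[OF w, of i j] outerw_def
    using f False by auto
  qed
 qed
 also have "\<dots> = u0 * cnt (%w. hd w = i) + (\<Sum>h\<in>X - {i, j}. u1 * cnt (startsw h i)) + v0 * cnt (%w. last w = j)
   + (\<Sum>h\<in>X - {i, j}. v1 * cnt (endsw j h)) + \<kappa> * cnt (adjw i j) + \<alpha> * cnt (startsw i j)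
   + \<beta> * cnt (endsw i j) + \<gamma> * cnt (outerw i j)"
  unfolding wsum_add wsum_sum cnt_times ..
 also have "\<dots> = 0"
 proof -
  have "(\<Sum>h\<in>X - {i, j}. u1 * cnt (startsw h i)) = 0" "(\<Sum>h\<in>X - {i, j}. v1 * cnt (endsw j h)) = 0"
   using dead'(2)[OF _ ij(1)] dead'(4)[OF ij(2)] by (intro sum.neutral; auto)+
  then show ?thesis by (simp only: dead'[OF ij] dead'(3)[OF ij(2,1) ij(3)[symmetric]] add_0)
 qed
 finally show ?thesis .
qed

end

text \<open>All weights are 1 and all paddings 0, so the substitution merely identifies all letters
  other than \<open>i\<close> and \<open>j\<close>; this is why
  \<open>N + 2 = card X\<close>.\<close>

lemma (in two_letter_functional) evaluation_vanish:
 assumes X: "finite X" and ij: "i \<in> X" "j \<in> X" "i ~= j" and N: "N + 2 = card X"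
  and tot: "wcount K g (%w. True) = 0"
  and ord: "(\<forall>i\<in>X. \<forall>j\<in>X. i ~= j --> wcount K g (bef i j) = 0) \<or> (\<nu> = 0 & \<eta> = 0 & c = c')"
  and dead: "coefficients_killed K g X u0 u1 v0 v1 \<kappa> \<alpha> \<beta> \<gamma>"
  and dead': "coefficients_killed K g X u0' u1' v0' v1' \<kappa>' \<alpha>' \<beta>' \<gamma>'"
 shows "wsum (%w. \<phi> (map (%x. if x = i then 1 else if x = j then 2 else 0) w)) = 0"
proof -
 have N': "N = (\<Sum>x\<in>X - {i, j}. 1)" using X ij N by (simp add: card_Diff_subset)
 then have N'': "N = 0 + 0 + 0 + 0 + 0 + 0 + (\<Sum>x\<in>X - {i, j}. 1)" by simp
 have Nj: "N = (\<Sum>x\<in>X - {j, i}. 1)" using N' by (simp add: insert_commute)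
 have conv: "tw 0 @ concat (map (two_sub i (tw 0 @ 1 # tw 0) j (tw 0 @ 2 # tw 0) (%_. 1)) w) @ tw 0
   = map (%x. if x = i then 1 else if x = j then 2 else 0) w" for w
  by (induction w) (auto simp: two_sub_def tw_def)
 have fQ: "boundary_affine N (%k l m. \<phi> (map (transpose 1 2) (wP k l m))) c' (- \<eta>) (- \<nu>) u0' u1' v0' v1' \<kappa>' \<alpha>' \<beta>' \<gamma>'"
  using formQ by (simp only: swap_wP)
 have fP: "boundary_affine N (%k l m. \<phi> (map (transpose 1 2) (wQ k l m))) c (- (- \<nu>)) (- (- \<eta>)) u0 u1 v0 v1 \<kappa> \<alpha> \<beta> \<gamma>"
  using formP by (simp only: swap_wQ minus_minus)
 interpret s: two_letter_functional "%w. \<phi> (map (transpose 1 2) w)" N c' "- \<eta>" "- \<nu>" u0' u1' v0' v1' \<kappa>' \<alpha>' \<beta>' \<gamma>'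
   c u0 u1 v0 v1 \<kappa> \<alpha> \<beta> \<gamma> K g X
  by (unfold_locales, rule fQ, rule fP, rule finK, rule K)
 have b0: "boundary i j (%_. 1) 0 0 0 0 0 0 = 0"
  unfolding boundary_def[OF ij]
  using boundary_part_vanish[OF ij X N' dead] s.boundary_part_vanish[OF ij(2,1) ij(3)[symmetric] X Nj dead'] by simp
 show ?thesis
  using value_formula[OF ij N''] b0 bulk_zero[OF X ij tot ord] unfolding conv by simp
qed

section \<open>From mixed to skew exchanges\<close>

definition plus_op :: "(nat => nat) => ((nat => 'x) => 'v::ab_group_add) => (nat => 'x) => 'v" where
 "plus_op p F = (%c. F c + F (c o p))"

lemma dp_plus_op: "dp i j = plus_op (transpose i j)"
 by (simp add: fun_eq_iff dp_def plus_op_def)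

lemma plus_op_dm: "p o transpose i j = transpose i j o p ==> plus_op p (dm i j F) = dm i j (plus_op p F)"
 unfolding plus_op_def dm_def by (rule ext) (metis (no_types, lifting) comp_assoc add_diff_add)

lemma plus_op_commute: "p o q = q o p ==> plus_op p (plus_op q F) = plus_op q (plus_op p F)"
 unfolding plus_op_def by (rule ext) (metis (no_types, lifting) comp_assoc add.assoc add.left_commute)

lemma plus_op_pull:
 assumes "\<And>c. m (c o p) = m c o p'"
 shows "plus_op p (%c. H (m c)) = (%c. plus_op p' H (m c))"
 by (simp add: fun_eq_iff plus_op_def assms)

lemma dm_pull:
 assumes "\<And>c. m (c o transpose i j) = m c o transpose i' j'"
 shows "dm i j (%c. H (m c)) = (%c. dm i' j' H (m c))"
 by (simp add: fun_eq_iff dm_def assms)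

lemma plus_op_zero [simp]: "plus_op p (%c. 0) = (%c. 0)" and dm_zero [simp]: "dm i j (%c. 0) = (%c. 0)"
 by (simp_all add: fun_eq_iff plus_op_def dm_def)

definition sign_eigen :: "nat \<times> nat => ((nat => 'x) => 'v::ab_group_add) => bool => bool" where
 "sign_eigen t Y s \<longleftrightarrow> (\<forall>c. Y (c o transpose (fst t) (snd t)) = (if s then Y c else - Y c))"

text \<open>For an involution, \<open>2 * Y\<close> is the sum of its symmetric part
  \<open>dp\<close> and its skew part \<open>dm\<close>, and one of them is nonzero where
  \<open>Y\<close> is. As the transpositions commute, passing to that part keeps the eigenvalues
  found before, and \<open>P\<close> records whatever else is to survive.\<close>

lemma eigenfunction_exists:
 fixes F :: "(nat => 'x) => 'f::field_char_0"
 assumes comm: "\<And>t t'. t \<in> set ts ==> t' \<in> set ts ==>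
   transpose (fst t) (snd t) o transpose (fst t') (snd t') = transpose (fst t') (snd t') o transpose (fst t) (snd t)"
  and P: "P F" "F c0 ~= 0"
  and closed: "\<And>t Y. t \<in> set ts ==> P Y ==> P (dp (fst t) (snd t) Y) & P (dm (fst t) (snd t) Y)"
 shows "\<exists>Y c. P Y & Y c ~= 0 & (\<forall>t\<in>set ts. \<exists>s. sign_eigen t Y s)"
 using comm closed
proof (induction ts)
 case Nil
 then show ?case using P by auto
next
 case (Cons t ts)
 then obtain Y c where Y: "P Y" "Y c ~= 0" "\<forall>t\<in>set ts. \<exists>s. sign_eigen t Y s" by auto
 let ?t = "transpose (fst t) (snd t)"
 have inv: "d o ?t o ?t = d" for d :: "nat => 'x" by (simp add: comp_assoc)
 have keep: "\<exists>s. sign_eigen t' (dp (fst t) (snd t) Y) s" "\<exists>s. sign_eigen t' (dm (fst t) (snd t) Y) s"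
  if t': "t' \<in> set ts" for t'
 proof -
  obtain s where s: "sign_eigen t' Y s" using Y(3) t' by blast
  have cm: "d o transpose (fst t') (snd t') o ?t = d o ?t o transpose (fst t') (snd t')" for d :: "nat => 'x"
   using Cons.prems(1)[of t' t] t' by (metis comp_assoc list.set_intros)
  have "sign_eigen t' (dp (fst t) (snd t) Y) s" "sign_eigen t' (dm (fst t) (snd t) Y) s"
   using s unfolding sign_eigen_def dp_def dm_def cm by auto
  then show "\<exists>s. sign_eigen t' (dp (fst t) (snd t) Y) s" "\<exists>s. sign_eigen t' (dm (fst t) (snd t) Y) s" by blast+
 qed
 have "2 * Y c = dp (fst t) (snd t) Y c + dm (fst t) (snd t) Y c" by (simp add: dp_def dm_def)
 then consider "dp (fst t) (snd t) Y c ~= 0" | "dm (fst t) (snd t) Y c ~= 0" using Y(2) by fastforce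
 then show ?case
 proof cases
  case 1
  have "sign_eigen t (dp (fst t) (snd t) Y) True" unfolding sign_eigen_def dp_def inv by simp
  then have "\<forall>t'\<in>set (t # ts). \<exists>s. sign_eigen t' (dp (fst t) (snd t) Y) s" using keep(1) by auto
  moreover have "P (dp (fst t) (snd t) Y)" using Cons.prems(2)[of t Y] Y(1) by simp
  ultimately show ?thesis using 1 by blast
 next
  case 2
  have "sign_eigen t (dm (fst t) (snd t) Y) False" unfolding sign_eigen_def dm_def inv by simp
  then have "\<forall>t'\<in>set (t # ts). \<exists>s. sign_eigen t' (dm (fst t) (snd t) Y) s" using keep(2) by auto
  moreover have "P (dm (fst t) (snd t) Y)" using Cons.prems(2)[of t Y] Y(1) by simp
  ultimately show ?thesis using 2 by blast
 qed
qed

definition mixed_words :: "nat => (nat list => 'v::ab_group_add) => bool" where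
 "mixed_words n0 \<phi> \<longleftrightarrow> (\<forall>W c i1 j1 i2 j2 i3 j3 k1 l1 k2 l2 k3 l3. distinct W --> n0 <= length W -->
   {i1, j1, i2, j2, i3, j3, k1, l1, k2, l2, k3, l3} \<subseteq> set W -->
   distinct [i1, j1, i2, j2, i3, j3, k1, l1, k2, l2, k3, l3] --> (\<forall>x. c x ~= []) -->
   plus_op (transpose k1 l1) (plus_op (transpose k2 l2) (plus_op (transpose k3 l3)
    (dm i1 j1 (dm i2 j2 (dm i3 j3 (%c. \<phi> (concat (map c W)))))))) c = 0)"

lemma mixed_wordsD:
 assumes "mixed_words n0 \<phi>" "distinct W" "n0 <= length W"
  "{i1, j1, i2, j2, i3, j3, k1, l1, k2, l2, k3, l3} \<subseteq> set W"
  "distinct [i1, j1, i2, j2, i3, j3, k1, l1, k2, l2, k3, l3]" "\<And>x. c x ~= []"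
 shows "plus_op (transpose k1 l1) (plus_op (transpose k2 l2) (plus_op (transpose k3 l3)
    (dm i1 j1 (dm i2 j2 (dm i3 j3 (%c. \<phi> (concat (map c W)))))))) c = 0"
 using assms(1)[unfolded mixed_words_def, rule_format, OF assms(2-5)] assms(6) by simp

text \<open>Empty fillings are outside the scope of \<open>mixed_words\<close>. Replacing them by a
  default word commutes with permuting slots and makes the operators act on functions of all
  assignments.\<close>

definition fill :: "(nat => nat list) => nat => nat list" where
 "fill c = (%x. if c x = [] then [0] else c x)"

lemma fill_comp: "fill (c o p) = fill c o p" by (simp add: fill_def fun_eq_iff)

lemma fill_ne: "fill c x ~= []" by (simp add: fill_def)

lemma fill_id: "(\<And>x. c x ~= []) ==> fill c = c" by (simp add: fill_def fun_eq_iff)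

text \<open>Glues the slot \<open>nx x\<close> to the slot \<open>x\<close> for \<open>x\<close> in
  \<open>Fs\<close>. The freed slots get the dummy \<open>[0]\<close>; they will be deleted from the
  list of slots, so it is never read.\<close>

definition merge :: "(nat => nat) => nat set => (nat => nat list) => nat => nat list" where
 "merge nx Fs c = (%x. if x \<in> Fs then c x @ c (nx x) else if x \<in> nx ` Fs then [0] else c x)"

lemma merge_comp_outside:
 assumes "i ~: Fs" "j ~: Fs" "i ~: nx ` Fs" "j ~: nx ` Fs"
 shows "merge nx Fs (c o transpose i j) = merge nx Fs c o transpose i j"
proof
 fix x
 have n: "nx y ~= i" "nx y ~= j" if "y \<in> Fs" for y using assms(3,4) that by auto
 show "merge nx Fs (c o transpose i j) x = (merge nx Fs c o transpose i j) x"
  using assms n by (auto simp: merge_def transpose_def)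
qed

lemma merge_comp_block:
 assumes "p \<in> Fs" "q \<in> Fs" "inj_on nx Fs" "nx ` Fs \<inter> Fs = {}"
 shows "merge nx Fs (c o (transpose p q o transpose (nx p) (nx q))) = merge nx Fs c o transpose p q"
proof
 fix x
 have n: "nx y ~= z" if "y \<in> Fs" "z \<in> Fs" for y z using assms(4) that by auto
 have i: "nx y = nx z \<longleftrightarrow> y = z" if "y \<in> Fs" "z \<in> Fs" for y z using assms(3) that by (simp add: inj_on_eq_iff)
 define T where "T = transpose p q o transpose (nx p) (nx q)"
 have d: "nx p ~= p" "nx p ~= q" "nx q ~= p" "nx q ~= q" using n assms(1,2) by auto
 have T: "T p = q" "T q = p" "T (nx p) = nx q" "T (nx q) = nx p"
  using d by (simp_all add: T_def transpose_def)
 have T': "T y = y" if "y ~: {p, q, nx p, nx q}" for y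
  using that by (simp add: T_def)
 consider "x = p" | "x = q" | "x \<in> Fs" "x ~: {p, q}" | "x ~: Fs" "x \<in> nx ` Fs" | "x ~: Fs" "x ~: nx ` Fs"
  by blast
 then have "merge nx Fs (c o T) x = (merge nx Fs c o transpose p q) x"
 proof cases
  case 3
  then have "T x = x" "T (nx x) = nx x" using n assms(1,2) i by (auto intro!: T')
  then show ?thesis using 3 by (simp add: merge_def)
 next
  case 4
  then have "x ~= p" "x ~= q" using assms by auto
  then show ?thesis using 4 by (simp add: merge_def)
 next
  case 5
  then have "x ~: {p, q, nx p, nx q}" using assms by auto
  then show ?thesis using 5 T' by (simp add: merge_def)
 qed (simp_all add: merge_def T assms(1,2))
 then show "merge nx Fs (c o (transpose p q o transpose (nx p) (nx q))) x = (merge nx Fs c o transpose p q) x"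
  unfolding T_def .
qed

lemma card_ge_3E:
 assumes "card S \<ge> 3"
 obtains x y z where "x \<in> S" "y \<in> S" "z \<in> S" "x ~= y" "x ~= z" "y ~= z"
proof -
 obtain xs where "set xs \<subseteq> S" "distinct xs" "length xs = 3" using obtain_distinct[OF assms] .
 then show ?thesis using that by (auto simp: numeral_eq_Suc length_Suc_conv)
qed

lemma plus_op_invariant:
 fixes Y :: "(nat => 'x) => 'f::field_char_0"
 assumes "plus_op p1 (plus_op p2 (plus_op p3 Y)) c = 0"
  and "\<And>c. Y (c o p1) = Y c" "\<And>c. Y (c o p2) = Y c" "\<And>c. Y (c o p3) = Y c"
 shows "Y c = 0"
proof -
 have "plus_op p1 (plus_op p2 (plus_op p3 Y)) c = 8 * Y c"
  using assms(2-4) by (simp add: plus_op_def)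
 then show ?thesis using assms(1) by simp
qed

text \<open>\<open>W\<close> is cut into consecutive blocks of two slots, and \<open>rr\<close>
  selects ten blocks that avoid the six skew letters.\<close>

locale block_pairs =
 fixes \<phi> :: "nat list => 'f::field_char_0" and n0 :: nat and W :: "nat list"
  and i1 j1 i2 j2 i3 j3 :: nat and rr :: "nat => nat"
 assumes mixed: "mixed_words n0 \<phi>"
  and W: "distinct W" "2 * n0 + 40 <= length W"
  and sp: "{i1, j1, i2, j2, i3, j3} \<subseteq> set W" "distinct [i1, j1, i2, j2, i3, j3]"
  and rr: "inj_on rr {..<10}" "\<And>k. k < 10 ==> rr k < length W div 2"
   "\<And>k. k < 10 ==> W ! (2 * rr k) ~: {i1, j1, i2, j2, i3, j3}"
   "\<And>k. k < 10 ==> W ! (2 * rr k + 1) ~: {i1, j1, i2, j2, i3, j3}"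
begin

definition a where "a r = W ! (2 * r)"
definition b where "b r = W ! (2 * r + 1)"

text \<open>The ten blocks form five pairs. For \<open>k < 5\<close>, \<open>tp k\<close> exchanges
  the first slots of the two blocks of pair \<open>k\<close> and \<open>tp (k + 5)\<close> their
  second slots, so that \<open>sg k\<close> exchanges the two blocks as a whole.\<close>

definition la where "la k = (if k < 5 then a (rr (2 * k)) else b (rr (2 * (k - 5))))"
definition lb where "lb k = (if k < 5 then a (rr (2 * k + 1)) else b (rr (2 * (k - 5) + 1)))"

abbreviation (input) tp where "tp k \<equiv> transpose (la k) (lb k)"
abbreviation (input) sg where "sg k \<equiv> tp k o tp (k + 5)"

lemma ab_eq: "r < length W div 2 ==> r' < length W div 2 ==> a r = a r' \<longleftrightarrow> r = r'"
 "r < length W div 2 ==> r' < length W div 2 ==> b r = b r' \<longleftrightarrow> r = r'"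
 "r < length W div 2 ==> r' < length W div 2 ==> a r ~= b r'"
proof -
 assume r: "r < length W div 2" "r' < length W div 2"
 then have l: "2 * r < length W" "2 * r' < length W" "2 * r + 1 < length W" "2 * r' + 1 < length W" by auto
 show "a r = a r' \<longleftrightarrow> r = r'" unfolding a_def using nth_eq_iff_index_eq[OF W(1) l(1,2)] by simp
 show "b r = b r' \<longleftrightarrow> r = r'" unfolding b_def using nth_eq_iff_index_eq[OF W(1) l(3,4)] by simp
 show "a r ~= b r'" unfolding a_def b_def using nth_eq_iff_index_eq[OF W(1) l(1,4)] by presburger
qed

lemma rr_eq: "k < 10 ==> k' < 10 ==> rr k = rr k' \<longleftrightarrow> k = k'"
 using rr(1) by (simp add: inj_on_eq_iff)

lemma ab_sp: "k < 10 ==> a (rr k) ~: {i1, j1, i2, j2, i3, j3}" "k < 10 ==> b (rr k) ~: {i1, j1, i2, j2, i3, j3}"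
 using rr(3,4) unfolding a_def b_def by blast+

lemma lab_sp: "k < 10 ==> la k ~: {i1, j1, i2, j2, i3, j3}" "k < 10 ==> lb k ~: {i1, j1, i2, j2, i3, j3}"
 unfolding la_def lb_def using ab_sp[of "2 * k"] ab_sp[of "2 * k + 1"] ab_sp[of "2 * (k - 5)"] ab_sp[of "2 * (k - 5) + 1"]
 by (auto split: if_splits)

lemma ab_in: "r < length W div 2 ==> a r \<in> set W" "r < length W div 2 ==> b r \<in> set W"
 unfolding a_def b_def by (auto intro!: nth_mem)

lemma lab_in: "k < 10 ==> la k \<in> set W" "k < 10 ==> lb k \<in> set W"
 unfolding la_def lb_def by (auto intro!: ab_in rr(2))

lemma lab_distinct:
 assumes "k < 10" "k' < 10"
 shows "la k ~= lb k'" "la k = la k' \<longleftrightarrow> k = k'" "lb k = lb k' \<longleftrightarrow> k = k'"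
proof -
 have u: "2 * k < 10 & 2 * k + 1 < 10" if "k < 5" for k :: nat using that by auto
 have v: "2 * (k - 5) < 10 & 2 * (k - 5) + 1 < 10" if "k < 10" for k :: nat using that by auto
 have w: "2 * x ~= Suc (2 * y)" "Suc (2 * x) ~= 2 * y" for x y :: nat by presburger+
 show "la k ~= lb k'" "la k = la k' \<longleftrightarrow> k = k'" "lb k = lb k' \<longleftrightarrow> k = k'"
  unfolding la_def lb_def using assms u v
  by (auto simp: ab_eq rr(2) ab_eq(3)[THEN not_sym] rr_eq w)
qed

lemma tp_commute: "k < 10 ==> k' < 10 ==> tp k o tp k' = tp k' o tp k"
 using lab_distinct[of k k'] lab_distinct[of k' k] lab_distinct(1)[of k k] lab_distinct(1)[of k' k']
 by (cases "k = k'") (auto intro!: transpose_comp_disjoint)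

lemma sg_commute: "k < 5 ==> k' < 10 ==> sg k o tp k' = tp k' o sg k"
proof -
 assume "k < 5" "k' < 10"
 then have "tp k o tp k' = tp k' o tp k" "tp (k+5) o tp k' = tp k' o tp (k+5)" by (auto intro!: tp_commute)
 then show ?thesis by (metis comp_assoc)
qed

definition H where "H c = \<phi> (concat (map c W))" for c :: "nat => nat list"
definition D where "D = dm i1 j1 (dm i2 j2 (dm i3 j3 (%c. H (fill c))))"

lemma D_plus:
 assumes "k1 < 10" "k2 < 10" "k3 < 10" "k1 ~= k2" "k1 ~= k3" "k2 ~= k3"
 shows "plus_op (tp k1) (plus_op (tp k2) (plus_op (tp k3) D)) = (%c. 0)"
proof -
 have f: "plus_op (transpose p q) (%c. G (fill c)) = (%c. plus_op (transpose p q) G (fill c))"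
  "dm p q (%c. G (fill c)) = (%c. dm p q G (fill c))" for G :: "(nat => nat list) => 'f" and p q
  by (rule plus_op_pull dm_pull, rule fill_comp)+
 have "plus_op (tp k1) (plus_op (tp k2) (plus_op (tp k3) D))
   = (%c. plus_op (tp k1) (plus_op (tp k2) (plus_op (tp k3) (dm i1 j1 (dm i2 j2 (dm i3 j3 H))))) (fill c))"
  unfolding D_def f(2)[of i3 j3 H] f(2)[of i2 j2 "dm i3 j3 H"] f(2)[of i1 j1 "dm i2 j2 (dm i3 j3 H)"]
   f(1)[of _ _ "dm i1 j1 (dm i2 j2 (dm i3 j3 H))"]
   f(1)[of _ _ "plus_op (tp k3) (dm i1 j1 (dm i2 j2 (dm i3 j3 H)))"]
   f(1)[of _ _ "plus_op (tp k2) (plus_op (tp k3) (dm i1 j1 (dm i2 j2 (dm i3 j3 H))))"] ..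
 also have "\<dots> = (%c. 0)"
 proof
  fix c
  have "plus_op (tp k1) (plus_op (tp k2) (plus_op (tp k3) (dm i1 j1 (dm i2 j2 (dm i3 j3 (%c. \<phi> (concat (map c W)))))))) (fill c) = 0"
  proof (rule mixed_wordsD[OF mixed W(1) _ _ _ fill_ne])
   show "n0 <= length W" using W(2) by simp
   show "{i1, j1, i2, j2, i3, j3, la k1, lb k1, la k2, lb k2, la k3, lb k3} \<subseteq> set W"
    using sp(1) lab_in assms by auto
   have "distinct [la k1, lb k1, la k2, lb k2, la k3, lb k3]"
    using lab_distinct[OF assms(1,2)] lab_distinct[OF assms(1,3)] lab_distinct[OF assms(2,3)]
     lab_distinct(1)[OF assms(1,1)] lab_distinct(1)[OF assms(2,2)] lab_distinct(1)[OF assms(3,3)]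
     lab_distinct(1)[OF assms(2,1)] lab_distinct(1)[OF assms(3,1)] lab_distinct(1)[OF assms(3,2)] assms
    by auto
   then show "distinct [i1, j1, i2, j2, i3, j3, la k1, lb k1, la k2, lb k2, la k3, lb k3]"
    using sp(2) lab_sp[OF assms(1)] lab_sp[OF assms(2)] lab_sp[OF assms(3)] by auto
  qed
  then show "plus_op (tp k1) (plus_op (tp k2) (plus_op (tp k3) (dm i1 j1 (dm i2 j2 (dm i3 j3 H))))) (fill c) = 0"
   unfolding H_def .
 qed
 finally show ?thesis .
qed

definition nx where "nx x = b (SOME r. r < length W div 2 & a r = x)"

lemma nx_a: "r < length W div 2 ==> nx (a r) = b r"
proof -
 assume r: "r < length W div 2"
 have "(SOME r'. r' < length W div 2 & a r' = a r) = r"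
  by (rule some_equality) (use r ab_eq in auto)
 then show ?thesis by (simp add: nx_def)
qed

lemma W_pairs: "\<exists>rest. W = concat (map (%r. [a r, b r]) [0..<length W div 2]) @ rest"
proof -
 have "concat (map (%r. [a r, b r]) [0..<m]) = take (2 * m) W" if "2 * m <= length W" for m
  using that
 proof (induction m)
  case (Suc m)
  have "take (2 * Suc m) W = take (2 * m) W @ [W ! (2 * m), W ! (2 * m + 1)]"
   using Suc.prems by (simp add: take_Suc_conv_app_nth)
  then show ?case using Suc by (simp add: a_def b_def)
 qed simp
 from this[of "length W div 2"] have "W = concat (map (%r. [a r, b r]) [0..<length W div 2]) @ drop (2 * (length W div 2)) W"
  by simp
 then show ?thesis by blast
qed

text \<open>Glue the six blocks concerned into single slots. The list of slots loses at most six
  entries, so it is still long enough for \<open>mixed_words\<close>, and each \<open>sg k\<close>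
  has become an ordinary exchange of two slots.\<close>

lemma D_block:
 assumes k: "k1 < 5" "k2 < 5" "k3 < 5" "k1 ~= k2" "k1 ~= k3" "k2 ~= k3"
 shows "plus_op (sg k1) (plus_op (sg k2) (plus_op (sg k3) D)) = (%c. 0)"
proof -
 define Fs where "Fs = {la k1, lb k1, la k2, lb k2, la k3, lb k3}"
 define m where "m = length W div 2"
 define Rs where "Rs = rr ` {2 * k1, 2 * k1 + 1, 2 * k2, 2 * k2 + 1, 2 * k3, 2 * k3 + 1}"
 have Rs: "Rs \<subseteq> {..<m}" unfolding Rs_def m_def using k by (auto intro!: rr(2))
 have Fs: "Fs = a ` Rs" unfolding Fs_def Rs_def la_def lb_def using k by auto
 have nxF: "nx ` Fs = b ` Rs" unfolding Fs image_image using Rs by (intro image_cong) (auto simp: nx_a m_def)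
 have inj: "inj_on nx Fs" unfolding Fs using Rs ab_eq(2)
  by (auto simp: inj_on_def nx_a m_def subset_eq)
 have dis: "nx ` Fs \<inter> Fs = {}" unfolding nxF unfolding Fs using Rs ab_eq(3) by (force simp: m_def subset_eq)
 have nxl: "nx (la k) = la (k + 5)" "nx (lb k) = lb (k + 5)" if "k < 5" for k
  using that nx_a[OF rr(2)] unfolding la_def lb_def by auto
 have kF: "la k \<in> Fs" "lb k \<in> Fs" if "k \<in> {k1, k2, k3}" for k using that by (auto simp: Fs_def)
 have RsE: "\<exists>k<10. r = rr k" if "r \<in> Rs" for r
 proof -
  have "{2 * k1, 2 * k1 + 1, 2 * k2, 2 * k2 + 1, 2 * k3, 2 * k3 + 1} \<subseteq> {..<10}" using k by auto
  then show ?thesis using that unfolding Rs_def by blast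
 qed
 have spF: "x ~: Fs" "x ~: nx ` Fs" if x: "x \<in> {i1, j1, i2, j2, i3, j3}" for x
 proof -
  show "x ~: Fs"
  proof
   assume "x \<in> Fs"
   then obtain k where "k < 10" "x = a (rr k)" using RsE unfolding Fs by blast
   then show False using ab_sp(1) x by blast
  qed
  show "x ~: nx ` Fs"
  proof
   assume "x \<in> nx ` Fs"
   then obtain k where "k < 10" "x = b (rr k)" using RsE unfolding nxF by blast
   then show False using ab_sp(2) x by blast
  qed
 qed
 obtain rest where rest: "W = concat (map (%r. [a r, b r]) [0..<m]) @ rest" using W_pairs m_def by blast
 define W' where "W' = filter (%x. x ~: nx ` Fs) W"
 define \<mu> where "\<mu> c = merge nx Fs (fill c)" for c
 have Rsm: "r' < length W div 2" if "r' \<in> Rs" for r' using that Rs unfolding m_def by auto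
 have aF: "a r \<in> Fs \<longleftrightarrow> r \<in> Rs" "b r \<in> nx ` Fs \<longleftrightarrow> r \<in> Rs" if "r < m" for r
  unfolding nxF unfolding Fs image_iff using ab_eq(1,2)[OF that[unfolded m_def] Rsm] by auto
 have ab: "a r ~: nx ` Fs" "b r ~: Fs" if "r < m" for r
  unfolding nxF unfolding Fs image_iff
  using ab_eq(3)[OF that[unfolded m_def] Rsm] ab_eq(3)[OF Rsm that[unfolded m_def]] by metis+
 have rW: "x ~: Fs" "x ~: nx ` Fs" if x: "x \<in> set rest" for x
 proof -
  have "distinct (concat (map (%r. [a r, b r]) [0..<m]) @ rest)" using W(1) rest by simp
  then have "x ~: set (concat (map (%r. [a r, b r]) [0..<m]))" using x by auto
  then have "\<forall>r<m. x ~= a r & x ~= b r" by auto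
  then have "x ~= a r" "x ~= b r" if "r \<in> Rs" for r using Rsm[OF that] unfolding m_def by auto
  then show "x ~: Fs" "x ~: nx ` Fs" unfolding nxF unfolding Fs image_iff by auto
 qed
 have sub: "concat (map (merge nx Fs c) W') = concat (map c W)" for c
 proof -
  have "concat (map (merge nx Fs c) (filter (%x. x ~: nx ` Fs) (concat (map (%r. [a r, b r]) xs))))
    = concat (map c (concat (map (%r. [a r, b r]) xs)))" if "set xs \<subseteq> {..<m}" for xs
   using that
  proof (induction xs)
   case (Cons r xs)
   then have r: "r < m" by simp
   then have "nx (a r) = b r" using nx_a m_def by simp
   then show ?case
    using Cons aF[OF r] ab[OF r] by (auto simp: merge_def)
  qed simp
  moreover have "set [0..<m] \<subseteq> {..<m}" by auto
  ultimately have 1: "concat (map (merge nx Fs c) (filter (%x. x ~: nx ` Fs) (concat (map (%r. [a r, b r]) [0..<m]))))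
    = concat (map c (concat (map (%r. [a r, b r]) [0..<m])))" by blast
  have "filter (%x. x ~: nx ` Fs) rest = rest" using rW(2) by (simp add: filter_id_conv)
  moreover have "concat (map (merge nx Fs c) rest) = concat (map c rest)"
   by (rule arg_cong[of _ _ concat], rule map_cong) (use rW in \<open>auto simp: merge_def\<close>)
  ultimately show ?thesis
   unfolding W'_def using 1 arg_cong[OF rest, of "%v. concat (map c v)"]
    arg_cong[OF rest, of "%v. concat (map (merge nx Fs c) (filter (%x. x ~: nx ` Fs) v))"] by simp
 qed
 have setW': "set W' = set W - b ` Rs" by (auto simp: W'_def nxF)
 have distW': "distinct W'" using W(1) by (simp add: W'_def)
 have lenW': "n0 <= length W'"
 proof -
  have "length W' = card (set W')" using distW' by (simp add: distinct_card)
  also have "\<dots> \<ge> card (set W) - card (b ` Rs)" unfolding setW' by (rule diff_card_le_card_Diff) (simp add: Rs_def)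
  finally have "length W - card (b ` Rs) <= length W'" using W(1) by (simp add: distinct_card)
  moreover have "card (b ` Rs) <= 6"
  proof -
   have "card (b ` Rs) <= card {2 * k1, 2 * k1 + 1, 2 * k2, 2 * k2 + 1, 2 * k3, 2 * k3 + 1}"
    unfolding Rs_def image_image by (rule card_image_le) simp
   also have "\<dots> <= 6" by (simp add: card_insert_if)
   finally show ?thesis .
  qed
  ultimately show ?thesis using W(2) by simp
 qed
 define H' where "H' c = \<phi> (concat (map c W'))" for c :: "nat => nat list"
 have HH: "(%c. H (fill c)) = (%c. H' (\<mu> c))" by (simp add: H_def H'_def \<mu>_def sub)
 have f: "plus_op (sg k) (%c. G (\<mu> c)) = (%c. plus_op (tp k) G (\<mu> c))" if "k \<in> {k1, k2, k3}"
  for G :: "(nat => nat list) => 'f" and k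
 proof (rule plus_op_pull)
  fix c
  have "k < 5" using that k by auto
  then show "\<mu> (c o sg k) = \<mu> c o tp k"
   unfolding \<mu>_def fill_comp using merge_comp_block[OF kF[OF that] inj dis, of "fill c"] nxl by simp
 qed
 have g: "dm p q (%c. G (\<mu> c)) = (%c. dm p q G (\<mu> c))" if "p \<in> {i1, j1, i2, j2, i3, j3}" "q \<in> {i1, j1, i2, j2, i3, j3}"
  for G :: "(nat => nat list) => 'f" and p q
 proof (rule dm_pull)
  show "\<mu> (c o transpose p q) = \<mu> c o transpose p q" for c
   unfolding \<mu>_def fill_comp
   by (rule merge_comp_outside[OF spF(1)[OF that(1)] spF(1)[OF that(2)] spF(2)[OF that(1)] spF(2)[OF that(2)]])
 qed
 have "plus_op (sg k1) (plus_op (sg k2) (plus_op (sg k3) D))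
   = (%c. plus_op (tp k1) (plus_op (tp k2) (plus_op (tp k3) (dm i1 j1 (dm i2 j2 (dm i3 j3 H'))))) (\<mu> c))"
 proof -
  let ?E = "dm i1 j1 (dm i2 j2 (dm i3 j3 H'))"
  have e1: "dm i3 j3 (%c. H' (\<mu> c)) = (%c. dm i3 j3 H' (\<mu> c))" by (rule g) auto
  have e2: "dm i2 j2 (%c. dm i3 j3 H' (\<mu> c)) = (%c. dm i2 j2 (dm i3 j3 H') (\<mu> c))" by (rule g) auto
  have e3: "dm i1 j1 (%c. dm i2 j2 (dm i3 j3 H') (\<mu> c)) = (%c. ?E (\<mu> c))" by (rule g) auto
  have e4: "plus_op (sg k3) (%c. ?E (\<mu> c)) = (%c. plus_op (tp k3) ?E (\<mu> c))" by (rule f) auto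
  have e5: "plus_op (sg k2) (%c. plus_op (tp k3) ?E (\<mu> c)) = (%c. plus_op (tp k2) (plus_op (tp k3) ?E) (\<mu> c))"
   by (rule f) auto
  have e6: "plus_op (sg k1) (%c. plus_op (tp k2) (plus_op (tp k3) ?E) (\<mu> c))
   = (%c. plus_op (tp k1) (plus_op (tp k2) (plus_op (tp k3) ?E)) (\<mu> c))"
   by (rule f) auto
  show ?thesis unfolding D_def HH e1 e2 e3 e4 e5 e6 ..
 qed
 also have "\<dots> = (%c. 0)"
 proof
  fix c
  have k10: "k1 < 10" "k2 < 10" "k3 < 10" using k by auto
  have "plus_op (tp k1) (plus_op (tp k2) (plus_op (tp k3) (dm i1 j1 (dm i2 j2 (dm i3 j3 (%c. \<phi> (concat (map c W')))))))) (\<mu> c) = 0"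
  proof (rule mixed_wordsD[OF mixed distW' lenW'])
   show "{i1, j1, i2, j2, i3, j3, la k1, lb k1, la k2, lb k2, la k3, lb k3} \<subseteq> set W'"
   proof
    fix x assume x: "x \<in> {i1, j1, i2, j2, i3, j3, la k1, lb k1, la k2, lb k2, la k3, lb k3}"
    then have "x \<in> set W" using sp(1) lab_in k10 by auto
    moreover have "x ~: nx ` Fs"
    proof (cases "x \<in> {i1, j1, i2, j2, i3, j3}")
     case False
     then have "x \<in> Fs" using x by (auto simp: Fs_def)
     then show ?thesis using dis by blast
    qed (rule spF)
    ultimately show "x \<in> set W'" unfolding setW' nxF by blast
   qed
   have "distinct [la k1, lb k1, la k2, lb k2, la k3, lb k3]"
    using lab_distinct[OF k10(1,2)] lab_distinct[OF k10(1,3)] lab_distinct[OF k10(2,3)]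
     lab_distinct(1)[OF k10(1,1)] lab_distinct(1)[OF k10(2,2)] lab_distinct(1)[OF k10(3,3)]
     lab_distinct(1)[OF k10(2,1)] lab_distinct(1)[OF k10(3,1)] lab_distinct(1)[OF k10(3,2)] k
    by auto
   then show "distinct [i1, j1, i2, j2, i3, j3, la k1, lb k1, la k2, lb k2, la k3, lb k3]"
    using sp(2) lab_sp[OF k10(1)] lab_sp[OF k10(2)] lab_sp[OF k10(3)] by auto
   show "\<mu> c x ~= []" for x by (simp add: \<mu>_def merge_def fill_ne)
  qed
  then show "plus_op (tp k1) (plus_op (tp k2) (plus_op (tp k3) (dm i1 j1 (dm i2 j2 (dm i3 j3 H'))))) (\<mu> c) = 0"
   unfolding H'_def .
 qed
 finally show ?thesis .
qed

text \<open>Take a joint eigenfunction of the ten exchanges \<open>tp k\<close>. With three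
  symmetric signs it contradicts \<open>D_plus\<close>. With at most two, at least three of the five
  pairs have both signs skew; there \<open>sg k\<close> acts trivially, which contradicts
  \<open>D_block\<close>. Ten exchanges are taken because \<open>5 - 2 = 3\<close>.\<close>

lemma D_zero: "D c = 0"
proof (rule ccontr)
 assume nz: "D c ~= 0"
 define P where "P Y \<longleftrightarrow>
  (\<forall>k1 k2 k3. k1 < 10 --> k2 < 10 --> k3 < 10 --> k1 ~= k2 --> k1 ~= k3 --> k2 ~= k3 -->
    plus_op (tp k1) (plus_op (tp k2) (plus_op (tp k3) Y)) = (%c. 0)) &
  (\<forall>k1 k2 k3. k1 < 5 --> k2 < 5 --> k3 < 5 --> k1 ~= k2 --> k1 ~= k3 --> k2 ~= k3 -->
    plus_op (sg k1) (plus_op (sg k2) (plus_op (sg k3) Y)) = (%c. 0))" for Y :: "(nat => nat list) => 'f"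
 define ts where "ts = map (%k. (la k, lb k)) [0..<10]"
 have PD: "P D" unfolding P_def using D_plus D_block by blast
 have closed: "P (dp (la k) (lb k) Y) & P (dm (la k) (lb k) Y)" if "k < 10" "P Y" for k Y
 proof -
  have c1: "plus_op (tp k') (dp (la k) (lb k) Z) = dp (la k) (lb k) (plus_op (tp k') Z)"
   "plus_op (tp k') (dm (la k) (lb k) Z) = dm (la k) (lb k) (plus_op (tp k') Z)" if "k' < 10"
   for k' and Z :: "(nat => nat list) => 'f"
   unfolding dp_plus_op using tp_commute[OF that \<open>k < 10\<close>] by (rule plus_op_commute plus_op_dm)+
  have c2: "plus_op (sg k') (dp (la k) (lb k) Z) = dp (la k) (lb k) (plus_op (sg k') Z)"
   "plus_op (sg k') (dm (la k) (lb k) Z) = dm (la k) (lb k) (plus_op (sg k') Z)" if "k' < 5"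
   for k' and Z :: "(nat => nat list) => 'f"
   unfolding dp_plus_op using sg_commute[OF that \<open>k < 10\<close>] by (rule plus_op_commute plus_op_dm)+
  have z: "dp p q (%c. 0) = (%c. 0 :: 'f)" for p q by (simp add: dp_plus_op)
  show ?thesis using that(2) unfolding P_def by (simp add: c1 c2 z)
 qed
 have "\<exists>Y c. P Y & Y c ~= 0 & (\<forall>t\<in>set ts. \<exists>s. sign_eigen t Y s)"
  by (rule eigenfunction_exists[where P = P, OF _ PD nz]) (use tp_commute closed in \<open>auto simp: ts_def\<close>)
 then obtain Y d where Y: "P Y" "Y d ~= 0" "\<And>t. t \<in> set ts ==> \<exists>s. sign_eigen t Y s" by blast
 have "\<forall>k. \<exists>s. k < 10 --> sign_eigen (la k, lb k) Y s" using Y(3) by (auto simp: ts_def)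
 then obtain sn where sn: "\<And>k. k < 10 ==> sign_eigen (la k, lb k) Y (sn k)" by metis
 define Pl where "Pl = {k. k < 10 & sn k}"
 show False
 proof (cases "card Pl \<ge> 3")
  case True
  then obtain k1 k2 k3 where k: "k1 \<in> Pl" "k2 \<in> Pl" "k3 \<in> Pl" "k1 ~= k2" "k1 ~= k3" "k2 ~= k3"
   using card_ge_3E by metis
  have "plus_op (tp k1) (plus_op (tp k2) (plus_op (tp k3) Y)) d = 0"
   using Y(1) k unfolding P_def Pl_def by simp
  moreover have "Y (c o tp k) = Y c" if "k \<in> Pl" for k c
   using sn[of k] that by (simp add: Pl_def sign_eigen_def)
  ultimately have "Y d = 0" using plus_op_invariant k by metis
  then show False using Y(2) by simp
 next
  case False
  \<comment> \<open>The pairs of blocks with a symmetric sign at the first or at the second slots;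
    reduction modulo 5 maps \<open>Pl\<close> onto them.\<close>
  define Bd where "Bd = {k. k < 5 & (sn k \<or> sn (k + 5))}"
  have "Bd \<subseteq> (%k. k mod 5) ` Pl"
  proof
   fix k assume "k \<in> Bd"
   then have "k < 5" "k \<in> Pl \<or> k + 5 \<in> Pl" by (auto simp: Bd_def Pl_def)
   then show "k \<in> (%k. k mod 5) ` Pl" by (metis (no_types, lifting) image_eqI mod_add_self2 mod_less)
  qed
  moreover have "finite Pl" by (simp add: Pl_def)
  ultimately have "card Bd <= card Pl" by (metis card_image_le card_mono finite_imageI le_trans)
  then have "card Bd <= 2" using False by simp
  moreover have "Bd \<subseteq> {..<5}" by (auto simp: Bd_def)
  ultimately have "card ({..<5} - Bd) \<ge> 3" by (simp add: card_Diff_subset finite_subset)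
  then obtain k1 k2 k3 where k: "k1 \<in> {..<5} - Bd" "k2 \<in> {..<5} - Bd" "k3 \<in> {..<5} - Bd" "k1 ~= k2" "k1 ~= k3" "k2 ~= k3"
   using card_ge_3E by metis
  have "plus_op (sg k1) (plus_op (sg k2) (plus_op (sg k3) Y)) d = 0"
   using Y(1) k unfolding P_def by simp
  moreover have "Y (c o sg k) = Y c" if "k \<in> {..<5} - Bd" for k c
   using sn[of k] sn[of "k + 5"] that by (simp add: Bd_def sign_eigen_def comp_assoc[symmetric])
  ultimately have "Y d = 0" using plus_op_invariant k by metis
  then show False using Y(2) by simp
 qed
qed

end

lemma skew3_of_mixed:
 fixes \<phi> :: "nat list => 'f::field_char_0"
 assumes "mixed_words n0 \<phi>"
 shows "skew3_words (2 * n0 + 40) \<phi>"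
 unfolding skew3_words_def
proof (intro allI impI)
 fix W :: "nat list" and c :: "nat => nat list" and i1 j1 i2 j2 i3 j3 :: nat
 assume W: "distinct W" "2 * n0 + 40 <= length W"
  and sp: "{i1, j1, i2, j2, i3, j3} \<subseteq> set W" "distinct [i1, j1, i2, j2, i3, j3]"
  and ne: "\<forall>x. c x ~= []"
 let ?S = "{i1, j1, i2, j2, i3, j3}"
 define B where "B = {r. r < length W div 2 & (W ! (2 * r) \<in> ?S \<or> W ! (2 * r + 1) \<in> ?S)}"
 define pos where "pos x = (SOME p. p < length W & W ! p = x)" for x
 have pos: "pos (W ! p) = p" if "p < length W" for p
  unfolding pos_def by (rule some_equality) (use that W(1) nth_eq_iff_index_eq in auto)
 have "B \<subseteq> (%x. pos x div 2) ` ?S"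
 proof
  fix r assume "r \<in> B"
  then have r: "2 * r < length W" "2 * r + 1 < length W" "W ! (2 * r) \<in> ?S \<or> W ! (2 * r + 1) \<in> ?S"
   by (auto simp: B_def)
  have "pos (W ! (2 * r)) div 2 = r" "pos (W ! (2 * r + 1)) div 2 = r"
   unfolding pos[OF r(1)] pos[OF r(2)] by auto
  then show "r \<in> (%x. pos x div 2) ` ?S" using r(3) by (metis (no_types, lifting) image_eqI)
 qed
 then have "card B <= card ((%x. pos x div 2) ` ?S)" by (rule card_mono[rotated]) simp
 also have "\<dots> <= card ?S" by (rule card_image_le) simp
 also have "\<dots> <= 6" by (simp add: card_insert_if)
 finally have "card B <= 6" .
 moreover have "B \<subseteq> {..<length W div 2}" by (auto simp: B_def)
 \<comment> \<open>At least 20 blocks are available, and the six skew letters spoil at most six of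
   them.\<close>
 ultimately have "10 <= card ({..<length W div 2} - B)"
  using W(2) by (simp add: card_Diff_subset finite_subset)
 then obtain rs where rs: "set rs \<subseteq> {..<length W div 2} - B" "distinct rs" "length rs = 10"
  by (rule obtain_distinct)
 have in_rs: "rs ! k \<in> {..<length W div 2} - B" if "k < 10" for k
  by (rule subsetD[OF rs(1) nth_mem]) (use rs(3) that in simp)
 interpret block_pairs \<phi> n0 W i1 j1 i2 j2 i3 j3 "%k. rs ! k"
 proof
  show "inj_on ((!) rs) {..<10}" using rs by (auto simp: inj_on_def nth_eq_iff_index_eq)
  show "W ! (2 * rs ! k) ~: ?S" "W ! (2 * rs ! k + 1) ~: ?S" "rs ! k < length W div 2" if "k < 10" for k
   using in_rs[OF that] unfolding B_def by blast+
 qed (fact assms W sp)+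
 have f: "dm p q (%c. G (fill c)) = (%c. dm p q G (fill c))" for G :: "(nat => nat list) => 'f" and p q
  by (rule dm_pull, rule fill_comp)
 have "D c = dm i1 j1 (dm i2 j2 (dm i3 j3 H)) (fill c)"
  unfolding D_def f[of i3 j3 H] f[of i2 j2 "dm i3 j3 H"] f[of i1 j1 "dm i2 j2 (dm i3 j3 H)"] ..
 then show "dm i1 j1 (dm i2 j2 (dm i3 j3 (%c. \<phi> (concat (map c W))))) c = 0"
  using D_zero[of c] fill_id[of c] ne by (simp add: H_def[abs_def])
qed

section \<open>The free algebra and T-ideals\<close>

text \<open>With concatenation written as addition, the convolution product of finitely supported
  functions on words is the product of the free algebra.\<close>

instantiation list :: (type) monoid_add
begin
definition zero_list :: "'a list" where "zero_list = []"
definition plus_list :: "'a list => 'a list => 'a list" where "plus_list = (@)"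
instance by standard (simp_all add: zero_list_def plus_list_def)
end

abbreviation coef :: "'f::field nc_poly => nat list => 'f" where "coef \<equiv> Poly_Mapping.lookup"

abbreviation supp :: "'f::field nc_poly => nat list set" where "supp \<equiv> Poly_Mapping.keys"

abbreviation term_poly :: "nat list => 'f => 'f::field nc_poly" where "term_poly \<equiv> Poly_Mapping.single"

abbreviation mono :: "nat list => 'f::field nc_poly" where "mono w \<equiv> Poly_Mapping.single w 1"

lemma lookup_scale_poly [simp]: "coef (scale_poly c f) w = c * coef f w"
 by (simp add: scale_poly_def map.rep_eq when_def)

lemma scale_poly_eq_mult: "scale_poly c f = term_poly [] c * f"
 unfolding scale_poly_def mult_map_scale_conv_mult zero_list_def ..

lemma term_poly_mult: "term_poly v c * term_poly w d = term_poly (v @ w) (c * d)"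
 by (simp add: mult_single plus_list_def)

lemma scale_term_poly [simp]: "scale_poly c (term_poly w d) = term_poly w (c * d)"
 by (simp add: scale_poly_def)

interpretation nc: vector_space "scale_poly :: 'f::field => _ => _"
 by standard (auto intro!: poly_mapping_eqI simp: lookup_add algebra_simps)

lemma free_algebra_closed:
 "0 \<in> free_algebra" "f \<in> free_algebra ==> g \<in> free_algebra ==> f + g \<in> free_algebra"
 "f \<in> free_algebra ==> g \<in> free_algebra ==> f - g \<in> free_algebra"
 "f \<in> free_algebra ==> - f \<in> free_algebra"
 "f \<in> free_algebra ==> scale_poly c f \<in> free_algebra"
 for f g :: "'f::field nc_poly"
 by (simp_all add: free_algebra_def lookup_add lookup_minus)

lemma term_poly_free [simp]: "w ~= [] ==> term_poly w c \<in> free_algebra"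
 by (simp add: free_algebra_def lookup_single)

lemma sum_free: "(\<And>x. x \<in> A ==> f x \<in> free_algebra) ==> sum f A \<in> (free_algebra :: 'f::field nc_poly set)"
 by (induction A rule: infinite_finite_induct) (auto intro: free_algebra_closed)

lemma poly_expand:
 assumes "finite K" "supp f \<subseteq> K"
 shows "f = (\<Sum>w\<in>K. term_poly w (coef f w))"
proof (rule poly_mapping_eqI)
 fix v
 have "(\<Sum>w\<in>K. coef (term_poly w (coef f w)) v) = (\<Sum>w\<in>K. if w = v then coef f w else 0)"
  by (rule sum.cong) (auto simp: lookup_single when_def)
 also have "\<dots> = coef f v" using assms by (auto simp: not_in_keys_iff_lookup_eq_zero)
 finally show "coef f v = coef (\<Sum>w\<in>K. term_poly w (coef f w)) v" by (simp add: lookup_sum)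
qed

lemma keys_free: "f \<in> free_algebra \<longleftrightarrow> [] ~: supp f"
 by (simp add: free_algebra_def in_keys_iff)

lemma poly_induct_on [consumes 1, case_names zero single add]:
 assumes "supp f \<subseteq> K" "P 0" "\<And>w c. w \<in> K ==> P (term_poly w c)"
  "\<And>f g. supp f \<subseteq> K ==> supp g \<subseteq> K ==> P f ==> P g ==> P (f + g)"
 shows "P (f :: 'f::field nc_poly)"
proof -
 have "P (\<Sum>w\<in>X. term_poly w (coef f w)) & supp (\<Sum>w\<in>X. term_poly w (coef f w)) \<subseteq> K"
  if "finite X" "X \<subseteq> K" for X
  using that
 proof (induction X)
  case empty
  then show ?case by (simp add: assms(2))
 next
  case (insert x X)
  then have "supp (term_poly x (coef f x)) \<subseteq> K" "P (term_poly x (coef f x))" by (auto intro: assms(3))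
  moreover have "supp (term_poly x (coef f x) + (\<Sum>w\<in>X. term_poly w (coef f w))) \<subseteq> K"
   using keys_add[of "term_poly x (coef f x)" "\<Sum>w\<in>X. term_poly w (coef f w)"] calculation(1) insert by blast
  moreover have "P (term_poly x (coef f x) + (\<Sum>w\<in>X. term_poly w (coef f w)))"
   by (rule assms(4)) (use calculation insert in auto)
  ultimately show ?case using insert by simp
 qed
 from this[OF finite_keys assms(1)] show ?thesis using poly_expand[OF finite_keys order_refl, of f] by simp
qed

lemma free_induct [consumes 1, case_names zero single add]:
 assumes "f \<in> free_algebra" "P 0" "\<And>w c. w ~= [] ==> P (term_poly w c)"
  "\<And>f g. f \<in> free_algebra ==> g \<in> free_algebra ==> P f ==> P g ==> P (f + g)"
 shows "P (f :: 'f::field nc_poly)"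
proof (rule poly_induct_on[of f "- {[]}"])
 show "supp f \<subseteq> - {[]}" using assms(1) by (auto simp: keys_free)
qed (use assms in \<open>auto simp: keys_free\<close>)

lemma free_mult: "f \<in> free_algebra ==> g \<in> free_algebra ==> f * g \<in> (free_algebra :: 'f::field nc_poly set)"
proof (induction f rule: free_induct)
 case (single v c)
 from single(2,1) show ?case
 proof (induction g rule: free_induct)
  case (add f g)
  then show ?case by (simp add: distrib_left free_algebra_closed)
 qed (simp_all add: free_algebra_closed term_poly_mult)
qed (simp_all add: free_algebra_closed distrib_right)

context assoc_algebra
begin

lemma scale_zero_left: "x \<in> carrier A ==> 0 \<odot>\<^bsub>A\<^esub> x = \<zero>"
 using scale_l_distr[of x 0 0] scale_closed[of x 0] by simp

lemma scale_zero_right: "c \<odot>\<^bsub>A\<^esub> \<zero> = \<zero>"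
 using scale_r_distr[of \<zero> \<zero> c] scale_closed[of \<zero> c] by simp

lemma mult_zero_left: "x \<in> carrier A ==> \<zero> \<otimes> x = \<zero>"
 using mult_l_distr[of \<zero> \<zero> x] mult_closed[of \<zero> x] by simp

lemma mult_zero_right: "x \<in> carrier A ==> x \<otimes> \<zero> = \<zero>"
 using mult_r_distr[of \<zero> \<zero> x] mult_closed[of x \<zero>] by simp

lemma list_mult_Cons: "xs ~= [] ==> list_mult A (x # xs) = x \<otimes> list_mult A xs"
 by (cases xs) auto

lemma list_mult_closed: "set xs \<subseteq> carrier A ==> list_mult A xs \<in> carrier A"
proof (induction xs)
 case (Cons x xs)
 then show ?case by (cases "xs = []") (auto simp: list_mult_Cons mult_closed)
qed simp

lemma list_mult_append:
 assumes "set xs \<subseteq> carrier A" "set ys \<subseteq> carrier A" "xs ~= []" "ys ~= []"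
 shows "list_mult A (xs @ ys) = list_mult A xs \<otimes> list_mult A ys"
 using assms
proof (induction xs)
 case (Cons x xs)
 then show ?case
  by (cases "xs = []") (auto simp: list_mult_Cons list_mult_closed mult_assoc)
qed simp

context
 fixes a :: "nat => _" assumes a: "range a \<subseteq> carrier A"
begin

lemma term_closed: "c \<odot>\<^bsub>A\<^esub> list_mult A (map a w) \<in> carrier A"
proof -
 have "set (map a w) \<subseteq> carrier A" using a by auto
 then show ?thesis using list_mult_closed scale_closed by blast
qed

lemma poly_eval_superset:
 assumes "finite K" "supp f \<subseteq> K"
 shows "poly_eval A a f = (\<Oplus>\<^bsub>A\<^esub>w\<in>K. coef f w \<odot>\<^bsub>A\<^esub> list_mult A (map a w))"
proof -
 have "(\<Oplus>\<^bsub>A\<^esub>w\<in>supp f \<union> (K - supp f). coef f w \<odot>\<^bsub>A\<^esub> list_mult A (map a w))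
   = poly_eval A a f \<oplus> (\<Oplus>\<^bsub>A\<^esub>w\<in>K - supp f. coef f w \<odot>\<^bsub>A\<^esub> list_mult A (map a w))"
  unfolding poly_eval_def using assms by (subst finsum_Un_disjoint) (auto intro!: term_closed)
 also have "(\<Oplus>\<^bsub>A\<^esub>w\<in>K - supp f. coef f w \<odot>\<^bsub>A\<^esub> list_mult A (map a w)) = \<zero>"
 proof -
  have "coef f w \<odot>\<^bsub>A\<^esub> list_mult A (map a w) = \<zero>" if "w \<in> K - supp f" for w
  proof -
   have "set (map a w) \<subseteq> carrier A" using a by auto
   then show ?thesis using that by (simp add: in_keys_iff scale_zero_left list_mult_closed)
  qed
  then have "(\<Oplus>\<^bsub>A\<^esub>w\<in>K - supp f. coef f w \<odot>\<^bsub>A\<^esub> list_mult A (map a w)) = (\<Oplus>\<^bsub>A\<^esub>w\<in>K - supp f. \<zero>)"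
   by (intro finsum_cong') auto
  then show ?thesis by simp
 qed
 also have "supp f \<union> (K - supp f) = K" using assms by auto
 finally show ?thesis unfolding poly_eval_def using term_closed by (simp add: finsum_closed)
qed

lemma poly_eval_closed: "poly_eval A a f \<in> carrier A"
 unfolding poly_eval_def using term_closed by (auto intro!: finsum_closed)

lemma poly_eval_zero: "poly_eval A a 0 = \<zero>"
 by (simp add: poly_eval_def)

lemma poly_eval_add: "poly_eval A a (f + g) = poly_eval A a f \<oplus> poly_eval A a g"
proof -
 let ?K = "supp f \<union> supp g"
 have "poly_eval A a (f + g) = (\<Oplus>\<^bsub>A\<^esub>w\<in>?K. coef f w \<odot>\<^bsub>A\<^esub> list_mult A (map a w) \<oplus> coef g w \<odot>\<^bsub>A\<^esub> list_mult A (map a w))"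
  unfolding poly_eval_superset[of ?K "f + g", OF _ keys_add, simplified]
 proof (rule finsum_cong')
  fix w
  have "set (map a w) \<subseteq> carrier A" using a by auto
  then show "coef (f + g) w \<odot>\<^bsub>A\<^esub> list_mult A (map a w)
    = coef f w \<odot>\<^bsub>A\<^esub> list_mult A (map a w) \<oplus> coef g w \<odot>\<^bsub>A\<^esub> list_mult A (map a w)"
   by (simp add: lookup_add scale_l_distr list_mult_closed)
 qed (auto intro!: term_closed a_closed)
 also have "\<dots> = (\<Oplus>\<^bsub>A\<^esub>w\<in>?K. coef f w \<odot>\<^bsub>A\<^esub> list_mult A (map a w)) \<oplus> (\<Oplus>\<^bsub>A\<^esub>w\<in>?K. coef g w \<odot>\<^bsub>A\<^esub> list_mult A (map a w))"
  by (rule finsum_addf) (auto intro!: term_closed)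
 also have "\<dots> = poly_eval A a f \<oplus> poly_eval A a g"
  by (simp add: poly_eval_superset[of ?K f] poly_eval_superset[of ?K g])
 finally show ?thesis .
qed

lemma poly_eval_single: "poly_eval A a (term_poly w c) = c \<odot>\<^bsub>A\<^esub> list_mult A (map a w)"
 using poly_eval_superset[of "{w}" "term_poly w c"] term_closed[of c w] by (simp add: finsum_singleton)

lemma poly_eval_scale: "poly_eval A a (scale_poly c f) = c \<odot>\<^bsub>A\<^esub> poly_eval A a f"
proof -
 have "supp f \<subseteq> UNIV" by simp
 then show ?thesis
 proof (induction f rule: poly_induct_on)
  case (single w d)
  have "set (map a w) \<subseteq> carrier A" using a by auto
  then show ?case by (simp add: poly_eval_single scale_scale list_mult_closed)
 next
  case (add f g)
  then show ?case by (simp add: nc.scale_right_distrib poly_eval_add scale_r_distr poly_eval_closed)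
 qed (simp add: poly_eval_zero scale_zero_right)
qed

lemma poly_eval_mult:
 assumes "f \<in> free_algebra" "g \<in> free_algebra"
 shows "poly_eval A a (f * g) = poly_eval A a f \<otimes> poly_eval A a g"
 using assms
proof (induction f rule: free_induct)
 case zero
 then show ?case by (simp add: poly_eval_zero poly_eval_closed mult_zero_left)
next
 case (single v c)
 have c: "set (map a w) \<subseteq> carrier A" for w using a by auto
 from single(2,1) show ?case
 proof (induction g rule: free_induct)
  case zero
  then show ?case by (simp add: poly_eval_zero poly_eval_closed mult_zero_right)
 next
  case (single w d)
  then have "poly_eval A a (term_poly v c * term_poly w d)
    = (c * d) \<odot>\<^bsub>A\<^esub> (list_mult A (map a v) \<otimes> list_mult A (map a w))"
   using c[of v] c[of w] by (simp add: term_poly_mult poly_eval_single list_mult_append)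
  then show ?case
   using list_mult_closed[OF c[of v]] list_mult_closed[OF c[of w]]
   by (simp add: poly_eval_single scale_mult_left scale_mult_right scale_scale[symmetric] mult.commute
     mult_closed scale_closed)
 next
  case (add f g)
  then show ?case by (simp add: distrib_left poly_eval_add mult_r_distr poly_eval_closed)
 qed
next
 case (add f g)
 then show ?case by (simp add: distrib_right poly_eval_add mult_l_distr poly_eval_closed)
qed

end

end

definition alg_hom :: "('f, 'a) module => ('f, 'b) module => ('a => 'b) => bool" where
 "alg_hom A B h \<longleftrightarrow> (\<forall>x\<in>carrier A. h x \<in> carrier B) &
   (\<forall>x\<in>carrier A. \<forall>y\<in>carrier A. h (x \<oplus>\<^bsub>A\<^esub> y) = h x \<oplus>\<^bsub>B\<^esub> h y & h (x \<otimes>\<^bsub>A\<^esub> y) = h x \<otimes>\<^bsub>B\<^esub> h y) &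
   (\<forall>x\<in>carrier A. \<forall>c. h (c \<odot>\<^bsub>A\<^esub> x) = c \<odot>\<^bsub>B\<^esub> h x)"

lemma hom_poly_eval:
 assumes "assoc_algebra A" "assoc_algebra B" and h: "alg_hom A B h" and a: "range a \<subseteq> carrier A"
 shows "h \<zero>\<^bsub>A\<^esub> = \<zero>\<^bsub>B\<^esub>" "h (poly_eval A a f) = poly_eval B (%x. h (a x)) f"
proof -
 interpret A: assoc_algebra A by fact
 interpret B: assoc_algebra B by fact
 have ha: "range (%x. h (a x)) \<subseteq> carrier B" using a h by (auto simp: alg_hom_def)
 have c: "set (map a w) \<subseteq> carrier A" "set (map (%x. h (a x)) w) \<subseteq> carrier B" for w using a ha by auto
 show 0: "h \<zero>\<^bsub>A\<^esub> = \<zero>\<^bsub>B\<^esub>"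
 proof -
  have "h (0 \<odot>\<^bsub>A\<^esub> \<zero>\<^bsub>A\<^esub>) = 0 \<odot>\<^bsub>B\<^esub> h \<zero>\<^bsub>A\<^esub>" "h \<zero>\<^bsub>A\<^esub> \<in> carrier B" using h by (auto simp: alg_hom_def)
  then show ?thesis by (simp add: A.scale_zero_right B.scale_zero_left)
 qed
 have l: "h (list_mult A xs) = list_mult B (map h xs)" if "set xs \<subseteq> carrier A" for xs
  using that
 proof (induction xs)
  case (Cons x xs)
  then show ?case using h A.list_mult_closed[of xs]
   by (cases "xs = []") (auto simp: A.list_mult_Cons B.list_mult_Cons alg_hom_def)
 qed (simp add: 0)
 have "supp f \<subseteq> UNIV" by simp
 then show "h (poly_eval A a f) = poly_eval B (%x. h (a x)) f"
 proof (induction f rule: poly_induct_on)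
  case (single w d)
  then show ?case using l[OF c(1)[of w]] h A.list_mult_closed[OF c(1)[of w]]
   by (simp add: A.poly_eval_single[OF a] B.poly_eval_single[OF ha] alg_hom_def comp_def)
 next
  case (add f g)
  then show ?case using h
   by (simp add: A.poly_eval_add[OF a] B.poly_eval_add[OF ha] A.poly_eval_closed[OF a] alg_hom_def)
 qed (simp add: 0 A.poly_eval_zero[OF a] B.poly_eval_zero[OF ha])
qed

lemma scale_mult_polys:
 "scale_poly c f * g = scale_poly c (f * g)" "f * scale_poly c g = scale_poly c (f * g)"
proof -
 have "supp f \<subseteq> UNIV" by simp
 then have "term_poly [] c * f = f * term_poly [] c"
  by (induction f rule: poly_induct_on) (simp_all add: term_poly_mult mult.commute algebra_simps)
 then show "f * scale_poly c g = scale_poly c (f * g)" by (metis mult.assoc scale_poly_eq_mult)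
qed (simp add: scale_poly_eq_mult mult.assoc)

definition free_alg :: "('f::field, 'f nc_poly) module" where
 "free_alg = \<lparr>carrier = free_algebra, mult = (*), one = 0, zero = 0, add = (+), smult = scale_poly\<rparr>"

lemma free_alg_simps [simp]:
 "carrier free_alg = free_algebra" "mult free_alg = (*)" "zero free_alg = 0" "add free_alg = (+)"
 "smult free_alg = scale_poly"
 by (simp_all add: free_alg_def)

lemma assoc_algebra_free_alg: "assoc_algebra (free_alg :: ('f::field, 'f nc_poly) module)"
proof -
 interpret abelian_group "free_alg :: ('f::field, 'f nc_poly) module"
 proof (rule abelian_groupI)
  fix x :: "'f nc_poly" assume "x \<in> carrier free_alg"
  then show "\<exists>y\<in>carrier free_alg. y \<oplus>\<^bsub>free_alg\<^esub> x = \<zero>\<^bsub>free_alg\<^esub>"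
   by (intro bexI[of _ "- x"]) (auto simp: free_algebra_closed)
 qed (auto simp: free_algebra_closed add.assoc add.commute)
 show ?thesis
  by standard (auto simp: free_algebra_closed free_mult algebra_simps nc.scale_left_distrib
    nc.scale_right_distrib scale_mult_polys)
qed

definition ev :: "(nat list => 'f::field) => 'f nc_poly => 'f" where
 "ev \<phi> f = (\<Sum>w\<in>supp f. coef f w * \<phi> w)"

lemma ev_superset: "finite K ==> supp f \<subseteq> K ==> ev \<phi> f = (\<Sum>w\<in>K. coef f w * \<phi> w)"
 unfolding ev_def by (rule sum.mono_neutral_left) (auto simp: in_keys_iff)

lemma ev_zero [simp]: "ev \<phi> 0 = 0" by (simp add: ev_def)

lemma ev_add: "ev \<phi> (f + g) = ev \<phi> f + ev \<phi> g"
proof -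
 let ?K = "supp f \<union> supp g"
 have "ev \<phi> (f + g) = (\<Sum>w\<in>?K. coef (f + g) w * \<phi> w)" by (rule ev_superset) (use keys_add[of f g] in auto)
 also have "\<dots> = (\<Sum>w\<in>?K. coef f w * \<phi> w) + (\<Sum>w\<in>?K. coef g w * \<phi> w)"
  by (simp add: lookup_add algebra_simps sum.distrib)
 finally show ?thesis by (simp add: ev_superset[of ?K f] ev_superset[of ?K g])
qed

lemma ev_scale: "ev \<phi> (scale_poly c f) = c * ev \<phi> f"
proof -
 have "supp (scale_poly c f) \<subseteq> supp f" by (auto simp: in_keys_iff)
 then have "ev \<phi> (scale_poly c f) = (\<Sum>w\<in>supp f. coef (scale_poly c f) w * \<phi> w)" by (intro ev_superset) auto
 then show ?thesis by (simp add: ev_def sum_distrib_left mult.assoc)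
qed

lemma ev_single [simp]: "ev \<phi> (term_poly w c) = c * \<phi> w"
 by (subst ev_superset[of "{w}"]) auto

lemma ev_sum: "ev \<phi> (sum f A) = (\<Sum>x\<in>A. ev \<phi> (f x))"
 by (induction A rule: infinite_finite_induct) (auto simp: ev_add)

lemma ev_cong: "(\<And>w. w \<in> supp f ==> \<phi> w = \<psi> w) ==> ev \<phi> f = ev \<psi> f"
 by (simp add: ev_def)

lemma ev_sum_functional: "ev (%w. \<Sum>x\<in>A. \<phi> x w) f = (\<Sum>x\<in>A. ev (\<phi> x) f)"
 unfolding ev_def sum_distrib_left by (rule sum.swap)

lemma ev_scale_functional: "ev (%w. c * \<phi> w) f = c * ev \<phi> f"
 unfolding ev_def sum_distrib_left by (simp add: mult.left_commute)

text \<open>A linear form on polynomials is determined by its values on monomials, so a form that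
  vanishes on \<open>T\<close> but not at \<open>f\<close>, obtained by extending from a basis, is
  the same thing as a function on words.\<close>

lemma separating_functional:
 assumes "nc.subspace T" "f ~: T"
 obtains \<phi> where "\<And>g. g \<in> T ==> ev \<phi> g = 0" "ev \<phi> f ~= 0"
proof -
 interpret vp: vector_space_pair "scale_poly :: 'a => _" "(*) :: 'a => 'a => 'a"
  by unfold_locales (auto simp: algebra_simps)
 obtain B where B: "B \<subseteq> T" "nc.independent B" "T \<subseteq> nc.span B" "card B = nc.dim T"
  by (rule nc.basis_exists)
 have sp: "nc.span B = T" by (rule subset_antisym[OF nc.span_minimal[OF B(1) assms(1)] B(3)])
 have ind: "nc.independent (insert f B)" by (rule nc.independent_insertI[OF _ B(2)]) (use assms(2) sp in simp)
 from vp.linear_independent_extend[OF ind, of "%x. if x = f then 1 else 0"]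
 obtain l where l: "Vector_Spaces.linear scale_poly (*) l" "\<forall>x\<in>insert f B. l x = (if x = f then 1 else 0)"
  by (elim exE conjE) (rule that)
 interpret l: Vector_Spaces.linear "scale_poly :: 'a => _ => _" "(*) :: 'a => 'a => 'a" l by (rule l(1))
 have fB: "f ~: B" using B(1) assms(2) by blast
 have lT: "l g = 0" if "g \<in> T" for g
  by (rule vp.linear_eq_0_on_span[OF l(1), of B]) (use that sp l(2) fB in auto)
 have e: "ev (%w. l (mono w)) g = l g" for g
 proof -
  have "supp g \<subseteq> UNIV" by simp
  then show ?thesis
  proof (induction g rule: poly_induct_on)
   case (single w c)
   have "l (scale_poly c (mono w)) = c * l (mono w)" by (rule l.scale)
   then show ?case by simp
  qed (auto simp: ev_add l.add l.zero)
 qed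
 show ?thesis by (rule that[of "%w. l (mono w)"]) (use lT l(2) in \<open>auto simp: e\<close>)
qed

abbreviation subst_poly :: "(nat => 'f nc_poly) => 'f::field nc_poly => 'f nc_poly" where
 "subst_poly \<equiv> poly_eval free_alg"

interpretation fa: assoc_algebra "free_alg :: ('f::field, 'f nc_poly) module"
 by (rule assoc_algebra_free_alg)

definition T_ideal :: "'f::field nc_poly set => bool" where
 "T_ideal T \<longleftrightarrow> T \<subseteq> free_algebra & nc.subspace T &
   (\<forall>f\<in>T. \<forall>g\<in>free_algebra. f * g \<in> T & g * f \<in> T) &
   (\<forall>f\<in>T. \<forall>\<sigma>. range \<sigma> \<subseteq> free_algebra --> subst_poly \<sigma> f \<in> T)"

lemma T_idealD:
 assumes "T_ideal T"
 shows "T \<subseteq> free_algebra" "nc.subspace T" "f \<in> T ==> g \<in> free_algebra ==> f * g \<in> T"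
  "f \<in> T ==> g \<in> free_algebra ==> g * f \<in> T"
  "f \<in> T ==> range \<sigma> \<subseteq> free_algebra ==> subst_poly \<sigma> f \<in> T"
 using assms unfolding T_ideal_def by blast+

lemma poly_eval_hom:
 assumes "assoc_algebra A" "range a \<subseteq> carrier A"
 shows "alg_hom free_alg A (poly_eval A a)"
proof -
 interpret assoc_algebra A by fact
 show ?thesis
  using assms(2) by (simp add: alg_hom_def poly_eval_add poly_eval_closed poly_eval_mult poly_eval_scale)
qed

lemma poly_eval_subst:
 assumes "assoc_algebra A" "range a \<subseteq> carrier A" "range \<sigma> \<subseteq> free_algebra"
 shows "poly_eval A a (subst_poly \<sigma> f) = poly_eval A (%x. poly_eval A a (\<sigma> x)) f"
 by (rule hom_poly_eval(2)[OF assoc_algebra_free_alg assms(1) poly_eval_hom[OF assms(1,2)]])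
  (use assms(3) in simp)

lemma T_ideal_identities:
 fixes A :: "('f::field, 'a) module"
 assumes "assoc_algebra A"
 shows "T_ideal (identities A)"
proof -
 interpret assoc_algebra A by fact
 show ?thesis
  unfolding T_ideal_def nc.subspace_def
 proof (intro conjI ballI allI impI)
  fix f :: "'f nc_poly" and \<sigma> :: "nat => 'f nc_poly"
  assume f: "f \<in> identities A" and s: "range \<sigma> \<subseteq> free_algebra"
  have "subst_poly \<sigma> f \<in> free_algebra" using fa.poly_eval_closed[of \<sigma> f] s by simp
  moreover have "poly_eval A a (subst_poly \<sigma> f) = \<zero>\<^bsub>A\<^esub>" if a: "range a \<subseteq> carrier A" for a
  proof -
   have "range (%x. poly_eval A a (\<sigma> x)) \<subseteq> carrier A" using poly_eval_closed[OF a] by auto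
   then show ?thesis using f unfolding poly_eval_subst[OF assms a s] by (simp add: identities_def)
  qed
  ultimately show "subst_poly \<sigma> f \<in> identities A" by (simp add: identities_def)
 qed (auto simp: identities_def free_algebra_closed free_mult poly_eval_zero poly_eval_add poly_eval_scale
   scale_zero_right poly_eval_mult poly_eval_closed mult_zero_left mult_zero_right)
qed

lemma list_mult_mono:
 "w ~= [] ==> list_mult free_alg (map (%x. mono (s x)) w) = mono (concat (map s w))"
proof (induction w)
 case (Cons x w)
 then show ?case by (cases "w = []") (auto simp: fa.list_mult_Cons term_poly_mult)
qed simp

lemma ev_word_subst:
 assumes "f \<in> free_algebra" "\<And>x. s x ~= []"
 shows "ev \<phi> (subst_poly (%x. mono (s x)) f) = ev (%w. \<phi> (concat (map s w))) f"
proof -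
 have s: "range (%x. mono (s x)) \<subseteq> carrier free_alg" using assms(2) by auto
 show ?thesis
  using assms(1)
 proof (induction f rule: free_induct)
  case (single w c)
  then show ?case by (simp add: fa.poly_eval_single[OF s] list_mult_mono)
 qed (simp_all add: fa.poly_eval_zero[OF s] fa.poly_eval_add[OF s] ev_add)
qed

lemma ev_context: "ev \<phi> (mono u * f * mono v) = ev (%w. \<phi> (u @ w @ v)) f"
proof -
 have "supp f \<subseteq> UNIV" by simp
 then show ?thesis
  by (induction f rule: poly_induct_on) (simp_all add: term_poly_mult algebra_simps ev_add)
qed

lemma T_ideal_context:
 assumes "T_ideal T" "f \<in> T"
 shows "mono u * f * mono v \<in> T"
proof -
 have e: "mono [] = (1 :: 'a nc_poly)" by (metis single_one zero_list_def)
 have "mono u * f \<in> T" using T_idealD(4)[OF assms, of "mono u"] assms(2) by (cases "u = []") (simp_all add: e)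
 then show ?thesis using T_idealD(3)[OF assms(1), of "mono u * f" "mono v"] by (cases "v = []") (simp_all add: e)
qed

lemma T_ideal_word_subst:
 assumes "T_ideal T" "f \<in> T" "\<And>x. s x ~= []"
 shows "subst_poly (%x. mono (s x)) f \<in> T"
 by (rule T_idealD(5)[OF assms(1,2)]) (use assms(3) in auto)

lemma ev_vanish:
 assumes T: "T_ideal T" "\<And>g. g \<in> T ==> ev \<phi> g = 0" "f \<in> T" "\<And>x. s x ~= []"
 shows "ev (%w. \<phi> (u @ concat (map s w) @ v)) f = 0"
proof -
 have "ev \<phi> (mono u * subst_poly (%x. mono (s x)) f * mono v) = 0"
  by (intro T(2) T_ideal_context T_ideal_word_subst assms)
 then show ?thesis
  using T_idealD(1)[OF T(1)] T(3) unfolding ev_context by (subst (asm) ev_word_subst) (use T(4) in auto)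
qed

section \<open>Polarization and the role of multilinear polynomials\<close>

lemma sum_inter_exclusion:
 assumes "finite Y" and sub: "B \<subseteq> Y"
 shows "(\<Sum>A\<in>Pow Y. (- 1) ^ card (Y - A) * of_bool (B \<subseteq> A)) = (of_bool (B = Y) :: 'f::field)"
proof -
 have "(\<Prod>y\<in>Y. 1 + (- of_bool (y ~: B))) = (\<Sum>A\<in>Pow Y. (\<Prod>y\<in>A. 1) * (\<Prod>y\<in>Y - A. - of_bool (y ~: B) :: 'f))"
  by (rule prod_add[OF assms(1)])
 also have "\<dots> = (\<Sum>A\<in>Pow Y. (- 1) ^ card (Y - A) * of_bool (B \<subseteq> A))"
 proof (rule sum.cong)
  fix A assume A: "A \<in> Pow Y"
  have fin: "finite (Y - A)" using assms by simp
  show "(\<Prod>y\<in>A. 1) * (\<Prod>y\<in>Y - A. - of_bool (y ~: B) :: 'f) = (- 1) ^ card (Y - A) * of_bool (B \<subseteq> A)"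
  proof (cases "B \<subseteq> A")
   case True
   then have "(\<Prod>y\<in>Y - A. - of_bool (y ~: B) :: 'f) = (\<Prod>y\<in>Y - A. - 1)" by (intro prod.cong) auto
   then show ?thesis using True by simp
  next
   case False
   then obtain y where "y \<in> B" "y \<in> Y - A" using sub by blast
   then have "(\<Prod>y\<in>Y - A. - of_bool (y ~: B) :: 'f) = 0" using fin by (auto simp: prod_zero_iff)
   then show ?thesis using False by simp
  qed
 qed simp
 also have "(\<Prod>y\<in>Y. 1 + (- of_bool (y ~: B))) = (of_bool (B = Y) :: 'f)"
 proof (cases "B = Y")
  case False
  then obtain y where "y \<in> Y" "y ~: B" using sub by blast
  then show ?thesis using False assms by (auto simp: prod_zero_iff)
 qed simp
 finally show ?thesis by simp
qed

definition color_subst :: "nat set => (nat => nat) => nat => 'f::field nc_poly" where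
 "color_subst A cl x = (\<Sum>y | y \<in> A & cl y = x. mono [y])"

definition polarize :: "nat set => (nat => nat) => 'f::field nc_poly => 'f nc_poly" where
 "polarize Y cl f = (\<Sum>A\<in>Pow Y. scale_poly ((- 1) ^ card (Y - A)) (subst_poly (color_subst A cl) f))"

lemma color_subst_free: "range (color_subst A cl) \<subseteq> free_algebra"
 unfolding color_subst_def by (auto intro!: sum_free)

lemma color_subst_carrier: "range (color_subst A cl) \<subseteq> carrier free_alg"
 using color_subst_free by simp

lemma finite_lists_over: "finite A ==> finite {v. map cl v = w & set v \<subseteq> A}"
 by (rule finite_subset[OF _ finite_lists_length_eq[of A "length w"]]) auto

lemma list_mult_color_subst:
 assumes "finite A" "w ~= []"
 shows "list_mult free_alg (map (color_subst A cl) w) = (\<Sum>v | map cl v = w & set v \<subseteq> A. mono v)"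
 using assms(2)
proof (induction w)
 case (Cons x w)
 show ?case
 proof (cases "w = []")
  case True
  have "{v. map cl v = [x] & set v \<subseteq> A} = (%y. [y]) ` {y. y \<in> A & cl y = x}"
   by (auto simp: image_iff)
  then show ?thesis using True by (simp add: color_subst_def sum.reindex inj_on_def)
 next
  case False
  have "{v. map cl v = x # w & set v \<subseteq> A}
    = (%(y, v). y # v) ` ({y. y \<in> A & cl y = x} \<times> {v. map cl v = w & set v \<subseteq> A})" (is "_ = ?h ` (?Y \<times> ?V)")
   by (auto simp: image_iff)
  then have "(\<Sum>v | map cl v = x # w & set v \<subseteq> A. mono v) = (\<Sum>p\<in>?Y \<times> ?V. mono (?h p))"
   by (simp add: sum.reindex inj_on_def case_prod_unfold)
  also have "\<dots> = (\<Sum>y\<in>?Y. \<Sum>v\<in>?V. mono [y] * mono v)"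
   by (simp add: sum.cartesian_product term_poly_mult case_prod_unfold)
  also have "\<dots> = color_subst A cl x * (\<Sum>v\<in>?V. mono v)"
   by (simp add: color_subst_def sum_product)
  finally have e: "(\<Sum>v | map cl v = x # w & set v \<subseteq> A. mono v) = color_subst A cl x * (\<Sum>v\<in>?V. mono v)" .
  show ?thesis unfolding e using False Cons.IH[OF False] by (simp add: fa.list_mult_Cons)
 qed
qed simp

lemma polarize_zero: "polarize Y cl 0 = 0"
 by (simp add: polarize_def fa.poly_eval_zero[OF color_subst_carrier])

lemma polarize_add: "polarize Y cl (f + g) = polarize Y cl f + polarize Y cl g"
 by (simp add: polarize_def fa.poly_eval_add[OF color_subst_carrier] nc.scale_right_distrib sum.distrib)

text \<open>Substituting for each variable the sum of the letters of its colour spreads the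
  coefficient of a word over all its colourings by letters of \<open>A\<close>; the alternating sum
  over \<open>A\<close> keeps those that use every letter of \<open>Y\<close>.\<close>

lemma coef_polarize:
 assumes "finite Y" "f \<in> free_algebra"
 shows "coef (polarize Y cl f) v = (if set v = Y then coef f (map cl v) else 0)"
 using assms(2)
proof (induction f rule: free_induct)
 case (single w c)
 have fA: "finite A" if "A \<in> Pow Y" for A using that assms(1) finite_subset by auto
 have "coef (polarize Y cl (term_poly w c)) v
   = (\<Sum>A\<in>Pow Y. (- 1) ^ card (Y - A) * (c * (\<Sum>v' | map cl v' = w & set v' \<subseteq> A. coef (mono v') v)))"
  unfolding polarize_def lookup_sum
  using single fA
  by (intro sum.cong) (auto simp: fa.poly_eval_single[OF color_subst_carrier] list_mult_color_subst lookup_sum)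
 also have "\<dots> = (\<Sum>A\<in>Pow Y. (- 1) ^ card (Y - A) * (c * (of_bool (map cl v = w) * of_bool (set v \<subseteq> A))))"
 proof (rule sum.cong)
  fix A assume A: "A \<in> Pow Y"
  have "(\<Sum>v' | map cl v' = w & set v' \<subseteq> A. coef (mono v' :: 'a nc_poly) v)
    = (\<Sum>v' | map cl v' = w & set v' \<subseteq> A. if v' = v then 1 else 0)"
   by (rule sum.cong) (auto simp: lookup_single when_def)
  also have "\<dots> = of_bool (map cl v = w) * of_bool (set v \<subseteq> A)"
   using finite_lists_over[OF fA[OF A], of cl w] by (simp add: sum.delta)
  finally show "(- 1) ^ card (Y - A) * (c * (\<Sum>v' | map cl v' = w & set v' \<subseteq> A. coef (mono v') v))
    = (- 1) ^ card (Y - A) * (c * (of_bool (map cl v = w) * of_bool (set v \<subseteq> A)))" by simp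
 qed simp
 also have "\<dots> = c * of_bool (map cl v = w) * (\<Sum>A\<in>Pow Y. (- 1) ^ card (Y - A) * of_bool (set v \<subseteq> A))"
  by (simp add: sum_distrib_left mult_ac)
 also have "(\<Sum>A\<in>Pow Y. (- 1) ^ card (Y - A) * of_bool (set v \<subseteq> A)) = (of_bool (set v = Y) :: 'a)"
 proof (cases "set v \<subseteq> Y")
  case False
  then have "(\<Sum>A\<in>Pow Y. (- 1) ^ card (Y - A) * of_bool (set v \<subseteq> A)) = (\<Sum>A\<in>Pow Y. 0 :: 'a)"
   by (intro sum.cong) auto
  then show ?thesis using False by auto
 qed (rule sum_inter_exclusion[OF assms(1)])
 finally show ?case by (auto simp: lookup_single when_def)
next
 case (add f g)
 then show ?case by (simp add: polarize_add lookup_add)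
qed (simp add: polarize_zero)

lemma T_ideal_polarize:
 assumes "T_ideal T" "f \<in> T"
 shows "polarize Y cl f \<in> T"
 unfolding polarize_def
 by (intro nc.subspace_sum nc.subspace_scale T_idealD(2)[OF assms(1)] T_idealD(5)[OF assms] color_subst_free)

lemma coef_eq_ev: "coef g w = ev (%v. of_bool (v = w)) g"
proof -
 have "ev (%v. of_bool (v = w)) g = (\<Sum>v\<in>insert w (supp g). coef g v * of_bool (v = w))"
  by (rule ev_superset) auto
 also have "\<dots> = (\<Sum>v\<in>insert w (supp g). if v = w then coef g v else 0)"
  by (rule sum.cong) auto
 finally show ?thesis by (simp only: sum.delta finite_insert finite_keys) simp
qed

text \<open>Induction on the support: the multilinear part of \<open>f\<close> belonging to a longest word \<open>u\<close> is
 polarized, and the letters are then identified again.\<close>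

lemma multilinear_determines:
 fixes T1 T2 :: "'f::field_char_0 nc_poly set"
 assumes T1: "T_ideal T1" and T2: "nc.subspace T2"
  and letters: "\<And>c f. f \<in> T2 ==> subst_poly (%x. mono [c x]) f \<in> T2"
  and le: "\<And>n. T1 \<inter> multilinear_polys n \<subseteq> T2"
 shows "T1 \<subseteq> T2"
proof
 fix f assume "f \<in> T1"
 then show "f \<in> T2"
 proof (induction "card (supp f)" arbitrary: f rule: less_induct)
  case less
  show ?case
  proof (cases "f = 0")
   case True
   then show ?thesis using T2 nc.subspace_0 by blast
  next
   case False
   then have "length ` supp f ~= {}" by simp
   then have "Max (length ` supp f) \<in> length ` supp f" by (intro Max_in) auto
   then obtain u where u1: "u \<in> supp f" "length u = Max (length ` supp f)" by auto
   then have u: "u \<in> supp f" "\<And>w. w \<in> supp f ==> length w <= length u" by auto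
   define d where "d = length u"
   define cl where "cl y = (if y < d then u ! y else 0)" for y
   define p where "p = polarize {..<d} cl f"
   have f: "f \<in> free_algebra" using T_idealD(1)[OF T1] less.prems by blast
   have cp: "coef p v = (if set v = {..<d} then coef f (map cl v) else 0)" for v
    unfolding p_def by (rule coef_polarize) (use f in auto)
   \<comment> \<open>A word of \<open>p\<close> uses all \<open>d\<close> letters but cannot be
     longer than the longest word \<open>u\<close>, which has length \<open>d\<close>; so no letter
     is repeated.\<close>
   have dist: "distinct v & set v = {..<d}" if "v \<in> supp p" for v
   proof -
    have v: "set v = {..<d}" "map cl v \<in> supp f" using that by (auto simp: in_keys_iff cp split: if_splits)
    have "length v <= card (set v)" using u(2)[OF v(2)] v(1) by (simp add: d_def)
    then show ?thesis using v card_distinct[of v] card_length[of v] by auto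
   qed
   have pT: "p \<in> T1" unfolding p_def by (rule T_ideal_polarize[OF T1 less.prems])
   have "p \<in> multilinear_polys d"
    unfolding multilinear_polys_def using dist T_idealD(1)[OF T1] pT by auto
   then have pT2: "p \<in> T2" using le pT by blast
   define g where "g = subst_poly (%x. mono [cl x]) p"
   define Nw where "Nw w = card {v \<in> {v. set v = {..<d} & distinct v}. map cl v = w}" for w
   have fin: "finite {v. set v = {..<d} & distinct v}"
    by (rule finite_subset[OF _ finite_subset_distinct[of "{..<d}"]]) auto
   have gT: "g \<in> T1" "g \<in> T2" unfolding g_def using T_ideal_word_subst[OF T1 pT, of "%x. [cl x]"] letters[OF pT2] by auto
   have cg: "coef g w = of_nat (Nw w) * coef f w" for w
   proof -
    have "coef g w = ev (%v. of_bool (concat (map (%x. [cl x]) v) = w)) p"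
     unfolding g_def coef_eq_ev by (rule ev_word_subst) (use T_idealD(1)[OF T1] pT in auto)
    also have "\<dots> = ev (%v. of_bool (map cl v = w)) p" by simp
    also have "\<dots> = (\<Sum>v | set v = {..<d} & distinct v. coef p v * of_bool (map cl v = w))"
     by (rule ev_superset[OF fin]) (use dist in blast)
    also have "\<dots> = (\<Sum>v | set v = {..<d} & distinct v. coef f w * of_bool (map cl v = w))"
     by (rule sum.cong) (auto simp: cp of_bool_def)
    also have "\<dots> = of_nat (Nw w) * coef f w"
    proof -
     have "(\<Sum>v | set v = {..<d} & distinct v. of_bool (map cl v = w))
       = (of_nat (card ({v. set v = {..<d} & distinct v} \<inter> {v. map cl v = w})) :: 'f)"
      by (rule sum_of_bool_eq[OF fin fin])
     then show ?thesis by (simp add: Nw_def Int_def sum_distrib_left[symmetric])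
    qed
    finally show ?thesis .
   qed
   have um: "u = map cl [0..<d]" by (rule nth_equalityI) (simp_all add: d_def cl_def)
   have ne: "{v \<in> {v. set v = {..<d} & distinct v}. map cl v = u} ~= {}"
   proof -
    have "[0..<d] \<in> {v \<in> {v. set v = {..<d} & distinct v}. map cl v = u}"
     by (simp add: um[symmetric] lessThan_atLeast0)
    then show ?thesis by blast
   qed
   have "finite {v \<in> {v. set v = {..<d} & distinct v}. map cl v = u}"
    by (rule finite_subset[OF _ fin]) (rule Collect_restrict)
   then have "0 < Nw u" unfolding Nw_def using ne by (simp only: card_gt_0_iff simp_thms)
   then have Nu: "Nw u ~= 0" by simp
   \<comment> \<open>\<open>g\<close> multiplies the coefficient of \<open>w\<close> by the number
     \<open>Nw w\<close> of distinct words coloured as \<open>w\<close>. Subtracting with the factor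
     \<open>Nw u\<close> removes \<open>u\<close>; it can be divided out again because the
     characteristic is zero.\<close>
   define h where "h = scale_poly (of_nat (Nw u)) f - g"
   have ch: "coef h w = (of_nat (Nw u) - of_nat (Nw w)) * coef f w" for w
    by (simp add: h_def lookup_minus cg algebra_simps)
   have "supp h \<subseteq> supp f" by (auto simp: in_keys_iff ch)
   moreover have "u ~: supp h" by (simp add: in_keys_iff ch)
   ultimately have "supp h \<subset> supp f" using u(1) by blast
   then have "card (supp h) < card (supp f)" by (rule psubset_card_mono[OF finite_keys])
   moreover have "h \<in> T1" unfolding h_def
    by (intro nc.subspace_diff nc.subspace_scale T_idealD(2)[OF T1] gT less.prems)
   ultimately have "h \<in> T2" by (rule less.hyps)
   then have "h + g \<in> T2" by (intro nc.subspace_add T2 gT)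
   then have "scale_poly (1 / of_nat (Nw u)) (h + g) \<in> T2" by (intro nc.subspace_scale T2)
   then show ?thesis using Nu by (simp add: h_def)
  qed
 qed
qed

lemma T_ideal_eqI:
 fixes T1 T2 :: "'f::field_char_0 nc_poly set"
 assumes "T_ideal T1" "T_ideal T2" "\<And>n. T1 \<inter> multilinear_polys n \<subseteq> T2"
 shows "T1 \<subseteq> T2"
 by (rule multilinear_determines[OF assms(1) T_idealD(2)[OF assms(2)] _ assms(3)])
  (use T_ideal_word_subst[OF assms(2)] in auto)

definition truncate :: "nat => 'f::field nc_poly => 'f nc_poly" where
 "truncate k f = (\<Sum>w | w \<in> supp f & length w < k. term_poly w (coef f w))"

lemma coef_truncate: "coef (truncate k f) w = (if length w < k then coef f w else 0)"
proof -
 have "coef (truncate k f) w = (\<Sum>v | v \<in> supp f & length v < k. if v = w then coef f v else 0)"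
  unfolding truncate_def lookup_sum by (rule sum.cong) (auto simp: lookup_single when_def)
 then show ?thesis by (simp add: sum.delta in_keys_iff)
qed

text \<open>T-ideals are graded in characteristic zero. The set \<open>?T\<close> need not visibly
  be closed under all substitutions, since these mix degrees; but identifying letters preserves
  degrees, and this is all that \<open>multilinear_determines\<close> asks of the larger
  space.\<close>

lemma truncate_in_T_ideal:
 fixes T :: "'f::field_char_0 nc_poly set"
 assumes T: "T_ideal T" "f \<in> T"
 shows "truncate k f \<in> T"
proof -
 let ?T = "{f \<in> free_algebra. truncate k f \<in> T}"
 have add: "truncate k (f + g) = truncate k f + truncate k g" for f g :: "'f nc_poly"
  by (rule poly_mapping_eqI) (simp add: coef_truncate lookup_add)
 have z: "truncate k 0 = (0 :: 'f nc_poly)"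
  by (rule poly_mapping_eqI) (simp add: coef_truncate)
 have sc: "truncate k (scale_poly c f) = scale_poly c (truncate k f)" for c and f :: "'f nc_poly"
  by (rule poly_mapping_eqI) (simp add: coef_truncate)
 have tsingle: "truncate k (term_poly w c) = (if length w < k then term_poly w c else 0)" for w and c :: 'f
  by (rule poly_mapping_eqI) (auto simp: coef_truncate lookup_single when_def)
 have sub: "nc.subspace ?T"
  unfolding nc.subspace_def using T_idealD(2)[OF T(1)]
  by (auto simp: add z sc free_algebra_closed intro: nc.subspace_0 nc.subspace_add nc.subspace_scale)
 have "T \<subseteq> ?T"
 proof (rule multilinear_determines[OF T(1) sub])
  fix c :: "nat => nat" and f :: "'f nc_poly" assume f: "f \<in> ?T"
  have s: "range (%x. mono [c x]) \<subseteq> carrier (free_alg :: ('f, 'f nc_poly) module)" by auto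
  have "truncate k (subst_poly (%x. mono [c x]) g) = subst_poly (%x. mono [c x]) (truncate k g)"
   if "g \<in> free_algebra" for g :: "'f nc_poly"
   using that
  proof (induction g rule: free_induct)
   case (single w d)
   then have "list_mult free_alg (map (%x. mono [c x]) w) = (mono (map c w) :: 'f nc_poly)"
    using list_mult_mono[of w "%x. [c x]"] by simp
   then show ?case by (auto simp: fa.poly_eval_single[OF s] tsingle fa.poly_eval_zero[OF s])
  qed (simp_all add: z add fa.poly_eval_zero[OF s] fa.poly_eval_add[OF s])
  moreover have "subst_poly (%x. mono [c x]) (truncate k f) \<in> T" using T_ideal_word_subst[OF T(1), of _ "%x. [c x]"] f by simp
  ultimately show "subst_poly (%x. mono [c x]) f \<in> ?T" using f fa.poly_eval_closed[OF s, of f] by simp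
 next
  fix n
  show "T \<inter> multilinear_polys n \<subseteq> ?T"
  proof
   fix f assume f: "f \<in> T \<inter> multilinear_polys n"
   have l: "length w = n" if "w \<in> supp f" for w
    using that f distinct_card[of w] by (auto simp: multilinear_polys_def)
   have "truncate k f = (if n < k then f else 0)"
    by (rule poly_mapping_eqI) (use l in \<open>auto simp: coef_truncate in_keys_iff\<close>)
   then show "f \<in> ?T" using f T_idealD(1,2)[OF T(1)] nc.subspace_0 by auto
  qed
 qed
 then show ?thesis using T(2) by blast
qed

section \<open>Codimensions and commuting pair swaps\<close>

lemma underdetermined:
 fixes M :: "'i => 'j => 'f::field"
 assumes "finite I" "finite J" "card I < card J"
 shows "\<exists>c. (\<exists>j\<in>J. c j ~= 0) & (\<forall>i\<in>I. (\<Sum>j\<in>J. c j * M i j) = 0)"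
 using assms
proof (induction I arbitrary: J M rule: finite_induct)
 case empty
 then obtain j where "j \<in> J" by fastforce
 then show ?case by (intro exI[of _ "%_. 1"]) auto
next
 case (insert i I)
 show ?case
 proof (cases "\<forall>j\<in>J. M i j = 0")
  case True
  have "card I < card J" using insert by simp
  then obtain c where "\<exists>j\<in>J. c j ~= 0" "\<forall>i\<in>I. (\<Sum>j\<in>J. c j * M i j) = 0"
   using insert.IH[of J M] insert.prems by blast
  then show ?thesis using True by (intro exI[of _ c]) auto
 next
  case False
  then obtain j0 where j0: "j0 \<in> J" "M i j0 ~= 0" by blast
  define M' where "M' i' j = M i' j - M i' j0 * M i j / M i j0" for i' j
  have "card I < card (J - {j0})" using insert j0 by simp
  then obtain c where c: "\<exists>j\<in>J - {j0}. c j ~= 0" "\<forall>i\<in>I. (\<Sum>j\<in>J - {j0}. c j * M' i j) = 0"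
   using insert.IH[of "J - {j0}" M'] insert.prems by blast
  define s where "s = (\<Sum>j\<in>J - {j0}. c j * M i j)"
  define c' where "c' j = (if j = j0 then - s / M i j0 else c j)" for j
  have sum': "(\<Sum>j\<in>J. c' j * M i' j) = (\<Sum>j\<in>J - {j0}. c j * M i' j) - s / M i j0 * M i' j0" for i'
  proof -
   have "(\<Sum>j\<in>J. c' j * M i' j) = c' j0 * M i' j0 + (\<Sum>j\<in>J - {j0}. c' j * M i' j)"
    by (rule sum.remove[OF insert.prems(1) j0(1)])
   also have "(\<Sum>j\<in>J - {j0}. c' j * M i' j) = (\<Sum>j\<in>J - {j0}. c j * M i' j)"
    by (rule sum.cong) (auto simp: c'_def)
   finally show ?thesis by (simp add: c'_def)
  qed
  have "(\<Sum>j\<in>J. c' j * M i' j) = 0" if "i' \<in> insert i I" for i'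
  proof (cases "i' = i")
   case True
   then show ?thesis using j0 by (simp add: sum' s_def)
  next
   case False
   then have "(\<Sum>j\<in>J - {j0}. c j * M' i' j) = 0" using c(2) that by blast
   moreover have "(\<Sum>j\<in>J - {j0}. c j * M' i' j) = (\<Sum>j\<in>J - {j0}. c j * M i' j - M i' j0 / M i j0 * (c j * M i j))"
    by (rule sum.cong) (simp_all add: M'_def algebra_simps)
   ultimately have "(\<Sum>j\<in>J - {j0}. c j * M i' j) - M i' j0 / M i j0 * s = 0"
    by (simp only: sum_subtractf sum_distrib_left[symmetric] s_def)
   then show ?thesis by (simp add: sum')
  qed
  moreover have "\<exists>j\<in>J. c' j ~= 0" using c(1) by (auto simp: c'_def)
  ultimately show ?thesis by blast
 qed
qed

lemma mono_eq_iff [simp]: "mono v = (mono w :: 'f::field nc_poly) \<longleftrightarrow> v = w"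
 by (metis keys_single singleton_inject zero_neq_one)

definition indep_mod :: "'f::field nc_poly set => 'j set => ('j => 'f nc_poly) => bool" where
 "indep_mod W J e \<longleftrightarrow> (\<forall>c. (\<Sum>j\<in>J. scale_poly (c j) (e j)) \<in> W --> (\<forall>j\<in>J. c j = 0))"

text \<open>Modulo \<open>W\<close> the members of \<open>J\<close> are combinations of
  \<open>B\<close>; if there were more of them than elements of \<open>B\<close>, the homogeneous
  system for a relation would have a nontrivial solution.\<close>

lemma indep_mod_card_le:
 assumes W: "nc.subspace W" and B: "quotient_basis U W B"
  and J: "finite J" "e ` J \<subseteq> U" "indep_mod W J e"
 shows "card J <= card B"
proof (rule ccontr)
 assume "\<not> ?thesis"
 then have lt: "card B < card J" by simp
 have B': "finite B" "\<And>u. u \<in> U ==> \<exists>c. u - (\<Sum>b\<in>B. scale_poly (c b) b) \<in> W"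
  using B by (auto simp: quotient_basis_def)
 have "\<forall>j\<in>J. \<exists>c. e j - (\<Sum>b\<in>B. scale_poly (c b) b) \<in> W" using B'(2) J(2) by blast
 then have m: "e j - (\<Sum>b\<in>B. scale_poly ((SOME c. e j - (\<Sum>b\<in>B. scale_poly (c b) b) \<in> W) b) b) \<in> W" if "j \<in> J" for j
  using someI_ex[of "%c. e j - (\<Sum>b\<in>B. scale_poly (c b) b) \<in> W"] that by blast
 define m where "m j = (SOME c. e j - (\<Sum>b\<in>B. scale_poly (c b) b) \<in> W)" for j
 note m = m[folded m_def]
 from underdetermined[OF B'(1) J(1) lt, of "%b j. m j b"]
 obtain c where c: "\<exists>j\<in>J. c j ~= 0" "\<forall>b\<in>B. (\<Sum>j\<in>J. c j * m j b) = 0"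
  by (elim exE conjE) (rule that)
 have "(\<Sum>j\<in>J. scale_poly (c j) (e j - (\<Sum>b\<in>B. scale_poly (m j b) b))) \<in> W"
  by (intro nc.subspace_sum nc.subspace_scale W m)
 also have "(\<Sum>j\<in>J. scale_poly (c j) (e j - (\<Sum>b\<in>B. scale_poly (m j b) b)))
   = (\<Sum>j\<in>J. scale_poly (c j) (e j)) - (\<Sum>b\<in>B. \<Sum>j\<in>J. scale_poly (c j * m j b) b)"
  unfolding sum.swap[of _ J B] sum_subtractf[symmetric]
  by (rule sum.cong) (simp_all add: nc.scale_right_diff_distrib nc.scale_sum_right)
 also have "(\<Sum>b\<in>B. \<Sum>j\<in>J. scale_poly (c j * m j b) b) = (\<Sum>b\<in>B. scale_poly (\<Sum>j\<in>J. c j * m j b) b)"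
  by (simp add: nc.scale_sum_left)
 also have "\<dots> = 0" using c(2) by simp
 finally show False using J(3) c(1) by (simp add: indep_mod_def)
qed

lemma quotient_dim_eq:
 assumes W: "nc.subspace W" and B: "quotient_basis U W B"
 shows "quotient_dim U W = card B"
proof -
 have ind: "indep_mod W B' (%b. b)" "finite B'" "(%b. b) ` B' \<subseteq> U" if "quotient_basis U W B'" for B'
  using that by (auto simp: quotient_basis_def indep_mod_def)
 have "card B' = card B" if B': "quotient_basis U W B'" for B'
  using indep_mod_card_le[OF W B ind(2,3,1)[OF B']] indep_mod_card_le[OF W B' ind(2,3,1)[OF B]] by simp
 then show ?thesis unfolding quotient_dim_def
  by (intro the_equality exI[of _ B] conjI B refl) (elim exE conjE, simp)
qed

text \<open>A maximal set of monomials that is independent modulo \<open>W\<close> represents a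
  basis, because finitely many monomials span \<open>U\<close>.\<close>

lemma quotient_basis_exists:
 fixes W :: "'f::field nc_poly set"
 assumes W: "nc.subspace W" and K: "finite K" and U: "U = {f. supp f \<subseteq> K}"
 obtains B where "quotient_basis U W B"
proof -
 define ok where "ok X \<longleftrightarrow> X \<subseteq> K & indep_mod W X mono" for X
 have okf: "finite (Collect ok)" by (rule finite_subset[of _ "Pow K"]) (use K in \<open>auto simp: ok_def\<close>)
 have "ok {}" by (simp add: ok_def indep_mod_def)
 then have "card ` Collect ok ~= {}" by blast
 then have "Max (card ` Collect ok) \<in> card ` Collect ok" using okf by (intro Max_in) auto
 then obtain X where X1: "ok X" "card X = Max (card ` Collect ok)" by auto
 have Xmax: "card Y <= card X" if "ok Y" for Y using that okf X1(2) by auto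
 have X: "X \<subseteq> K" "indep_mod W X mono" "finite X" using X1(1) K finite_subset unfolding ok_def by auto
 define B where "B = (mono ` X :: 'f nc_poly set)"
 have inj: "inj_on (mono :: _ => 'f nc_poly) X" by (auto simp: inj_on_def)
 have re: "(\<Sum>b\<in>B. scale_poly (c b) b) = (\<Sum>x\<in>X. scale_poly (c (mono x)) (mono x))" for c
  unfolding B_def by (rule sum.reindex_cong[OF inj]) auto
 have sp: "\<exists>c. f - (\<Sum>b\<in>B. scale_poly (c b) b) \<in> W" if "supp f \<subseteq> K" for f
  using that
 proof (induction f rule: poly_induct_on)
  case zero
  show ?case by (rule exI[of _ "%_. 0"]) (use W nc.subspace_0 in auto)
 next
  case (single w d)
  show ?case
  proof (cases "w \<in> X")
   case True
   have "(\<Sum>x\<in>X. scale_poly (if mono x = (mono w :: 'f nc_poly) then d else 0) (mono x)) = (\<Sum>x\<in>X. if x = w then term_poly w d else 0)"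
    by (rule sum.cong) auto
   also have "\<dots> = term_poly w d" using True X(3) by (simp add: sum.delta)
   finally have e: "(\<Sum>x\<in>X. scale_poly (if mono x = (mono w :: 'f nc_poly) then d else 0) (mono x)) = term_poly w d" .
   show ?thesis
    by (rule exI[of _ "%b. if b = mono w then d else 0"], unfold re e) (use W nc.subspace_0 in auto)
  next
   case False
   have "\<not> ok (insert w X)" using Xmax[of "insert w X"] False X(3) by auto
   then obtain c where c: "(\<Sum>j\<in>insert w X. scale_poly (c j) (mono j)) \<in> W" "\<exists>j\<in>insert w X. c j ~= 0"
    using X(1) single unfolding ok_def indep_mod_def by blast
   have cs: "scale_poly (c w) (mono w) + (\<Sum>j\<in>X. scale_poly (c j) (mono j)) \<in> W"
    using c(1) False X(3) by simp
   have cw: "c w ~= 0"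
   proof
    assume z: "c w = 0"
    then have "(\<Sum>j\<in>X. scale_poly (c j) (mono j)) \<in> W" using cs by simp
    then have "\<forall>j\<in>X. c j = 0" using X(2) unfolding indep_mod_def by blast
    then show False using z c(2) by auto
   qed
   define c' where "c' b = - (d / c w) * c (the_inv_into X mono b)" for b :: "'f nc_poly"
   have c': "c' (mono x) = - (d / c w) * c x" if "x \<in> X" for x
    using the_inv_into_f_f[OF inj that] by (simp add: c'_def)
   have "scale_poly (d / c w) (scale_poly (c w) (mono w) + (\<Sum>j\<in>X. scale_poly (c j) (mono j))) \<in> W"
    by (rule nc.subspace_scale[OF W cs])
   also have "scale_poly (d / c w) (scale_poly (c w) (mono w) + (\<Sum>j\<in>X. scale_poly (c j) (mono j)))
     = term_poly w d + (\<Sum>j\<in>X. scale_poly (d / c w * c j) (mono j))"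
    using cw by (simp add: nc.scale_right_distrib nc.scale_sum_right)
   also have "(\<Sum>j\<in>X. scale_poly (d / c w * c j) (mono j)) = - (\<Sum>b\<in>B. scale_poly (c' b) b)"
    unfolding re sum_negf[symmetric] by (rule sum.cong) (auto simp: c' single_uminus[symmetric])
   finally show ?thesis by auto
  qed
 next
  case (add f g)
  then obtain c c' where "f - (\<Sum>b\<in>B. scale_poly (c b) b) \<in> W" "g - (\<Sum>b\<in>B. scale_poly (c' b) b) \<in> W" by blast
  from nc.subspace_add[OF W this]
  have "f + g - (\<Sum>b\<in>B. scale_poly (c b + c' b) b) \<in> W"
   by (simp add: nc.scale_left_distrib sum.distrib algebra_simps)
  then show ?case by (intro exI[of _ "%b. c b + c' b"])
 qed
 have "quotient_basis U W B"
  unfolding quotient_basis_def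
 proof (intro conjI)
  show "finite B" "B \<subseteq> U" using X by (auto simp: B_def U)
  show "\<forall>u\<in>U. \<exists>c. u - (\<Sum>b\<in>B. scale_poly (c b) b) \<in> W" using sp U by blast
  show "\<forall>c. (\<Sum>b\<in>B. scale_poly (c b) b) \<in> W --> (\<forall>b\<in>B. c b = 0)"
   unfolding re using X(2) by (auto simp: indep_mod_def B_def)
 qed
 then show ?thesis by (rule that)
qed

lemma multilinear_polys_alt:
 "multilinear_polys n = {f. supp f \<subseteq> {w. w ~= [] & distinct w & set w = {..<n}}}"
 by (auto simp: multilinear_polys_def keys_free)

lemma finite_multilinear_words: "finite {w. w ~= [] & distinct w & set w = {..<n::nat}}"
 by (rule finite_subset[OF _ finite_subset_distinct[of "{..<n}"]]) auto

lemma subspace_multilinear: "nc.subspace (multilinear_polys n :: 'f::field nc_poly set)"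
 unfolding multilinear_polys_def nc.subspace_def
proof (intro conjI ballI allI)
 fix f g :: "'f nc_poly" and c
 assume f: "f \<in> {f \<in> free_algebra. \<forall>w\<in>supp f. distinct w & set w = {..<n}}"
 then show "scale_poly c f \<in> {f \<in> free_algebra. \<forall>w\<in>supp f. distinct w & set w = {..<n}}"
  by (auto simp: free_algebra_closed in_keys_iff)
 assume "g \<in> {f \<in> free_algebra. \<forall>w\<in>supp f. distinct w & set w = {..<n}}"
 then show "f + g \<in> {f \<in> free_algebra. \<forall>w\<in>supp f. distinct w & set w = {..<n}}"
  using f keys_add[of f g] by (auto simp: free_algebra_closed)
qed (auto simp: free_algebra_closed)

definition codim_T :: "'f::field nc_poly set => nat => nat" where
 "codim_T T n = quotient_dim (multilinear_polys n) (multilinear_polys n \<inter> T)"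

lemma codim_T_basis:
 assumes "nc.subspace T"
 obtains B where "quotient_basis (multilinear_polys n) (multilinear_polys n \<inter> T) B" "codim_T T n = card B"
proof -
 have s: "nc.subspace (multilinear_polys n \<inter> T)" by (rule nc.subspace_inter[OF subspace_multilinear assms])
 obtain B where B: "quotient_basis (multilinear_polys n) (multilinear_polys n \<inter> T) B"
  by (rule quotient_basis_exists[OF s finite_multilinear_words multilinear_polys_alt])
 show ?thesis by (rule that[OF B]) (simp add: codim_T_def quotient_dim_eq[OF s B])
qed

lemma codim_T_lower:
 assumes T: "nc.subspace T" and J: "finite J" "e ` J \<subseteq> multilinear_polys n" "indep_mod T J e"
 shows "card J <= codim_T T n"
proof -
 obtain B where B: "quotient_basis (multilinear_polys n) (multilinear_polys n \<inter> T) B" "codim_T T n = card B"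
  by (rule codim_T_basis[OF T])
 show ?thesis unfolding B(2)
  by (rule indep_mod_card_le[OF nc.subspace_inter[OF subspace_multilinear T] B(1) J(1,2)])
   (use J(3) in \<open>auto simp: indep_mod_def\<close>)
qed

text \<open>If finitely many functionals jointly detect membership in \<open>T\<close>, more basis
  elements than functionals would admit a nontrivial combination killed by all of them.\<close>

lemma codim_T_upper:
 assumes T: "nc.subspace T" and I: "finite I"
  and sep: "\<And>f. f \<in> multilinear_polys n ==> (\<And>i. i \<in> I ==> ev (\<psi> i) f = 0) ==> f \<in> T"
 shows "codim_T T n <= card I"
proof -
 obtain B where B: "quotient_basis (multilinear_polys n) (multilinear_polys n \<inter> T) B" "codim_T T n = card B"
  by (rule codim_T_basis[OF T])
 have B': "finite B" "B \<subseteq> multilinear_polys n" using B(1) by (auto simp: quotient_basis_def)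
 show ?thesis
 proof (rule ccontr)
  assume "\<not> ?thesis"
  then have "card I < card B" using B(2) by simp
  then obtain c where c: "\<exists>b\<in>B. c b ~= 0" "\<forall>i\<in>I. (\<Sum>b\<in>B. c b * ev (\<psi> i) b) = 0"
   using underdetermined[OF I B'(1), of "%i b. ev (\<psi> i) b"] by blast
  have "(\<Sum>b\<in>B. scale_poly (c b) b) \<in> multilinear_polys n"
   by (intro nc.subspace_sum nc.subspace_scale subspace_multilinear) (use B'(2) in blast)
  moreover have "(\<Sum>b\<in>B. scale_poly (c b) b) \<in> T"
   by (rule sep[OF calculation]) (use c(2) in \<open>simp add: ev_sum ev_scale\<close>)
  ultimately show False using B(1) c(1) by (auto simp: quotient_basis_def)
 qed
qed

lemma codim_eq: "codim A n = codim_T (identities A) n"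
 by (simp add: codim_def codim_T_def)

section \<open>Swaps inside pairs of letters and their characters\<close>

definition pair_swap :: "nat => nat => nat" where
 "pair_swap j = transpose (2 * j) (2 * j + 1)"

definition pair_perm :: "nat => (nat => nat) => nat => nat" where
 "pair_perm m r x = (if x < 2 * m then 2 * r (x div 2) + x mod 2 else x)"

lemma pair_swap_commute: "pair_swap i o pair_swap j = pair_swap j o pair_swap i"
proof (cases "i = j")
 case False
 have "2 * i ~= 2 * j + 1" "2 * j ~= 2 * i + 1" by presburger+
 with False show ?thesis unfolding pair_swap_def by (intro transpose_comp_disjoint) auto
qed simp

lemma pair_swap_permutes: "2 * j + 1 < n ==> pair_swap j permutes {..<n}"
 unfolding pair_swap_def by (rule permutes_swap_id) auto

lemma pair_perm_comp:
 assumes "\<And>j. j < m ==> s j < m"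
 shows "pair_perm m r (pair_perm m s x) = pair_perm m (r o s) x"
proof (cases "x < 2 * m")
 case True
 then have "s (x div 2) < m" using assms[of "x div 2"] by simp
 then have "2 * s (x div 2) + x mod 2 < 2 * m" by presburger
 moreover have "(2 * s (x div 2) + x mod 2) div 2 = s (x div 2)" "(2 * s (x div 2) + x mod 2) mod 2 = x mod 2"
  by presburger+
 ultimately show ?thesis using True by (simp add: pair_perm_def)
qed (simp add: pair_perm_def)

lemma pair_perm_id: "pair_perm m id x = x" "pair_perm m (%x. x) x = x"
 by (simp_all add: pair_perm_def)

lemma permutes_less: "r permutes {..<m} ==> j < m ==> r j < (m::nat)"
 using permutes_in_image[of r "{..<m}" j] by simp

lemma pair_perm_inverse:
 assumes "r permutes {..<m}"
 shows "pair_perm m (inv_into UNIV r) (pair_perm m r x) = x" "pair_perm m r (pair_perm m (inv_into UNIV r) x) = x"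
 using permutes_less[OF assms] permutes_less[OF permutes_inv[OF assms]] permutes_inv_o[OF assms]
 by (simp_all add: pair_perm_comp pair_perm_id)

lemma pair_perm_permutes:
 assumes r: "r permutes {..<m}" and "2 * m <= n"
 shows "pair_perm m r permutes {..<n}"
proof (rule bij_imp_permutes)
 have lt: "pair_perm m r x < n" if "x < n" "r permutes {..<m}" for x r
 proof (cases "x < 2 * m")
  case True
  then have "r (x div 2) < m" using permutes_less[OF that(2), of "x div 2"] by simp
  then have "2 * r (x div 2) + x mod 2 < 2 * m" by presburger
  then show ?thesis using True assms(2) by (simp add: pair_perm_def)
 qed (use that in \<open>simp add: pair_perm_def\<close>)
 show "bij_betw (pair_perm m r) {..<n} {..<n}"
  by (rule bij_betw_byWitness[of _ "pair_perm m (inv_into UNIV r)"])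
   (use lt r permutes_inv[OF r] in \<open>auto simp: pair_perm_inverse[OF r]\<close>)
 show "pair_perm m r x = x" if "x ~: {..<n}" for x
  using that assms(2) by (simp add: pair_perm_def)
qed

lemma pair_perm_swap:
 assumes r: "r permutes {..<m}" and j: "j < m"
 shows "pair_swap (r j) o pair_perm m r = pair_perm m r o pair_swap j"
proof
 fix x
 have inj: "pair_perm m r x = pair_perm m r y \<longleftrightarrow> x = y" for x y
  using pair_perm_inverse(1)[OF r] by metis
 have v: "pair_perm m r (2 * j) = 2 * r j" "pair_perm m r (2 * j + 1) = 2 * r j + 1"
  using j by (simp_all add: pair_perm_def)
 consider "x = 2 * j" | "x = 2 * j + 1" | "x ~= 2 * j" "x ~= 2 * j + 1" by blast
 then show "(pair_swap (r j) o pair_perm m r) x = (pair_perm m r o pair_swap j) x"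
 proof cases
  case 3
  then have "pair_perm m r x ~= 2 * r j" "pair_perm m r x ~= 2 * r j + 1"
   using inj[of x "2 * j"] inj[of x "2 * j + 1"] unfolding v by auto
  then show ?thesis using 3 unfolding pair_swap_def comp_apply by (simp only: transpose_apply_other not_False_eq_True)
 qed (simp_all only: comp_apply pair_swap_def transpose_apply_first transpose_apply_second v)
qed

lemma permutes_between_subsets:
 assumes "finite A" "K \<subseteq> A" "I \<subseteq> A" "card K = card I"
 obtains r where "r permutes A" "r ` K = I"
proof -
 have fin: "finite K" "finite I" using assms finite_subset by auto
 obtain f where f: "bij_betw f K I" using finite_same_card_bij[OF fin assms(4)] by blast
 have "card (A - K) = card (A - I)" using assms fin by (simp add: card_Diff_subset)
 then obtain g where g: "bij_betw g (A - K) (A - I)" using finite_same_card_bij assms(1) by blast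
 define r where "r x = (if x \<in> A then if x \<in> K then f x else g x else x)" for x
 have rK: "bij_betw r K I" by (rule bij_betw_cong[THEN iffD1, OF _ f]) (use assms(2) in \<open>auto simp: r_def\<close>)
 moreover have "bij_betw r (A - K) (A - I)"
  by (rule bij_betw_cong[THEN iffD1, OF _ g]) (auto simp: r_def)
 ultimately have "bij_betw r (K \<union> (A - K)) (I \<union> (A - I))" by (rule bij_betw_combine) auto
 moreover have "K \<union> (A - K) = A" "I \<union> (A - I) = A" using assms by auto
 ultimately have "r permutes A" by (intro bij_imp_permutes) (auto simp: r_def)
 then show ?thesis using that rK by (auto simp: bij_betw_def)
qed

text \<open>Applying one swap to a vanishing sum and adding or subtracting the result splits the sum
  into the parts with either sign. Induction over the swaps isolates a single character.\<close>

lemma eigen_independent: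
 fixes y :: "nat set => (nat => nat) => 'f::field_char_0"
 assumes "finite Fam"
  and "\<And>I j c. I \<in> Fam ==> j \<in> set js ==> y I (c o pair_swap j) = (if j \<in> I then - y I c else y I c)"
  and "\<And>I I'. I \<in> Fam ==> I' \<in> Fam ==> (\<And>j. j \<in> set js ==> j \<in> I \<longleftrightarrow> j \<in> I') ==> I = I'"
  and "\<And>c. (\<Sum>I\<in>Fam. y I c) = 0"
 shows "I \<in> Fam ==> y I c = 0"
 using assms
proof (induction js arbitrary: Fam I c)
 case Nil
 then have "Fam = {I}" by auto
 then show ?case using Nil.prems(5)[of c] by simp
next
 case (Cons j js)
 define P where "P = {I \<in> Fam. j \<in> I}"
 define M where "M = {I \<in> Fam. j ~: I}"
 have fin: "finite P" "finite M" using Cons.prems(2) by (auto simp: P_def M_def)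
 have split: "(\<Sum>I\<in>Fam. h I) = (\<Sum>I\<in>P. h I) + (\<Sum>I\<in>M. h I)" for h :: "nat set => 'f"
 proof -
  have "Fam = P \<union> M" "P \<inter> M = {}" by (auto simp: P_def M_def)
  then show ?thesis using sum.union_disjoint[OF fin, of h] by simp
 qed
 have z: "(\<Sum>I\<in>P. y I c) = 0 & (\<Sum>I\<in>M. y I c) = 0" for c
 proof -
  have 1: "(\<Sum>I\<in>P. y I c) + (\<Sum>I\<in>M. y I c) = 0" using Cons.prems(5)[of c] split by simp
  have "(\<Sum>I\<in>P. y I (c o pair_swap j)) = (\<Sum>I\<in>P. - y I c)"
  proof (rule sum.cong)
   fix I assume "I \<in> P"
   then have "I \<in> Fam" "j \<in> I" by (auto simp: P_def)
   then show "y I (c o pair_swap j) = - y I c"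
    unfolding Cons.prems(3)[OF \<open>I \<in> Fam\<close> list.set_intros(1)] by simp
  qed simp
  moreover have "(\<Sum>I\<in>M. y I (c o pair_swap j)) = (\<Sum>I\<in>M. y I c)"
  proof (rule sum.cong)
   fix I assume "I \<in> M"
   then have "I \<in> Fam" "j ~: I" by (auto simp: M_def)
   then show "y I (c o pair_swap j) = y I c"
    unfolding Cons.prems(3)[OF \<open>I \<in> Fam\<close> list.set_intros(1)] by simp
  qed simp
  ultimately have 2: "- (\<Sum>I\<in>P. y I c) + (\<Sum>I\<in>M. y I c) = 0"
   using Cons.prems(5)[of "c o pair_swap j"] split[of "%I. y I (c o pair_swap j)"]
   by (simp only: sum_negf)
  have "2 * (\<Sum>I\<in>M. y I c)
    = ((\<Sum>I\<in>P. y I c) + (\<Sum>I\<in>M. y I c)) + (- (\<Sum>I\<in>P. y I c) + (\<Sum>I\<in>M. y I c))" by simp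
  then have "2 * (\<Sum>I\<in>M. y I c) = 0" unfolding 1 2 by simp
  then show ?thesis using 1 by simp
 qed
 have sub: "P \<subseteq> Fam" "M \<subseteq> Fam" by (auto simp: P_def M_def)
 have IH: "y I c = 0" if G: "I \<in> G" "finite G" "G \<subseteq> Fam" "\<And>I I'. I \<in> G ==> I' \<in> G ==> j \<in> I \<longleftrightarrow> j \<in> I'"
  "\<And>c. (\<Sum>I\<in>G. y I c) = 0" for G
 proof (rule Cons.IH[OF G(1,2)])
  fix I j' c assume "I \<in> G" "j' \<in> set js"
  then show "y I (c o pair_swap j') = (if j' \<in> I then - y I c else y I c)"
   by (intro Cons.prems(3) subsetD[OF G(3)]) simp_all
 next
  fix I I' assume I: "I \<in> G" "I' \<in> G" "\<And>j. j \<in> set js ==> j \<in> I \<longleftrightarrow> j \<in> I'"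
  show "I = I'" by (rule Cons.prems(4)) (use I G(3) G(4)[OF I(1,2)] in auto)
 qed (rule G(5))
 show ?case
 proof (cases "j \<in> I")
  case True
  show ?thesis by (rule IH[of P]) (use True Cons.prems(1) fin sub z in \<open>auto simp: P_def\<close>)
 next
  case False
  show ?thesis by (rule IH[of M]) (use False Cons.prems(1) fin sub z in \<open>auto simp: M_def\<close>)
 qed
qed

definition sign_under :: "(nat => nat) => bool => ((nat => 'x) => 'v::ab_group_add) => bool" where
 "sign_under q s X \<longleftrightarrow> (\<forall>c. X (c o q) = (if s then X c else - X c))"

lemma sign_under_dm_self: "sign_under (transpose i j) False (dm i j F)"
 unfolding sign_under_def dm_def comp_assoc transpose_comp_involutory by simp

lemma sign_under_plus_self: "sign_under (transpose i j) True (plus_op (transpose i j) F)"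
 unfolding sign_under_def plus_op_def comp_assoc transpose_comp_involutory by simp

lemma sign_under_plus:
 assumes "sign_under q s X" "q o p = p o q"
 shows "sign_under q s (plus_op p X)"
proof -
 have "c o q o p = c o p o q" for c :: "nat => 'a" by (simp only: comp_assoc assms(2))
 then show ?thesis using assms(1) unfolding sign_under_def plus_op_def by simp
qed

lemma sign_under_dm:
 assumes "sign_under q s X" "q o transpose i j = transpose i j o q"
 shows "sign_under q s (dm i j X)"
proof -
 have "c o q o transpose i j = c o transpose i j o q" for c :: "nat => 'a" by (simp only: comp_assoc assms(2))
 then show ?thesis using assms(1) unfolding sign_under_def dm_def by simp
qed

text \<open>The coefficients \<open>g\<close> are the point: they turn an eigenfunction into a
  multilinear polynomial on which the functional takes the values of the eigenfunction.\<close>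

definition perm_span :: "nat => ((nat => 'x) => 'f::field) => ((nat => 'x) => 'f) => bool" where
 "perm_span n F Y \<longleftrightarrow> (\<exists>g. Y = (%c. \<Sum>p | p permutes {..<n}. g p * F (c o p)))"

lemma finite_perms: "finite {p. p permutes {..<n::nat}}" by (rule finite_permutations) simp

lemma perm_span_self: "perm_span n F F"
 unfolding perm_span_def
proof (intro exI ext)
 fix c
 have "(\<Sum>p | p permutes {..<n}. of_bool (p = id) * F (c o p)) = (\<Sum>p | p permutes {..<n}. if p = id then F c else 0)"
  by (rule sum.cong) auto
 then show "F c = (\<Sum>p | p permutes {..<n}. of_bool (p = id) * F (c o p))"
  using finite_perms permutes_id by (simp add: sum.delta)
qed

lemma perm_span_comp:
 assumes "perm_span n F Y" "t permutes {..<n}"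
 shows "perm_span n F (%c. Y (c o t))"
proof -
 obtain g where g: "Y = (%c. \<Sum>p | p permutes {..<n}. g p * F (c o p))" using assms(1) perm_span_def by blast
 have "(\<Sum>p | p permutes {..<n}. g p * F (c o t o p)) = (\<Sum>p | p permutes {..<n}. g (inv_into UNIV t o p) * F (c o p))" for c
 proof -
  have "(\<Sum>p | p permutes {..<n}. g (inv_into UNIV t o p) * F (c o p))
    = (\<Sum>p | p permutes {..<n}. g (inv_into UNIV t o (t o p)) * F (c o (t o p)))"
   by (rule setum_permutations_compose_left[OF assms(2)])
  also have "\<dots> = (\<Sum>p | p permutes {..<n}. g p * F (c o t o p))"
   by (simp add: comp_assoc[symmetric] permutes_inv_o[OF assms(2)])
  finally show ?thesis by simp
 qed
 then show ?thesis unfolding perm_span_def g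
  by (intro exI[of _ "%p. g (inv_into UNIV t o p)"]) (rule ext)
qed

lemma perm_span_add:
 assumes "perm_span n F Y" "perm_span n F Z"
 shows "perm_span n F (%c. Y c + Z c)"
proof -
 obtain g h where g: "Y = (%c. \<Sum>p | p permutes {..<n}. g p * F (c o p))"
  "Z = (%c. \<Sum>p | p permutes {..<n}. h p * F (c o p))" using assms perm_span_def by blast
 show ?thesis unfolding perm_span_def g
  by (rule exI[of _ "%p. g p + h p"]) (simp add: algebra_simps sum.distrib)
qed

lemma perm_span_uminus:
 assumes "perm_span n F Y"
 shows "perm_span n F (%c. - Y c)"
proof -
 obtain g where g: "Y = (%c. \<Sum>p | p permutes {..<n}. g p * F (c o p))" using assms perm_span_def by blast
 show ?thesis unfolding perm_span_def g by (rule exI[of _ "%p. - g p"]) (simp add: sum_negf)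
qed

lemma perm_span_plus: "perm_span n F Y ==> t permutes {..<n} ==> perm_span n F (plus_op t Y)"
 unfolding plus_op_def by (intro perm_span_add perm_span_comp)

lemma perm_span_dm: "perm_span n F Y ==> transpose i j permutes {..<n} ==> perm_span n F (dm i j Y)"
 using perm_span_add[OF _ perm_span_uminus[OF perm_span_comp]] unfolding dm_def diff_conv_add_uminus by blast

lemma choose_3_le:
 assumes "3 <= k" "k + 3 <= m"
 shows "m choose 3 <= m choose k"
proof (cases "2 * k <= m")
 case True
 then show ?thesis using assms by (intro binomial_mono) auto
next
 case False
 have "m choose 3 <= m choose (m - k)" using assms False by (intro binomial_mono) auto
 then show ?thesis using assms binomial_symmetric[of k m] by simp
qed

lemma pair_swap_dm: "dp (2 * j) (2 * j + 1) = plus_op (pair_swap j)"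
 by (simp add: dp_plus_op pair_swap_def)

text \<open>A joint eigenfunction of the pair swaps with at least three signs of each kind has, up to a
 permutation of the pairs, at least \<open>m choose 3\<close> different characters, and eigenfunctions with
 different characters are independent.\<close>

lemma mixed_eigen_vanish:
 fixes \<psi> :: "nat list => 'f::field_char_0"
 assumes T: "T_ideal T" and van: "\<And>f c. f \<in> T ==> ev (%w. \<psi> (map c w)) f = 0"
  and W: "distinct W" "set W = {..<n}"
  and n: "6 <= m" "2 * m <= n" and cd: "codim_T T n < m choose 3"
  and F: "F = (%c. \<psi> (map c W))"
  and Y: "perm_span n F Y" "\<And>j. j < m ==> \<exists>s. sign_under (pair_swap j) s Y"
  and sg: "\<And>j. j < 3 ==> sign_under (pair_swap j) False Y" "\<And>j. 3 <= j ==> j < 6 ==> sign_under (pair_swap j) True Y"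
 shows "Y c0 = 0"
proof (rule ccontr)
 assume nz: "Y c0 ~= 0"
 define K where "K = {j. j < m & sign_under (pair_swap j) False Y}"
 have Ksub: "K \<subseteq> {..<m}" by (auto simp: K_def)
 have finK: "finite K" using Ksub finite_subset by blast
 have Yneg: "Y (c o pair_swap j) = - Y c" if "j \<in> K" for j c
  using that by (simp add: K_def sign_under_def)
 have Ypos: "Y (c o pair_swap j) = Y c" if j: "j < m" "j ~: K" for j c
 proof -
  obtain s where s: "sign_under (pair_swap j) s Y" using Y(2)[OF j(1)] by blast
  then have s by (cases s) (use j in \<open>auto simp: K_def\<close>)
  then show ?thesis using s by (simp add: sign_under_def)
 qed
 have nK: "j ~: K" if "3 <= j" "j < 6" for j
 proof
  assume "j \<in> K"
  then have "Y (c0 o pair_swap j) = - Y c0" by (rule Yneg)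
  moreover have "Y (c0 o pair_swap j) = Y c0" using sg(2)[OF that] by (simp add: sign_under_def)
  ultimately show False using nz by simp
 qed
 have "{0, 1, 2} \<subseteq> K" using sg(1) n by (auto simp: K_def)
 then have k3: "3 <= card K" using card_mono[OF finK, of "{0, 1, 2}"] by simp
 have "K \<subseteq> {..<m} - {3, 4, 5}" using Ksub nK by auto
 then have "card K <= card ({..<m} - {3, 4, 5})" by (intro card_mono) auto
 also have "\<dots> = m - 3" using n by (subst card_Diff_subset) auto
 finally have k: "card K + 3 <= m" using n by simp
 \<comment> \<open>All ways of distributing the \<open>card K\<close> skew signs over the
   \<open>m\<close> pairs. Permuting the pairs carries \<open>Y\<close> to an eigenfunction with any
   prescribed such distribution.\<close>
 define Fam where "Fam = {I. I \<subseteq> {..<m} & card I = card K}"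
 have finFam: "finite Fam" unfolding Fam_def by (rule finite_subset[of _ "Pow {..<m}"]) auto
 have cardFam: "card Fam = m choose card K" unfolding Fam_def by (subst n_subsets) auto
 define r where "r I = (SOME r. r permutes {..<m} & r ` K = I)" for I
 have r: "r I permutes {..<m}" "r I ` K = I" if "I \<in> Fam" for I
 proof -
  have "I \<subseteq> {..<m}" "card K = card I" using that by (auto simp: Fam_def)
  then obtain r' where "r' permutes {..<m}" "r' ` K = I"
   by (rule permutes_between_subsets[OF finite_lessThan Ksub])
  then have "\<exists>r. r permutes {..<m} & r ` K = I" by (intro exI conjI)
  from someI_ex[OF this] show "r I permutes {..<m}" "r I ` K = I" by (simp_all add: r_def)
 qed
 define y where "y I c = Y (c o pair_perm m (r I))" for I c
 have ysign: "y I (c o pair_swap j) = (if j \<in> I then - y I c else y I c)" if I: "I \<in> Fam" and j: "j < m" for I j c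
 proof -
  define j' where "j' = inv_into UNIV (r I) j"
  have j': "r I j' = j" unfolding j'_def using permutes_inverses(1)[OF r(1)[OF I]] .
  have jm: "j' < m" using permutes_less[OF permutes_inv[OF r(1)[OF I]] j] by (simp add: j'_def)
  have "pair_swap j o pair_perm m (r I) = pair_perm m (r I) o pair_swap j'"
   using pair_perm_swap[OF r(1)[OF I] jm] unfolding j' .
  then have e: "y I (c o pair_swap j) = Y (c o pair_perm m (r I) o pair_swap j')"
   unfolding y_def by (simp only: comp_assoc)
  have "j \<in> I \<longleftrightarrow> j' \<in> K"
   using inj_image_mem_iff[OF permutes_inj[OF r(1)[OF I]], of j' K] unfolding r(2)[OF I] j' .
  then show ?thesis unfolding e using Yneg Ypos[OF jm] by (simp add: y_def)
 qed
 from Y(1)[unfolded perm_span_def]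
 obtain g where g: "Y = (%c. \<Sum>p | p permutes {..<n}. g p * F (c o p))" by (elim exE) (rule that)
 \<comment> \<open>The multilinear polynomial behind the eigenfunction \<open>y I\<close>: pairing
   it with the relabelled functionals gives the values of \<open>y I\<close>, as \<open>eY\<close>
   records. A relation modulo \<open>T\<close> between the \<open>e I\<close> is thus a relation
   between the \<open>y I\<close>.\<close>
 define e :: "nat set => 'f nc_poly" where
  "e I = (\<Sum>p | p permutes {..<n}. scale_poly (g p) (mono (map (pair_perm m (r I) o p) W)))" for I
 have eY: "ev (%w. \<psi> (map c w)) (e I) = y I c" for c I
  unfolding e_def y_def g F by (simp add: ev_sum comp_assoc)
 have "card Fam <= codim_T T n"
 proof (rule codim_T_lower[OF T_idealD(2)[OF T] finFam, of e])
  show "e ` Fam \<subseteq> multilinear_polys n"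
  proof
   fix x assume "x \<in> e ` Fam"
   then obtain I where I: "I \<in> Fam" "x = e I" by blast
   have mp: "mono (map (pair_perm m (r I) o p) W) \<in> (multilinear_polys n :: 'f nc_poly set)" if p: "p permutes {..<n}" for p
   proof -
    have pp: "pair_perm m (r I) o p permutes {..<n}"
     by (rule permutes_compose[OF p pair_perm_permutes[OF r(1)[OF I(1)] n(2)]])
    have "0 \<in> set W" unfolding W(2) using n by simp
    then have "W ~= []" by (cases W) simp_all
    moreover have "distinct (map (pair_perm m (r I) o p) W)"
     unfolding distinct_map using W(1) permutes_inj_on[OF pp, of "set W"] by (rule conjI)
    moreover have "set (map (pair_perm m (r I) o p) W) = {..<n}"
     using permutes_image[OF pp] W(2) by (simp only: set_map)
    ultimately show ?thesis unfolding multilinear_polys_alt by (simp del: map_map set_map distinct_map)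
   qed
   then show "x \<in> multilinear_polys n" unfolding I(2) e_def
    by (intro nc.subspace_sum nc.subspace_scale subspace_multilinear mp) (simp only: mem_Collect_eq)
  qed
  show "indep_mod T Fam e"
   unfolding indep_mod_def
  proof (intro allI impI ballI)
   fix h I assume z: "(\<Sum>I\<in>Fam. scale_poly (h I) (e I)) \<in> T" and I: "I \<in> Fam"
   have s0: "(\<Sum>I\<in>Fam. h I * y I c) = 0" for c
    using van[OF z, of c] by (simp add: ev_sum ev_scale eY)
   \<comment> \<open>The point at which \<open>y I\<close> takes the nonzero value
     \<open>Y c0\<close>.\<close>
   define c1 where "c1 = c0 o pair_perm m (inv_into UNIV (r I))"
   have "h I * y I c1 = 0"
   proof (rule eigen_independent[where js = "[0..<m]" and y = "%I c. h I * y I c", OF finFam _ _ _ I])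
    show "(\<Sum>I\<in>Fam. h I * y I c) = 0" for c by (rule s0)
   next
    fix I j c assume "I \<in> Fam" "j \<in> set [0..<m]"
    then show "h I * y I (c o pair_swap j) = (if j \<in> I then - (h I * y I c) else h I * y I c)"
     using ysign by simp
   next
    fix I I' assume "I \<in> Fam" "I' \<in> Fam" "\<And>j. j \<in> set [0..<m] ==> j \<in> I \<longleftrightarrow> j \<in> I'"
    then show "I = I'" unfolding Fam_def by auto
   qed
   moreover have "y I c1 = Y c0"
   proof -
    have "c1 o pair_perm m (r I) = c0"
     unfolding c1_def comp_assoc by (rule ext) (simp add: pair_perm_inverse(1)[OF r(1)[OF I]])
    then show ?thesis by (simp add: y_def)
   qed
   ultimately show "h I = 0" using nz by simp
  qed
 qed
 then show False using cd choose_3_le[OF k3 k] cardFam by simp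
qed

text \<open>The letters are numbered so that the six exchanges are the swaps of the pairs 0 to 5,
  skew for the first three and symmetric for the last three. As all pair swaps commute, a joint
  eigenfunction built from \<open>E\<close> keeps these six signs, as
  \<open>mixed_eigen_vanish\<close> requires.\<close>

lemma mixed_index_vanish:
 fixes \<psi> :: "nat list => 'f::field_char_0"
 assumes T: "T_ideal T" and van: "\<And>f c. f \<in> T ==> ev (%w. \<psi> (map c w)) f = 0"
  and W: "distinct W" "set W = {..<n}"
  and n: "6 <= m" "2 * m <= n" and cd: "codim_T T n < m choose 3"
  and E: "E = plus_op (pair_swap 3) (plus_op (pair_swap 4) (plus_op (pair_swap 5)
   (dm 0 1 (dm 2 3 (dm 4 5 (%c. \<psi> (map c W)))))))"
 shows "E c = 0"
proof (rule ccontr)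
 assume nz: "E c ~= 0"
 let ?F = "%c. \<psi> (map c W)"
 have tr: "transpose 0 1 = pair_swap 0" "transpose 2 3 = pair_swap 1" "transpose 4 5 = pair_swap 2"
  by (simp_all add: pair_swap_def)
 have ps: "pair_swap j permutes {..<n}" if "j < m" for j using that n by (intro pair_swap_permutes) auto
 have sp: "perm_span n ?F E"
 proof -
  have p: "pair_swap j permutes {..<n}" if "j < 6" for j using that n by (intro ps) simp
  have "transpose 0 1 permutes {..<n}" "transpose 2 3 permutes {..<n}" "transpose 4 5 permutes {..<n}"
   unfolding tr by (rule p, simp)+
  moreover have "pair_swap 3 permutes {..<n}" "pair_swap 4 permutes {..<n}" "pair_swap 5 permutes {..<n}"
   by (rule p, simp)+
  ultimately show ?thesis unfolding E by (intro perm_span_plus perm_span_dm perm_span_self)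
 qed
 have cm: "pair_swap j o transpose 0 1 = transpose 0 1 o pair_swap j"
  "pair_swap j o transpose 2 3 = transpose 2 3 o pair_swap j"
  "pair_swap j o transpose 4 5 = transpose 4 5 o pair_swap j" for j
  unfolding tr by (rule pair_swap_commute)+
 have s0: "sign_under (pair_swap 0) False E"
  unfolding E by (intro sign_under_plus pair_swap_commute) (simp only: tr[symmetric] sign_under_dm_self)
 have s1: "sign_under (pair_swap 1) False E"
  unfolding E by (intro sign_under_plus sign_under_dm[where i = 0 and j = 1] pair_swap_commute cm)
   (simp only: tr[symmetric] sign_under_dm_self)
 have s2: "sign_under (pair_swap 2) False E"
  unfolding E by (intro sign_under_plus sign_under_dm[where i = 0 and j = 1] sign_under_dm[where i = 2 and j = 3] pair_swap_commute cm)
   (simp only: tr[symmetric] sign_under_dm_self)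
 have self: "sign_under (pair_swap j) True (plus_op (pair_swap j) X)" for j and X :: "(nat => nat) => 'f"
  unfolding pair_swap_def by (rule sign_under_plus_self)
 have s3: "sign_under (pair_swap 3) True E" unfolding E by (rule self)
 have s4: "sign_under (pair_swap 4) True E" unfolding E by (rule sign_under_plus[OF self pair_swap_commute])
 have s5: "sign_under (pair_swap 5) True E"
  unfolding E by (rule sign_under_plus[OF sign_under_plus[OF self pair_swap_commute] pair_swap_commute])
 define S where "S Y \<longleftrightarrow> sign_under (pair_swap 0) False Y & sign_under (pair_swap 1) False Y & sign_under (pair_swap 2) False Y
  & sign_under (pair_swap 3) True Y & sign_under (pair_swap 4) True Y & sign_under (pair_swap 5) True Y"
  for Y :: "(nat => nat) => 'f"
 define P where "P Y \<longleftrightarrow> perm_span n ?F Y & S Y" for Y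
 define ts where "ts = map (%j. (2 * j, 2 * j + 1 :: nat)) [0..<m]"
 have closed: "P (plus_op (pair_swap j) Y) & P (dm (2 * j) (2 * j + 1) Y)" if "j < m" "P Y" for j Y
 proof
  have cm': "pair_swap i o transpose (2 * j) (2 * j + 1) = transpose (2 * j) (2 * j + 1) o pair_swap i" for i
   unfolding pair_swap_def[symmetric] by (rule pair_swap_commute)
  have ps': "transpose (2 * j) (2 * j + 1) permutes {..<n}"
   using ps[OF that(1)] unfolding pair_swap_def .
  show "P (plus_op (pair_swap j) Y)"
   using that(2)[unfolded P_def S_def] ps[OF that(1)] unfolding P_def S_def
   by - (elim conjE, intro conjI perm_span_plus sign_under_plus pair_swap_commute; assumption)
  show "P (dm (2 * j) (2 * j + 1) Y)"
   using that(2)[unfolded P_def S_def] ps' unfolding P_def S_def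
   by - (elim conjE, intro conjI perm_span_dm sign_under_dm cm'; assumption)
 qed
 have PE: "P E" unfolding P_def S_def using sp s0 s1 s2 s3 s4 s5 by blast
 have "\<exists>Y c. P Y & Y c ~= 0 & (\<forall>t\<in>set ts. \<exists>s. sign_eigen t Y s)"
 proof (rule eigenfunction_exists[where P = P, OF _ PE nz])
  fix t t' assume "t \<in> set ts" "t' \<in> set ts"
  then obtain j j' where "t = (2 * j, 2 * j + 1)" "t' = (2 * j', 2 * j' + 1)" by (auto simp: ts_def)
  then show "transpose (fst t) (snd t) o transpose (fst t') (snd t') = transpose (fst t') (snd t') o transpose (fst t) (snd t)"
   using pair_swap_commute[of j j'] by (simp only: pair_swap_def fst_conv snd_conv)
 next
  fix t Y assume t: "t \<in> set ts" "P Y"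
  then obtain j where "t = (2 * j, 2 * j + 1)" "j < m" by (auto simp: ts_def)
  then show "P (dp (fst t) (snd t) Y) & P (dm (fst t) (snd t) Y)"
   using closed[OF _ t(2)] by (simp only: fst_conv snd_conv pair_swap_dm simp_thms)
 qed
 then obtain Y d where Y: "P Y" "Y d ~= 0" "\<forall>t\<in>set ts. \<exists>s. sign_eigen t Y s" by (elim exE conjE) (rule that)
 have eig: "\<exists>s. sign_under (pair_swap j) s Y" if "j < m" for j
 proof -
  have "(2 * j, 2 * j + 1) \<in> set ts" using that by (auto simp: ts_def)
  then obtain s where "sign_eigen (2 * j, 2 * j + 1) Y s" using Y(3) by blast
  then show ?thesis by (auto simp: sign_eigen_def sign_under_def pair_swap_def)
 qed
 have "Y d = 0"
 proof (rule mixed_eigen_vanish[OF T van W n cd refl _ eig])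
  show "perm_span n ?F Y" using Y(1) by (simp add: P_def)
  have l3: "j = 0 \<or> j = 1 \<or> j = 2" if "j < 3" for j :: nat using that by presburger
  have l6: "j = 3 \<or> j = 4 \<or> j = 5" if "3 <= j" "j < 6" for j :: nat using that by presburger
  show "sign_under (pair_swap j) False Y" if "j < 3" for j
   using l3[OF that] Y(1) unfolding P_def S_def by (elim disjE) simp_all
  show "sign_under (pair_swap j) True Y" if "3 <= j" "j < 6" for j
   using l6[OF that] Y(1) unfolding P_def S_def by (elim disjE) simp_all
 qed
 then show False using Y(2) by simp
qed

text \<open>This is \<open>mixed_index_vanish\<close> after a renumbering: slot names become
  indices, and the words filled into the slots are absorbed into the functional
  \<open>\<psi>\<close>, which still vanishes on \<open>T\<close> after any relabelling.\<close>

lemma mixed_words_of_codim: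
 fixes \<phi> :: "nat list => 'f::field_char_0"
 assumes T: "T_ideal T" and van: "\<And>f. f \<in> T ==> ev \<phi> f = 0"
  and cd: "\<And>n. n1 <= n ==> codim_T T n < (n div 2) choose 3"
 shows "mixed_words n1 \<phi>"
 unfolding mixed_words_def
proof (intro allI impI)
 fix W and c :: "nat => nat list" and i1 j1 i2 j2 i3 j3 k1 l1 k2 l2 k3 l3 :: nat
 assume W: "distinct W" "n1 <= length W"
  and S: "{i1, j1, i2, j2, i3, j3, k1, l1, k2, l2, k3, l3} \<subseteq> set W"
  "distinct [i1, j1, i2, j2, i3, j3, k1, l1, k2, l2, k3, l3]"
  and ne: "\<forall>x. c x ~= []"
 define n where "n = length W"
 define sp where "sp = [i1, j1, i2, j2, i3, j3, k1, l1, k2, l2, k3, l3]"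
 \<comment> \<open>The twelve exchanged letters are listed first, so that they occupy the pairs 0 to
   5.\<close>
 define L where "L = sp @ filter (%x. x ~: set sp) W"
 have spW: "set sp \<subseteq> set W" "distinct sp" "length sp = 12" using S by (simp_all add: sp_def)
 have L: "distinct L" "set L = set W" using W(1) spW by (auto simp: L_def)
 then have lenL: "length L = n" using W(1) by (metis distinct_card n_def)
 have n12: "12 <= n" using lenL spW(3) by (simp add: L_def)
 have Lsp: "L ! i = sp ! i" if "i < 12" for i using that spW(3) by (simp add: L_def nth_append)
 have sp_nth: "L ! 0 = i1" "L ! 1 = j1" "L ! 2 = i2" "L ! 3 = j2" "L ! 4 = i3" "L ! 5 = j3"
  "L ! 6 = k1" "L ! 7 = l1" "L ! 8 = k2" "L ! 9 = l2" "L ! 10 = k3" "L ! 11 = l3"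
  by (simp_all add: Lsp) (simp_all add: sp_def)
 \<comment> \<open>Names outside \<open>W\<close> go to the spare index \<open>n\<close>, which no
   transposition of indices below \<open>n\<close> moves and which \<open>dL\<close> fills with
   \<open>[0]\<close>.\<close>
 define ix where "ix x = (if x \<in> set W then THE i. i < n & L ! i = x else n)" for x
 have ix: "ix (L ! i) = i" if "i < n" for i
 proof -
  have "(THE i'. i' < n & L ! i' = L ! i) = i"
   by (rule the_equality) (use that lenL L(1) nth_eq_iff_index_eq in auto)
  moreover have "L ! i \<in> set W" using that lenL L(2) nth_mem by blast
  ultimately show ?thesis by (simp add: ix_def)
 qed
 have Lix: "L ! ix x = x" "ix x < n" if x: "x \<in> set W" for x
 proof -
  obtain i where "i < n" "L ! i = x" using x lenL unfolding L(2)[symmetric] in_set_conv_nth by blast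
  then show "L ! ix x = x" "ix x < n" using ix by auto
 qed
 have ix_out: "ix x = n" if "x ~: set W" for x using that by (simp add: ix_def)
 have ix_transpose: "transpose p q (ix x) = ix (transpose (L ! p) (L ! q) x)" if "p < n" "q < n" for p q x
 proof -
  consider "x = L ! p" | "x = L ! q" | "x ~= L ! p" "x ~= L ! q" by blast
  then show ?thesis
  proof cases
   case 3
   have "ix x ~= p" "ix x ~= q" using 3 Lix ix_out that by (metis less_irrefl)+
   then show ?thesis using 3 by (simp add: transpose_apply_other)
  qed (use ix that in simp_all)
 qed
 define W' where "W' = map ix W"
 have W': "distinct W'" "set W' = {..<n}"
 proof -
  have "inj_on ix (set W)" by (rule inj_on_inverseI[of _ "%i. L ! i"]) (rule Lix)
  then show d: "distinct W'" using W(1) by (simp add: W'_def distinct_map)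
  have "set W' \<subseteq> {..<n}" using Lix(2) by (auto simp: W'_def)
  moreover have "card (set W') = card {..<n}" unfolding distinct_card[OF d] by (simp add: W'_def n_def)
  ultimately show "set W' = {..<n}" by (intro card_subset_eq) auto
 qed
 define dL where "dL i = (if i < n then c (L ! i) else [0])" for i
 define \<psi> where "\<psi> w = \<phi> (concat (map dL w))" for w
 have vps: "ev (%w. \<psi> (map e w)) f = 0" if "f \<in> T" for f e
 proof -
  have "ev (%w. \<phi> ([] @ concat (map (%x. dL (e x)) w) @ [])) f = 0"
   by (rule ev_vanish[OF T van that]) (use ne in \<open>auto simp: dL_def\<close>)
  then show ?thesis by (simp add: \<psi>_def comp_def)
 qed
 define H where "H c = \<phi> (concat (map c W))" for c :: "nat => nat list"
 define \<mu> where "\<mu> e = (%x. dL (e (ix x)))" for e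
 \<comment> \<open>Overwrites \<open>c\<close> outside \<open>W\<close> by the same default
   \<open>[0]\<close>, so that \<open>\<mu> id\<close> and \<open>\<rho> c\<close> agree everywhere
   and not just on \<open>W\<close>.\<close>
 define \<rho> where "\<rho> c = (%x. if x \<in> set W then c x else [0])" for c :: "nat => nat list"
 define op where "op F = plus_op (transpose k1 l1) (plus_op (transpose k2 l2) (plus_op (transpose k3 l3)
    (dm i1 j1 (dm i2 j2 (dm i3 j3 F)))))" for F :: "(nat => nat list) => 'f"
 have \<mu>_transpose: "\<mu> (e o transpose p q) = \<mu> e o transpose (L ! p) (L ! q)" if "p < n" "q < n" for e p q
  by (rule ext) (simp add: \<mu>_def ix_transpose[OF that])
 have \<rho>_transpose: "\<rho> (c o transpose x y) = \<rho> c o transpose x y" if "x \<in> set W" "y \<in> set W" for x y c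
  by (rule ext) (use that in \<open>auto simp: \<rho>_def transpose_def\<close>)
 have inW: "i1 \<in> set W" "j1 \<in> set W" "i2 \<in> set W" "j2 \<in> set W" "i3 \<in> set W" "j3 \<in> set W"
  "k1 \<in> set W" "l1 \<in> set W" "k2 \<in> set W" "l2 \<in> set W" "k3 \<in> set W" "l3 \<in> set W" using S(1) by simp_all
 have H\<rho>: "(%c. H (\<rho> c)) = H"
 proof
  fix c
  have "map (\<rho> c) W = map c W" by (simp add: \<rho>_def)
  then show "H (\<rho> c) = H c" by (simp only: H_def)
 qed
 have dm\<rho>: "dm x y (%c. G (\<rho> c)) = (%c. dm x y G (\<rho> c))"
  and plus\<rho>: "plus_op (transpose x y) (%c. G (\<rho> c)) = (%c. plus_op (transpose x y) G (\<rho> c))"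
  if "x \<in> set W" "y \<in> set W" for x y and G :: "(nat => nat list) => 'f"
  by (rule dm_pull plus_op_pull, rule \<rho>_transpose[OF that])+
 have "op (%c. H (\<rho> c)) = (%c. op H (\<rho> c))"
  unfolding op_def dm\<rho>[OF inW(5,6), of H] dm\<rho>[OF inW(3,4), of "dm i3 j3 H"]
   dm\<rho>[OF inW(1,2), of "dm i2 j2 (dm i3 j3 H)"]
   plus\<rho>[OF inW(11,12), of "dm i1 j1 (dm i2 j2 (dm i3 j3 H))"]
   plus\<rho>[OF inW(9,10), of "plus_op (transpose k3 l3) (dm i1 j1 (dm i2 j2 (dm i3 j3 H)))"]
   plus\<rho>[OF inW(7,8), of "plus_op (transpose k2 l2) (plus_op (transpose k3 l3) (dm i1 j1 (dm i2 j2 (dm i3 j3 H))))"] ..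
 then have op\<rho>: "op H c = op H (\<rho> c)" for c unfolding H\<rho> by (rule fun_cong)
 let ?E = "plus_op (pair_swap 3) (plus_op (pair_swap 4) (plus_op (pair_swap 5)
   (dm 0 1 (dm 2 3 (dm 4 5 (%e. \<psi> (map e W')))))))"
 have dm\<mu>: "dm p q (%e. G (\<mu> e)) = (%e. dm (L ! p) (L ! q) G (\<mu> e))"
  and plus\<mu>: "plus_op (transpose p q) (%e. G (\<mu> e)) = (%e. plus_op (transpose (L ! p) (L ! q)) G (\<mu> e))"
  if "p < 12" "q < 12" for p q and G :: "(nat => nat list) => 'f"
  using that n12 by (intro dm_pull plus_op_pull \<mu>_transpose; simp)+
 have base: "(%e. \<psi> (map e W')) = (%e. H (\<mu> e))"
  by (simp add: \<psi>_def H_def \<mu>_def W'_def comp_def)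
 have ps: "pair_swap 3 = transpose 6 7" "pair_swap 4 = transpose 8 9" "pair_swap 5 = transpose 10 11"
  by (simp_all add: pair_swap_def)
 have d: "dm 4 5 (%e. G (\<mu> e)) = (%e. dm i3 j3 G (\<mu> e))" "dm 2 3 (%e. G (\<mu> e)) = (%e. dm i2 j2 G (\<mu> e))"
  "dm 0 1 (%e. G (\<mu> e)) = (%e. dm i1 j1 G (\<mu> e))"
  "plus_op (transpose 6 7) (%e. G (\<mu> e)) = (%e. plus_op (transpose k1 l1) G (\<mu> e))"
  "plus_op (transpose 8 9) (%e. G (\<mu> e)) = (%e. plus_op (transpose k2 l2) G (\<mu> e))"
  "plus_op (transpose 10 11) (%e. G (\<mu> e)) = (%e. plus_op (transpose k3 l3) G (\<mu> e))"
  for G :: "(nat => nat list) => 'f"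
  unfolding sp_nth[symmetric] by (rule dm\<mu> plus\<mu>; simp)+
 have "?E = (%e. op H (\<mu> e))"
  unfolding ps base op_def d(1)[of H] d(2)[of "dm i3 j3 H"] d(3)[of "dm i2 j2 (dm i3 j3 H)"]
   d(6)[of "dm i1 j1 (dm i2 j2 (dm i3 j3 H))"]
   d(5)[of "plus_op (transpose k3 l3) (dm i1 j1 (dm i2 j2 (dm i3 j3 H)))"]
   d(4)[of "plus_op (transpose k2 l2) (plus_op (transpose k3 l3) (dm i1 j1 (dm i2 j2 (dm i3 j3 H))))"] ..
 moreover have "?E id = 0"
  by (rule mixed_index_vanish[OF T vps W' _ _ cd refl])
   (use n12 W(2) in \<open>auto simp: n_def\<close>)
 ultimately have "op H (\<mu> id) = 0" by simp
 moreover have "\<mu> id = \<rho> c"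
 proof
  fix x
  show "\<mu> id x = \<rho> c x"
   by (cases "x \<in> set W") (auto simp: \<mu>_def \<rho>_def dL_def Lix ix_out)
 qed
 ultimately have "op H c = 0" using op\<rho>[of c] by simp
 then show "plus_op (transpose k1 l1) (plus_op (transpose k2 l2) (plus_op (transpose k3 l3)
    (dm i1 j1 (dm i2 j2 (dm i3 j3 (%c. \<phi> (concat (map c W)))))))) c = 0"
  unfolding op_def H_def .
qed

section \<open>Multilinear elements of a T-ideal\<close>

definition word_count :: "'f::field_char_0 nc_poly => (nat list => bool) => 'f" where
 "word_count f S = ev (%w. of_bool (S w)) f"

lemma wcount_supp: "wcount (supp f) (coef f) S = word_count f S"
 by (simp add: wcount_def word_count_def ev_def)

text \<open>The lower bound 3 serves \<open>coefficients_killed\<close>. The upper bound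
  \<open>D\<close> makes the required number of zeros, \<open>2 * D + 20\<close>, the same for all
  relations.\<close>

definition has_relation :: "'f::field_char_0 nc_poly set => nat => (nat => nat => 'f nc_poly => bool) => bool" where
 "has_relation T D S \<longleftrightarrow> (\<exists>d g i j. 3 <= d & d <= D & g \<in> T & g \<in> multilinear_polys d & i < d & j < d & i ~= j & S i j g)"

lemma has_relation_mono: "has_relation T D S ==> D <= D' ==> has_relation T D' S"
 unfolding has_relation_def by (meson le_trans)

abbreviation "pairs_vanish n f S \<equiv> \<forall>i<n. \<forall>j<n. i ~= j --> word_count f (S i j) = 0"

definition "rel_first i j f \<longleftrightarrow> word_count f (%w. hd w = i) ~= 0"
definition "rel_last i j f \<longleftrightarrow> word_count f (%w. last w = i) ~= 0"
definition "rel_starts i j f \<longleftrightarrow> word_count f (startsw i j) ~= 0"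
definition "rel_ends i j f \<longleftrightarrow> word_count f (endsw i j) ~= 0"
definition "rel_outer i j f \<longleftrightarrow> word_count f (outerw i j) ~= 0"
definition "rel_adj i j f \<longleftrightarrow> word_count f (adjw i j) ~= 0"
text \<open>The first inequality kills the slopes, the second makes the system for \<open>c\<close>
  and \<open>c'\<close> in \<open>order_killed\<close> force \<open>c = c'\<close>.\<close>

definition "rel_bef i j f \<longleftrightarrow> word_count f (bef i j) ~= 0 & word_count f (bef i j) ~= word_count f (bef j i)"

lemma has_relationE:
 assumes "has_relation T D S"
 obtains d g i j where "3 <= d" "d <= D" "g \<in> T" "g \<in> multilinear_polys d" "i < d" "j < d" "i ~= j" "S i j g"
 using assms[unfolded has_relation_def] by (elim exE conjE) (rule that)

text \<open>For each statistic, either \<open>T\<close> contains an element that kills the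
  corresponding coefficients of every functional, or \<open>f\<close> is blind to it. Either way the
  product of coefficient and statistic vanishes.\<close>

definition governed :: "'f::field_char_0 nc_poly set => nat => nat => 'f nc_poly => bool" where
 "governed T D n f \<longleftrightarrow>
  (has_relation T D rel_first \<or> pairs_vanish n f (%i j w. hd w = i)) &
  (has_relation T D rel_last \<or> pairs_vanish n f (%i j w. last w = i)) &
  (has_relation T D rel_starts \<or> pairs_vanish n f startsw) &
  (has_relation T D rel_ends \<or> pairs_vanish n f endsw) &
  (has_relation T D rel_outer \<or> pairs_vanish n f outerw) &
  (has_relation T D rel_adj \<or> pairs_vanish n f adjw) &
  (has_relation T D rel_bef \<or> pairs_vanish n f bef)"

locale vanishing_form =
 fixes T :: "'f::field_char_0 nc_poly set" and \<phi> :: "nat list => 'f" and N :: nat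
  and c \<nu> \<eta> u0 u1 v0 v1 \<kappa> \<alpha> \<beta> \<gamma> c' u0' u1' v0' v1' \<kappa>' \<alpha>' \<beta>' \<gamma>' :: 'f
 assumes T: "T_ideal T" and van: "\<And>f. f \<in> T ==> ev \<phi> f = 0"
  and formP: "boundary_affine N (%k l m. \<phi> (wP k l m)) c \<nu> \<eta> u0 u1 v0 v1 \<kappa> \<alpha> \<beta> \<gamma>"
  and formQ: "boundary_affine N (%k l m. \<phi> (wQ k l m)) c' (- \<eta>) (- \<nu>) u0' u1' v0' v1' \<kappa>' \<alpha>' \<beta>' \<gamma>'"
begin

lemma multilinear_form:
 assumes "g \<in> multilinear_polys d"
 shows "two_letter_functional \<phi> N c \<nu> \<eta> u0 u1 v0 v1 \<kappa> \<alpha> \<beta> \<gamma> c' u0' u1' v0' v1' \<kappa>' \<alpha>' \<beta>' \<gamma>' (supp g) {..<d}"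
 by unfold_locales (use formP formQ assms in \<open>auto simp: multilinear_polys_def\<close>)

lemma killed:
 assumes g: "g \<in> T" "g \<in> multilinear_polys d" and N: "2 * d + 20 <= N"
 shows "killed_functional \<phi> N c \<nu> \<eta> u0 u1 v0 v1 \<kappa> \<alpha> \<beta> \<gamma> c' u0' u1' v0' v1' \<kappa>' \<alpha>' \<beta>' \<gamma>' (supp g) (coef g) {..<d}"
proof -
 interpret two_letter_functional \<phi> N c \<nu> \<eta> u0 u1 v0 v1 \<kappa> \<alpha> \<beta> \<gamma> c' u0' u1' v0' v1' \<kappa>' \<alpha>' \<beta>' \<gamma>' "supp g" "coef g" "{..<d}"
  by (rule multilinear_form[OF g(2)])
 show ?thesis
 proof
  fix s :: "nat => nat list" and u v
  assume "\<And>x. s x ~= []"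
  then have "ev (%w. \<phi> (u @ concat (map s w) @ v)) g = 0" by (intro ev_vanish[OF T van g(1)])
  then show "wsum (%w. \<phi> (u @ concat (map s w) @ v)) = 0" by (simp add: wsum_def ev_def)
 qed (use N in simp_all)
qed

text \<open>An element of \<open>T\<close> of degree at most \<open>D\<close> annihilates the
  functional, so its nonzero statistic forces the coefficient paired with it to vanish, for
  \<open>P\<close> and, by symmetry, for \<open>Q\<close>.\<close>

lemma relation_kills:
 assumes N: "2 * D + 20 <= N"
 shows "has_relation T D rel_first ==> u0 = 0 & u0' = 0"
  and "has_relation T D rel_last ==> v0 = 0 & v0' = 0"
  and "has_relation T D rel_starts ==> u1 = 0 & u1' = 0 & \<alpha> = 0 & \<alpha>' = 0"
  and "has_relation T D rel_ends ==> v1 = 0 & v1' = 0 & \<beta> = 0 & \<beta>' = 0"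
  and "has_relation T D rel_outer ==> \<gamma> = 0 & \<gamma>' = 0"
  and "has_relation T D rel_adj ==> \<kappa> = 0 & \<kappa>' = 0"
  and "has_relation T D rel_bef ==> \<nu> = 0 & \<eta> = 0 & c = c'"
proof -
 have k: "coefficients_killed (supp g) (coef g) {..<d} u0 u1 v0 v1 \<kappa> \<alpha> \<beta> \<gamma>"
   "coefficients_killed (supp g) (coef g) {..<d} u0' u1' v0' v1' \<kappa>' \<alpha>' \<beta>' \<gamma>'"
  if g: "3 <= d" "d <= D" "g \<in> T" "g \<in> multilinear_polys d" for d g
 proof -
  have "2 * d + 20 <= N" using N g(2) by simp
  note K = killed[OF g(3,4) this]
  from killed_functional.coefficients_killed[OF K, unfolded card_lessThan, OF g(1)]
   killed_functional.coefficients_killed'[OF K, unfolded card_lessThan, OF g(1)]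
  show "coefficients_killed (supp g) (coef g) {..<d} u0 u1 v0 v1 \<kappa> \<alpha> \<beta> \<gamma>"
   "coefficients_killed (supp g) (coef g) {..<d} u0' u1' v0' v1' \<kappa>' \<alpha>' \<beta>' \<gamma>'" .
 qed
 note k = k[unfolded coefficients_killed_def wcount_supp, rule_format, OF _ _ _ _ iffD2[OF lessThan_iff] iffD2[OF lessThan_iff]]
 show "u0 = 0 & u0' = 0" if "has_relation T D rel_first"
  using that by (rule has_relationE) (frule (6) k(1), drule (6) k(2), simp add: rel_first_def)
 show "v0 = 0 & v0' = 0" if "has_relation T D rel_last"
  using that by (rule has_relationE) (frule (6) k(1), drule (6) k(2), simp add: rel_last_def)
 show "u1 = 0 & u1' = 0 & \<alpha> = 0 & \<alpha>' = 0" if "has_relation T D rel_starts"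
  using that by (rule has_relationE) (frule (6) k(1), drule (6) k(2), simp add: rel_starts_def)
 show "v1 = 0 & v1' = 0 & \<beta> = 0 & \<beta>' = 0" if "has_relation T D rel_ends"
  using that by (rule has_relationE) (frule (6) k(1), drule (6) k(2), simp add: rel_ends_def)
 show "\<gamma> = 0 & \<gamma>' = 0" if "has_relation T D rel_outer"
  using that by (rule has_relationE) (frule (6) k(1), drule (6) k(2), simp add: rel_outer_def)
 show "\<kappa> = 0 & \<kappa>' = 0" if "has_relation T D rel_adj"
  using that by (rule has_relationE) (frule (6) k(1), drule (6) k(2), simp add: rel_adj_def)
 show "\<nu> = 0 & \<eta> = 0 & c = c'" if h: "has_relation T D rel_bef"
 proof -
  from h obtain d g i j where g: "3 <= d" "d <= D" "g \<in> T" "g \<in> multilinear_polys d" "i < d" "j < d" "i ~= j"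
   and r: "rel_bef i j g" by (rule has_relationE)
  have ij: "i \<in> {..<d}" "j \<in> {..<d}" using g by auto
  have N': "2 * d + 20 <= N" using N g(2) by simp
  have nz: "wcount (supp g) (coef g) (bef i j) ~= 0" using r by (simp add: wcount_supp rel_bef_def)
  note K = killed_functional.order_killed[OF killed[OF g(3,4) N'] ij g(7) nz, unfolded wcount_supp]
  have "(c - c') * (word_count g (bef i j) - word_count g (bef j i))
    = (c * word_count g (bef i j) + c' * word_count g (bef j i))
     - (c' * word_count g (bef i j) + c * word_count g (bef j i))" by (simp add: algebra_simps)
  then have "(c - c') * (word_count g (bef i j) - word_count g (bef j i)) = 0" unfolding K(3,4) by simp
  then show ?thesis using K(1,2) r by (simp add: rel_bef_def)
 qed
qed

lemma evaluation_vanish: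
 assumes N: "2 * D + 20 <= N" and f: "f \<in> multilinear_polys n" "N + 2 = n" and ij: "i < n" "j < n" "i ~= j"
  and tot: "word_count f (%w. True) = 0"
  and gov: "governed T D n f"
 shows "ev (%w. \<phi> (map (%x. if x = i then 1 else if x = j then 2 else 0) w)) f = 0"
proof -
 interpret two_letter_functional \<phi> N c \<nu> \<eta> u0 u1 v0 v1 \<kappa> \<alpha> \<beta> \<gamma> c' u0' u1' v0' v1' \<kappa>' \<alpha>' \<beta>' \<gamma>' "supp f" "coef f" "{..<n}"
  by (rule multilinear_form[OF f(1)])
 note R = relation_kills[OF N]
 note gov = gov[unfolded governed_def]
 have z: "a1 * word_count f (%w. hd w = i) = 0 & a2 * word_count f (startsw i j) = 0 &
   a3 * word_count f (%w. last w = i) = 0 & a4 * word_count f (endsw i j) = 0 &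
   a5 * word_count f (adjw i j) = 0 & a6 * word_count f (startsw i j) = 0 &
   a7 * word_count f (endsw i j) = 0 & a8 * word_count f (outerw i j) = 0"
  if ij: "i \<in> {..<n}" "j \<in> {..<n}" "i ~= j" and k: "has_relation T D rel_first ==> a1 = 0" "has_relation T D rel_starts ==> a2 = 0"
   "has_relation T D rel_last ==> a3 = 0" "has_relation T D rel_ends ==> a4 = 0" "has_relation T D rel_adj ==> a5 = 0"
   "has_relation T D rel_starts ==> a6 = 0" "has_relation T D rel_ends ==> a7 = 0" "has_relation T D rel_outer ==> a8 = 0"
  for a1 a2 a3 a4 a5 a6 a7 a8 :: 'f and i j
 proof -
  have m: "x * word_count f (S i j) = 0" if "H \<or> pairs_vanish n f S" "H ==> x = 0" for H x S
   using that ij by auto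
  note g = conjunct1[OF gov] gov[THEN conjunct2]
  note g = g(1) conjunct1[OF g(2)] g(2)[THEN conjunct2]
  note g = g(1,2) conjunct1[OF g(3)] g(3)[THEN conjunct2]
  note g = g(1-3) conjunct1[OF g(4)] g(4)[THEN conjunct2]
  note g = g(1-4) conjunct1[OF g(5)] g(5)[THEN conjunct2, THEN conjunct1]
  show ?thesis
   by (intro conjI m[OF g(1)] m[OF g(2)] m[OF g(3)] m[OF g(4)] m[OF g(5)] m[OF g(6)]) (erule k)+
 qed
 have "wsum (%w. \<phi> (map (%x. if x = i then 1 else if x = j then 2 else 0) w)) = 0"
 proof (rule evaluation_vanish)
  show "finite {..<n}" "i \<in> {..<n}" "j \<in> {..<n}" "i ~= j" "N + 2 = card {..<n}" using ij f(2) by simp_all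
  show "wcount (supp f) (coef f) (%w. True) = 0" by (simp only: wcount_supp tot)
  show "(\<forall>i\<in>{..<n}. \<forall>j\<in>{..<n}. i ~= j --> wcount (supp f) (coef f) (bef i j) = 0) \<or> \<nu> = 0 & \<eta> = 0 & c = c'"
   unfolding wcount_supp using gov[THEN conjunct2, THEN conjunct2, THEN conjunct2, THEN conjunct2, THEN conjunct2, THEN conjunct2] R(7) by blast
  show "coefficients_killed (supp f) (coef f) {..<n} u0 u1 v0 v1 \<kappa> \<alpha> \<beta> \<gamma>"
   unfolding coefficients_killed_def wcount_supp by (intro ballI impI z) (simp_all add: R)
  show "coefficients_killed (supp f) (coef f) {..<n} u0' u1' v0' v1' \<kappa>' \<alpha>' \<beta>' \<gamma>'"
   unfolding coefficients_killed_def wcount_supp by (intro ballI impI z) (simp_all add: R)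
 qed
 then show ?thesis by (simp add: wsum_def ev_def)
qed

end

section \<open>Identifying all letters but two, and undoing it by polarization\<close>

lemma relabel_exists:
 assumes v: "distinct v" "set v = A" and w: "distinct w" "set w = A"
 obtains p where "p permutes A" "map p w = v"
proof -
 have len: "length v = length w" using v w by (metis distinct_card)
 define p where "p x = (if x \<in> A then v ! (THE k. k < length w & w ! k = x) else x)" for x
 have pn: "p (w ! k) = v ! k" if k: "k < length w" for k
 proof -
  have "(THE k'. k' < length w & w ! k' = w ! k) = k"
   by (rule the_equality) (use k w(1) nth_eq_iff_index_eq in auto)
  moreover have "w ! k \<in> A" using k w(2) nth_mem by blast
  ultimately show ?thesis by (simp add: p_def)
 qed
 have m: "map p w = v" by (rule nth_equalityI) (simp_all add: len pn)
 have img: "p ` A = A" using arg_cong[OF m, of set] by (simp add: v w)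
 have fin: "finite A" using v(2) by auto
 have "bij_betw p A A" unfolding bij_betw_def using img eq_card_imp_inj_on[OF fin, of p] by simp
 then have "p permutes A" by (rule bij_imp_permutes) (simp add: p_def)
 then show ?thesis using m that by blast
qed

definition two_color :: "nat => nat => nat => nat" where
 "two_color i j x = (if x = i then 1 else if x = j then 2 else 0)"

text \<open>The words with the colouring of \<open>w\<close> arise from \<open>w\<close> by
  permuting the letters other than \<open>i\<close> and \<open>j\<close>, each in exactly one
  way.\<close>

lemma two_color_fibre_sum:
 assumes w: "distinct w" "set w = A" and ij: "i \<in> A" "j \<in> A" "i ~= j"
 shows "(\<Sum>v | distinct v & set v = A. of_bool (map (two_color i j) w = map (two_color i j) v) * \<theta> v)
  = (\<Sum>p | p permutes (A - {i, j}). \<theta> (map p w) :: 'f::field)"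
proof -
 let ?B = "{v. (distinct v & set v = A) & map (two_color i j) w = map (two_color i j) v}"
 have fA: "finite A" using w(2) by auto
 have fin: "finite {v. distinct v & set v = A}"
  by (rule finite_subset[OF _ finite_subset_distinct[OF fA]]) auto
 have col: "two_color i j x = 1 \<longleftrightarrow> x = i" "two_color i j x = 2 \<longleftrightarrow> x = j" for x
  using ij(3) by (auto simp: two_color_def)
 have inj: "inj_on (%p. map p w) {p. p permutes (A - {i, j})}"
 proof (rule inj_onI)
  fix p q assume p: "p \<in> {p. p permutes (A - {i, j})}" "q \<in> {p. p permutes (A - {i, j})}" "map p w = map q w"
  have eq: "p x = q x" if "x \<in> A" for x using p(3) that w(2) by (simp add: map_eq_conv)
  show "p = q"
  proof
   fix x show "p x = q x"
   proof (cases "x \<in> A")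
    case False
    then show ?thesis using p(1,2) permutes_not_in[of p "A - {i, j}" x] permutes_not_in[of q "A - {i, j}" x] by simp
   qed (rule eq)
  qed
 qed
 have img: "(%p. map p w) ` {p. p permutes (A - {i, j})} = ?B"
 proof
  show "(%p. map p w) ` {p. p permutes (A - {i, j})} \<subseteq> ?B"
  proof
   fix v assume "v \<in> (%p. map p w) ` {p. p permutes (A - {i, j})}"
   then obtain p where p: "p permutes (A - {i, j})" "v = map p w" by blast
   have pA: "p permutes A" by (rule permutes_subset[OF p(1)]) blast
   have "p i = i" "p j = j" using permutes_not_in[OF p(1)] by simp_all
   then have "p x = i \<longleftrightarrow> x = i" "p x = j \<longleftrightarrow> x = j" for x
    using permutes_inj[OF pA] by (metis injD)+
   then have "two_color i j (p x) = two_color i j x" for x by (simp add: two_color_def)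
   moreover have "distinct v" unfolding p(2) distinct_map using w(1) permutes_inj_on[OF pA, of "set w"] by (rule conjI)
   moreover have "set v = A" unfolding p(2) set_map w(2) by (rule permutes_image[OF pA])
   ultimately show "v \<in> ?B" by (simp add: p(2) comp_def)
  qed
  show "?B \<subseteq> (%p. map p w) ` {p. p permutes (A - {i, j})}"
  proof
   fix v assume "v \<in> ?B"
   then have v: "distinct v" "set v = A" "map (two_color i j) w = map (two_color i j) v" by simp_all
   obtain p where p: "p permutes A" "map p w = v" by (rule relabel_exists[OF v(1,2) w])
   have "map (two_color i j) w = map (two_color i j o p) w" using v(3) p(2) by (metis map_map)
   then have c: "two_color i j x = two_color i j (p x)" if "x \<in> A" for x
    using that w(2) unfolding map_eq_conv by simp
   have "p i = i" using c[OF ij(1)] col(1)[of "p i"] col(1)[of i] by simp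
   moreover have "p j = j" using c[OF ij(2)] col(2)[of "p j"] col(2)[of j] by simp
   ultimately have "p permutes (A - {i, j})"
    by (intro permutes_superset[OF p(1)]) auto
   then show "v \<in> (%p. map p w) ` {p. p permutes (A - {i, j})}" using p(2) by blast
  qed
 qed
 have "(\<Sum>v | distinct v & set v = A. of_bool (map (two_color i j) w = map (two_color i j) v) * \<theta> v)
   = (\<Sum>v\<in>?B. \<theta> v)"
  by (rule sum.mono_neutral_cong_right[OF fin]) auto
 also have "\<dots> = (\<Sum>p | p permutes (A - {i, j}). \<theta> (map p w))"
  unfolding img[symmetric] by (subst sum.reindex[OF inj]) (simp add: comp_def)
 finally show ?thesis .
qed

lemma separating_functional_ex:
 assumes "nc.subspace T" "f ~: T"
 shows "\<exists>\<phi>. (\<forall>g\<in>T. ev \<phi> g = 0) & ev \<phi> f ~= 0"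
proof (rule separating_functional[OF assms])
 fix \<phi> assume "\<And>g. g \<in> T ==> ev \<phi> g = 0" "ev \<phi> f ~= 0"
 then show ?thesis by (intro exI[of _ \<phi>] conjI ballI)
qed

lemma dm_ev: "dm i j (%c. ev (%w. G c w) f) = (%c. ev (%w. dm i j (%c. G c w) c) f)"
 unfolding dm_def ev_def by (rule ext) (simp add: sum_subtractf algebra_simps)

lemma skew3_vanish_relabelling:
 fixes f :: "'f::field_char_0 nc_poly"
 assumes "skew3_words n0 \<phi>" "f \<in> multilinear_polys n" "n0 <= n"
 shows "skew3_vanish {..<n} (%c :: nat => nat. ev (%w. \<phi> (map c w)) f)"
 unfolding skew3_vanish_def
proof (intro allI impI)
 fix i1 j1 i2 j2 i3 j3 and c :: "nat => nat"
 assume s: "{i1, j1, i2, j2, i3, j3} \<subseteq> {..<n}" "distinct [i1, j1, i2, j2, i3, j3]"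
 have "dm i1 j1 (dm i2 j2 (dm i3 j3 (%c :: nat => nat. \<phi> (map c w)))) c = 0" if w: "w \<in> supp f" for w
 proof -
  have dw: "distinct w" "set w = {..<n}" using w assms(2) by (auto simp: multilinear_polys_def)
  have lw: "n0 <= length w" using distinct_card[OF dw(1)] dw(2) assms(3) by simp
  define m where "m c = (%x. [c x])" for c :: "nat => nat"
  define H where "H d = \<phi> (concat (map d w))" for d
  have m: "m (c o transpose p q) = m c o transpose p q" for c p q by (simp add: m_def fun_eq_iff)
  have "(%c. \<phi> (map c w)) = (%c. H (m c))" by (simp add: H_def m_def)
  then have "dm i1 j1 (dm i2 j2 (dm i3 j3 (%c. \<phi> (map c w)))) = (%c. dm i1 j1 (dm i2 j2 (dm i3 j3 H)) (m c))"
   using dm_pull[of m i3 j3 i3 j3 H, OF m] dm_pull[of m i2 j2 i2 j2 "dm i3 j3 H", OF m]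
    dm_pull[of m i1 j1 i1 j1 "dm i2 j2 (dm i3 j3 H)", OF m] by (simp only:)
  moreover have "dm i1 j1 (dm i2 j2 (dm i3 j3 H)) (m c) = 0"
   unfolding H_def by (rule skew3_wordsD[OF assms(1) dw(1) lw]) (use s dw in \<open>simp_all add: m_def\<close>)
  ultimately show ?thesis by simp
 qed
 then show "dm i1 j1 (dm i2 j2 (dm i3 j3 (%c. ev (%w. \<phi> (map c w)) f))) c = 0"
  unfolding dm_ev by (simp add: ev_def)
qed

text \<open>Polarizing the polynomial in which all letters but \<open>i\<close> and \<open>j\<close>
  were identified gives the sum of all permutations of \<open>f\<close> in the other letters. It
  stays in \<open>T\<close>, so the functional kills it.\<close>

lemma symmetrized_vanish:
 fixes f :: "'f::field_char_0 nc_poly"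
 assumes T: "T_ideal T" and van: "\<And>f. f \<in> T ==> ev \<phi> f = 0" and f: "f \<in> multilinear_polys n"
  and ij: "i < n" "j < n" "i ~= j" and g: "subst_poly (%x. mono [two_color i j x]) f \<in> T"
 shows "sym_over ({..<n} - {i, j}) (%c :: nat => nat. ev (%w. \<phi> (map c w)) f) c = 0"
proof -
 let ?A = "{..<n}" and ?cl = "two_color i j"
 define g where "g = subst_poly (%x. mono [?cl x]) f"
 define W where "W = {v. distinct v & set v = ?A}"
 define \<theta> where "\<theta> w = \<phi> (map c w)" for w
 have finW: "finite W" unfolding W_def by (rule finite_subset[OF _ finite_subset_distinct[of ?A]]) auto
 have ff: "f \<in> free_algebra" and fw: "\<And>w. w \<in> supp f ==> distinct w & set w = ?A"
  using f by (auto simp: multilinear_polys_def)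
 have gf: "g \<in> free_algebra" using g T_idealD(1)[OF T] by (auto simp: g_def)
 have cg: "coef g u = (\<Sum>w\<in>supp f. coef f w * of_bool (map ?cl w = u))" for u
 proof -
  have "coef g u = ev (%w. of_bool (concat (map (%x. [?cl x]) w) = u)) f"
   unfolding g_def coef_eq_ev by (rule ev_word_subst[OF ff]) simp
  then show ?thesis by (simp add: ev_def)
 qed
 define pl where "pl = polarize ?A ?cl g"
 have plT: "pl \<in> T" unfolding pl_def by (rule T_ideal_polarize[OF T]) (use g g_def in simp)
 have cp: "coef pl v = (if set v = ?A then coef g (map ?cl v) else 0)" for v
  unfolding pl_def by (rule coef_polarize) (use gf in auto)
 have sp: "supp pl \<subseteq> W"
 proof
  fix v assume "v \<in> supp pl"
  then have v: "set v = ?A" "coef g (map ?cl v) ~= 0" by (auto simp: in_keys_iff cp split: if_splits)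
  from v(2)[unfolded cg] obtain w where w: "w \<in> supp f" "coef f w * of_bool (map ?cl w = map ?cl v) ~= 0"
   by (rule sum.not_neutral_contains_not_neutral)
  then have "map ?cl w = map ?cl v" by (simp split: if_splits)
  then have "length w = length v" by (rule map_eq_imp_length_eq)
  moreover have "length w = n" using fw[OF w(1)] distinct_card[of w] by simp
  ultimately have "length v = n" by simp
  then have "distinct v" using v(1) by (simp add: card_distinct)
  then show "v \<in> W" using v(1) by (simp add: W_def)
 qed
 have "0 = ev \<theta> pl"
  using ev_vanish[OF T van plT, of "%x. [c x]" "[]" "[]"] by (simp add: \<theta>_def[abs_def])
 also have "\<dots> = (\<Sum>v\<in>W. coef g (map ?cl v) * \<theta> v)"
  unfolding ev_superset[OF finW sp] by (rule sum.cong) (auto simp: cp W_def)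
 also have "\<dots> = (\<Sum>v\<in>W. \<Sum>w\<in>supp f. coef f w * (of_bool (map ?cl w = map ?cl v) * \<theta> v))"
  unfolding cg sum_distrib_right by (simp add: mult.assoc)
 also have "\<dots> = (\<Sum>w\<in>supp f. coef f w * (\<Sum>v\<in>W. of_bool (map ?cl w = map ?cl v) * \<theta> v))"
  unfolding sum_distrib_left by (rule sum.swap)
 also have "\<dots> = (\<Sum>w\<in>supp f. coef f w * (\<Sum>p | p permutes (?A - {i, j}). \<theta> (map p w)))"
  unfolding W_def using ij fw by (intro sum.cong refl arg_cong2[where f = "(*)"] two_color_fibre_sum) auto
 also have "\<dots> = ev (%w. \<Sum>p | p permutes (?A - {i, j}). \<phi> (map (c o p) w)) f"
  by (simp add: ev_def \<theta>_def)
 also have "\<dots> = sym_over (?A - {i, j}) (%c. ev (%w. \<phi> (map c w)) f) c"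
  unfolding ev_sum_functional sym_over_def ..
 finally show ?thesis by simp
qed

text \<open>Separating functionals are used twice: one against \<open>f\<close> itself, to which
  \<open>vanish_of_sym_over\<close> applies, and one against each polynomial obtained from
  \<open>f\<close> by identifying letters, to which the two-letter formula applies.\<close>

lemma multilinear_in_T_ideal:
 fixes T :: "'f::field_char_0 nc_poly set"
 assumes T: "T_ideal T"
  and mixed: "\<And>\<phi>. (\<And>f. f \<in> T ==> ev \<phi> f = 0) ==> mixed_words n1 \<phi>"
  and n: "2 * D + 22 <= n" "2 * n1 + 42 <= n"
  and f: "f \<in> multilinear_polys n" and tot: "word_count f (%w. True) = 0"
  and gov: "governed T D n f"
 shows "f \<in> T"
proof (rule ccontr)
 assume "f ~: T"
 from separating_functional_ex[OF T_idealD(2)[OF T] this]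
 obtain \<phi> where \<phi>0: "\<forall>g\<in>T. ev \<phi> g = 0" "ev \<phi> f ~= 0" by (elim exE conjE) (rule that)
 note \<phi> = \<phi>0(1)[rule_format] \<phi>0(2)
 have ff: "f \<in> free_algebra" using f by (simp add: multilinear_polys_def)
 have skew: "skew3_words (2 * n1 + 40) \<psi>" if "\<And>f. f \<in> T ==> ev \<psi> f = 0" for \<psi>
  by (rule skew3_of_mixed[OF mixed[OF that]])
 have two: "subst_poly (%x. mono [two_color i j x]) f \<in> T" if ij: "i < n" "j < n" "i ~= j" for i j
 proof (rule ccontr)
  assume "subst_poly (%x. mono [two_color i j x]) f ~: T"
  from separating_functional_ex[OF T_idealD(2)[OF T] this]
  obtain \<psi> where \<psi>0: "\<forall>g\<in>T. ev \<psi> g = 0"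
   "ev \<psi> (subst_poly (%x. mono [two_color i j x]) f) ~= 0" by (elim exE conjE) (rule that)
  note \<psi> = \<psi>0(1)[rule_format] \<psi>0(2)
  \<comment> \<open>Letters other than \<open>i\<close> and \<open>j\<close>. The two bounds on
    \<open>n\<close> are those needed for \<open>N\<close>, raised by 2.\<close>
  define N where "N = n - 2"
  have N: "2 * n1 + 40 <= N" "12 <= N" "2 * D + 20 <= N" "N + 2 = n" using n by (auto simp: N_def)
  have "ev (%w. \<psi> (map (%x. if x = i then 1 else if x = j then 2 else 0) w)) f = 0"
  proof (rule two_letter_form[OF skew[OF \<psi>(1)] N(1,2)])
   fix c \<nu> \<eta> u0 u1 v0 v1 \<kappa> \<alpha> \<beta> \<gamma> c' u0' u1' v0' v1' \<kappa>' \<alpha>' \<beta>' \<gamma>'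
   assume forms: "boundary_affine N (%k l m. \<psi> (wP k l m)) c \<nu> \<eta> u0 u1 v0 v1 \<kappa> \<alpha> \<beta> \<gamma>"
    "boundary_affine N (%k l m. \<psi> (wQ k l m)) c' (- \<eta>) (- \<nu>) u0' u1' v0' v1' \<kappa>' \<alpha>' \<beta>' \<gamma>'"
   interpret vanishing_form T \<psi> N c \<nu> \<eta> u0 u1 v0 v1 \<kappa> \<alpha> \<beta> \<gamma> c' u0' u1' v0' v1' \<kappa>' \<alpha>' \<beta>' \<gamma>'
    by unfold_locales (fact T \<psi>(1) forms)+
   show ?thesis
    by (rule evaluation_vanish[OF N(3) f N(4) ij tot gov])
  qed
  then show False using \<psi>(2) by (subst (asm) ev_word_subst) (use ff in \<open>simp_all add: two_color_def[abs_def]\<close>)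
 qed
 define F where "F c = ev (%w. \<phi> (map c w)) f" for c :: "nat => nat"
 have "F id = 0"
 proof (rule vanish_of_sym_over[where F = F and c = id and A = "{..<n}"])
  show "finite {..<n}" "6 <= card {..<n}" using n by simp_all
  show "skew3_vanish {..<n} F" unfolding F_def
   by (rule skew3_vanish_relabelling[OF skew[OF \<phi>(1)] f]) (use n in auto)
  fix C c assume C: "C \<subseteq> {..<n}" "card C = card {..<n} - 2"
  have "card ({..<n} - C) = 2" using C n finite_subset[OF C(1)] by (simp add: card_Diff_subset)
  then obtain i j where ij: "{..<n} - C = {i, j}" "i ~= j" unfolding card_2_iff by (elim exE conjE) (rule that)
  then have "i < n" "j < n" "C = {..<n} - {i, j}" using C(1) by auto
  then show "sym_over C F c = 0"
   unfolding F_def using symmetrized_vanish[OF T \<phi>(1) f _ _ ij(2) two[OF _ _ ij(2)]] by simp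
 qed
 then show False using \<phi>(2) by (simp add: F_def)
qed

section \<open>Identities of the model algebras\<close>

text \<open>A product of triangular matrices has the off-diagonal entry of factor \<open>i\<close>
  where every factor before it contributes a diagonal entry from one row and every factor after it
  one from another. \<open>p\<close> and \<open>q\<close> tell whether these diagonal positions are
  occupied; if not, no factor may stand there.\<close>

definition single_at :: "bool => bool => nat => nat list => bool" where
 "single_at p q i w \<longleftrightarrow> (\<exists>u v. w = u @ i # v & (u = [] \<or> p) & (v = [] \<or> q))"

definition double_at :: "bool => bool => bool => nat => nat => nat list => bool" where
 "double_at p q r i j w \<longleftrightarrow> (\<exists>u m v. w = u @ i # m @ j # v & (u = [] \<or> p) & (m = [] \<or> q) & (v = [] \<or> r))"

lemma single_at_Cons:
 assumes "x ~: set w"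
 shows "single_at p q x (x # w) \<longleftrightarrow> w = [] \<or> q" "i ~= x ==> single_at p q i (x # w) \<longleftrightarrow> p & single_at p q i w"
proof -
 have c: "x # w = u @ i # v \<longleftrightarrow> (u = [] & i = x & v = w) \<or> (\<exists>u'. u = x # u' & w = u' @ i # v)" for u v i
  by (cases u) auto
 show "single_at p q x (x # w) \<longleftrightarrow> w = [] \<or> q"
 proof
  assume "single_at p q x (x # w)"
  then obtain u v where *: "x # w = u @ x # v" "v = [] \<or> q" unfolding single_at_def by (elim exE conjE) (rule that)
  then have "u = []" using assms by (cases u) auto
  then show "w = [] \<or> q" using * by simp
 next
  assume "w = [] \<or> q"
  then show "single_at p q x (x # w)" unfolding single_at_def by (intro exI[of _ "[]"] exI[of _ w]) auto
 qed
 show "single_at p q i (x # w) \<longleftrightarrow> p & single_at p q i w" if ne: "i ~= x"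
 proof
  assume "single_at p q i (x # w)"
  then obtain u v where *: "x # w = u @ i # v" "u = [] \<or> p" "v = [] \<or> q" unfolding single_at_def by (elim exE conjE) (rule that)
  then obtain u' where "u = x # u'" "w = u' @ i # v" using ne by (cases u) auto
  then show "p & single_at p q i w" using * unfolding single_at_def by auto
 next
  assume "p & single_at p q i w"
  then obtain u v where "p" "w = u @ i # v" "v = [] \<or> q" unfolding single_at_def by (elim exE conjE) (rule that)
  then show "single_at p q i (x # w)" unfolding single_at_def by (intro exI[of _ "x # u"] exI[of _ v]) auto
 qed
qed

lemma double_at_Cons:
 assumes "x ~: set w"
 shows "double_at p q r x j (x # w) \<longleftrightarrow> single_at q r j w" "\<not> double_at p q r i x (x # w)"
  "i ~= x ==> double_at p q r i j (x # w) \<longleftrightarrow> p & double_at p q r i j w"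
proof -
 show "double_at p q r x j (x # w) \<longleftrightarrow> single_at q r j w"
 proof
  assume "double_at p q r x j (x # w)"
  then obtain u m v where *: "x # w = u @ x # m @ j # v" "m = [] \<or> q" "v = [] \<or> r"
   unfolding double_at_def by (elim exE conjE) (rule that)
  then have "u = []" using assms by (cases u) auto
  then show "single_at q r j w" using * by (auto simp: single_at_def)
 next
  assume "single_at q r j w"
  then obtain m v where "w = m @ j # v" "m = [] \<or> q" "v = [] \<or> r" unfolding single_at_def by (elim exE conjE) (rule that)
  then show "double_at p q r x j (x # w)" unfolding double_at_def
   by (intro exI[of _ "[]"] exI[of _ m] exI[of _ v]) auto
 qed
 show "\<not> double_at p q r i x (x # w)"
 proof
  assume "double_at p q r i x (x # w)"
  then obtain u m v where "x # w = u @ i # m @ x # v" unfolding double_at_def by (elim exE conjE) (rule that)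
  then have "x \<in> set w" by (cases u) auto
  then show False using assms by simp
 qed
 show "double_at p q r i j (x # w) \<longleftrightarrow> p & double_at p q r i j w" if ne: "i ~= x"
 proof
  assume "double_at p q r i j (x # w)"
  then obtain u m v where *: "x # w = u @ i # m @ j # v" "u = [] \<or> p" "m = [] \<or> q" "v = [] \<or> r"
   unfolding double_at_def by (elim exE conjE) (rule that)
  then obtain u' where "u = x # u'" "w = u' @ i # m @ j # v" using ne by (cases u) auto
  then show "p & double_at p q r i j w" using * unfolding double_at_def by blast
 next
  assume "p & double_at p q r i j w"
  then obtain u m v where "p" "w = u @ i # m @ j # v" "m = [] \<or> q" "v = [] \<or> r"
   unfolding double_at_def by (elim exE conjE) (rule that)
  then show "double_at p q r i j (x # w)" unfolding double_at_def
   by (intro exI[of _ "x # u"] exI[of _ m] exI[of _ v]) auto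
 qed
qed

text \<open>Entries of a product of upper triangular matrices whose diagonal is a scalar times a fixed
 0-1 pattern; the empty product is the identity matrix.\<close>

definition diag_entry :: "bool => (nat => 'f::field) => nat list => 'f" where
 "diag_entry p a w = of_bool (w = [] \<or> p) * (\<Prod>x\<leftarrow>w. a x)"

fun step_entry :: "bool => bool => (nat => 'f::field) => (nat => 'f) => nat list => 'f" where
 "step_entry p q a b [] = 0"
| "step_entry p q a b (x # w) = of_bool p * a x * step_entry p q a b w + b x * diag_entry q a w"

fun corner_entry :: "bool => bool => bool => (nat => 'f::field) => (nat => 'f) => (nat => 'f) => (nat => 'f) => nat list => 'f" where
 "corner_entry p q r a b c d [] = 0"
| "corner_entry p q r a b c d (x # w) =
   of_bool p * a x * corner_entry p q r a b c d w + b x * step_entry q r a d w + c x * diag_entry r a w"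

lemma diag_entry_Cons: "diag_entry p a (x # w) = of_bool p * a x * diag_entry p a w"
 by (auto simp: diag_entry_def)

lemma diag_entry_distinct: "distinct w ==> diag_entry p a w = of_bool (w = [] \<or> p) * (\<Prod>x\<in>set w. a x)"
 by (simp add: diag_entry_def prod.distinct_set_conv_list)

lemma step_entry_eq:
 "distinct w ==> step_entry p q a b w = (\<Sum>i\<in>set w. b i * (\<Prod>x\<in>set w - {i}. a x) * of_bool (single_at p q i w))"
proof (induction w)
 case (Cons x w)
 then have x: "x ~: set w" "distinct w" by auto
 have "(\<Sum>i\<in>set w. b i * (\<Prod>y\<in>insert x (set w) - {i}. a y) * of_bool (single_at p q i (x # w)))
   = (\<Sum>i\<in>set w. of_bool p * a x * (b i * (\<Prod>y\<in>set w - {i}. a y) * of_bool (single_at p q i w)))"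
 proof (rule sum.cong)
  fix i assume i: "i \<in> set w"
  then have "i ~= x" using x by auto
  then have "insert x (set w) - {i} = insert x (set w - {i})" by auto
  then have "(\<Prod>y\<in>insert x (set w) - {i}. a y) = a x * (\<Prod>y\<in>set w - {i}. a y)" using x by simp
  then show "b i * (\<Prod>y\<in>insert x (set w) - {i}. a y) * of_bool (single_at p q i (x # w))
   = of_bool p * a x * (b i * (\<Prod>y\<in>set w - {i}. a y) * of_bool (single_at p q i w))"
   using single_at_Cons(2)[OF x(1) \<open>i ~= x\<close>] by (cases p) simp_all
 qed simp
 moreover have "insert x (set w) - {x} = set w" using x by auto
 ultimately show ?case
  using Cons x by (simp add: single_at_Cons(1)[OF x(1)] diag_entry_distinct sum_distrib_left algebra_simps)
qed simp

text \<open>A path from the first to the third index either jumps once, using an entry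
  \<open>c\<close>, or makes two jumps, using an entry \<open>b\<close> and later an entry
  \<open>d\<close>; all other factors contribute diagonal entries.\<close>

lemma corner_entry_eq:
 "distinct w ==> corner_entry p q r a b c d w
  = (\<Sum>i\<in>set w. c i * (\<Prod>x\<in>set w - {i}. a x) * of_bool (single_at p r i w))
   + (\<Sum>i\<in>set w. \<Sum>j\<in>set w. b i * d j * (\<Prod>x\<in>set w - {i, j}. a x) * of_bool (double_at p q r i j w))"
proof (induction w)
 case (Cons x w)
 then have x: "x ~: set w" "distinct w" by auto
 let ?S = "set w"
 have ix: "insert x ?S - {x} = ?S" "insert x ?S - {x, j} = ?S - {j}" for j using x by auto
 have s: "(\<Sum>i\<in>?S. c i * (\<Prod>y\<in>insert x ?S - {i}. a y) * of_bool (single_at p r i (x # w)))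
   = of_bool p * a x * (\<Sum>i\<in>?S. c i * (\<Prod>y\<in>?S - {i}. a y) * of_bool (single_at p r i w))"
  unfolding sum_distrib_left
 proof (rule sum.cong)
  fix i assume i: "i \<in> ?S"
  then have "i ~= x" using x by auto
  then have "insert x ?S - {i} = insert x (?S - {i})" by auto
  then have "(\<Prod>y\<in>insert x ?S - {i}. a y) = a x * (\<Prod>y\<in>?S - {i}. a y)" using x by simp
  then show "c i * (\<Prod>y\<in>insert x ?S - {i}. a y) * of_bool (single_at p r i (x # w))
   = of_bool p * a x * (c i * (\<Prod>y\<in>?S - {i}. a y) * of_bool (single_at p r i w))"
   using single_at_Cons(2)[OF x(1) \<open>i ~= x\<close>] by (cases p) simp_all
 qed simp
 have dx: "(\<Sum>j\<in>insert x ?S. b i * d j * (\<Prod>y\<in>insert x ?S - {i, j}. a y) * of_bool (double_at p q r i j (x # w)))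
   = (\<Sum>j\<in>?S. b i * d j * (\<Prod>y\<in>insert x ?S - {i, j}. a y) * of_bool (double_at p q r i j (x # w)))" for i
  using x double_at_Cons(2)[OF x(1)] by simp
 have d1: "(\<Sum>j\<in>?S. b x * d j * (\<Prod>y\<in>insert x ?S - {x, j}. a y) * of_bool (double_at p q r x j (x # w)))
   = b x * step_entry q r a d w"
  unfolding step_entry_eq[OF x(2)] sum_distrib_left ix double_at_Cons(1)[OF x(1)] by (simp add: mult.assoc)
 have d2: "(\<Sum>i\<in>?S. \<Sum>j\<in>?S. b i * d j * (\<Prod>y\<in>insert x ?S - {i, j}. a y) * of_bool (double_at p q r i j (x # w)))
   = of_bool p * a x * (\<Sum>i\<in>?S. \<Sum>j\<in>?S. b i * d j * (\<Prod>y\<in>?S - {i, j}. a y) * of_bool (double_at p q r i j w))"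
  unfolding sum_distrib_left
 proof (intro sum.cong refl)
  fix i j assume "i \<in> ?S" "j \<in> ?S"
  then have ij: "i ~= x" "j ~= x" using x by auto
  then have "insert x ?S - {i, j} = insert x (?S - {i, j})" by auto
  then have "(\<Prod>y\<in>insert x ?S - {i, j}. a y) = a x * (\<Prod>y\<in>?S - {i, j}. a y)" using x by simp
  then show "b i * d j * (\<Prod>y\<in>insert x ?S - {i, j}. a y) * of_bool (double_at p q r i j (x # w))
   = of_bool p * a x * (b i * d j * (\<Prod>y\<in>?S - {i, j}. a y) * of_bool (double_at p q r i j w))"
   using double_at_Cons(3)[OF x(1) ij(1)] by (cases p) simp_all
 qed
 have "(\<Sum>i\<in>insert x ?S. c i * (\<Prod>y\<in>insert x ?S - {i}. a y) * of_bool (single_at p r i (x # w)))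
   = c x * diag_entry r a w + of_bool p * a x * (\<Sum>i\<in>?S. c i * (\<Prod>y\<in>?S - {i}. a y) * of_bool (single_at p r i w))"
  unfolding sum.insert[OF finite_set x(1)] s ix single_at_Cons(1)[OF x(1)] diag_entry_distinct[OF x(2)]
  by (simp only: mult_ac)
 moreover have "(\<Sum>i\<in>insert x ?S. \<Sum>j\<in>insert x ?S. b i * d j * (\<Prod>y\<in>insert x ?S - {i, j}. a y) * of_bool (double_at p q r i j (x # w)))
   = b x * step_entry q r a d w
    + of_bool p * a x * (\<Sum>i\<in>?S. \<Sum>j\<in>?S. b i * d j * (\<Prod>y\<in>?S - {i, j}. a y) * of_bool (double_at p q r i j w))"
  unfolding dx unfolding sum.insert[OF finite_set x(1)] d1 d2 ..
 ultimately show ?case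
  using Cons.IH[OF x(2)] by (simp add: algebra_simps)
qed simp

lemma ev_const_mult: "ev (%w. x * of_bool (S w)) f = x * word_count f S"
 by (simp add: word_count_def ev_scale_functional)

lemma multilinear_word:
 assumes "f \<in> multilinear_polys n" "w \<in> supp f"
 shows "w ~= []" "distinct w" "set w = {..<n}"
 using assms by (auto simp: multilinear_polys_alt)

lemma ev_diag_entry:
 assumes "f \<in> multilinear_polys n"
 shows "ev (diag_entry p a) f = of_bool p * (\<Prod>x<n. a x) * word_count f (%w. True)"
proof -
 have "ev (diag_entry p a) f = ev (%w. (of_bool p * (\<Prod>x<n. a x)) * of_bool True) f"
  by (rule ev_cong) (use multilinear_word[OF assms] in \<open>simp add: diag_entry_distinct\<close>)
 then show ?thesis using ev_const_mult[of "of_bool p * (\<Prod>x<n. a x)" "%_. True" f] by simp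
qed

lemma ev_step_entry:
 assumes "f \<in> multilinear_polys n"
 shows "ev (step_entry p q a b) f = (\<Sum>i<n. b i * (\<Prod>x\<in>{..<n} - {i}. a x) * word_count f (single_at p q i))"
proof -
 have "ev (step_entry p q a b) f = ev (%w. \<Sum>i<n. b i * (\<Prod>x\<in>{..<n} - {i}. a x) * of_bool (single_at p q i w)) f"
  by (rule ev_cong) (simp only: step_entry_eq[OF multilinear_word(2)[OF assms]] multilinear_word(3)[OF assms])
 then show ?thesis by (simp only: ev_sum_functional ev_const_mult)
qed

lemma ev_corner_entry:
 assumes "f \<in> multilinear_polys n"
 shows "ev (corner_entry p q r a b c d) f
  = (\<Sum>i<n. c i * (\<Prod>x\<in>{..<n} - {i}. a x) * word_count f (single_at p r i))
   + (\<Sum>i<n. \<Sum>j<n. b i * d j * (\<Prod>x\<in>{..<n} - {i, j}. a x) * word_count f (double_at p q r i j))"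
proof -
 have add: "ev (%w. g w + h w) f = ev g f + ev h f" for g h by (simp add: ev_def sum.distrib algebra_simps)
 have "ev (corner_entry p q r a b c d) f = ev (%w. (\<Sum>i<n. c i * (\<Prod>x\<in>{..<n} - {i}. a x) * of_bool (single_at p r i w))
   + (\<Sum>i<n. \<Sum>j<n. b i * d j * (\<Prod>x\<in>{..<n} - {i, j}. a x) * of_bool (double_at p q r i j w))) f"
  by (rule ev_cong) (simp only: corner_entry_eq[OF multilinear_word(2)[OF assms]] multilinear_word(3)[OF assms])
 then show ?thesis by (simp only: add ev_sum_functional ev_const_mult)
qed

lemma linear_poly_eval:
 assumes "assoc_algebra A" "range a \<subseteq> carrier A" "f \<in> free_algebra"
  and l: "\<And>x y. x \<in> carrier A ==> y \<in> carrier A ==> l (x \<oplus>\<^bsub>A\<^esub> y) = l x + l y"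
   "\<And>x c. x \<in> carrier A ==> l (c \<odot>\<^bsub>A\<^esub> x) = c * l x"
 shows "l (poly_eval A a f) = ev (%w. l (list_mult A (map a w))) f"
proof -
 interpret assoc_algebra A by fact
 show ?thesis
  using assms(3)
 proof (induction f rule: free_induct)
  case zero
  have "l (0 \<odot>\<^bsub>A\<^esub> \<zero>\<^bsub>A\<^esub>) = 0" using l(2) by simp
  then show ?case by (simp add: poly_eval_zero[OF assms(2)] scale_zero_right)
 next
  case (single w c)
  have "set (map a w) \<subseteq> carrier A" using assms(2) by auto
  then show ?case by (simp add: poly_eval_single[OF assms(2)] l(2) list_mult_closed)
 next
  case (add f g)
  then show ?case by (simp add: poly_eval_add[OF assms(2)] poly_eval_closed[OF assms(2)] l(1) ev_add)
 qed
qed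

section \<open>Triangular matrix algebras with a prescribed diagonal pattern\<close>

lemma matrix_algebra_simps [simp]:
 "carrier (matrix_algebra n C) = C" "mult (matrix_algebra n C) = (*)" "add (matrix_algebra n C) = (+)"
 "zero (matrix_algebra n C) = 0\<^sub>m n n" "smult (matrix_algebra n C) = (\<cdot>\<^sub>m)"
 by (simp_all add: matrix_algebra_def module_mat_def)

lemma assoc_matrix_algebra:
 fixes C :: "'f::field mat set"
 assumes C: "C \<subseteq> carrier_mat n n" "0\<^sub>m n n \<in> C" "\<And>x y. x \<in> C ==> y \<in> C ==> x + y \<in> C"
  "\<And>x y. x \<in> C ==> y \<in> C ==> x * y \<in> C" "\<And>x c. x \<in> C ==> c \<cdot>\<^sub>m x \<in> C"
 shows "assoc_algebra (matrix_algebra n C)"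
proof -
 let ?M = "matrix_algebra n C"
 note M = subsetD[OF C(1)]
 interpret abelian_group ?M
 proof (rule abelian_groupI)
  fix x assume "x \<in> carrier (?M)"
  then have x: "x \<in> C" by simp
  show "\<exists>y\<in>carrier (?M). y \<oplus>\<^bsub>?M\<^esub> x = \<zero>\<^bsub>?M\<^esub>"
  proof (rule bexI)
   show "(- 1) \<cdot>\<^sub>m x \<oplus>\<^bsub>?M\<^esub> x = \<zero>\<^bsub>?M\<^esub>"
    using M[OF x] by (intro eq_matI) auto
   show "(- 1) \<cdot>\<^sub>m x \<in> carrier (?M)" using C(5)[OF x] by simp
  qed
  show "\<zero>\<^bsub>?M\<^esub> \<oplus>\<^bsub>?M\<^esub> x = x" using M[OF x] by simp
  fix y assume "y \<in> carrier (?M)"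
  then have y: "y \<in> C" by simp
  show "x \<oplus>\<^bsub>?M\<^esub> y \<in> carrier (?M)" using x y C(3) by simp
  show "x \<oplus>\<^bsub>?M\<^esub> y = y \<oplus>\<^bsub>?M\<^esub> x" using comm_add_mat[OF M[OF x] M[OF y]] by simp
  fix z assume "z \<in> carrier (?M)"
  then have z: "z \<in> C" by simp
  show "x \<oplus>\<^bsub>?M\<^esub> y \<oplus>\<^bsub>?M\<^esub> z = x \<oplus>\<^bsub>?M\<^esub> (y \<oplus>\<^bsub>?M\<^esub> z)"
   using assoc_add_mat[OF M[OF x] M[OF y] M[OF z]] by simp
 qed (use C(2) in simp)
 show ?thesis
 proof
  fix x c d assume "x \<in> carrier (?M)"
  then have x: "x \<in> C" by simp
  note X = M[OF x]
  show "c \<odot>\<^bsub>?M\<^esub> x \<in> carrier (?M)" using C(5) x by simp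
  show "(c + d) \<odot>\<^bsub>?M\<^esub> x = c \<odot>\<^bsub>?M\<^esub> x \<oplus>\<^bsub>?M\<^esub> d \<odot>\<^bsub>?M\<^esub> x"
   using X by (simp add: add_smult_distrib_right_mat[of x n n])
  show "(c * d) \<odot>\<^bsub>?M\<^esub> x = c \<odot>\<^bsub>?M\<^esub> (d \<odot>\<^bsub>?M\<^esub> x)"
   using X by (intro eq_matI) auto
  show "1 \<odot>\<^bsub>?M\<^esub> x = x" using X by (intro eq_matI) auto
  fix y assume "y \<in> carrier (?M)"
  then have y: "y \<in> C" by simp
  note Y = M[OF y]
  show "x \<otimes>\<^bsub>?M\<^esub> y \<in> carrier (?M)" using C(4) x y by simp
  show "c \<odot>\<^bsub>?M\<^esub> (x \<oplus>\<^bsub>?M\<^esub> y) = c \<odot>\<^bsub>?M\<^esub> x \<oplus>\<^bsub>?M\<^esub> c \<odot>\<^bsub>?M\<^esub> y"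
   using X Y by (simp add: add_smult_distrib_left_mat[of x n n y])
  show "c \<odot>\<^bsub>?M\<^esub> x \<otimes>\<^bsub>?M\<^esub> y = c \<odot>\<^bsub>?M\<^esub> (x \<otimes>\<^bsub>?M\<^esub> y)"
   using X Y by (simp add: mult_smult_assoc_mat[of x n n y n])
  show "x \<otimes>\<^bsub>?M\<^esub> (c \<odot>\<^bsub>?M\<^esub> y) = c \<odot>\<^bsub>?M\<^esub> (x \<otimes>\<^bsub>?M\<^esub> y)"
   using X Y by (simp add: mult_smult_distrib[of x n n y n])
  fix z assume "z \<in> carrier (?M)"
  then have z: "z \<in> C" by simp
  note Z = M[OF z]
  show "x \<otimes>\<^bsub>?M\<^esub> y \<otimes>\<^bsub>?M\<^esub> z = x \<otimes>\<^bsub>?M\<^esub> (y \<otimes>\<^bsub>?M\<^esub> z)"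
   using X Y Z by (simp add: assoc_mult_mat[of x n n y n z n])
  show "(x \<oplus>\<^bsub>?M\<^esub> y) \<otimes>\<^bsub>?M\<^esub> z = x \<otimes>\<^bsub>?M\<^esub> z \<oplus>\<^bsub>?M\<^esub> y \<otimes>\<^bsub>?M\<^esub> z"
   using X Y Z by (simp add: add_mult_distrib_mat[of x n n y z n])
  show "z \<otimes>\<^bsub>?M\<^esub> (x \<oplus>\<^bsub>?M\<^esub> y) = z \<otimes>\<^bsub>?M\<^esub> x \<oplus>\<^bsub>?M\<^esub> z \<otimes>\<^bsub>?M\<^esub> y"
   using X Y Z by (simp add: mult_add_distrib_mat[of z n n x n y])
 qed
qed

definition ut3 :: "'f::field => 'f => 'f => 'f => 'f => 'f => 'f mat" where
 "ut3 q0 q1 q2 b c d = mat 3 3 (%(r, s). if r = s then (if r = 0 then q0 else if r = 1 then q1 else q2)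
   else if r = 0 & s = 1 then b else if r = 0 & s = 2 then c else if r = 1 & s = 2 then d else 0)"

definition ut2 :: "'f::field => 'f => 'f => 'f mat" where
 "ut2 q0 q1 b = mat 2 2 (%(r, s). if r = s then (if r = 0 then q0 else q1) else if r = 0 & s = 1 then b else 0)"

lemma all3: "(\<forall>i<3. P i) \<longleftrightarrow> P 0 & P 1 & P (2::nat)"
 by (auto simp: numeral_3_eq_3 less_Suc_eq numeral_2_eq_2)

lemma all2: "(\<forall>i<2. P i) \<longleftrightarrow> P 0 & P (1::nat)"
 by (auto simp: numeral_2_eq_2 less_Suc_eq)

lemma eq_mat3I:
 assumes "A \<in> carrier_mat 3 3" "B \<in> carrier_mat 3 3" "\<forall>i<3. \<forall>j<3. A $$ (i, j) = B $$ (i, j)"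
 shows "A = B"
 by (rule eq_matI) (use assms in auto)

lemma eq_mat2I:
 assumes "A \<in> carrier_mat 2 2" "B \<in> carrier_mat 2 2" "\<forall>i<2. \<forall>j<2. A $$ (i, j) = B $$ (i, j)"
 shows "A = B"
 by (rule eq_matI) (use assms in auto)

lemma ut3_carrier [simp]: "ut3 q0 q1 q2 b c d \<in> carrier_mat 3 3" by (simp add: ut3_def)
lemma ut2_carrier [simp]: "ut2 q0 q1 b \<in> carrier_mat 2 2" by (simp add: ut2_def)

lemma ut3_entries [simp]:
 "ut3 q0 q1 q2 b c d $$ (0, 0) = q0" "ut3 q0 q1 q2 b c d $$ (Suc 0, Suc 0) = q1" "ut3 q0 q1 q2 b c d $$ (2, 2) = q2"
 "ut3 q0 q1 q2 b c d $$ (0, Suc 0) = b" "ut3 q0 q1 q2 b c d $$ (0, 2) = c" "ut3 q0 q1 q2 b c d $$ (Suc 0, 2) = d"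
 "ut3 q0 q1 q2 b c d $$ (Suc 0, 0) = 0" "ut3 q0 q1 q2 b c d $$ (2, 0) = 0" "ut3 q0 q1 q2 b c d $$ (2, Suc 0) = 0"
 by (simp_all add: ut3_def)

lemma ut2_entries [simp]:
 "ut2 q0 q1 b $$ (0, 0) = q0" "ut2 q0 q1 b $$ (Suc 0, Suc 0) = q1"
 "ut2 q0 q1 b $$ (0, Suc 0) = b" "ut2 q0 q1 b $$ (Suc 0, 0) = 0"
 by (simp_all add: ut2_def)

lemma mult_entry:
 assumes "A \<in> carrier_mat n n" "B \<in> carrier_mat n n" "i < n" "j < n"
 shows "(A * B) $$ (i, j) = (\<Sum>k<n. A $$ (i, k) * B $$ (k, j))"
 using assms by (simp add: scalar_prod_def lessThan_atLeast0)

lemma lessThan_3: "{..<3} = {0, 1, 2::nat}" and lessThan_2: "{..<2} = {0, 1::nat}"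
 by auto

lemma ut3_mult: "ut3 q0 q1 q2 b c d * ut3 q0' q1' q2' b' c' d'
 = ut3 (q0 * q0') (q1 * q1') (q2 * q2') (q0 * b' + b * q1') (q0 * c' + b * d' + c * q2') (q1 * d' + d * q2')"
proof (rule eq_mat3I)
 have m: "ut3 q0 q1 q2 b c d * ut3 q0' q1' q2' b' c' d' \<in> carrier_mat 3 3" by (rule mult_carrier_mat[OF ut3_carrier ut3_carrier])
 then show "ut3 q0 q1 q2 b c d * ut3 q0' q1' q2' b' c' d' \<in> carrier_mat 3 3" .
 have e: "(ut3 q0 q1 q2 b c d * ut3 q0' q1' q2' b' c' d') $$ (i, j)
  = ut3 q0 q1 q2 b c d $$ (i, 0) * ut3 q0' q1' q2' b' c' d' $$ (0, j)
   + (ut3 q0 q1 q2 b c d $$ (i, 1) * ut3 q0' q1' q2' b' c' d' $$ (1, j)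
   + ut3 q0 q1 q2 b c d $$ (i, 2) * ut3 q0' q1' q2' b' c' d' $$ (2, j))" if "i < 3" "j < 3" for i j
  using mult_entry[OF ut3_carrier ut3_carrier that] unfolding lessThan_3 by simp
 have l: "0 < (3::nat)" "1 < (3::nat)" "2 < (3::nat)" by auto
 show "\<forall>i<3. \<forall>j<3. (ut3 q0 q1 q2 b c d * ut3 q0' q1' q2' b' c' d') $$ (i, j)
  = ut3 (q0 * q0') (q1 * q1') (q2 * q2') (q0 * b' + b * q1') (q0 * c' + b * d' + c * q2') (q1 * d' + d * q2') $$ (i, j)"
  unfolding all3 by (simp only: e[OF l(1) l(1)] e[OF l(1) l(2)] e[OF l(1) l(3)] e[OF l(2) l(1)] e[OF l(2) l(2)] e[OF l(2) l(3)]
   e[OF l(3) l(1)] e[OF l(3) l(2)] e[OF l(3) l(3)]) simp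
qed simp

lemma ut2_mult: "ut2 q0 q1 b * ut2 q0' q1' b' = ut2 (q0 * q0') (q1 * q1') (q0 * b' + b * q1')"
proof (rule eq_mat2I)
 show "ut2 q0 q1 b * ut2 q0' q1' b' \<in> carrier_mat 2 2" by (rule mult_carrier_mat[OF ut2_carrier ut2_carrier])
 have e: "(ut2 q0 q1 b * ut2 q0' q1' b') $$ (i, j)
  = ut2 q0 q1 b $$ (i, 0) * ut2 q0' q1' b' $$ (0, j) + ut2 q0 q1 b $$ (i, 1) * ut2 q0' q1' b' $$ (1, j)"
  if "i < 2" "j < 2" for i j
  using mult_entry[OF ut2_carrier ut2_carrier that] unfolding lessThan_2 by simp
 have l: "0 < (2::nat)" "1 < (2::nat)" by auto
 show "\<forall>i<2. \<forall>j<2. (ut2 q0 q1 b * ut2 q0' q1' b') $$ (i, j)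
  = ut2 (q0 * q0') (q1 * q1') (q0 * b' + b * q1') $$ (i, j)"
  unfolding all2 by (simp only: e[OF l(1) l(1)] e[OF l(1) l(2)] e[OF l(2) l(1)] e[OF l(2) l(2)]) simp
qed simp

lemma ut3_add: "ut3 q0 q1 q2 b c d + ut3 q0' q1' q2' b' c' d'
 = ut3 (q0 + q0') (q1 + q1') (q2 + q2') (b + b') (c + c') (d + d')"
 and ut3_smult: "x \<cdot>\<^sub>m ut3 q0 q1 q2 b c d = ut3 (x * q0) (x * q1) (x * q2) (x * b) (x * c) (x * d)"
 and ut3_zero: "0\<^sub>m 3 3 = ut3 0 0 0 0 0 0"
 by (rule eq_matI; simp add: ut3_def)+

lemma ut2_add: "ut2 q0 q1 b + ut2 q0' q1' b' = ut2 (q0 + q0') (q1 + q1') (b + b')"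
 and ut2_smult: "x \<cdot>\<^sub>m ut2 q0 q1 b = ut2 (x * q0) (x * q1) (x * b)"
 and ut2_zero: "0\<^sub>m 2 2 = ut2 0 0 0"
 by (rule eq_matI; simp add: ut2_def)+

text \<open>The five quadratic models differ only in the pattern of the diagonal, so one computation
  with \<open>p\<close>, \<open>q\<close>, \<open>r\<close> serves all of them.\<close>

definition tri3 :: "bool => bool => bool => ('f::field, 'f mat) module" where
 "tri3 p q r = matrix_algebra 3 {ut3 (of_bool p * a) (of_bool q * a) (of_bool r * a) b c d | a b c d. True}"

definition tri2 :: "bool => bool => ('f::field, 'f mat) module" where
 "tri2 p q = matrix_algebra 2 {ut2 (of_bool p * a) (of_bool q * a) b | a b. True}"

lemma assoc_tri3: "assoc_algebra (tri3 p q r :: ('f::field, 'f mat) module)"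
 unfolding tri3_def
proof (rule assoc_matrix_algebra)
 let ?C = "{ut3 (of_bool p * a) (of_bool q * a) (of_bool r * a) b c d | a b c d. True} :: 'f mat set"
 have I: "ut3 q0 q1 q2 b c d \<in> ?C" if "q0 = of_bool p * a" "q1 = of_bool q * a" "q2 = of_bool r * a" for q0 q1 q2 a b c d
  using that by blast
 show "?C \<subseteq> carrier_mat 3 3" by auto
 show "0\<^sub>m 3 3 \<in> ?C" unfolding ut3_zero by (rule I[of _ 0]) auto
 fix x assume "x \<in> ?C"
 then obtain a b c d where x: "x = ut3 (of_bool p * a) (of_bool q * a) (of_bool r * a) b c d" by blast
 show "e \<cdot>\<^sub>m x \<in> ?C" for e unfolding x ut3_smult by (rule I[of _ "e * a"]) auto
 fix y assume "y \<in> ?C"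
 then obtain a' b' c' d' where y: "y = ut3 (of_bool p * a') (of_bool q * a') (of_bool r * a') b' c' d'" by blast
 show "x + y \<in> ?C" unfolding x y ut3_add by (rule I[of _ "a + a'"]) (auto simp: algebra_simps)
 show "x * y \<in> ?C" unfolding x y ut3_mult by (rule I[of _ "a * a'"]) auto
qed

lemma assoc_tri2: "assoc_algebra (tri2 p q :: ('f::field, 'f mat) module)"
 unfolding tri2_def
proof (rule assoc_matrix_algebra)
 let ?C = "{ut2 (of_bool p * a) (of_bool q * a) b | a b. True} :: 'f mat set"
 have I: "ut2 q0 q1 b \<in> ?C" if "q0 = of_bool p * a" "q1 = of_bool q * a" for q0 q1 a b
  using that by blast
 show "?C \<subseteq> carrier_mat 2 2" by auto
 show "0\<^sub>m 2 2 \<in> ?C" unfolding ut2_zero by (rule I[of _ 0]) auto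
 fix x assume "x \<in> ?C"
 then obtain a b where x: "x = ut2 (of_bool p * a) (of_bool q * a) b" by blast
 show "e \<cdot>\<^sub>m x \<in> ?C" for e unfolding x ut2_smult by (rule I[of _ "e * a"]) auto
 fix y assume "y \<in> ?C"
 then obtain a' b' where y: "y = ut2 (of_bool p * a') (of_bool q * a') b'" by blast
 show "x + y \<in> ?C" unfolding x y ut2_add by (rule I[of _ "a + a'"]) (auto simp: algebra_simps)
 show "x * y \<in> ?C" unfolding x y ut2_mult by (rule I[of _ "a * a'"]) auto
qed

lemma tri_simps [simp]:
 "mult (tri3 p q r) = (*)" "add (tri3 p q r) = (+)" "zero (tri3 p q r) = 0\<^sub>m 3 3" "smult (tri3 p q r) = (\<cdot>\<^sub>m)"
 "mult (tri2 p q) = (*)" "add (tri2 p q) = (+)" "zero (tri2 p q) = 0\<^sub>m 2 2" "smult (tri2 p q) = (\<cdot>\<^sub>m)"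
 by (simp_all only: tri3_def tri2_def matrix_algebra_simps)

lemma list_mult_tri3:
 assumes "w ~= []" and a: "\<And>x. a x = ut3 (of_bool p * \<alpha> x) (of_bool q * \<alpha> x) (of_bool r * \<alpha> x) (b x) (c x) (d x)"
 shows "list_mult (tri3 p q r) (map a w) = ut3 (diag_entry p \<alpha> w) (diag_entry q \<alpha> w) (diag_entry r \<alpha> w)
  (step_entry p q \<alpha> b w) (corner_entry p q r \<alpha> b c d w) (step_entry q r \<alpha> d w)"
 using assms(1)
proof (induction w)
 case (Cons x w)
 interpret assoc_algebra "tri3 p q r :: ('a, 'a mat) module" by (rule assoc_tri3)
 show ?case
 proof (cases "w = []")
  case True
  have e: "diag_entry s \<alpha> [] = 1" "diag_entry s \<alpha> [x] = of_bool s * \<alpha> x" for s by (simp_all add: diag_entry_def)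
  show ?thesis using True by (simp add: e a)
 next
  case False
  have "list_mult (tri3 p q r) (map a (x # w)) = a x * list_mult (tri3 p q r) (map a w)"
   using False by (simp add: list_mult_Cons)
  then show ?thesis
   unfolding Cons.IH[OF False] a ut3_mult by (simp only: diag_entry_Cons step_entry.simps corner_entry.simps)
 qed
qed simp

lemma carrier_tri3: "x \<in> carrier (tri3 p q r) \<longleftrightarrow> (\<exists>a b c d. x = ut3 (of_bool p * a) (of_bool q * a) (of_bool r * a) b c d)"
 by (simp add: tri3_def)

lemma carrier_tri2: "x \<in> carrier (tri2 p q) \<longleftrightarrow> (\<exists>a b. x = ut2 (of_bool p * a) (of_bool q * a) b)"
 by (simp add: tri2_def)

lemma poly_eval_tri3:
 assumes f: "f \<in> multilinear_polys n"
  and a: "\<And>x. a x = ut3 (of_bool p * \<alpha> x) (of_bool q * \<alpha> x) (of_bool r * \<alpha> x) (b x) (c x) (d x)"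
 shows "poly_eval (tri3 p q r) a f = ut3 (ev (diag_entry p \<alpha>) f) (ev (diag_entry q \<alpha>) f) (ev (diag_entry r \<alpha>) f)
  (ev (step_entry p q \<alpha> b) f) (ev (corner_entry p q r \<alpha> b c d) f) (ev (step_entry q r \<alpha> d) f)"
proof (rule eq_mat3I)
 let ?A = "tri3 p q r :: ('a, 'a mat) module"
 interpret assoc_algebra ?A by (rule assoc_tri3)
 have ra: "range a \<subseteq> carrier ?A" unfolding image_subset_iff carrier_tri3 using a by blast
 have fc: "x \<in> carrier_mat 3 3" if "x \<in> carrier ?A" for x using that unfolding carrier_tri3 by (elim exE) simp
 show "poly_eval ?A a f \<in> carrier_mat 3 3" by (rule fc[OF poly_eval_closed[OF ra]])
 have ff: "f \<in> free_algebra" using f by (simp add: multilinear_polys_def)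
 have e: "poly_eval ?A a f $$ (i, j) = ev (%w. ut3 (diag_entry p \<alpha> w) (diag_entry q \<alpha> w) (diag_entry r \<alpha> w)
  (step_entry p q \<alpha> b w) (corner_entry p q r \<alpha> b c d w) (step_entry q r \<alpha> d w) $$ (i, j)) f" if ij: "i < 3" "j < 3" for i j
 proof -
  have "poly_eval ?A a f $$ (i, j) = ev (%w. list_mult ?A (map a w) $$ (i, j)) f"
  proof (rule linear_poly_eval[OF assoc_tri3 ra ff])
   fix x y assume "x \<in> carrier ?A" "y \<in> carrier ?A"
   then show "(x \<oplus>\<^bsub>?A\<^esub> y) $$ (i, j) = x $$ (i, j) + y $$ (i, j)" using fc[of x] fc[of y] ij by simp
  next
   fix x and s :: 'a assume "x \<in> carrier ?A"
   then show "(s \<odot>\<^bsub>?A\<^esub> x) $$ (i, j) = s * x $$ (i, j)" using fc[of x] ij by simp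
  qed
  also have "\<dots> = ev (%w. ut3 (diag_entry p \<alpha> w) (diag_entry q \<alpha> w) (diag_entry r \<alpha> w)
   (step_entry p q \<alpha> b w) (corner_entry p q r \<alpha> b c d w) (step_entry q r \<alpha> d w) $$ (i, j)) f"
   by (rule ev_cong) (simp only: list_mult_tri3[OF multilinear_word(1)[OF f] a])
  finally show ?thesis .
 qed
 have l: "0 < (3::nat)" "1 < (3::nat)" "2 < (3::nat)" by auto
 have ev0: "ev (%w. 0) f = 0" by (simp add: ev_def)
 show "\<forall>i<3. \<forall>j<3. poly_eval ?A a f $$ (i, j) = ut3 (ev (diag_entry p \<alpha>) f) (ev (diag_entry q \<alpha>) f) (ev (diag_entry r \<alpha>) f)
  (ev (step_entry p q \<alpha> b) f) (ev (corner_entry p q r \<alpha> b c d) f) (ev (step_entry q r \<alpha> d) f) $$ (i, j)"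
  unfolding all3 by (simp only: e[OF l(1) l(1)] e[OF l(1) l(2)] e[OF l(1) l(3)] e[OF l(2) l(1)] e[OF l(2) l(2)] e[OF l(2) l(3)]
   e[OF l(3) l(1)] e[OF l(3) l(2)] e[OF l(3) l(3)]) (simp add: ev0)
qed simp

lemma ut3_eq_zero: "ut3 q0 q1 q2 b c d = 0\<^sub>m 3 3 \<longleftrightarrow> q0 = 0 & q1 = 0 & q2 = 0 & b = 0 & c = 0 & d = 0"
proof
 assume h: "ut3 q0 q1 q2 b c d = 0\<^sub>m 3 3"
 have "ut3 q0 q1 q2 b c d $$ (i, j) = 0" if "i < 3" "j < 3" for i j using that by (simp add: h)
 from this[of 0 0] this[of 1 1] this[of 2 2] this[of 0 1] this[of 0 2] this[of 1 2]
 show "q0 = 0 & q1 = 0 & q2 = 0 & b = 0 & c = 0 & d = 0" by simp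
qed (simp add: ut3_zero)

lemma ut2_eq_zero: "ut2 q0 q1 b = 0\<^sub>m 2 2 \<longleftrightarrow> q0 = 0 & q1 = 0 & b = 0"
proof
 assume h: "ut2 q0 q1 b = 0\<^sub>m 2 2"
 have "ut2 q0 q1 b $$ (i, j) = 0" if "i < 2" "j < 2" for i j using that by (simp add: h)
 from this[of 0 0] this[of 1 1] this[of 0 1]
 show "q0 = 0 & q1 = 0 & b = 0" by simp
qed (simp add: ut2_zero)

text \<open>Bordering by a zero row and column embeds \<open>tri2 p q\<close> into
  \<open>tri3 p q False\<close>, where evaluations have been computed already.\<close>

lemma poly_eval_tri2_eq_zero:
 assumes f: "f \<in> multilinear_polys n"
  and a: "\<And>x. a x = ut2 (of_bool p * \<alpha> x) (of_bool q * \<alpha> x) (b x)"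
 shows "poly_eval (tri2 p q) a f = 0\<^sub>m 2 2 \<longleftrightarrow>
  ev (diag_entry p \<alpha>) f = 0 & ev (diag_entry q \<alpha>) f = 0 & ev (step_entry p q \<alpha> b) f = 0"
proof -
 let ?A = "tri2 p q :: ('a, 'a mat) module" and ?B = "tri3 p q False :: ('a, 'a mat) module"
 let ?h = "%M. ut3 (M $$ (0, 0)) (M $$ (1, 1)) 0 (M $$ (0, 1)) 0 0"
 interpret assoc_algebra ?A by (rule assoc_tri2)
 have hom: "alg_hom ?A ?B ?h"
  unfolding alg_hom_def
 proof (intro conjI ballI allI)
  fix x y s assume "x \<in> carrier ?A"
  then obtain t u where x: "x = ut2 (of_bool p * t) (of_bool q * t) u" unfolding carrier_tri2 by (elim exE) (rule that)
  show "?h x \<in> carrier ?B" unfolding carrier_tri3 x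
   by (rule exI[of _ t], rule exI[of _ u], rule exI[of _ 0], rule exI[of _ 0]) simp
  show "?h (s \<odot>\<^bsub>?A\<^esub> x) = s \<odot>\<^bsub>?B\<^esub> ?h x" by (simp add: x ut2_smult ut3_smult)
  assume "y \<in> carrier ?A"
  then obtain t' u' where y: "y = ut2 (of_bool p * t') (of_bool q * t') u'" unfolding carrier_tri2 by (elim exE) (rule that)
  show "?h (x \<oplus>\<^bsub>?A\<^esub> y) = ?h x \<oplus>\<^bsub>?B\<^esub> ?h y" by (simp add: x y ut2_add ut3_add)
  show "?h (x \<otimes>\<^bsub>?A\<^esub> y) = ?h x \<otimes>\<^bsub>?B\<^esub> ?h y" by (simp add: x y ut2_mult ut3_mult)
 qed
 have ra: "range a \<subseteq> carrier ?A" unfolding image_subset_iff carrier_tri2 using a by blast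
 obtain x y z where P: "poly_eval ?A a f = ut2 x y z"
  using poly_eval_closed[OF ra, of f] unfolding carrier_tri2 by (elim exE) (rule that)
 have h: "?h (a x) = ut3 (of_bool p * \<alpha> x) (of_bool q * \<alpha> x) (of_bool False * \<alpha> x) (b x) 0 0" for x by (simp add: a)
 have "?h (poly_eval ?A a f) = poly_eval ?B (%x. ?h (a x)) f" by (rule hom_poly_eval(2)[OF assoc_tri2 assoc_tri3 hom ra])
 note e = this[unfolded poly_eval_tri3[where a = "%x. ?h (a x)" and c = "%_. 0" and d = "%_. 0", OF f h], unfolded P]
 show ?thesis
  using arg_cong[OF e, of "%M. M $$ (0, 0)"] arg_cong[OF e, of "%M. M $$ (1, 1)"] arg_cong[OF e, of "%M. M $$ (0, 1)"]
  unfolding P ut2_eq_zero by simp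
qed

lemma sum_of_bool_index: "i < n ==> (\<Sum>k<n. of_bool (k = i) * h k) = (h i :: 'f::field)" for i n :: nat
proof -
 assume "i < n"
 have "(\<Sum>k<n. of_bool (k = i) * h k) = (\<Sum>k<n. if k = i then h k else 0)" by (rule sum.cong) auto
 then show ?thesis using \<open>i < n\<close> by (simp add: sum.delta)
qed

text \<open>Evaluations are linear combinations of the statistics. Conversely, diagonal values 1
  together with off-diagonal entries supported at a single letter or pair of letters extract each
  statistic; the total is visible on an occupied diagonal position.\<close>

lemma identities_tri3:
 assumes f: "f \<in> multilinear_polys n" and pq: "p \<or> q \<or> r"
 shows "f \<in> identities (tri3 p q r) \<longleftrightarrow> word_count f (%w. True) = 0 &
  (\<forall>i<n. word_count f (single_at p q i) = 0 & word_count f (single_at q r i) = 0 & word_count f (single_at p r i) = 0) &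
  (\<forall>i<n. \<forall>j<n. word_count f (double_at p q r i j) = 0)" (is "?L \<longleftrightarrow> ?R")
proof
 let ?A = "tri3 p q r :: ('a, 'a mat) module"
 have ff: "f \<in> free_algebra" using f by (simp add: multilinear_polys_def)
 have zero: "\<zero>\<^bsub>?A\<^esub> = 0\<^sub>m 3 3" by simp
 {
  assume L: ?L
  have z: "ev (diag_entry p \<alpha>) f = 0 & ev (diag_entry q \<alpha>) f = 0 & ev (diag_entry r \<alpha>) f = 0 &
   ev (step_entry p q \<alpha> b) f = 0 & ev (corner_entry p q r \<alpha> b c d) f = 0 & ev (step_entry q r \<alpha> d) f = 0" for \<alpha> b c d
  proof -
   define a where "a x = ut3 (of_bool p * \<alpha> x) (of_bool q * \<alpha> x) (of_bool r * \<alpha> x) (b x) (c x) (d x)" for x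
   have "range a \<subseteq> carrier ?A" unfolding image_subset_iff carrier_tri3 a_def by blast
   then have "poly_eval ?A a f = 0\<^sub>m 3 3" using L zero by (simp add: identities_def)
   then show ?thesis unfolding poly_eval_tri3[OF f a_def] ut3_eq_zero .
  qed
  have tot: "word_count f (%w. True) = 0"
  proof -
   have "of_bool p * word_count f (%w. True) = 0" "of_bool q * word_count f (%w. True) = 0"
    "of_bool r * word_count f (%w. True) = 0"
    using z[of "%_. 1"] unfolding ev_diag_entry[OF f] by simp_all
   then show ?thesis using pq by auto
  qed
  have st: "word_count f (single_at s t i) = 0" if "\<And>b. ev (step_entry s t (%_. 1) b) f = 0" "i < n" for s t i
   using that(1)[of "%k. of_bool (k = i)"]
   by (simp only: ev_step_entry[OF f] prod.neutral_const mult_1_right sum_of_bool_index[OF that(2)])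
  have "word_count f (single_at p q i) = 0" "word_count f (single_at q r i) = 0" if "i < n" for i
   by (rule st[OF _ that], use z in blast)+
  moreover have "word_count f (single_at p r i) = 0" if i: "i < n" for i
  proof -
   have "(\<Sum>k<n. of_bool (k = i) * word_count f (single_at p r k)) = 0"
    using z[of "%_. 1" "%_. 0" "%k. of_bool (k = i)" "%_. 0"] unfolding ev_corner_entry[OF f] by simp
   then show ?thesis unfolding sum_of_bool_index[OF i] .
  qed
  moreover have "word_count f (double_at p q r i j) = 0" if i: "i < n" and j: "j < n" for i j
  proof -
   have "(\<Sum>k<n. \<Sum>l<n. of_bool (k = i) * of_bool (l = j) * word_count f (double_at p q r k l)) = 0"
    using z[of "%_. 1" "%k. of_bool (k = i)" "%_. 0" "%k. of_bool (k = j)"] unfolding ev_corner_entry[OF f] by simp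
   then have "(\<Sum>k<n. of_bool (k = i) * (\<Sum>l<n. of_bool (l = j) * word_count f (double_at p q r k l))) = 0"
    by (simp only: sum_distrib_left mult.assoc)
   then show ?thesis unfolding sum_of_bool_index[OF i] sum_of_bool_index[OF j] .
  qed
  ultimately show ?R using tot by blast
 }
 assume R: ?R
 have "poly_eval ?A a f = \<zero>\<^bsub>?A\<^esub>" if a: "range a \<subseteq> carrier ?A" for a
 proof -
  have "\<exists>t. a x = ut3 (of_bool p * t) (of_bool q * t) (of_bool r * t) (a x $$ (0, 1)) (a x $$ (0, 2)) (a x $$ (1, 2))" for x
  proof -
   have "a x \<in> carrier ?A" using a by auto
   then obtain t b c d where "a x = ut3 (of_bool p * t) (of_bool q * t) (of_bool r * t) b c d"
    unfolding carrier_tri3 by (elim exE) (rule that)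
   then show ?thesis by (intro exI[of _ t]) simp
  qed
  then have "\<forall>x. \<exists>t. a x = ut3 (of_bool p * t) (of_bool q * t) (of_bool r * t) (a x $$ (0, 1)) (a x $$ (0, 2)) (a x $$ (1, 2))" ..
  from choice[OF this] obtain \<alpha> where
   "\<forall>x. a x = ut3 (of_bool p * \<alpha> x) (of_bool q * \<alpha> x) (of_bool r * \<alpha> x) (a x $$ (0, 1)) (a x $$ (0, 2)) (a x $$ (1, 2))"
   by (elim exE) (rule that)
  note e = this[rule_format]
  show ?thesis unfolding zero poly_eval_tri3[OF f e] ut3_eq_zero
   unfolding ev_diag_entry[OF f] ev_step_entry[OF f] ev_corner_entry[OF f] using R by simp
 qed
 then show ?L using ff by (simp add: identities_def)
qed

lemma identities_tri2:
 assumes f: "f \<in> multilinear_polys n" and pq: "p \<or> q"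
 shows "f \<in> identities (tri2 p q) \<longleftrightarrow> word_count f (%w. True) = 0 & (\<forall>i<n. word_count f (single_at p q i) = 0)" (is "?L \<longleftrightarrow> ?R")
proof
 let ?A = "tri2 p q :: ('a, 'a mat) module"
 have ff: "f \<in> free_algebra" using f by (simp add: multilinear_polys_def)
 have zero: "\<zero>\<^bsub>?A\<^esub> = 0\<^sub>m 2 2" by simp
 {
  assume L: ?L
  have z: "ev (diag_entry p \<alpha>) f = 0 & ev (diag_entry q \<alpha>) f = 0 & ev (step_entry p q \<alpha> b) f = 0" for \<alpha> b
  proof -
   define a where "a x = ut2 (of_bool p * \<alpha> x) (of_bool q * \<alpha> x) (b x)" for x
   have "range a \<subseteq> carrier ?A" unfolding image_subset_iff carrier_tri2 a_def by blast
   then have "poly_eval ?A a f = 0\<^sub>m 2 2" using L zero by (simp add: identities_def)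
   then show ?thesis unfolding poly_eval_tri2_eq_zero[OF f a_def] .
  qed
  have "of_bool p * word_count f (%w. True) = 0" "of_bool q * word_count f (%w. True) = 0"
   using z[of "%_. 1"] unfolding ev_diag_entry[OF f] by simp_all
  then have "word_count f (%w. True) = 0" using pq by auto
  moreover have "word_count f (single_at p q i) = 0" if "i < n" for i
   using conjunct2[OF conjunct2[OF z[of "%_. 1" "%k. of_bool (k = i)"]]]
   by (simp only: ev_step_entry[OF f] prod.neutral_const mult_1_right sum_of_bool_index[OF that])
  ultimately show ?R by blast
 }
 assume R: ?R
 have "poly_eval ?A a f = \<zero>\<^bsub>?A\<^esub>" if a: "range a \<subseteq> carrier ?A" for a
 proof -
  have "\<exists>t. a x = ut2 (of_bool p * t) (of_bool q * t) (a x $$ (0, 1))" for x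
  proof -
   have "a x \<in> carrier ?A" using a by auto
   then obtain t b where "a x = ut2 (of_bool p * t) (of_bool q * t) b"
    unfolding carrier_tri2 by (elim exE) (rule that)
   then show ?thesis by (intro exI[of _ t]) simp
  qed
  then have "\<forall>x. \<exists>t. a x = ut2 (of_bool p * t) (of_bool q * t) (a x $$ (0, 1))" ..
  from choice[OF this] obtain \<alpha> where "\<forall>x. a x = ut2 (of_bool p * \<alpha> x) (of_bool q * \<alpha> x) (a x $$ (0, 1))"
   by (elim exE) (rule that)
  note e = this[rule_format]
  show ?thesis unfolding zero poly_eval_tri2_eq_zero[OF f e]
   unfolding ev_diag_entry[OF f] ev_step_entry[OF f] using R by simp
 qed
 then show ?L using ff by (simp add: identities_def)
qed

lemma A2_eq: "A2 = (tri3 True True True :: ('f::field, 'f mat) module)" and A4_eq: "A4 = (tri3 True False False :: ('f, 'f mat) module)"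
 and A4_star_eq: "A4_star = (tri3 False False True :: ('f, 'f mat) module)" and A5_eq: "A5 = (tri3 False True False :: ('f, 'f mat) module)"
 and A6_eq: "A6 = (tri3 True False True :: ('f, 'f mat) module)"
proof -
 have m: "a \<cdot>\<^sub>m (e3 1 1 + e3 2 2 + e3 3 3) + b \<cdot>\<^sub>m e3 1 2 + c \<cdot>\<^sub>m e3 1 3 + d \<cdot>\<^sub>m e3 2 3 = ut3 a a a b c d"
  "a \<cdot>\<^sub>m e3 1 1 + b \<cdot>\<^sub>m e3 1 2 + c \<cdot>\<^sub>m e3 1 3 + d \<cdot>\<^sub>m e3 2 3 = ut3 a 0 0 b c d"
  "a \<cdot>\<^sub>m e3 3 3 + b \<cdot>\<^sub>m e3 1 2 + c \<cdot>\<^sub>m e3 1 3 + d \<cdot>\<^sub>m e3 2 3 = ut3 0 0 a b c d"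
  "a \<cdot>\<^sub>m e3 2 2 + b \<cdot>\<^sub>m e3 1 2 + c \<cdot>\<^sub>m e3 1 3 + d \<cdot>\<^sub>m e3 2 3 = ut3 0 a 0 b c d"
  "a \<cdot>\<^sub>m (e3 1 1 + e3 3 3) + b \<cdot>\<^sub>m e3 1 2 + c \<cdot>\<^sub>m e3 1 3 + d \<cdot>\<^sub>m e3 2 3 = ut3 a 0 a b c d" for a b c d :: 'f
  by (rule eq_mat3I; simp add: all3 mat_unit_def ut3_def)+
 show "A2 = (tri3 True True True :: ('f, 'f mat) module)" "A4 = (tri3 True False False :: ('f, 'f mat) module)"
  "A4_star = (tri3 False False True :: ('f, 'f mat) module)" "A5 = (tri3 False True False :: ('f, 'f mat) module)"
  "A6 = (tri3 True False True :: ('f, 'f mat) module)"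
  unfolding A2_def A4_def A4_star_def A5_def A6_def tri3_def m by simp_all
qed

lemma A1_eq: "A1 = (tri2 True False :: ('f::field, 'f mat) module)" and A1_star_eq: "A1_star = (tri2 False True :: ('f, 'f mat) module)"
proof -
 have m: "a \<cdot>\<^sub>m e2 1 1 + b \<cdot>\<^sub>m e2 1 2 = ut2 a 0 b" "a \<cdot>\<^sub>m e2 2 2 + b \<cdot>\<^sub>m e2 1 2 = ut2 0 a b" for a b :: 'f
  by (rule eq_mat2I; simp add: all2 mat_unit_def ut2_def)+
 show "A1 = (tri2 True False :: ('f, 'f mat) module)" "A1_star = (tri2 False True :: ('f, 'f mat) module)"
  unfolding A1_def A1_star_def tri2_def m by simp_all
qed

lemma word_count_cong: "(\<And>w. w \<in> supp f ==> S w = S' w) ==> word_count f S = word_count f S'"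
 unfolding word_count_def by (rule ev_cong) simp

lemma word_count_none: "(\<And>w. w \<in> supp f ==> \<not> S w) ==> word_count f S = 0"
 by (simp add: word_count_def ev_def)

lemma single_at_last: "w ~= [] ==> single_at True False i w \<longleftrightarrow> last w = i"
 by (cases w rule: rev_cases) (auto simp: single_at_def)

lemma single_at_hd: "w ~= [] ==> single_at False True i w \<longleftrightarrow> hd w = i"
 by (cases w) (auto simp: single_at_def)

lemma single_at_mem: "single_at True True i w \<longleftrightarrow> i \<in> set w"
 by (simp add: single_at_def in_set_conv_decomp)

lemma single_at_only: "single_at False False i w \<longleftrightarrow> w = [i]"
 by (auto simp: single_at_def)

lemma double_at_bef: "double_at True True True i j w \<longleftrightarrow> bef i j w"
 by (simp add: double_at_def bef_def)

lemma double_at_ends: "double_at True False False i j w \<longleftrightarrow> endsw i j w"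
 by (simp add: double_at_def endsw_def)

lemma double_at_starts: "double_at False False True i j w \<longleftrightarrow> startsw i j w"
 by (simp add: double_at_def startsw_def)

lemma double_at_adj: "double_at True False True i j w \<longleftrightarrow> adjw i j w"
 by (simp add: double_at_def adjw_def)

lemma double_at_outer:
 assumes "i ~= j" "w ~= []"
 shows "double_at False True False i j w \<longleftrightarrow> outerw i j w"
proof
 assume "double_at False True False i j w"
 then show "outerw i j w" by (auto simp: double_at_def outerw_def)
next
 assume h: "outerw i j w"
 obtain x w' where w: "w = x # w'" using assms(2) by (cases w) auto
 then have "w' ~= []" using h assms(1) by (auto simp: outerw_def)
 then obtain m y where "w' = m @ [y]" by (cases w' rule: rev_cases) auto
 then show "double_at False True False i j w" using h w by (auto simp: double_at_def outerw_def)
qed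

lemma double_at_distinct: "distinct w ==> \<not> double_at p q r i i w"
 by (auto simp: double_at_def)

context
 fixes f :: "'f::field_char_0 nc_poly" and n assumes f: "f \<in> multilinear_polys n"
begin

lemma word_count_hd: "word_count f (single_at False True i) = word_count f (%w. hd w = i)"
 and word_count_last: "word_count f (single_at True False i) = word_count f (%w. last w = i)"
 by (rule word_count_cong; simp add: single_at_hd single_at_last multilinear_word[OF f])+

lemma word_count_mem: "i < n ==> word_count f (single_at True True i) = word_count f (%w. True)"
 by (rule word_count_cong) (simp add: single_at_mem multilinear_word[OF f])

lemma word_count_only:
 assumes "word_count f (%w. True) = 0" "i < n"
 shows "word_count f (single_at False False i) = 0"
proof (cases "n = 1")
 case True
 have "word_count f (single_at False False i) = word_count f (%w. True)"
 proof (rule word_count_cong)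
  fix w assume "w \<in> supp f"
  then have w: "distinct w" "set w = {i}" using multilinear_word[OF f] True assms(2) by auto
  then have "length w = 1" using distinct_card[of w] by simp
  then obtain x where "w = [x]" by (cases w) auto
  then show "single_at False False i w = True" using w by (simp add: single_at_only)
 qed
 then show ?thesis using assms(1) by simp
next
 case False
 show ?thesis
 proof (rule word_count_none)
  fix w assume w: "w \<in> supp f"
  then have "length w = n" using distinct_card[of w] multilinear_word[OF f] by simp
  then show "\<not> single_at False False i w" using False by (auto simp: single_at_only)
 qed
qed

lemma word_count_diagonal: "word_count f (double_at p q r i i) = 0"
 by (rule word_count_none) (rule double_at_distinct[OF multilinear_word(2)[OF f]])

lemma word_count_outer: "i ~= j ==> word_count f (double_at False True False i j) = word_count f (outerw i j)"
 by (rule word_count_cong) (simp add: double_at_outer multilinear_word[OF f])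

lemma all_pairs: "(\<forall>i<n. \<forall>j<n. word_count f (double_at p q r i j) = 0)
  \<longleftrightarrow> (\<forall>i<n. \<forall>j<n. i ~= j --> word_count f (double_at p q r i j) = 0)"
proof (intro iffI allI impI)
 fix i j assume "\<forall>i<n. \<forall>j<n. i ~= j --> word_count f (double_at p q r i j) = 0" "i < n" "j < n"
 then show "word_count f (double_at p q r i j) = 0" by (cases "i = j") (simp_all add: word_count_diagonal)
qed simp

lemma identities_A1: "f \<in> identities A1 \<longleftrightarrow> word_count f (%w. True) = 0 & (\<forall>i<n. word_count f (%w. last w = i) = 0)"
 unfolding A1_eq by (subst identities_tri2[OF f]) (simp_all add: word_count_last)

lemma identities_A1_star: "f \<in> identities A1_star \<longleftrightarrow> word_count f (%w. True) = 0 & (\<forall>i<n. word_count f (%w. hd w = i) = 0)"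
 unfolding A1_star_eq by (subst identities_tri2[OF f]) (simp_all add: word_count_hd)

lemma identities_A2: "f \<in> identities A2 \<longleftrightarrow> word_count f (%w. True) = 0 &
  (\<forall>i<n. \<forall>j<n. i ~= j --> word_count f (bef i j) = 0)"
proof -
 have e: "double_at True True True i j = bef i j" for i j by (rule ext) (rule double_at_bef)
 have "f \<in> identities A2 \<longleftrightarrow> word_count f (%w. True) = 0 &
  (\<forall>i<n. word_count f (single_at True True i) = 0 & word_count f (single_at True True i) = 0 & word_count f (single_at True True i) = 0) &
  (\<forall>i<n. \<forall>j<n. word_count f (double_at True True True i j) = 0)"
  unfolding A2_eq by (rule identities_tri3[OF f]) simp
 then show ?thesis unfolding all_pairs unfolding e using word_count_mem by auto
qed

lemma identities_A4: "f \<in> identities A4 \<longleftrightarrow> word_count f (%w. True) = 0 &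
  (\<forall>i<n. word_count f (%w. last w = i) = 0) & (\<forall>i<n. \<forall>j<n. i ~= j --> word_count f (endsw i j) = 0)"
proof -
 have e: "double_at True False False i j = endsw i j" for i j by (rule ext) (rule double_at_ends)
 have "f \<in> identities A4 \<longleftrightarrow> word_count f (%w. True) = 0 &
  (\<forall>i<n. word_count f (single_at True False i) = 0 & word_count f (single_at False False i) = 0 & word_count f (single_at True False i) = 0) &
  (\<forall>i<n. \<forall>j<n. word_count f (double_at True False False i j) = 0)"
  unfolding A4_eq by (rule identities_tri3[OF f]) simp
 then show ?thesis unfolding all_pairs unfolding e word_count_last using word_count_only by auto
qed

lemma identities_A4_star: "f \<in> identities A4_star \<longleftrightarrow> word_count f (%w. True) = 0 &
  (\<forall>i<n. word_count f (%w. hd w = i) = 0) & (\<forall>i<n. \<forall>j<n. i ~= j --> word_count f (startsw i j) = 0)"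
proof -
 have e: "double_at False False True i j = startsw i j" for i j by (rule ext) (rule double_at_starts)
 have "f \<in> identities A4_star \<longleftrightarrow> word_count f (%w. True) = 0 &
  (\<forall>i<n. word_count f (single_at False False i) = 0 & word_count f (single_at False True i) = 0 & word_count f (single_at False True i) = 0) &
  (\<forall>i<n. \<forall>j<n. word_count f (double_at False False True i j) = 0)"
  unfolding A4_star_eq by (rule identities_tri3[OF f]) simp
 then show ?thesis unfolding all_pairs unfolding e word_count_hd using word_count_only by auto
qed

lemma identities_A5: "f \<in> identities A5 \<longleftrightarrow> word_count f (%w. True) = 0 &
  (\<forall>i<n. word_count f (%w. hd w = i) = 0) & (\<forall>i<n. word_count f (%w. last w = i) = 0) &
  (\<forall>i<n. \<forall>j<n. i ~= j --> word_count f (outerw i j) = 0)"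
proof -
 have "f \<in> identities A5 \<longleftrightarrow> word_count f (%w. True) = 0 &
  (\<forall>i<n. word_count f (single_at False True i) = 0 & word_count f (single_at True False i) = 0 & word_count f (single_at False False i) = 0) &
  (\<forall>i<n. \<forall>j<n. word_count f (double_at False True False i j) = 0)"
  unfolding A5_eq by (rule identities_tri3[OF f]) simp
 then show ?thesis unfolding all_pairs unfolding word_count_hd word_count_last
  using word_count_only word_count_outer by auto
qed

lemma identities_A6: "f \<in> identities A6 \<longleftrightarrow> word_count f (%w. True) = 0 &
  (\<forall>i<n. word_count f (%w. hd w = i) = 0) & (\<forall>i<n. word_count f (%w. last w = i) = 0) &
  (\<forall>i<n. \<forall>j<n. i ~= j --> word_count f (adjw i j) = 0)"
proof -
 have e: "double_at True False True i j = adjw i j" for i j by (rule ext) (rule double_at_adj)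
 have "f \<in> identities A6 \<longleftrightarrow> word_count f (%w. True) = 0 &
  (\<forall>i<n. word_count f (single_at True False i) = 0 & word_count f (single_at False True i) = 0 & word_count f (single_at True True i) = 0) &
  (\<forall>i<n. \<forall>j<n. word_count f (double_at True False True i j) = 0)"
  unfolding A6_eq by (rule identities_tri3[OF f]) simp
 then show ?thesis unfolding all_pairs unfolding word_count_hd word_count_last e
  using word_count_mem by auto
qed

end

section \<open>From an identity violated in a model to a relation of degree at least three\<close>

lemma coef_pad: "coef (mono u * g * mono v) w = ev (%x. of_bool (u @ x @ v = w)) g"
 unfolding coef_eq_ev ev_context ..

lemma word_count_pad: "word_count (mono u * g * mono v) S = word_count g (%w. S (u @ w @ v))"
 unfolding word_count_def ev_context ..

lemma pad_multilinear:
 assumes g: "g \<in> multilinear_polys d" and uv: "distinct (u @ v)" "set (u @ v) = {d..<e}" "d <= e"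
 shows "mono u * g * mono v \<in> multilinear_polys e"
 unfolding multilinear_polys_alt
proof (intro CollectI subsetI)
 fix w assume "w \<in> supp (mono u * g * mono v)"
 then have "ev (%x. of_bool (u @ x @ v = w)) g ~= 0" by (simp add: in_keys_iff coef_pad)
 then obtain x where x: "x \<in> supp g" "coef g x * of_bool (u @ x @ v = w) ~= 0"
  unfolding ev_def by (rule sum.not_neutral_contains_not_neutral)
 have w: "w = u @ x @ v" using x(2) by (cases "u @ x @ v = w") simp_all
 note X = multilinear_word[OF g x(1)]
 have "set w = set x \<union> set (u @ v)" unfolding w by auto
 also have "\<dots> = {..<e}" unfolding X(3) uv(2) by (rule ivl_disj_un_one(2)[OF uv(3)])
 finally have "set w = {..<e}" .
 moreover have "set x \<inter> set (u @ v) = {}" unfolding X(3) uv(2) by auto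
 then have "distinct w" unfolding w using X(2) uv(1) by auto
 ultimately show "w ~= [] & distinct w & set w = {..<e}" using X(1) by (simp add: w)
qed

text \<open>Multiplying by three new letters secures degree at least 3. Their placement also lets a
  coarser nonzero statistic, such as the total or the count of a first letter, reappear as the finer
  one that is wanted.\<close>

lemma has_relation_pad:
 assumes T: "T_ideal T" and g: "g \<in> T" "g \<in> multilinear_polys d" and uv: "u @ v = [d, d + 1, d + 2]"
  and ij: "i < d + 3" "j < d + 3" "i ~= j" and S: "S i j (mono u * g * mono v)"
 shows "\<exists>D. has_relation T D S"
proof -
 have "mono u * g * mono v \<in> multilinear_polys (d + 3)"
  by (rule pad_multilinear[OF g(2)]) (auto simp: uv)
 moreover have "mono u * g * mono v \<in> T" by (rule T_ideal_context[OF T g(1)])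
 ultimately have "has_relation T (d + 3) S" unfolding has_relation_def
  using ij S by (intro exI[of _ "d + 3"] exI[of _ "mono u * g * mono v"] exI[of _ i] exI[of _ j]) simp
 then show ?thesis ..
qed

lemma startsw_Cons: "startsw i j (x # w) \<longleftrightarrow> x = i & w ~= [] & hd w = j"
 by (cases w) (auto simp: startsw_def)

lemma endsw_snoc: "endsw i j (w @ [x]) \<longleftrightarrow> x = j & w ~= [] & last w = i"
 by (cases w rule: rev_cases) (auto simp: endsw_def)

lemma adjw_not_mem: "i ~: set w \<or> j ~: set w ==> \<not> adjw i j w"
 by (auto simp: adjw_def)

lemma bef_not_mem: "i ~: set w \<or> j ~: set w ==> \<not> bef i j w"
 by (auto simp: bef_def)

lemma adjw_Cons_iff: "adjw i j (x # w) \<longleftrightarrow> adjw i j w \<or> (w ~= [] & x = i & hd w = j)"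
proof
 assume "adjw i j (x # w)"
 then obtain u v where "x # w = u @ i # j # v" unfolding adjw_def by (elim exE) (rule that)
 then show "adjw i j w \<or> (w ~= [] & x = i & hd w = j)" by (cases u) (auto simp: adjw_def)
next
 assume "adjw i j w \<or> (w ~= [] & x = i & hd w = j)"
 then show "adjw i j (x # w)"
 proof
  assume "adjw i j w"
  then obtain u v where "w = u @ i # j # v" unfolding adjw_def by (elim exE) (rule that)
  then have "x # w = (x # u) @ i # j # v" by simp
  then show ?thesis unfolding adjw_def by (intro exI)
 next
  assume "w ~= [] & x = i & hd w = j"
  then have "x # w = [] @ i # j # tl w" by (cases w) auto
  then show ?thesis unfolding adjw_def by (intro exI)
 qed
qed

lemma adjw_append: "adjw i j (u @ v) \<longleftrightarrow> adjw i j u \<or> adjw i j v \<or> (u ~= [] & v ~= [] & last u = i & hd v = j)"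
proof (induction u)
 case (Cons x u)
 show ?case by (cases "u = []") (auto simp: adjw_Cons_iff Cons.IH adjw_def[of i j "[]"])
qed (simp add: adjw_def[of i j "[]"])

lemma bef_Cons_iff: "bef i j (x # w) \<longleftrightarrow> bef i j w \<or> (x = i & j \<in> set w)"
proof
 assume "bef i j (x # w)"
 then obtain u v t where "x # w = u @ i # v @ j # t" unfolding bef_def by (elim exE) (rule that)
 then show "bef i j w \<or> (x = i & j \<in> set w)" by (cases u) (auto simp: bef_def)
next
 assume "bef i j w \<or> (x = i & j \<in> set w)"
 then show "bef i j (x # w)"
 proof
  assume "bef i j w"
  then obtain u v t where "w = u @ i # v @ j # t" unfolding bef_def by (elim exE) (rule that)
  then have "x # w = (x # u) @ i # v @ j # t" by simp
  then show ?thesis unfolding bef_def by (intro exI)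
 next
  assume h: "x = i & j \<in> set w"
  then obtain v t where "w = v @ j # t" by (meson in_set_conv_decomp)
  then have "x # w = [] @ i # v @ j # t" using h by simp
  then show ?thesis unfolding bef_def by (intro exI)
 qed
qed

lemma bef_append: "bef i j (u @ v) \<longleftrightarrow> bef i j u \<or> bef i j v \<or> (i \<in> set u & j \<in> set v)"
 by (induction u) (auto simp: bef_Cons_iff bef_def[of i j "[]"])

lemma adjw_Cons: "x ~= i ==> adjw i j (x # w) \<longleftrightarrow> adjw i j w"
 and bef_Cons: "x ~= i ==> bef i j (x # w) \<longleftrightarrow> bef i j w"
 by (simp_all add: adjw_Cons_iff bef_Cons_iff)

lemma bef_Cons_self: "x ~: set w ==> bef x j (x # w) \<longleftrightarrow> j \<in> set w"
 and adjw_hd: "x ~: set w ==> adjw x j (x # w) \<longleftrightarrow> w ~= [] & hd w = j"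
 by (auto simp: bef_Cons_iff adjw_Cons_iff bef_not_mem adjw_not_mem)

lemma adjw_last:
 assumes "x ~: set w" "x ~: set v"
 shows "adjw i x (w @ x # v) \<longleftrightarrow> w ~= [] & last w = i"
proof -
 have "hd v ~= x" if "v ~= []" using hd_in_set[OF that] assms(2) by blast
 then show ?thesis using assms by (auto simp: adjw_append adjw_Cons_iff adjw_not_mem)
qed

context
 fixes T :: "'f::field_char_0 nc_poly set" and g d
 assumes T: "T_ideal T" and g: "g \<in> T" "g \<in> multilinear_polys d"
begin

lemma word_facts:
 assumes "w \<in> supp g"
 shows "w ~= []" "distinct w" "set w = {..<d}" "hd w < d" "last w < d" "length w = d"
  "d ~: set w" "Suc d ~: set w" "Suc (Suc d) ~: set w"
proof -
 note W = multilinear_word[OF g(2) assms]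
 show "w ~= []" "distinct w" "set w = {..<d}" by (fact W)+
 show "hd w < d" "last w < d" using hd_in_set[OF W(1)] last_in_set[OF W(1)] unfolding W(3) by simp_all
 show "length w = d" using distinct_card[OF W(2)] unfolding W(3) by simp
 show "d ~: set w" "Suc d ~: set w" "Suc (Suc d) ~: set w" unfolding W(3) by simp_all
qed

lemma pad_relation:
 assumes "u @ v = [d, d + 1, d + 2]" "i < d + 3" "j < d + 3" "i ~= j"
  and "\<And>w. w \<in> supp g ==> S (u @ w @ v) = S' w" "word_count g S' ~= 0"
  and "\<And>f. word_count f S ~= 0 ==> R i j f"
 shows "\<exists>D. has_relation T D R"
proof (rule has_relation_pad[OF T g assms(1-4)])
 have "word_count (mono u * g * mono v) S = word_count g S'"
  unfolding word_count_pad by (rule word_count_cong) (rule assms(5))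
 then show "R i j (mono u * g * mono v)" by (intro assms(7)) (use assms(6) in simp)
qed

lemma relation_first:
 assumes "word_count g (%w. True) ~= 0 \<or> (\<exists>i<d. word_count g (%w. hd w = i) ~= 0)"
 shows "\<exists>D. has_relation T D rel_first"
 using assms
proof
 assume h: "word_count g (%w. True) ~= 0"
 show ?thesis
  by (rule pad_relation[of "[d]" "[d + 1, d + 2]" d "d + 1" "%w. hd w = d", OF _ _ _ _ _ h]) (simp_all add: rel_first_def)
next
 assume "\<exists>i<d. word_count g (%w. hd w = i) ~= 0"
 then obtain i where i: "i < d" and h: "word_count g (%w. hd w = i) ~= 0" by blast
 show ?thesis
  by (rule pad_relation[of "[]" "[d, d + 1, d + 2]" i d "%w. hd w = i", OF _ _ _ _ _ h])
   (use i in \<open>simp_all add: rel_first_def word_facts(1)\<close>)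
qed

lemma relation_last:
 assumes "word_count g (%w. True) ~= 0 \<or> (\<exists>i<d. word_count g (%w. last w = i) ~= 0)"
 shows "\<exists>D. has_relation T D rel_last"
 using assms
proof
 assume h: "word_count g (%w. True) ~= 0"
 show ?thesis
  by (rule pad_relation[of "[d]" "[d + 1, d + 2]" "d + 2" d "%w. last w = d + 2", OF _ _ _ _ _ h]) (simp_all add: rel_last_def)
next
 assume "\<exists>i<d. word_count g (%w. last w = i) ~= 0"
 then obtain i where i: "i < d" and h: "word_count g (%w. last w = i) ~= 0" by blast
 show ?thesis
  by (rule pad_relation[of "[d, d + 1, d + 2]" "[]" i d "%w. last w = i", OF _ _ _ _ _ h])
   (use i in \<open>simp_all add: rel_last_def word_facts(1)\<close>)
qed

lemma relation_starts:
 assumes "word_count g (%w. True) ~= 0 \<or> (\<exists>i<d. word_count g (%w. hd w = i) ~= 0) \<or>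
  (\<exists>i<d. \<exists>j<d. i ~= j & word_count g (startsw i j) ~= 0)"
 shows "\<exists>D. has_relation T D rel_starts"
proof -
 consider (a) "word_count g (%w. True) ~= 0" | (b) i where "i < d" "word_count g (%w. hd w = i) ~= 0"
  | (c) i j where "i < d" "j < d" "i ~= j" "word_count g (startsw i j) ~= 0"
  using assms by blast
 then show ?thesis
 proof cases
  case a
  show ?thesis
   by (rule pad_relation[of "[d, d + 1]" "[d + 2]" d "d + 1" "startsw d (d + 1)", OF _ _ _ _ _ a])
    (simp_all add: rel_starts_def startsw_Cons)
 next
  case b
  show ?thesis
   by (rule pad_relation[of "[d]" "[d + 1, d + 2]" d i "startsw d i", OF _ _ _ _ _ b(2)])
    (use b(1) in \<open>simp_all add: rel_starts_def startsw_Cons word_facts(1)\<close>)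
 next
  case c
  show ?thesis
  proof (rule pad_relation[of "[]" "[d, d + 1, d + 2]" i j "startsw i j", OF _ _ _ _ _ c(4)])
   fix w assume w: "w \<in> supp g"
   have "2 <= length w" using word_facts(6)[OF w] c(1-3) by linarith
   then obtain x y z where "w = x # y # z" by (cases w; cases "tl w") auto
   then show "startsw i j ([] @ w @ [d, d + 1, d + 2]) = startsw i j w" by (simp add: startsw_Cons)
  qed (use c in \<open>simp_all add: rel_starts_def\<close>)
 qed
qed

lemma relation_ends:
 assumes "word_count g (%w. True) ~= 0 \<or> (\<exists>i<d. word_count g (%w. last w = i) ~= 0) \<or>
  (\<exists>i<d. \<exists>j<d. i ~= j & word_count g (endsw i j) ~= 0)"
 shows "\<exists>D. has_relation T D rel_ends"
proof -
 consider (a) "word_count g (%w. True) ~= 0" | (b) i where "i < d" "word_count g (%w. last w = i) ~= 0"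
  | (c) i j where "i < d" "j < d" "i ~= j" "word_count g (endsw i j) ~= 0"
  using assms by blast
 then show ?thesis
 proof cases
  case a
  show ?thesis
  proof (rule pad_relation[of "[d]" "[d + 1, d + 2]" "d + 1" "d + 2" "endsw (d + 1) (d + 2)", OF _ _ _ _ _ a])
   fix w
   have "[d] @ w @ [d + 1, d + 2] = ([d] @ w @ [d + 1]) @ [d + 2]" by simp
   then show "endsw (d + 1) (d + 2) ([d] @ w @ [d + 1, d + 2]) = True" by (simp only: endsw_snoc) simp
  qed (simp_all add: rel_ends_def)
 next
  case b
  show ?thesis
  proof (rule pad_relation[of "[d, d + 1]" "[d + 2]" i "d + 2" "endsw i (d + 2)", OF _ _ _ _ _ b(2)])
   fix w assume w: "w \<in> supp g"
   have "[d, d + 1] @ w @ [d + 2] = ([d, d + 1] @ w) @ [d + 2]" by simp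
   then show "endsw i (d + 2) ([d, d + 1] @ w @ [d + 2]) = (last w = i)"
    using word_facts(1)[OF w] by (simp only: endsw_snoc) simp
  qed (use b(1) in \<open>simp_all add: rel_ends_def\<close>)
 next
  case c
  show ?thesis
  proof (rule pad_relation[of "[d, d + 1, d + 2]" "[]" i j "endsw i j", OF _ _ _ _ _ c(4)])
   fix w assume w: "w \<in> supp g"
   have "2 <= length w" using word_facts(6)[OF w] c(1-3) by linarith
   then obtain x z where xz: "w = z @ [x]" by (cases w rule: rev_cases) auto
   then have "z ~= []" using \<open>2 <= length w\<close> by auto
   moreover have "[d, d + 1, d + 2] @ w @ [] = ([d, d + 1, d + 2] @ z) @ [x]" by (simp add: xz)
   ultimately show "endsw i j ([d, d + 1, d + 2] @ w @ []) = endsw i j w"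
    unfolding xz by (simp only: endsw_snoc) simp
  qed (use c in \<open>simp_all add: rel_ends_def\<close>)
 qed
qed

lemma relation_adj:
 assumes "word_count g (%w. True) ~= 0 \<or> (\<exists>i<d. word_count g (%w. hd w = i) ~= 0) \<or>
  (\<exists>i<d. word_count g (%w. last w = i) ~= 0) \<or> (\<exists>i<d. \<exists>j<d. i ~= j & word_count g (adjw i j) ~= 0)"
 shows "\<exists>D. has_relation T D rel_adj"
proof -
 consider (a) "word_count g (%w. True) ~= 0" | (b) i where "i < d" "word_count g (%w. hd w = i) ~= 0"
  | (c) i where "i < d" "word_count g (%w. last w = i) ~= 0"
  | (e) i j where "i < d" "j < d" "i ~= j" "word_count g (adjw i j) ~= 0"
  using assms by blast
 then show ?thesis
 proof cases
  case a
  show ?thesis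
   by (rule pad_relation[of "[d, d + 1]" "[d + 2]" d "d + 1" "adjw d (d + 1)", OF _ _ _ _ _ a])
    (simp_all add: rel_adj_def adjw_hd word_facts)
 next
  case b
  show ?thesis
   by (rule pad_relation[of "[d, d + 1, d + 2]" "[]" "d + 2" i "adjw (d + 2) i", OF _ _ _ _ _ b(2)])
    (use b(1) in \<open>simp_all add: rel_adj_def adjw_hd adjw_Cons word_facts\<close>)
 next
  case c
  show ?thesis
   by (rule pad_relation[of "[]" "[d, d + 1, d + 2]" i d "adjw i d", OF _ _ _ _ _ c(2)])
    (use c(1) in \<open>simp_all add: rel_adj_def adjw_last word_facts\<close>)
 next
  case e
  show ?thesis
   by (rule pad_relation[of "[d, d + 1, d + 2]" "[]" i j "adjw i j", OF _ _ _ _ _ e(4)])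
    (use e(1-3) in \<open>simp_all add: rel_adj_def adjw_Cons\<close>)
 qed
qed

text \<open>If the total is nonzero, two new letters in front have counts total and 0 for their two
  orders. If it is zero, the counts of the two orders of \<open>i\<close> and \<open>j\<close> are
  opposite, hence distinct when nonzero in characteristic zero.\<close>

lemma relation_bef:
 assumes "word_count g (%w. True) ~= 0 \<or> (\<exists>i<d. \<exists>j<d. i ~= j & word_count g (bef i j) ~= 0)"
 shows "\<exists>D. has_relation T D rel_bef"
proof (cases "word_count g (%w. True) = 0")
 case False
 have e: "word_count (mono [d, d + 1, d + 2] * g * mono []) (bef d (d + 1)) = word_count g (%w. True)"
  unfolding word_count_pad by (rule word_count_cong) (simp add: bef_Cons_self word_facts)
 have e': "word_count (mono [d, d + 1, d + 2] * g * mono []) (bef (d + 1) d) = 0"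
  unfolding word_count_pad by (rule word_count_none) (simp add: bef_Cons bef_Cons_self word_facts)
 show ?thesis
  by (rule has_relation_pad[OF T g, of "[d, d + 1, d + 2]" "[]" d "d + 1"])
   (use False e e' in \<open>simp_all add: rel_bef_def del: One_nat_def\<close>)
next
 case True
 then obtain i j where ij: "i < d" "j < d" "i ~= j" and nz: "word_count g (bef i j) ~= 0" using assms by blast
 have p: "word_count (mono [d, d + 1, d + 2] * g * mono []) (bef k l) = word_count g (bef k l)" if "k < d" for k l
  unfolding word_count_pad by (rule word_count_cong) (use that in \<open>simp add: bef_Cons\<close>)
 have "word_count g (bef i j) + word_count g (bef j i) = word_count g (%w. True)"
 proof -
  have "of_bool (bef i j w) + of_bool (bef j i w) = (1 :: 'f)" if w: "w \<in> supp g" for w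
  proof -
   note W = word_facts[OF w]
   have "i \<in> set w" "j \<in> set w" using ij W(3) by simp_all
   then show ?thesis using bef_cases[of i w j] bef_not_bef[OF W(2), of i j] ij(3) by auto
  qed
  then have "ev (%w. of_bool (bef i j w) + of_bool (bef j i w)) g = word_count g (%w. True)"
   unfolding word_count_def by (intro ev_cong) simp
  then show ?thesis unfolding word_count_def ev_def by (simp add: algebra_simps sum.distrib)
 qed
 then have "word_count g (bef j i) = - word_count g (bef i j)" using True by (simp add: add_eq_0_iff)
 moreover have "x ~= - x" if "x ~= 0" for x :: 'f
 proof
  assume "x = - x"
  then have "2 * x = 0" by (metis add.right_inverse mult_2)
  then show False using that by simp
 qed
 ultimately have "rel_bef i j (mono [d, d + 1, d + 2] * g * mono [])"
  unfolding rel_bef_def p[OF ij(1)] p[OF ij(2)] using nz by simp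
 then show ?thesis by (intro has_relation_pad[OF T g, of "[d, d + 1, d + 2]" "[]" i j]) (use ij in simp_all)
qed

lemma relation_outer:
 assumes "word_count g (%w. True) ~= 0 \<or> (\<exists>i<d. word_count g (%w. hd w = i) ~= 0) \<or>
  (\<exists>i<d. word_count g (%w. last w = i) ~= 0) \<or> (\<exists>i<d. \<exists>j<d. i ~= j & word_count g (outerw i j) ~= 0)"
 shows "\<exists>D. has_relation T D rel_outer"
proof -
 have b: "\<exists>D. has_relation T D rel_outer" if b: "i < d" "word_count g (%w. hd w = i) ~= 0" for i
  by (rule pad_relation[of "[]" "[d, d + 1, d + 2]" i "d + 2" "outerw i (d + 2)", OF _ _ _ _ _ b(2)])
   (use b(1) in \<open>simp_all add: rel_outer_def outerw_def word_facts\<close>)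
 consider (a) "word_count g (%w. True) ~= 0" | (b) i where "i < d" "word_count g (%w. hd w = i) ~= 0"
  | (c) i where "i < d" "word_count g (%w. last w = i) ~= 0"
  | (e) i j where "i < d" "j < d" "i ~= j" "word_count g (outerw i j) ~= 0"
  using assms by blast
 then show ?thesis
 proof cases
  case a
  show ?thesis
   by (rule pad_relation[of "[d]" "[d + 1, d + 2]" d "d + 2" "outerw d (d + 2)", OF _ _ _ _ _ a])
    (simp_all add: rel_outer_def outerw_def)
 next
  case c
  show ?thesis
   by (rule pad_relation[of "[d, d + 1, d + 2]" "[]" d i "outerw d i", OF _ _ _ _ _ c(2)])
    (use c(1) in \<open>simp_all add: rel_outer_def outerw_def word_facts\<close>)
 next
  case e
  show ?thesis
  proof (cases "3 <= d")
   case True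
   then show ?thesis using e g unfolding has_relation_def rel_outer_def by blast
  next
   case False
   \<comment> \<open>Padding would destroy the outer letters, so a relation of degree 2 cannot be
     raised directly. In that degree, however, the outer pair is determined by the first letter, and
     the case \<open>b\<close> applies.\<close>
   have "word_count g (outerw i j) = word_count g (%w. hd w = i)"
   proof (rule word_count_cong)
    fix w assume w: "w \<in> supp g"
    have d: "d = 2" using False e(1-3) by linarith
    then have "length w = 2" using word_facts(6)[OF w] by simp
    then obtain x y where xy: "w = [x, y]" by (cases w; cases "tl w") auto
    then have "x ~= y" "x < 2" "y < 2" using word_facts(2,3)[OF w] d by auto
    then show "outerw i j w = (hd w = i)" using e(1-3) d by (auto simp: outerw_def xy)
   qed
   then show ?thesis using b e(1,4) by simp
  qed
 qed (rule b)
qed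

end

lemma assoc_models: "M \<in> linear_family \<union> quadratic_family ==> assoc_algebra M"
 unfolding linear_family_def quadratic_family_def A1_eq A1_star_eq A2_eq A4_eq A4_star_eq A5_eq A6_eq
 using assoc_tri3 assoc_tri2 by auto

lemma violated_identity:
 fixes T :: "'f::field_char_0 nc_poly set"
 assumes "T_ideal T" "assoc_algebra M" "\<not> T \<subseteq> identities M"
 obtains g d where "g \<in> T" "g \<in> multilinear_polys d" "g ~: identities M"
proof -
 have "\<not> (\<forall>n. T \<inter> multilinear_polys n \<subseteq> identities M)"
  using T_ideal_eqI[OF assms(1) T_ideal_identities[OF assms(2)]] assms(3) by blast
 then show ?thesis using that by blast
qed

lemma uniform_relation_bound:
 fixes T :: "'f::field_char_0 nc_poly set"
 assumes "finite R"
 shows "\<exists>D. \<forall>S\<in>R. (\<exists>D. has_relation T D S) --> has_relation T D S"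
 using assms
proof (induction R rule: finite_induct)
 case (insert S R)
 then obtain D where D: "\<forall>S\<in>R. (\<exists>D. has_relation T D S) --> has_relation T D S" by (elim exE) (rule that)
 obtain D' where D': "(\<exists>D. has_relation T D S) --> has_relation T D' S" by blast
 have "\<forall>S'\<in>insert S R. (\<exists>D. has_relation T D S') --> has_relation T (D + D') S'"
  using D D' has_relation_mono[OF _ le_add1] has_relation_mono[OF _ le_add2] by (metis insert_iff)
 then show ?case by (intro exI)
qed simp

text \<open>For each model there are two cases. If it does not satisfy all of \<open>T\<close>, a
  violated multilinear element yields the relation for its statistic; if it does, then
  \<open>f\<close> is an identity of it and the statistic of \<open>f\<close> vanishes. This is
  exactly \<open>governed\<close>.\<close>

theorem large_multilinear:
 fixes T :: "'f::field_char_0 nc_poly set"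
 assumes T: "T_ideal T"
  and mixed: "\<And>\<phi>. (\<And>f. f \<in> T ==> ev \<phi> f = 0) ==> mixed_words n1 \<phi>"
 shows "\<exists>n3. \<forall>n\<ge>n3. \<forall>f\<in>multilinear_polys n. word_count f (%w. True) = 0 -->
  (\<forall>M\<in>linear_family \<union> quadratic_family. T \<subseteq> identities M --> f \<in> identities M) --> f \<in> T"
proof -
 have "finite {rel_first, rel_last, rel_starts, rel_ends, rel_outer, rel_adj, rel_bef :: nat => nat => 'f nc_poly => bool}" by simp
 from uniform_relation_bound[OF this, of T] obtain D where
  D: "\<forall>S\<in>{rel_first, rel_last, rel_starts, rel_ends, rel_outer, rel_adj, rel_bef}. (\<exists>D. has_relation T D S) --> has_relation T D S"
  by (elim exE) (rule that)
 note D = D[rule_format]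
 have fams: "A1 \<in> linear_family \<union> quadratic_family" "A1_star \<in> linear_family \<union> quadratic_family"
  "A2 \<in> linear_family \<union> quadratic_family" "A4 \<in> linear_family \<union> quadratic_family"
  "A4_star \<in> linear_family \<union> quadratic_family" "A5 \<in> linear_family \<union> quadratic_family"
  "A6 \<in> linear_family \<union> quadratic_family" by (simp_all add: linear_family_def quadratic_family_def)
 have rel: "has_relation T D R \<or> Q"
  if M: "M \<in> linear_family \<union> quadratic_family" and R: "R \<in> {rel_first, rel_last, rel_starts, rel_ends, rel_outer, rel_adj, rel_bef}"
   and ex: "\<And>d g. g \<in> T ==> g \<in> multilinear_polys d ==> g ~: identities M ==> \<exists>D. has_relation T D R"
   and Q: "T \<subseteq> identities M ==> Q" for M R Q
 proof (cases "T \<subseteq> identities M")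
  case False
  obtain g d where g: "g \<in> T" "g \<in> multilinear_polys d" "g ~: identities M"
   by (rule violated_identity[OF T assoc_models[OF M] False])
  show ?thesis using D[OF R ex[OF g]] ..
 qed (use Q in blast)
 show ?thesis
 proof (intro exI[of _ "2 * D + 2 * n1 + 100"] allI impI ballI)
  fix n f
  assume n: "2 * D + 2 * n1 + 100 <= n" and f: "f \<in> multilinear_polys n" and tot: "word_count f (%w. True) = 0"
   and ids: "\<forall>M\<in>linear_family \<union> quadratic_family. T \<subseteq> identities M --> f \<in> identities M"
  note ids = ids[rule_format]
  show "f \<in> T"
  proof (rule multilinear_in_T_ideal[OF T mixed _ _ f tot])
   show "2 * D + 22 <= n" "2 * n1 + 42 <= n" using n by simp_all
   show "governed T D n f"
    unfolding governed_def
   proof (intro conjI)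
    show "has_relation T D rel_first \<or> pairs_vanish n f (%i j w. hd w = i)"
     by (rule rel[OF fams(2)], simp, rule relation_first[OF T])
      (use identities_A1_star ids[OF fams(2)] f in blast)+
    show "has_relation T D rel_last \<or> pairs_vanish n f (%i j w. last w = i)"
     by (rule rel[OF fams(1)], simp, rule relation_last[OF T])
      (use identities_A1 ids[OF fams(1)] f in blast)+
    show "has_relation T D rel_starts \<or> pairs_vanish n f startsw"
     by (rule rel[OF fams(5)], simp, rule relation_starts[OF T])
      (use identities_A4_star ids[OF fams(5)] f in blast)+
    show "has_relation T D rel_ends \<or> pairs_vanish n f endsw"
     by (rule rel[OF fams(4)], simp, rule relation_ends[OF T])
      (use identities_A4 ids[OF fams(4)] f in blast)+
    show "has_relation T D rel_outer \<or> pairs_vanish n f outerw"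
     by (rule rel[OF fams(6)], simp, rule relation_outer[OF T])
      (use identities_A5 ids[OF fams(6)] f in blast)+
    show "has_relation T D rel_adj \<or> pairs_vanish n f adjw"
     by (rule rel[OF fams(7)], simp, rule relation_adj[OF T])
      (use identities_A6 ids[OF fams(7)] f in blast)+
    show "has_relation T D rel_bef \<or> pairs_vanish n f bef"
     by (rule rel[OF fams(3)], simp, rule relation_bef[OF T])
      (use identities_A2 ids[OF fams(3)] f in blast)+
   qed
  qed
 qed
qed

section \<open>Counting the statistics seen by the models\<close>

definition model_functional :: "nat \<times> nat \<times> nat => nat list => bool" where
 "model_functional t w = (case t of (k, i, j) =>
   if k = 0 then True else if k = 1 then hd w = i else if k = 2 then last w = i else if k = 3 then startsw i j w
   else if k = 4 then endsw i j w else if k = 5 then outerw i j w else if k = 6 then adjw i j w else bef i j w)"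

definition linear_index :: "nat => (nat \<times> nat \<times> nat) set" where
 "linear_index n = insert (0, 0, 0) ({1, 2} \<times> {..<n} \<times> {0})"

definition quadratic_index :: "nat => (nat \<times> nat \<times> nat) set" where
 "quadratic_index n = linear_index n \<union> {3, 4, 5, 6, 7} \<times> {..<n} \<times> {..<n}"

lemma card_linear_index: "finite (linear_index n)" "card (linear_index n) <= 1 + 2 * n"
 by (auto simp: linear_index_def card_insert_if card_cartesian_product)

lemma card_quadratic_index: "finite (quadratic_index n)" "card (quadratic_index n) <= 1 + 2 * n + 5 * n ^ 2"
proof -
 show "finite (quadratic_index n)" by (simp add: quadratic_index_def card_linear_index)
 have "card (quadratic_index n) <= card (linear_index n) + card ({3, 4, 5, 6, 7 :: nat} \<times> {..<n} \<times> {..<n})"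
  unfolding quadratic_index_def by (rule card_Un_le)
 also have "card ({3, 4, 5, 6, 7 :: nat} \<times> {..<n} \<times> {..<n}) = 5 * n ^ 2"
  by (simp add: card_cartesian_product power2_eq_square)
 finally show "card (quadratic_index n) <= 1 + 2 * n + 5 * n ^ 2" using card_linear_index(2)[of n] by simp
qed

lemma linear_index_zero:
 assumes f: "f \<in> multilinear_polys n" and z: "\<And>t. t \<in> linear_index n ==> word_count f (model_functional t) = 0"
 shows "word_count f (%w. True) = 0" "i < n ==> word_count f (%w. hd w = i) = 0" "i < n ==> word_count f (%w. last w = i) = 0"
 using z[of "(0, 0, 0)"] z[of "(1, i, 0)"] z[of "(2, i, 0)"]
 by (simp_all add: linear_index_def model_functional_def[abs_def])

lemma linear_functionals_suffice:
 assumes f: "f \<in> multilinear_polys n" and z: "\<And>t. t \<in> linear_index n ==> word_count f (model_functional t) = 0"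
  and M: "M \<in> linear_family"
 shows "f \<in> identities M"
 using M linear_index_zero[OF f z] unfolding linear_family_def
 by (auto simp: identities_A1[OF f] identities_A1_star[OF f])

lemma quadratic_functionals_suffice:
 assumes f: "f \<in> multilinear_polys n" and z: "\<And>t. t \<in> quadratic_index n ==> word_count f (model_functional t) = 0"
  and M: "M \<in> linear_family \<union> quadratic_family"
 shows "f \<in> identities M"
proof -
 have zl: "word_count f (model_functional t) = 0" if "t \<in> linear_index n" for t
  by (rule z) (use that in \<open>simp add: quadratic_index_def\<close>)
 note L = linear_index_zero[OF f zl]
 have q: "word_count f (startsw i j) = 0" "word_count f (endsw i j) = 0" "word_count f (outerw i j) = 0"
  "word_count f (adjw i j) = 0" "word_count f (bef i j) = 0" if "i < n" "j < n" for i j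
  using z[of "(3, i, j)"] z[of "(4, i, j)"] z[of "(5, i, j)"] z[of "(6, i, j)"] z[of "(7, i, j)"] that
  by (simp_all add: quadratic_index_def model_functional_def[abs_def])
 show ?thesis using M L q unfolding linear_family_def quadratic_family_def
  by (auto simp: identities_A1[OF f] identities_A1_star[OF f] identities_A2[OF f] identities_A4[OF f]
    identities_A4_star[OF f] identities_A5[OF f] identities_A6[OF f])
qed

lemma ev_model: "ev (%w. of_bool (model_functional t w)) f = word_count f (model_functional t)"
 by (simp add: word_count_def)

section \<open>Codimension bounds\<close>

text \<open>The words \<open>W i j\<close> and the statistics \<open>\<Phi> i j\<close> are dual to
  each other on a grid of \<open>h ^ 2\<close> index pairs, and the statistics vanish on
  \<open>T\<close>; so the words are independent modulo \<open>T\<close>.\<close>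

lemma grid_lower_bound:
 fixes T :: "'f::field_char_0 nc_poly set"
 assumes T: "nc.subspace T" and h: "2 * h <= n"
  and words: "\<And>i j. i < h ==> h <= j ==> j < 2 * h ==> distinct (W i j) & set (W i j) = {..<n} & W i j ~= []"
  and zero: "\<And>f i j. f \<in> T ==> f \<in> multilinear_polys n ==> i < n ==> j < n ==> i ~= j ==> word_count f (\<Phi> i j) = 0"
  and dual: "\<And>i j i' j'. i < h ==> h <= j ==> j < 2 * h ==> i' < h ==> h <= j' ==> j' < 2 * h ==>
   \<Phi> i' j' (W i j) \<longleftrightarrow> i = i' & j = j'"
 shows "h ^ 2 <= codim_T T n"
proof -
 let ?J = "{..<h} \<times> {h..<2 * h}"
 let ?e = "%(i, j). mono (W i j) :: 'f nc_poly"
 have "card ?J <= codim_T T n"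
 proof (rule codim_T_lower[OF T])
  show "finite ?J" by simp
  show sub: "?e ` ?J \<subseteq> multilinear_polys n"
  proof
   fix x assume "x \<in> ?e ` ?J"
   then obtain i j where ij: "i < h" "h <= j" "j < 2 * h" and x: "x = mono (W i j)" by auto
   show "x \<in> multilinear_polys n" unfolding x multilinear_polys_alt using words[OF ij] by simp
  qed
  show "indep_mod T ?J ?e"
   unfolding indep_mod_def
  proof (intro allI impI ballI)
   fix c t assume z: "(\<Sum>t\<in>?J. scale_poly (c t) (?e t)) \<in> T" and t: "t \<in> ?J"
   obtain i j where ij: "t = (i, j)" "i < h" "h <= j" "j < 2 * h" using t by auto
   have m: "(\<Sum>t\<in>?J. scale_poly (c t) (?e t)) \<in> multilinear_polys n"
    by (intro nc.subspace_sum nc.subspace_scale subspace_multilinear) (use sub in blast)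
   have "0 = word_count (\<Sum>t\<in>?J. scale_poly (c t) (?e t)) (\<Phi> i j)"
    by (rule zero[OF z m, symmetric]) (use ij h in simp_all)
   also have "\<dots> = (\<Sum>s\<in>?J. c s * of_bool (\<Phi> i j (W (fst s) (snd s))))"
    by (simp add: word_count_def ev_sum ev_scale case_prod_unfold)
   also have "\<dots> = (\<Sum>s\<in>?J. if s = t then c s else 0)"
    by (rule sum.cong) (use dual ij in auto)
   also have "\<dots> = c t" using t by (simp add: sum.delta)
   finally show "c t = 0" by simp
  qed
 qed
 then show ?thesis by (simp add: card_cartesian_product power2_eq_square)
qed

text \<open>Letters from the range \<open>h\<close> to \<open>2 * h\<close> come before those below
  \<open>h\<close>, except for \<open>i\<close> and \<open>j\<close>. Among pairs of a small and a
  large letter only \<open>(i, j)\<close> occurs in this order, and it is adjacent; so the same word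
  is dual both for order and for adjacency.\<close>

definition inverted_word :: "nat => nat => nat => nat => nat list" where
 "inverted_word n h i j = filter (%x. x ~= j) [h..<2 * h] @ [i, j] @ filter (%x. x ~= i) [0..<h] @ [2 * h..<n]"

definition other_letters :: "nat => nat => nat => nat list" where
 "other_letters n i j = filter (%x. x ~= i & x ~= j) [0..<n]"

lemma inverted_word_multilinear:
 assumes "2 * h <= n" "i < h" "h <= j" "j < 2 * h"
 shows "distinct (inverted_word n h i j) & set (inverted_word n h i j) = {..<n} & inverted_word n h i j ~= []"
proof (intro conjI)
 show "distinct (inverted_word n h i j)" using assms by (auto simp: inverted_word_def)
 show "set (inverted_word n h i j) = {..<n}"
 proof (rule Set.set_eqI)
  fix x show "x \<in> set (inverted_word n h i j) \<longleftrightarrow> x \<in> {..<n}"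
   using assms by (auto simp: inverted_word_def)
 qed
qed (simp add: inverted_word_def)

lemma other_letters_multilinear:
 assumes "i < n" "j < n" "i ~= j"
 shows "distinct (other_letters n i j @ [i, j]) & set (other_letters n i j @ [i, j]) = {..<n} & other_letters n i j @ [i, j] ~= []"
  "distinct ([i, j] @ other_letters n i j) & set ([i, j] @ other_letters n i j) = {..<n} & [i, j] @ other_letters n i j ~= []"
  "distinct ([i] @ other_letters n i j @ [j]) & set ([i] @ other_letters n i j @ [j]) = {..<n} & [i] @ other_letters n i j @ [j] ~= []"
proof -
 have d: "distinct (other_letters n i j)" "i ~: set (other_letters n i j)" "j ~: set (other_letters n i j)"
  by (auto simp: other_letters_def)
 have s: "x \<in> set (other_letters n i j) \<longleftrightarrow> x < n & x ~= i & x ~= j" for x by (auto simp: other_letters_def)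
 show "distinct (other_letters n i j @ [i, j]) & set (other_letters n i j @ [i, j]) = {..<n} & other_letters n i j @ [i, j] ~= []"
  by (intro conjI Set.set_eqI) (use d assms s in auto)
 show "distinct ([i, j] @ other_letters n i j) & set ([i, j] @ other_letters n i j) = {..<n} & [i, j] @ other_letters n i j ~= []"
  by (intro conjI Set.set_eqI) (use d assms s in auto)
 show "distinct ([i] @ other_letters n i j @ [j]) & set ([i] @ other_letters n i j @ [j]) = {..<n} & [i] @ other_letters n i j @ [j] ~= []"
  by (intro conjI Set.set_eqI) (use d assms s in auto)
qed

lemma quadratic_lower_bound:
 fixes T :: "'f::field_char_0 nc_poly set"
 assumes T: "nc.subspace T" "T \<subseteq> identities M" and M: "M \<in> quadratic_family"
 shows "(n div 2) ^ 2 <= codim_T T n"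
proof -
 define h where "h = n div 2"
 have h: "2 * h <= n" by (simp add: h_def)
 have I: "f \<in> identities M" if "f \<in> T" for f using T(2) that by blast
 note G = grid_lower_bound[OF T(1) h]
 consider "M = A2" | "M = A4" | "M = A4_star" | "M = A5" | "M = A6" using M by (auto simp: quadratic_family_def)
 then have "h ^ 2 <= codim_T T n"
 proof cases
  case 1
  show ?thesis
  proof (rule G[of "inverted_word n h" bef])
   show "word_count f (bef i j) = 0" if "f \<in> T" "f \<in> multilinear_polys n" "i < n" "j < n" "i ~= j" for f i j
    using I[OF that(1)] identities_A2[OF that(2)] that(3-5) unfolding 1 by blast
   show "bef i' j' (inverted_word n h i j) \<longleftrightarrow> i = i' & j = j'"
    if "i < h" "h <= j" "j < 2 * h" "i' < h" "h <= j'" "j' < 2 * h" for i j i' j'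
    unfolding inverted_word_def bef_append
    using that bef_not_mem[of i' "filter (%x. x ~= j) [h..<2 * h]" j'] bef_not_mem[of i' "filter (%x. x ~= i) [0..<h]" j']
     bef_not_mem[of i' "[2 * h..<n]" j'] bef_Cons_self[of i "[j]" j'] bef_not_mem[of i' "[i, j]" j'] by auto
  qed (rule inverted_word_multilinear[OF h])
 next
  case 2
  show ?thesis
  proof (rule G[of "%i j. other_letters n i j @ [i, j]" endsw])
   show "word_count f (endsw i j) = 0" if "f \<in> T" "f \<in> multilinear_polys n" "i < n" "j < n" "i ~= j" for f i j
    using I[OF that(1)] identities_A4[OF that(2)] that(3-5) unfolding 2 by blast
   show "distinct (other_letters n i j @ [i, j]) & set (other_letters n i j @ [i, j]) = {..<n} & other_letters n i j @ [i, j] ~= []"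
    if "i < h" "h <= j" "j < 2 * h" for i j
    by (rule other_letters_multilinear(1)) (use that h in simp_all)
   show "endsw i' j' (other_letters n i j @ [i, j]) \<longleftrightarrow> i = i' & j = j'" for i j i' j'
    using endsw_snoc[of i' j' "other_letters n i j @ [i]" j] by auto
  qed
 next
  case 3
  show ?thesis
  proof (rule G[of "%i j. [i, j] @ other_letters n i j" startsw])
   show "word_count f (startsw i j) = 0" if "f \<in> T" "f \<in> multilinear_polys n" "i < n" "j < n" "i ~= j" for f i j
    using I[OF that(1)] identities_A4_star[OF that(2)] that(3-5) unfolding 3 by blast
   show "distinct ([i, j] @ other_letters n i j) & set ([i, j] @ other_letters n i j) = {..<n} & [i, j] @ other_letters n i j ~= []"
    if "i < h" "h <= j" "j < 2 * h" for i j
    by (rule other_letters_multilinear(2)) (use that h in simp_all)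
   show "startsw i' j' ([i, j] @ other_letters n i j) \<longleftrightarrow> i = i' & j = j'" for i j i' j'
    by (auto simp: startsw_Cons)
  qed
 next
  case 4
  show ?thesis
  proof (rule G[of "%i j. [i] @ other_letters n i j @ [j]" outerw])
   show "word_count f (outerw i j) = 0" if "f \<in> T" "f \<in> multilinear_polys n" "i < n" "j < n" "i ~= j" for f i j
    using I[OF that(1)] identities_A5[OF that(2)] that(3-5) unfolding 4 by blast
   show "distinct ([i] @ other_letters n i j @ [j]) & set ([i] @ other_letters n i j @ [j]) = {..<n} & [i] @ other_letters n i j @ [j] ~= []"
    if "i < h" "h <= j" "j < 2 * h" for i j
    by (rule other_letters_multilinear(3)) (use that h in simp_all)
   show "outerw i' j' ([i] @ other_letters n i j @ [j]) \<longleftrightarrow> i = i' & j = j'" for i j i' j'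
    by (simp add: outerw_def)
  qed
 next
  case 5
  show ?thesis
  proof (rule G[of "inverted_word n h" adjw])
   show "word_count f (adjw i j) = 0" if "f \<in> T" "f \<in> multilinear_polys n" "i < n" "j < n" "i ~= j" for f i j
    using I[OF that(1)] identities_A6[OF that(2)] that(3-5) unfolding 5 by blast
   show "adjw i' j' (inverted_word n h i j) \<longleftrightarrow> i = i' & j = j'"
    if r: "i < h" "h <= j" "j < 2 * h" "i' < h" "h <= j'" "j' < 2 * h" for i j i' j'
   proof -
    define b where "b = filter (%x. x ~= j) [h..<2 * h]"
    define r where "r = filter (%x. x ~= i) [0..<h] @ [2 * h..<n]"
    have b: "i' ~: set b" using r by (auto simp: b_def)
    have rr: "j' ~: set r" using that by (auto simp: r_def)
    have lb: "last b ~= i'" if "b ~= []" using last_in_set[OF that] b by blast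
    have j: "j ~= i'" using that by simp
    have ij: "adjw i' j' [i, j] \<longleftrightarrow> i = i' & j = j'"
     using adjw_append[of i' j' "[i]" "[j]"] adjw_not_mem[of i' "[j]" j'] adjw_not_mem[of i' "[i]" j'] that by auto
    have "adjw i' j' (b @ [i, j] @ r) \<longleftrightarrow> adjw i' j' [i, j]"
     unfolding adjw_append[of _ _ b] adjw_append[of _ _ "[i, j]"]
     using adjw_not_mem[of i' b j'] adjw_not_mem[of i' r j'] b rr lb j by auto
    then show ?thesis using ij by (simp add: inverted_word_def b_def r_def)
   qed
  qed (rule inverted_word_multilinear[OF h])
 qed
 then show ?thesis by (simp add: h_def)
qed

lemma six_choose_three: "6 * ((k + 3) choose 3) = (k + 3) * (k + 2) * (k + 1 :: nat)"
proof (induction k)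
 case (Suc k)
 have two: "2 * (n choose 2) = n * (n - 1)" for n :: nat
  using choose_two[of n] by (cases n) (auto simp: dvd_mult_div_cancel)
 have "(Suc k + 3) choose 3 = ((k + 3) choose 2) + ((k + 3) choose 3)"
  using binomial_Suc_Suc[of "k + 3" 2] by (simp add: numeral_3_eq_3 numeral_2_eq_2)
 then have "6 * ((Suc k + 3) choose 3) = 3 * (2 * ((k + 3) choose 2)) + 6 * ((k + 3) choose 3)" by simp
 also have "\<dots> = 3 * ((k + 3) * (k + 2)) + (k + 3) * (k + 2) * (k + 1)" unfolding Suc two by simp
 finally show ?case by (simp add: algebra_simps)
qed simp

lemma quadratic_below_choose_three:
 fixes c :: "nat => nat"
 assumes "\<And>n. n0 <= n ==> real (c n) <= b * real n ^ 2"
 shows "\<exists>n1. \<forall>n\<ge>n1. c n < (n div 2) choose 3"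
proof -
 define B where "B = nat \<lceil>\<bar>b\<bar>\<rceil>"
 have B: "b <= real B" unfolding B_def by linarith
 show ?thesis
 \<comment> \<open>With \<open>k = n div 2 - 3\<close> this choice gives \<open>n <= 4 * k\<close>
   and \<open>96 * B < k\<close>. The factor 96 is 6 times 16, from the denominator of the binomial
   coefficient and from \<open>(4 * k) ^ 2\<close>.\<close>
 proof (intro exI[of _ "n0 + 400 * B + 400"] allI impI)
  fix n assume n: "n0 + 400 * B + 400 <= n"
  define k where "k = n div 2 - 3"
  have m: "n div 2 = k + 3" using n by (simp add: k_def)
  have nk: "n <= 4 * k" using n by (simp add: k_def)
  have kB: "96 * B < k" using n by (simp add: k_def)
  have "real (c n) <= b * real n ^ 2" using assms n by simp
  also have "\<dots> <= real B * real n ^ 2" using B by (simp add: mult_right_mono)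
  finally have "c n <= B * n ^ 2" by (simp flip: of_nat_power of_nat_mult)
  also have "\<dots> <= B * (4 * k) ^ 2" using nk by (intro mult_left_mono power_mono) auto
  also have "\<dots> = 16 * B * k ^ 2" by (simp add: power_mult_distrib)
  finally have c: "6 * c n <= (96 * B) * k ^ 2" by simp
  have k0: "0 < k" using kB by simp
  have "(96 * B) * k ^ 2 < k * k ^ 2" using kB k0 by simp
  also have "\<dots> <= (k + 3) * (k + 2) * (k + 1)" by (simp add: power2_eq_square algebra_simps)
  also have "\<dots> = 6 * ((k + 3) choose 3)" by (rule six_choose_three[symmetric])
  finally show "c n < (n div 2) choose 3" using c m by simp
 qed
qed

section \<open>Quotients of the free algebra and direct sums\<close>

definition deg_ge :: "nat => 'f::field nc_poly set" where
 "deg_ge k = {f. supp f \<subseteq> {w. w ~= [] & k <= length w}}"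

lemma subspace_deg_ge: "nc.subspace (deg_ge k :: 'f::field nc_poly set)"
 unfolding nc.subspace_def
proof (intro conjI ballI allI)
 fix f g :: "'f nc_poly" and c assume f: "f \<in> deg_ge k"
 show "scale_poly c f \<in> deg_ge k" using f by (auto simp: deg_ge_def in_keys_iff)
 assume "g \<in> deg_ge k"
 then show "f + g \<in> deg_ge k" using f keys_add[of f g] unfolding deg_ge_def by blast
qed (simp add: deg_ge_def)

lemma deg_ge_single: "w ~= [] ==> k <= length w ==> term_poly w c \<in> deg_ge k"
 by (simp add: deg_ge_def)

lemma deg_ge_mono: "k <= l ==> deg_ge l \<subseteq> deg_ge k"
 unfolding deg_ge_def by (auto dest: order_trans)

lemma deg_ge_free: "deg_ge k \<subseteq> free_algebra" "deg_ge 1 = free_algebra"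
 unfolding deg_ge_def by (auto simp: keys_free Suc_le_eq)

lemma deg_ge_mult:
 fixes f g :: "'f::field nc_poly"
 assumes "f \<in> deg_ge k" "g \<in> deg_ge l"
 shows "f * g \<in> deg_ge (k + l)"
proof -
 note S = subspace_deg_ge[of "k + l"]
 have "supp f \<subseteq> {w. w ~= [] & k <= length w}" "supp g \<subseteq> {w. w ~= [] & l <= length w}"
  using assms by (simp_all add: deg_ge_def)
 then show ?thesis
 proof (induction f rule: poly_induct_on)
  case (single v c)
  from single(2) show ?case
  proof (induction g rule: poly_induct_on)
   case (single w d)
   then show ?case using \<open>v \<in> {w. w ~= [] & k <= length w}\<close> by (auto simp: term_poly_mult intro!: deg_ge_single)
  next
   case (add f g)
   then show ?case using nc.subspace_add[OF S] by (simp add: distrib_left)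
  qed (use nc.subspace_0[OF S] in simp)
 next
  case (add f g)
  then show ?case using nc.subspace_add[OF S] by (simp add: distrib_right)
 qed (use nc.subspace_0[OF S] in simp)
qed

lemma deg_ge_list_mult:
 "gs ~= [] ==> set gs \<subseteq> (free_algebra :: 'f::field nc_poly set) ==> list_mult free_alg gs \<in> deg_ge (length gs)"
proof (induction gs)
 case (Cons g gs)
 have g: "g \<in> deg_ge 1" using Cons.prems deg_ge_free(2) by auto
 show ?case
 proof (cases "gs = []")
  case False
  then have "list_mult free_alg gs \<in> deg_ge (length gs)" using Cons by simp
  from deg_ge_mult[OF g this] show ?thesis using False by (simp add: fa.list_mult_Cons)
 qed (use g in simp)
qed simp

lemma deg_ge_subst:
 fixes f :: "'f::field nc_poly"
 assumes "f \<in> deg_ge k" and s: "range \<sigma> \<subseteq> free_algebra"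
 shows "subst_poly \<sigma> f \<in> deg_ge k"
proof -
 have sc: "range \<sigma> \<subseteq> carrier free_alg" using s by simp
 have "supp f \<subseteq> {w. w ~= [] & k <= length w}" using assms(1) by (simp add: deg_ge_def)
 then show ?thesis
 proof (induction f rule: poly_induct_on)
  case zero
  show ?case using nc.subspace_0[OF subspace_deg_ge] by (simp add: fa.poly_eval_zero[OF sc])
 next
  case (single w c)
  have "set (map \<sigma> w) \<subseteq> free_algebra" using s by auto
  then have "list_mult free_alg (map \<sigma> w) \<in> deg_ge (length w)" using deg_ge_list_mult[of "map \<sigma> w"] single by simp
  then have "list_mult free_alg (map \<sigma> w) \<in> deg_ge k" using deg_ge_mono[of k "length w"] single by auto
  then show ?case using nc.subspace_scale[OF subspace_deg_ge] by (simp add: fa.poly_eval_single[OF sc])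
 next
  case (add f g)
  then show ?case using nc.subspace_add[OF subspace_deg_ge] by (simp add: fa.poly_eval_add[OF sc])
 qed
qed

text \<open>The quotient by this ideal is nilpotent, and by homogeneity of \<open>T\<close> nothing
  is added to \<open>T\<close> in multilinear degrees below \<open>k\<close>.\<close>

definition plus_deg_ge :: "'f::field nc_poly set => nat => 'f nc_poly set" where
 "plus_deg_ge T k = {x + y | x y. x \<in> T & y \<in> deg_ge k}"

lemma plus_deg_ge_sub: "T_ideal T ==> T \<subseteq> plus_deg_ge T k" "T_ideal T ==> deg_ge k \<subseteq> plus_deg_ge T k"
proof -
 assume T: "T_ideal T"
 show "T \<subseteq> plus_deg_ge T k"
 proof
  fix x assume "x \<in> T"
  then have "x = x + 0 & x \<in> T & 0 \<in> deg_ge k" using nc.subspace_0[OF subspace_deg_ge] by simp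
  then show "x \<in> plus_deg_ge T k" unfolding plus_deg_ge_def by blast
 qed
 show "deg_ge k \<subseteq> plus_deg_ge T k"
 proof
  fix x :: "'a nc_poly" assume "x \<in> deg_ge k"
  then have "x = 0 + x & 0 \<in> T & x \<in> deg_ge k" using nc.subspace_0[OF T_idealD(2)[OF T]] by simp
  then show "x \<in> plus_deg_ge T k" unfolding plus_deg_ge_def by blast
 qed
qed

lemma T_ideal_plus_deg_ge:
 fixes T :: "'f::field nc_poly set"
 assumes T: "T_ideal T"
 shows "T_ideal (plus_deg_ge T k)"
 unfolding T_ideal_def
proof (intro conjI ballI allI impI)
 note S = nc.subspace_sums[OF T_idealD(2)[OF T] subspace_deg_ge[of k], folded plus_deg_ge_def]
 show "nc.subspace (plus_deg_ge T k)" by (rule S)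
 show "plus_deg_ge T k \<subseteq> free_algebra"
  unfolding plus_deg_ge_def using T_idealD(1)[OF T] deg_ge_free(1) by (auto intro!: free_algebra_closed(2))
 note sub = subsetD[OF plus_deg_ge_sub(1)[OF T]] subsetD[OF plus_deg_ge_sub(2)[OF T]]
 fix f assume "f \<in> plus_deg_ge T k"
 then obtain x y where f: "f = x + y" "x \<in> T" "y \<in> deg_ge k" unfolding plus_deg_ge_def by blast
 {
  fix g :: "'f nc_poly" assume g: "g \<in> free_algebra"
  then have "g \<in> deg_ge 1" using deg_ge_free(2) by blast
  then have "y * g \<in> deg_ge (k + 1)" "g * y \<in> deg_ge (1 + k)" using deg_ge_mult f(3) by blast+
  then have y: "y * g \<in> deg_ge k" "g * y \<in> deg_ge k" using deg_ge_mono[of k "k + 1"] by auto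
  show "f * g \<in> plus_deg_ge T k" unfolding f(1) distrib_right
   by (rule nc.subspace_add[OF S sub(1)[OF T_idealD(3)[OF T f(2) g]] sub(2)[OF y(1)]])
  show "g * f \<in> plus_deg_ge T k" unfolding f(1) distrib_left
   by (rule nc.subspace_add[OF S sub(1)[OF T_idealD(4)[OF T f(2) g]] sub(2)[OF y(2)]])
 }
 fix \<sigma> :: "nat => 'f nc_poly" assume s: "range \<sigma> \<subseteq> free_algebra"
 then have sc: "range \<sigma> \<subseteq> carrier free_alg" by simp
 show "subst_poly \<sigma> f \<in> plus_deg_ge T k" unfolding f(1) fa.poly_eval_add[OF sc] free_alg_simps
  by (rule nc.subspace_add[OF S sub(1)[OF T_idealD(5)[OF T f(2) s]] sub(2)[OF deg_ge_subst[OF f(3) s]]])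
qed

lemma plus_deg_ge_multilinear:
 fixes T :: "'f::field_char_0 nc_poly set"
 assumes T: "T_ideal T" and f: "f \<in> plus_deg_ge T k" "f \<in> multilinear_polys n" and n: "n < k"
 shows "f \<in> T"
proof -
 obtain x y where xy: "f = x + y" "x \<in> T" "y \<in> deg_ge k" using f(1) unfolding plus_deg_ge_def by blast
 have "f = truncate k x"
 proof (rule poly_mapping_eqI)
  fix w
  have "coef y w = 0" if "length w < k" using xy(3) that by (auto simp: deg_ge_def in_keys_iff)
  moreover have "coef f w = 0" if "\<not> length w < k"
  proof (rule ccontr)
   assume "coef f w ~= 0"
   then have "distinct w" "set w = {..<n}" using f(2) by (auto simp: multilinear_polys_def in_keys_iff)
   then have "length w = n" using distinct_card[of w] by simp
   then show False using that n by simp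
  qed
  ultimately show "coef f w = coef (truncate k x) w" by (simp add: coef_truncate xy(1) lookup_add)
 qed
 then show ?thesis using truncate_in_T_ideal[OF T xy(2)] by simp
qed

lemma assoc_algebra_hom_image:
 assumes A: "assoc_algebra A" and h: "alg_hom A B h" "h ` carrier A = carrier B" "h \<zero>\<^bsub>A\<^esub> = \<zero>\<^bsub>B\<^esub>"
 shows "assoc_algebra B"
proof -
 interpret A: assoc_algebra A by fact
 have hc: "x \<in> carrier A ==> h x \<in> carrier B"
  and ha: "x \<in> carrier A ==> y \<in> carrier A ==> h x \<oplus>\<^bsub>B\<^esub> h y = h (x \<oplus>\<^bsub>A\<^esub> y)"
  and hm: "x \<in> carrier A ==> y \<in> carrier A ==> h x \<otimes>\<^bsub>B\<^esub> h y = h (x \<otimes>\<^bsub>A\<^esub> y)"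
  and hs: "x \<in> carrier A ==> c \<odot>\<^bsub>B\<^esub> h x = h (c \<odot>\<^bsub>A\<^esub> x)" for x y c
  using h(1) by (auto simp: alg_hom_def)
 have ex: "\<exists>x\<in>carrier A. y = h x" if "y \<in> carrier B" for y using that h(2) by blast
 interpret abelian_group B
 proof (rule abelian_groupI)
  fix x assume "x \<in> carrier B"
  then obtain x' where x: "x' \<in> carrier A" "x = h x'" using ex by blast
  have "h (\<ominus>\<^bsub>A\<^esub> x') \<oplus>\<^bsub>B\<^esub> x = \<zero>\<^bsub>B\<^esub>" using x h(3) by (simp add: ha A.l_neg)
  moreover have "h (\<ominus>\<^bsub>A\<^esub> x') \<in> carrier B" using x hc by simp
  ultimately show "\<exists>y\<in>carrier B. y \<oplus>\<^bsub>B\<^esub> x = \<zero>\<^bsub>B\<^esub>" by blast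
  show "\<zero>\<^bsub>B\<^esub> \<oplus>\<^bsub>B\<^esub> x = x" using x ha[of "\<zero>\<^bsub>A\<^esub>" x'] by (simp add: h(3))
  fix y assume "y \<in> carrier B"
  then obtain y' where y: "y' \<in> carrier A" "y = h y'" using ex by blast
  show "x \<oplus>\<^bsub>B\<^esub> y \<in> carrier B" using x y by (simp add: ha hc)
  show "x \<oplus>\<^bsub>B\<^esub> y = y \<oplus>\<^bsub>B\<^esub> x" using x y by (simp add: ha A.a_comm)
  fix z assume "z \<in> carrier B"
  then obtain z' where z: "z' \<in> carrier A" "z = h z'" using ex by blast
  show "x \<oplus>\<^bsub>B\<^esub> y \<oplus>\<^bsub>B\<^esub> z = x \<oplus>\<^bsub>B\<^esub> (y \<oplus>\<^bsub>B\<^esub> z)" using x y z by (simp add: ha A.a_assoc)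
 qed (use hc[OF A.zero_closed] h(3) in simp)
 show ?thesis
 proof
  fix x c d assume "x \<in> carrier B"
  then obtain x' where x: "x' \<in> carrier A" "x = h x'" using ex by blast
  show "c \<odot>\<^bsub>B\<^esub> x \<in> carrier B" using x by (simp add: hs hc A.scale_closed)
  show "(c + d) \<odot>\<^bsub>B\<^esub> x = c \<odot>\<^bsub>B\<^esub> x \<oplus>\<^bsub>B\<^esub> d \<odot>\<^bsub>B\<^esub> x" using x by (simp add: hs ha A.scale_closed A.scale_l_distr)
  show "(c * d) \<odot>\<^bsub>B\<^esub> x = c \<odot>\<^bsub>B\<^esub> (d \<odot>\<^bsub>B\<^esub> x)" using x by (simp add: hs A.scale_closed A.scale_scale)
  show "1 \<odot>\<^bsub>B\<^esub> x = x" using x by (simp add: hs A.scale_one)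
  fix y assume "y \<in> carrier B"
  then obtain y' where y: "y' \<in> carrier A" "y = h y'" using ex by blast
  show "x \<otimes>\<^bsub>B\<^esub> y \<in> carrier B" using x y by (simp add: hm hc A.mult_closed)
  show "c \<odot>\<^bsub>B\<^esub> (x \<oplus>\<^bsub>B\<^esub> y) = c \<odot>\<^bsub>B\<^esub> x \<oplus>\<^bsub>B\<^esub> c \<odot>\<^bsub>B\<^esub> y"
   using x y by (simp add: hs ha A.scale_closed A.scale_r_distr)
  show "c \<odot>\<^bsub>B\<^esub> x \<otimes>\<^bsub>B\<^esub> y = c \<odot>\<^bsub>B\<^esub> (x \<otimes>\<^bsub>B\<^esub> y)"
   using x y by (simp add: hs hm A.scale_closed A.mult_closed A.scale_mult_left)
  show "x \<otimes>\<^bsub>B\<^esub> (c \<odot>\<^bsub>B\<^esub> y) = c \<odot>\<^bsub>B\<^esub> (x \<otimes>\<^bsub>B\<^esub> y)"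
   using x y by (simp add: hs hm A.scale_closed A.mult_closed A.scale_mult_right)
  fix z assume "z \<in> carrier B"
  then obtain z' where z: "z' \<in> carrier A" "z = h z'" using ex by blast
  show "x \<otimes>\<^bsub>B\<^esub> y \<otimes>\<^bsub>B\<^esub> z = x \<otimes>\<^bsub>B\<^esub> (y \<otimes>\<^bsub>B\<^esub> z)" using x y z by (simp add: hm A.mult_closed A.mult_assoc)
  show "(x \<oplus>\<^bsub>B\<^esub> y) \<otimes>\<^bsub>B\<^esub> z = x \<otimes>\<^bsub>B\<^esub> z \<oplus>\<^bsub>B\<^esub> y \<otimes>\<^bsub>B\<^esub> z"
   using x y z by (simp add: hm ha A.mult_closed A.mult_l_distr)
  show "z \<otimes>\<^bsub>B\<^esub> (x \<oplus>\<^bsub>B\<^esub> y) = z \<otimes>\<^bsub>B\<^esub> x \<oplus>\<^bsub>B\<^esub> z \<otimes>\<^bsub>B\<^esub> y"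
   using x y z by (simp add: hm ha A.mult_closed A.mult_r_distr)
 qed
qed

section \<open>Relatively free algebras as quotients\<close>

definition quot_rep :: "'f::field nc_poly set => 'f nc_poly => 'f nc_poly" where
 "quot_rep I f = (SOME g. g \<in> free_algebra & g - f \<in> I)"

text \<open>The quotient of the free algebra by \<open>I\<close>, on canonical representatives moved to another type by \<open>\<iota>\<close>.\<close>

definition quot_alg :: "('f::field nc_poly => 'u) => 'f nc_poly set => ('f, 'u) module" where
 "quot_alg \<iota> I = (let \<pi> = %f. \<iota> (quot_rep I f); s = inv_into UNIV \<iota> in
  \<lparr>carrier = \<pi> ` free_algebra, mult = (%x y. \<pi> (s x * s y)), one = \<pi> 0, zero = \<pi> 0,
   add = (%x y. \<pi> (s x + s y)), smult = (%c x. \<pi> (scale_poly c (s x)))\<rparr>)"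

lemma subst_id: "f \<in> free_algebra ==> subst_poly (%x. mono [x]) f = f"
proof (rule poly_mapping_eqI)
 fix w assume f: "f \<in> free_algebra"
 have "coef (subst_poly (%x. mono [x]) f) w = ev (%v. of_bool (concat (map (%x. [x]) v) = w)) f"
  unfolding coef_eq_ev by (rule ev_word_subst[OF f]) simp
 then show "coef (subst_poly (%x. mono [x]) f) w = coef f w" unfolding coef_eq_ev[of f] by simp
qed

context
 fixes \<iota> :: "'f::field nc_poly => 'u" and I :: "'f nc_poly set"
 assumes inj: "inj \<iota>" and I: "T_ideal I"
begin

lemma quot_rep:
 assumes "f \<in> free_algebra"
 shows "quot_rep I f \<in> free_algebra" "quot_rep I f - f \<in> I"
proof -
 have "f \<in> free_algebra & f - f \<in> I" using assms nc.subspace_0[OF T_idealD(2)[OF I]] by simp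
 then have "quot_rep I f \<in> free_algebra & quot_rep I f - f \<in> I" unfolding quot_rep_def by (rule someI)
 then show "quot_rep I f \<in> free_algebra" "quot_rep I f - f \<in> I" by blast+
qed

lemma quot_rep_eq_iff:
 assumes "f \<in> free_algebra" "g \<in> free_algebra"
 shows "quot_rep I f = quot_rep I g \<longleftrightarrow> f - g \<in> I"
proof
 note S = T_idealD(2)[OF I]
 assume e: "quot_rep I f = quot_rep I g"
 have "(quot_rep I g - g) - (quot_rep I f - f) \<in> I" by (intro nc.subspace_diff S quot_rep(2) assms)
 then show "f - g \<in> I" by (simp add: e)
next
 note S = T_idealD(2)[OF I]
 assume d: "f - g \<in> I"
 have "h - f \<in> I \<longleftrightarrow> h - g \<in> I" for h
 proof
  assume "h - f \<in> I"
  from nc.subspace_add[OF S this d] show "h - g \<in> I" by simp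
 next
  assume "h - g \<in> I"
  from nc.subspace_diff[OF S this d] show "h - f \<in> I" by simp
 qed
 then show "quot_rep I f = quot_rep I g" by (simp add: quot_rep_def)
qed

lemma quot_alg_simps:
 "carrier (quot_alg \<iota> I) = (%f. \<iota> (quot_rep I f)) ` free_algebra" "zero (quot_alg \<iota> I) = \<iota> (quot_rep I 0)"
 "add (quot_alg \<iota> I) (\<iota> x) (\<iota> y) = \<iota> (quot_rep I (x + y))" "mult (quot_alg \<iota> I) (\<iota> x) (\<iota> y) = \<iota> (quot_rep I (x * y))"
 "smult (quot_alg \<iota> I) c (\<iota> x) = \<iota> (quot_rep I (scale_poly c x))"
 by (simp_all add: quot_alg_def Let_def inv_f_f[OF inj])

lemma quot_hom: "alg_hom free_alg (quot_alg \<iota> I) (%f. \<iota> (quot_rep I f))"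
 unfolding alg_hom_def free_alg_simps
proof (intro conjI ballI allI)
 note S = T_idealD(2)[OF I]
 fix x y :: "'f nc_poly" and c
 assume x: "x \<in> free_algebra"
 note X = quot_rep[OF x]
 show "\<iota> (quot_rep I x) \<in> carrier (quot_alg \<iota> I)" using x by (simp add: quot_alg_simps)
 show "\<iota> (quot_rep I (scale_poly c x)) = c \<odot>\<^bsub>quot_alg \<iota> I\<^esub> \<iota> (quot_rep I x)"
 proof -
  have "scale_poly c (quot_rep I x - x) \<in> I" by (intro nc.subspace_scale S X)
  then have "scale_poly c (quot_rep I x) - scale_poly c x \<in> I" by (simp add: nc.scale_right_diff_distrib)
  then show ?thesis unfolding quot_alg_simps
   using quot_rep_eq_iff[OF free_algebra_closed(5)[OF X(1)] free_algebra_closed(5)[OF x], of c c] by simp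
 qed
 assume y: "y \<in> free_algebra"
 note Y = quot_rep[OF y]
 show "\<iota> (quot_rep I (x + y)) = \<iota> (quot_rep I x) \<oplus>\<^bsub>quot_alg \<iota> I\<^esub> \<iota> (quot_rep I y)"
 proof -
  have "(quot_rep I x - x) + (quot_rep I y - y) \<in> I" by (intro nc.subspace_add S X Y)
  then have "(quot_rep I x + quot_rep I y) - (x + y) \<in> I" by (simp add: algebra_simps)
  then show ?thesis unfolding quot_alg_simps
   using quot_rep_eq_iff[OF free_algebra_closed(2)[OF X(1) Y(1)] free_algebra_closed(2)[OF x y]] by simp
 qed
 show "\<iota> (quot_rep I (x * y)) = \<iota> (quot_rep I x) \<otimes>\<^bsub>quot_alg \<iota> I\<^esub> \<iota> (quot_rep I y)"
 proof -
  have "(quot_rep I x - x) * quot_rep I y + x * (quot_rep I y - y) \<in> I"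
   by (intro nc.subspace_add S T_idealD(3)[OF I X(2) Y(1)] T_idealD(4)[OF I Y(2) x])
  then have "quot_rep I x * quot_rep I y - x * y \<in> I" by (simp add: algebra_simps)
  then show ?thesis unfolding quot_alg_simps
   using quot_rep_eq_iff[OF free_mult[OF X(1) Y(1)] free_mult[OF x y]] by simp
 qed
qed

lemma assoc_quot_alg: "assoc_algebra (quot_alg \<iota> I)"
 by (rule assoc_algebra_hom_image[OF assoc_algebra_free_alg quot_hom]) (simp_all add: quot_alg_simps)

text \<open>The classes of the variables are generic elements, so an identity of the quotient lies
  in \<open>I\<close>. Conversely, any assignment lifts to a substitution in the free algebra, and
  \<open>I\<close> is closed under substitutions.\<close>

lemma identities_quot_alg: "identities (quot_alg \<iota> I) = I"
proof
 let ?\<pi> = "%f. \<iota> (quot_rep I f)"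
 have z: "?\<pi> f = zero (quot_alg \<iota> I) \<longleftrightarrow> f \<in> I" if "f \<in> free_algebra" for f
  unfolding quot_alg_simps inj_eq[OF inj] using quot_rep_eq_iff[OF that free_algebra_closed(1)] by simp
 have e: "poly_eval (quot_alg \<iota> I) (%x. ?\<pi> (\<sigma> x)) f = ?\<pi> (subst_poly \<sigma> f)" if "range \<sigma> \<subseteq> free_algebra" for \<sigma> f
  by (rule hom_poly_eval(2)[OF assoc_algebra_free_alg assoc_quot_alg quot_hom, symmetric]) (use that in simp)
 show "identities (quot_alg \<iota> I) \<subseteq> I"
 proof
  fix f assume f: "f \<in> identities (quot_alg \<iota> I)"
  then have ff: "f \<in> free_algebra" by (simp add: identities_def)
  have r: "range (%x. mono [x]) \<subseteq> (free_algebra :: 'f nc_poly set)" by auto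
  have "range (%x. ?\<pi> (mono [x])) \<subseteq> carrier (quot_alg \<iota> I)" unfolding quot_alg_simps by auto
  then have "poly_eval (quot_alg \<iota> I) (%x. ?\<pi> (mono [x])) f = zero (quot_alg \<iota> I)" using f by (simp add: identities_def)
  then show "f \<in> I" unfolding e[OF r] subst_id[OF ff] z[OF ff] .
 qed
 show "I \<subseteq> identities (quot_alg \<iota> I)"
 proof
  fix f assume f: "f \<in> I"
  have "poly_eval (quot_alg \<iota> I) a f = zero (quot_alg \<iota> I)" if a: "range a \<subseteq> carrier (quot_alg \<iota> I)" for a
  proof -
   define \<sigma> where "\<sigma> x = inv_into free_algebra ?\<pi> (a x)" for x
   have ax: "a x \<in> ?\<pi> ` free_algebra" for x using a unfolding quot_alg_simps by auto
   have s: "range \<sigma> \<subseteq> free_algebra" unfolding \<sigma>_def using inv_into_into[OF ax] by blast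
   have "a = (%x. ?\<pi> (\<sigma> x))" unfolding \<sigma>_def by (rule ext) (rule f_inv_into_f[OF ax, symmetric])
   moreover have "subst_poly \<sigma> f \<in> I" by (rule T_idealD(5)[OF I f s])
   ultimately show ?thesis using e[OF s, of f] z[of "subst_poly \<sigma> f"] T_idealD(1)[OF I] by auto
  qed
  then show "f \<in> identities (quot_alg \<iota> I)" using f T_idealD(1)[OF I] by (auto simp: identities_def)
 qed
qed

lemma nilpotent_quot_alg:
 assumes "deg_ge k \<subseteq> I" "1 <= k"
 shows "nilpotent_algebra (quot_alg \<iota> I)"
 unfolding nilpotent_algebra_def
proof (intro conjI exI[of _ k] allI impI)
 let ?\<pi> = "%f. \<iota> (quot_rep I f)"
 interpret Q: assoc_algebra "quot_alg \<iota> I" by (rule assoc_quot_alg)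
 fix xs assume xs: "length xs = k & set xs \<subseteq> carrier (quot_alg \<iota> I)"
 have l: "list_mult (quot_alg \<iota> I) (map ?\<pi> gs) = ?\<pi> (list_mult free_alg gs)"
  if "set gs \<subseteq> free_algebra" "gs ~= []" for gs
  using that
 proof (induction gs)
  case (Cons g gs)
  show ?case
  proof (cases "gs = []")
   case False
   have "list_mult free_alg gs \<in> free_algebra" using fa.list_mult_closed[of gs] Cons.prems by simp
   then show ?thesis using False Cons quot_hom by (simp add: Q.list_mult_Cons fa.list_mult_Cons alg_hom_def)
  qed simp
 qed simp
 obtain gs where gs: "set gs \<subseteq> free_algebra" "xs = map ?\<pi> gs"
 proof -
  have "\<exists>gs. set gs \<subseteq> free_algebra & xs = map ?\<pi> gs" using xs[THEN conjunct2] unfolding quot_alg_simps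
  proof (induction xs)
   case (Cons x xs)
   then obtain gs where "set gs \<subseteq> free_algebra" "xs = map ?\<pi> gs" by auto
   moreover obtain g where "g \<in> free_algebra" "x = ?\<pi> g" using Cons.prems by auto
   ultimately show ?case by (intro exI[of _ "g # gs"]) simp
  qed simp
  then show ?thesis using that by (elim exE conjE)
 qed
 have gne: "gs ~= []" "length gs = k" using xs gs(2) assms(2) by auto
 have "list_mult free_alg gs \<in> I" using deg_ge_list_mult[OF gne(1) gs(1)] gne(2) assms(1) by auto
 moreover have "list_mult free_alg gs \<in> free_algebra" using calculation T_idealD(1)[OF I] by auto
 ultimately have "quot_rep I (list_mult free_alg gs) = quot_rep I 0"
  using quot_rep_eq_iff[OF _ free_algebra_closed(1)] by simp
 then show "list_mult (quot_alg \<iota> I) xs = zero (quot_alg \<iota> I)" unfolding gs(2) l[OF gs(1) gne(1)] quot_alg_simps by simp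
qed (rule assoc_quot_alg assms(2))+

end

lemma nilpotent_multilinear:
 fixes N :: "('f::field, 'a) module"
 assumes "nilpotent_algebra N"
 shows "\<exists>k. \<forall>n\<ge>k. multilinear_polys n \<subseteq> identities N"
proof -
 obtain k where k: "1 <= k" "\<And>xs. length xs = k ==> set xs \<subseteq> carrier N ==> list_mult N xs = \<zero>\<^bsub>N\<^esub>"
  and N: "assoc_algebra N" using assms unfolding nilpotent_algebra_def by blast
 interpret assoc_algebra N by fact
 have long: "list_mult N xs = \<zero>\<^bsub>N\<^esub>" if "k <= length xs" "set xs \<subseteq> carrier N" for xs
 proof (cases "length xs = k")
  case False
  have s: "set (take k xs) \<subseteq> carrier N" "set (drop k xs) \<subseteq> carrier N"
   using that(2) set_take_subset[of k xs] set_drop_subset[of k xs] by auto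
  have "list_mult N (take k xs @ drop k xs) = list_mult N (take k xs) \<otimes>\<^bsub>N\<^esub> list_mult N (drop k xs)"
   by (rule list_mult_append[OF s]) (use that k(1) False in auto)
  also have "list_mult N (take k xs) = \<zero>\<^bsub>N\<^esub>" by (rule k(2)) (use that s in auto)
  finally show ?thesis using mult_zero_left[OF list_mult_closed[OF s(2)]] by simp
 qed (use k(2) that in simp)
 show ?thesis
 proof (intro exI[of _ k] allI impI subsetI)
  fix n and f :: "'f nc_poly" assume n: "k <= n" and f: "f \<in> multilinear_polys n"
  have "poly_eval N a f = \<zero>\<^bsub>N\<^esub>" if a: "range a \<subseteq> carrier N" for a
  proof -
   have "coef f w \<odot>\<^bsub>N\<^esub> list_mult N (map a w) = \<zero>\<^bsub>N\<^esub>" if w: "w \<in> supp f" for w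
   proof -
    have dw: "distinct w" "set w = {..<n}" using f w by (auto simp: multilinear_polys_def)
    have "length w = n" using distinct_card[OF dw(1)] unfolding dw(2) by simp
    moreover have "set (map a w) \<subseteq> carrier N" using a by auto
    ultimately have "list_mult N (map a w) = \<zero>\<^bsub>N\<^esub>" using n by (intro long) auto
    then show ?thesis by (simp add: scale_zero_right)
   qed
   then have "poly_eval N a f = (\<Oplus>\<^bsub>N\<^esub>w\<in>supp f. \<zero>\<^bsub>N\<^esub>)" unfolding poly_eval_def by (intro finsum_cong') auto
   then show ?thesis by simp
  qed
  then show "f \<in> identities N" using f by (auto simp: identities_def multilinear_polys_def)
 qed
qed

section \<open>Identities of nilpotent algebras' companions: direct sums and their factors\<close>

lemma direct_sum2_simps [simp]:
 "carrier (direct_sum2 A B) = carrier A \<times> carrier B" "zero (direct_sum2 A B) = (\<zero>\<^bsub>A\<^esub>, \<zero>\<^bsub>B\<^esub>)"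
 "add (direct_sum2 A B) (x, y) (x', y') = (x \<oplus>\<^bsub>A\<^esub> x', y \<oplus>\<^bsub>B\<^esub> y')"
 "mult (direct_sum2 A B) (x, y) (x', y') = (x \<otimes>\<^bsub>A\<^esub> x', y \<otimes>\<^bsub>B\<^esub> y')"
 "smult (direct_sum2 A B) c (x, y) = (c \<odot>\<^bsub>A\<^esub> x, c \<odot>\<^bsub>B\<^esub> y)"
 by (simp_all add: direct_sum2_def)

lemma assoc_direct_sum2:
 fixes A :: "('f::field, 'a) module" and B :: "('f, 'b) module"
 assumes "assoc_algebra A" "assoc_algebra B"
 shows "assoc_algebra (direct_sum2 A B)"
proof -
 interpret A: assoc_algebra A by fact
 interpret B: assoc_algebra B by fact
 interpret abelian_group "direct_sum2 A B"
 proof (rule abelian_groupI)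
  fix x assume "x \<in> carrier (direct_sum2 A B)"
  then obtain a b where x: "x = (a, b)" "a \<in> carrier A" "b \<in> carrier B" by auto
  then show "\<exists>y\<in>carrier (direct_sum2 A B). y \<oplus>\<^bsub>direct_sum2 A B\<^esub> x = \<zero>\<^bsub>direct_sum2 A B\<^esub>"
   by (intro bexI[of _ "(\<ominus>\<^bsub>A\<^esub> a, \<ominus>\<^bsub>B\<^esub> b)"]) (auto simp: A.l_neg B.l_neg)
 qed (auto simp: A.a_ac B.a_ac)
 show ?thesis
  by standard (auto simp: A.mult_closed B.mult_closed A.mult_assoc B.mult_assoc A.mult_l_distr B.mult_l_distr
    A.mult_r_distr B.mult_r_distr A.scale_closed B.scale_closed A.scale_l_distr B.scale_l_distr
    A.scale_r_distr B.scale_r_distr A.scale_scale B.scale_scale A.scale_one B.scale_one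
    A.scale_mult_left B.scale_mult_left A.scale_mult_right B.scale_mult_right)
qed

lemma identities_direct_sum2:
 fixes A :: "('f::field, 'a) module" and B :: "('f, 'b) module"
 assumes "assoc_algebra A" "assoc_algebra B"
 shows "identities (direct_sum2 A B) = identities A \<inter> identities B"
proof -
 let ?D = "direct_sum2 A B"
 interpret A: assoc_algebra A by fact
 interpret B: assoc_algebra B by fact
 have D: "assoc_algebra ?D" by (rule assoc_direct_sum2[OF assms])
 interpret D: assoc_algebra ?D by fact
 have hA: "alg_hom ?D A fst" and hB: "alg_hom ?D B snd" by (auto simp: alg_hom_def)
 have e: "fst (poly_eval ?D a f) = poly_eval A (%x. fst (a x)) f" "snd (poly_eval ?D a f) = poly_eval B (%x. snd (a x)) f"
  if "range a \<subseteq> carrier ?D" for a f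
  by (rule hom_poly_eval(2)[OF D assms(1) hA that] hom_poly_eval(2)[OF D assms(2) hB that])+
 show ?thesis
 proof (intro equalityI subsetI)
  fix f assume f: "f \<in> identities ?D"
  have "poly_eval A a f = \<zero>\<^bsub>A\<^esub>" if a: "range a \<subseteq> carrier A" for a
  proof -
   have r: "range (%x. (a x, \<zero>\<^bsub>B\<^esub>)) \<subseteq> carrier ?D" using a by auto
   then have "poly_eval ?D (%x. (a x, \<zero>\<^bsub>B\<^esub>)) f = \<zero>\<^bsub>?D\<^esub>" using f by (simp add: identities_def)
   then show ?thesis using e(1)[OF r, of f] by simp
  qed
  moreover have "poly_eval B a f = \<zero>\<^bsub>B\<^esub>" if a: "range a \<subseteq> carrier B" for a
  proof -
   have r: "range (%x. (\<zero>\<^bsub>A\<^esub>, a x)) \<subseteq> carrier ?D" using a by auto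
   then have "poly_eval ?D (%x. (\<zero>\<^bsub>A\<^esub>, a x)) f = \<zero>\<^bsub>?D\<^esub>" using f by (simp add: identities_def)
   then show ?thesis using e(2)[OF r, of f] by simp
  qed
  ultimately show "f \<in> identities A \<inter> identities B" using f by (simp add: identities_def)
 next
  fix f assume f: "f \<in> identities A \<inter> identities B"
  have "poly_eval ?D a f = \<zero>\<^bsub>?D\<^esub>" if a: "range a \<subseteq> carrier ?D" for a
  proof -
   have "range (%x. fst (a x)) \<subseteq> carrier A" "range (%x. snd (a x)) \<subseteq> carrier B"
    using a by (auto simp: image_subset_iff mem_Times_iff)
   then have "fst (poly_eval ?D a f) = \<zero>\<^bsub>A\<^esub>" "snd (poly_eval ?D a f) = \<zero>\<^bsub>B\<^esub>"
    unfolding e[OF a] using f by (simp_all add: identities_def)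
   then show ?thesis by (simp add: prod_eq_iff)
  qed
  then show "f \<in> identities ?D" using f by (simp add: identities_def)
 qed
qed

lemma direct_sum_set_simps:
 "carrier (direct_sum_set S) = (\<Pi>\<^sub>E M\<in>S. carrier M)" "zero (direct_sum_set S) = (\<lambda>M\<in>S. \<zero>\<^bsub>M\<^esub>)"
 "add (direct_sum_set S) g h = (\<lambda>M\<in>S. g M \<oplus>\<^bsub>M\<^esub> h M)" "mult (direct_sum_set S) g h = (\<lambda>M\<in>S. g M \<otimes>\<^bsub>M\<^esub> h M)"
 "smult (direct_sum_set S) c g = (\<lambda>M\<in>S. c \<odot>\<^bsub>M\<^esub> g M)"
 by (simp_all add: direct_sum_set_def)

lemma assoc_direct_sum_set:
 fixes S :: "('f::field, 'a) module set"
 assumes "\<And>M. M \<in> S ==> assoc_algebra M"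
 shows "assoc_algebra (direct_sum_set S)"
proof -
 let ?D = "direct_sum_set S"
 have c: "g M \<in> carrier M" if "g \<in> carrier ?D" "M \<in> S" for g M
  using that unfolding direct_sum_set_simps by (rule PiE_mem)
 have eq: "g = h" if "g \<in> extensional S" "h \<in> extensional S" "\<And>M. M \<in> S ==> g M = h M" for g h :: "('f, 'a) module => 'a"
  by (rule extensionalityI[OF that])
 have ext: "g \<in> extensional S" if "g \<in> carrier ?D" for g
  using that unfolding direct_sum_set_simps by (simp add: PiE_def)
 have mem: "(\<lambda>M\<in>S. k M) \<in> carrier ?D" if "\<And>M. M \<in> S ==> k M \<in> carrier M" for k
  unfolding direct_sum_set_simps using that by auto
 note AG = assoc_algebra.axioms(1)[OF assms]
 note AM = abelian_group.axioms(1)[OF AG]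
 interpret abelian_group ?D
 proof (rule abelian_groupI)
  fix x assume x: "x \<in> carrier ?D"
  have inv: "(\<lambda>M\<in>S. \<ominus>\<^bsub>M\<^esub> x M) \<in> carrier ?D"
   by (rule mem) (rule abelian_group.a_inv_closed[OF AG c[OF x]])
  have "(\<lambda>M\<in>S. \<ominus>\<^bsub>M\<^esub> x M) \<oplus>\<^bsub>?D\<^esub> x = \<zero>\<^bsub>?D\<^esub>"
   unfolding direct_sum_set_simps by (rule restrict_ext) (simp add: abelian_group.l_neg[OF AG c[OF x]])
  then show "\<exists>y\<in>carrier ?D. y \<oplus>\<^bsub>?D\<^esub> x = \<zero>\<^bsub>?D\<^esub>" using inv by blast
  show "\<zero>\<^bsub>?D\<^esub> \<oplus>\<^bsub>?D\<^esub> x = x"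
   by (rule eq[OF _ ext[OF x]]) (simp_all add: direct_sum_set_simps abelian_monoid.l_zero[OF AM c[OF x]])
  fix y assume y: "y \<in> carrier ?D"
  show "x \<oplus>\<^bsub>?D\<^esub> y \<in> carrier ?D" unfolding direct_sum_set_simps(3)
   by (rule mem) (rule abelian_monoid.a_closed[OF AM c[OF x] c[OF y]])
  show "x \<oplus>\<^bsub>?D\<^esub> y = y \<oplus>\<^bsub>?D\<^esub> x" unfolding direct_sum_set_simps(3)
   by (rule restrict_ext) (rule abelian_monoid.a_comm[OF AM c[OF x] c[OF y]])
  fix z assume z: "z \<in> carrier ?D"
  show "x \<oplus>\<^bsub>?D\<^esub> y \<oplus>\<^bsub>?D\<^esub> z = x \<oplus>\<^bsub>?D\<^esub> (y \<oplus>\<^bsub>?D\<^esub> z)" unfolding direct_sum_set_simps(3)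
   by (rule restrict_ext) (simp add: abelian_monoid.a_assoc[OF AM c[OF x] c[OF y] c[OF z]])
 next
  show "\<zero>\<^bsub>?D\<^esub> \<in> carrier ?D" unfolding direct_sum_set_simps(2)
   by (rule mem) (rule abelian_monoid.zero_closed[OF AM])
 qed
 show ?thesis
 proof
  fix x and s t :: 'f assume x: "x \<in> carrier ?D"
  show "s \<odot>\<^bsub>?D\<^esub> x \<in> carrier ?D" unfolding direct_sum_set_simps(5)
   by (rule mem) (rule assoc_algebra.scale_closed[OF assms c[OF x]])
  show "(s + t) \<odot>\<^bsub>?D\<^esub> x = s \<odot>\<^bsub>?D\<^esub> x \<oplus>\<^bsub>?D\<^esub> t \<odot>\<^bsub>?D\<^esub> x"
   unfolding direct_sum_set_simps(3,5)
   by (rule restrict_ext) (simp add: assoc_algebra.scale_l_distr[OF assms c[OF x]])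
  show "(s * t) \<odot>\<^bsub>?D\<^esub> x = s \<odot>\<^bsub>?D\<^esub> (t \<odot>\<^bsub>?D\<^esub> x)"
   unfolding direct_sum_set_simps(5)
   by (rule restrict_ext) (simp add: assoc_algebra.scale_scale[OF assms c[OF x]])
  show "1 \<odot>\<^bsub>?D\<^esub> x = x"
   by (rule eq[OF _ ext[OF x]]) (simp_all add: direct_sum_set_simps(5) assoc_algebra.scale_one[OF assms c[OF x]])
  fix y assume y: "y \<in> carrier ?D"
  show "x \<otimes>\<^bsub>?D\<^esub> y \<in> carrier ?D" unfolding direct_sum_set_simps(4)
   by (rule mem) (rule assoc_algebra.mult_closed[OF assms c[OF x] c[OF y]])
  show "s \<odot>\<^bsub>?D\<^esub> (x \<oplus>\<^bsub>?D\<^esub> y) = s \<odot>\<^bsub>?D\<^esub> x \<oplus>\<^bsub>?D\<^esub> s \<odot>\<^bsub>?D\<^esub> y"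
   unfolding direct_sum_set_simps(3,5)
   by (rule restrict_ext) (simp add: assoc_algebra.scale_r_distr[OF assms c[OF x] c[OF y]])
  show "s \<odot>\<^bsub>?D\<^esub> x \<otimes>\<^bsub>?D\<^esub> y = s \<odot>\<^bsub>?D\<^esub> (x \<otimes>\<^bsub>?D\<^esub> y)"
   unfolding direct_sum_set_simps(4,5)
   by (rule restrict_ext) (simp add: assoc_algebra.scale_mult_left[OF assms c[OF x] c[OF y]])
  show "x \<otimes>\<^bsub>?D\<^esub> (s \<odot>\<^bsub>?D\<^esub> y) = s \<odot>\<^bsub>?D\<^esub> (x \<otimes>\<^bsub>?D\<^esub> y)"
   unfolding direct_sum_set_simps(4,5)
   by (rule restrict_ext) (simp add: assoc_algebra.scale_mult_right[OF assms c[OF x] c[OF y]])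
  fix z assume z: "z \<in> carrier ?D"
  show "x \<otimes>\<^bsub>?D\<^esub> y \<otimes>\<^bsub>?D\<^esub> z = x \<otimes>\<^bsub>?D\<^esub> (y \<otimes>\<^bsub>?D\<^esub> z)"
   unfolding direct_sum_set_simps(4)
   by (rule restrict_ext) (simp add: assoc_algebra.mult_assoc[OF assms c[OF x] c[OF y] c[OF z]])
  show "(x \<oplus>\<^bsub>?D\<^esub> y) \<otimes>\<^bsub>?D\<^esub> z = x \<otimes>\<^bsub>?D\<^esub> z \<oplus>\<^bsub>?D\<^esub> y \<otimes>\<^bsub>?D\<^esub> z"
   unfolding direct_sum_set_simps(3,4)
   by (rule restrict_ext) (simp add: assoc_algebra.mult_l_distr[OF assms c[OF x] c[OF y] c[OF z]])
  show "z \<otimes>\<^bsub>?D\<^esub> (x \<oplus>\<^bsub>?D\<^esub> y) = z \<otimes>\<^bsub>?D\<^esub> x \<oplus>\<^bsub>?D\<^esub> z \<otimes>\<^bsub>?D\<^esub> y"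
   unfolding direct_sum_set_simps(3,4)
   by (rule restrict_ext) (simp add: assoc_algebra.mult_r_distr[OF assms c[OF x] c[OF y] c[OF z]])
 qed
qed

lemma identities_direct_sum_set:
 fixes S :: "('f::field, 'a) module set"
 assumes S: "\<And>M. M \<in> S ==> assoc_algebra M"
 shows "identities (direct_sum_set S) = {f \<in> free_algebra. \<forall>M\<in>S. f \<in> identities M}"
proof -
 let ?D = "direct_sum_set S"
 have D: "assoc_algebra ?D" by (rule assoc_direct_sum_set[OF S])
 interpret D: assoc_algebra ?D by fact
 have h: "alg_hom ?D M (%g. g M)" if M: "M \<in> S" for M
  unfolding alg_hom_def direct_sum_set_simps using M by (auto simp: PiE_mem)
 have e: "poly_eval ?D a f M = poly_eval M (%x. a x M) f" if "range a \<subseteq> carrier ?D" "M \<in> S" for a f M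
  by (rule hom_poly_eval(2)[OF D S[OF that(2)] h[OF that(2)] that(1)])
 show ?thesis
 proof (intro equalityI subsetI)
  fix f assume f: "f \<in> identities ?D"
  have "f \<in> identities M" if M: "M \<in> S" for M
  proof -
   have "poly_eval M a f = \<zero>\<^bsub>M\<^esub>" if a: "range a \<subseteq> carrier M" for a
   proof -
    define b where "b x = (\<lambda>M'\<in>S. if M' = M then a x else \<zero>\<^bsub>M'\<^esub>)" for x
    have "b x \<in> carrier ?D" for x
     unfolding b_def direct_sum_set_simps
    proof (rule restrict_PiE_iff[THEN iffD2], rule ballI)
     fix M' assume M': "M' \<in> S"
     interpret M': assoc_algebra M' by (rule S[OF M'])
     show "(if M' = M then a x else \<zero>\<^bsub>M'\<^esub>) \<in> carrier M'" using a by auto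
    qed
    then have r: "range b \<subseteq> carrier ?D" by blast
    have "poly_eval ?D b f = \<zero>\<^bsub>?D\<^esub>" using f r by (simp add: identities_def)
    moreover have "(%x. b x M) = a" using M by (simp add: b_def)
    ultimately show ?thesis using e[OF r M, of f] M by (simp add: direct_sum_set_simps(2))
   qed
   then show ?thesis using f by (simp add: identities_def)
  qed
  then show "f \<in> {f \<in> free_algebra. \<forall>M\<in>S. f \<in> identities M}" using f by (simp add: identities_def)
 next
  fix f assume f: "f \<in> {f \<in> free_algebra. \<forall>M\<in>S. f \<in> identities M}"
  have "poly_eval ?D a f = \<zero>\<^bsub>?D\<^esub>" if a: "range a \<subseteq> carrier ?D" for a
  proof (rule extensionalityI[of _ S])
   show "poly_eval ?D a f \<in> extensional S" using D.poly_eval_closed[OF a, of f] by (simp add: direct_sum_set_simps(1) PiE_def)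
   show "\<zero>\<^bsub>?D\<^esub> \<in> extensional S" by (simp add: direct_sum_set_simps(2))
   fix M assume M: "M \<in> S"
   have "range (%x. a x M) \<subseteq> carrier M" using h[OF M] a by (auto simp: alg_hom_def)
   then have "poly_eval M (%x. a x M) f = \<zero>\<^bsub>M\<^esub>" using f M by (simp add: identities_def)
   then show "poly_eval ?D a f M = \<zero>\<^bsub>?D\<^esub> M" using e[OF a M] M by (simp add: direct_sum_set_simps(2))
  qed
  then show "f \<in> identities ?D" using f by (simp add: identities_def)
 qed
qed

text \<open>\<open>T\<close> consists of the identities common to all members of \<open>V\<close>.
  It is a T-ideal because it is the set of identities of one algebra, the product of all members;
  \<open>direct_sum_set\<close> over an infinite index set is the full product.\<close>

lemma variety_generated_by_quotient:
 fixes V :: "('f::field, 'u) module set"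
 assumes inj: "inj (\<iota> :: 'f nc_poly => 'u)" and V: "is_variety V"
 obtains T where "T_ideal T" "V = {B. assoc_algebra B & T \<subseteq> identities B}"
proof -
 obtain \<Sigma> where \<Sigma>: "\<Sigma> \<subseteq> free_algebra" "V = {B. assoc_algebra B & \<Sigma> \<subseteq> identities B}"
  using V unfolding is_variety_def by (elim exE conjE) (rule that)
 have assoc: "assoc_algebra B" if "B \<in> V" for B using that \<Sigma>(2) by simp
 define T where "T = {f \<in> free_algebra. \<forall>B\<in>V. f \<in> identities B}"
 have "T_ideal T"
 proof -
  have "assoc_algebra (direct_sum_set V)" by (rule assoc_direct_sum_set) (rule assoc)
  moreover have "identities (direct_sum_set V) = T" unfolding T_def by (rule identities_direct_sum_set) (rule assoc)
  ultimately show ?thesis using T_ideal_identities by metis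
 qed
 moreover have "V = {B. assoc_algebra B & T \<subseteq> identities B}"
 proof (intro equalityI subsetI)
  fix B assume "B \<in> V"
  then show "B \<in> {B. assoc_algebra B & T \<subseteq> identities B}" using assoc by (auto simp: T_def)
 next
  fix B :: "('f, 'u) module" assume B: "B \<in> {B. assoc_algebra B & T \<subseteq> identities B}"
  have "\<Sigma> \<subseteq> T"
  proof
   fix f assume f: "f \<in> \<Sigma>"
   have "f \<in> identities B'" if "B' \<in> V" for B' using that f unfolding \<Sigma>(2) by auto
   then show "f \<in> T" using f \<Sigma>(1) by (auto simp: T_def)
  qed
  then show "B \<in> V" using B unfolding \<Sigma>(2) by auto
 qed
 ultimately show ?thesis by (rule that)
qed

text \<open>The relatively free algebra, moved into the universe by \<open>\<iota>\<close>, is a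
  member of \<open>V\<close> with identities exactly \<open>T\<close>. Hence every generator of
  \<open>V\<close> has the identities \<open>T\<close>, and the description in
  \<open>codim_variety\<close> picks out a unique number.\<close>

lemma codim_variety_eq:
 fixes V :: "('f::field, 'u) module set"
 assumes inj: "inj (\<iota> :: 'f nc_poly => 'u)" and T: "T_ideal T" and V: "V = {B. assoc_algebra B & T \<subseteq> identities B}"
 shows "codim_variety V n = codim_T T n"
 unfolding codim_variety_def
proof (rule the_equality)
 let ?R = "quot_alg \<iota> T"
 have R: "assoc_algebra ?R" "identities ?R = T" by (rule assoc_quot_alg[OF inj T] identities_quot_alg[OF inj T])+
 show "\<exists>A :: ('f, 'u) module. assoc_algebra A & V = variety_gen A & codim_T T n = codim A n"
  using R by (intro exI[of _ ?R]) (simp add: V variety_gen_def codim_eq)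
 fix c assume "\<exists>A :: ('f, 'u) module. assoc_algebra A & V = variety_gen A & c = codim A n"
 then obtain A :: "('f, 'u) module" where A: "assoc_algebra A" "V = variety_gen A" "c = codim A n"
  by (elim exE conjE) (rule that)
 have "?R \<in> V" "A \<in> variety_gen A" using R A(1) by (simp_all add: V variety_gen_def)
 then have "?R \<in> variety_gen A" "A \<in> V" using A(2) by simp_all
 then have "identities A = T" using R(2) by (auto simp: V variety_gen_def)
 then show "c = codim_T T n" using A(3) by (simp add: codim_eq)
qed

text \<open>If no quadratic model satisfied all of \<open>T\<close>, then in large degrees
  membership in \<open>T\<close> would be decided by the total and the counts of first and last
  letters. These are only \<open>1 + 2 * n\<close> functionals, too few for quadratic
  growth.\<close>

lemma quadratic_summand:
 fixes T :: "'f::field_char_0 nc_poly set"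
 assumes T: "T_ideal T" and a: "0 < (a :: real)" "\<And>n. n0 <= n ==> a * real n ^ 2 <= real (codim_T T n)"
  and large: "\<forall>n\<ge>n3. \<forall>f\<in>multilinear_polys n. word_count f (%w. True) = 0 -->
   (\<forall>M\<in>linear_family \<union> quadratic_family. T \<subseteq> identities M --> f \<in> identities M) --> f \<in> T"
 shows "\<exists>M\<in>quadratic_family. T \<subseteq> identities M"
proof (rule ccontr)
 assume n: "\<not> ?thesis"
 have up: "codim_T T n <= 1 + 2 * n" if "n3 <= n" for n
 proof -
  have "codim_T T n <= card (linear_index n)"
  proof (rule codim_T_upper[OF T_idealD(2)[OF T] card_linear_index(1), of _ _ "%t w. of_bool (model_functional t w)"])
   fix f :: "'f nc_poly" assume f: "f \<in> multilinear_polys n"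
    and "\<And>t. t \<in> linear_index n ==> ev (%w. of_bool (model_functional t w)) f = 0"
   then have z: "\<And>t. t \<in> linear_index n ==> word_count f (model_functional t) = 0" by (simp add: ev_model)
   have "f \<in> identities M" if "M \<in> linear_family \<union> quadratic_family" "T \<subseteq> identities M" for M
    by (rule linear_functionals_suffice[OF f z]) (use that n in auto)
   then show "f \<in> T" using large \<open>n3 <= n\<close> f linear_index_zero(1)[OF f z] by blast
  qed
  then show ?thesis using card_linear_index(2)[of n] by simp
 qed
 \<comment> \<open>Large enough for both bounds and for \<open>a * n > 3\<close>, while
   \<open>1 + 2 * n <= 3 * n\<close>.\<close>
 define n where "n = n0 + n3 + nat \<lceil>3 / a\<rceil> + 1"
 have "3 / a < real n" unfolding n_def by linarith
 then have an: "3 < a * real n" using a(1) by (simp add: field_simps)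
 have "a * real n ^ 2 <= real (1 + 2 * n)" using a(2)[of n] up[of n] by (simp add: n_def)
 also have "\<dots> <= 3 * real n" by (simp add: n_def)
 also have "\<dots> < (a * real n) * real n" using an by (intro mult_strict_right_mono) (auto simp: n_def)
 finally show False by (simp add: power2_eq_square)
qed

theorem theorem1p1:
  fixes V :: "('f::field_char_0, 'u) module set"
  assumes large_universe: "\<exists>\<iota> :: 'f nc_poly \<Rightarrow> 'u. inj \<iota>"
    and variety: "is_variety V"
  shows "quadratic_growth V \<longleftrightarrow>
    (\<exists>(N :: ('f, 'u) module) (S :: ('f, 'f mat) module set).
       nilpotent_algebra N \<and>
       S \<subseteq> linear_family \<union> quadratic_family \<and>
       S \<inter> quadratic_family \<noteq> {} \<and>
       V = variety_gen (direct_sum2 N (direct_sum_set S)))"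
proof
 obtain \<iota> :: "'f nc_poly => 'u" where inj: "inj \<iota>" using large_universe by (elim exE) (rule that)
 {
  assume growth: "quadratic_growth V"
  obtain T where T: "T_ideal T" and V: "V = {B. assoc_algebra B & T \<subseteq> identities B}"
   by (rule variety_generated_by_quotient[OF inj variety])
  from growth obtain a b :: real and n0 where ab: "0 < a"
   "\<forall>n\<ge>n0. a * real n ^ 2 <= real (codim_T T n) & real (codim_T T n) <= b * real n ^ 2"
   unfolding quadratic_growth_def growth_of_degree_def codim_variety_eq[OF inj T V]
   by (elim exE conjE) (rule that)
  have lower: "a * real n ^ 2 <= real (codim_T T n)" and upper: "real (codim_T T n) <= b * real n ^ 2" if "n0 <= n" for n
   using ab(2) that by simp_all
  have "\<exists>n1. \<forall>n\<ge>n1. codim_T T n < (n div 2) choose 3" by (rule quadratic_below_choose_three) (rule upper)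
  then obtain n1 where n1: "\<forall>n\<ge>n1. codim_T T n < (n div 2) choose 3" by (elim exE) (rule that)
  have mixed: "mixed_words n1 \<phi>" if "\<And>f. f \<in> T ==> ev \<phi> f = 0" for \<phi>
   by (rule mixed_words_of_codim[OF T that]) (use n1 in simp_all)
  have "\<exists>n3. \<forall>n\<ge>n3. \<forall>f\<in>multilinear_polys n. word_count f (%w. True) = 0 -->
   (\<forall>M\<in>linear_family \<union> quadratic_family. T \<subseteq> identities M --> f \<in> identities M) --> f \<in> T"
   by (rule large_multilinear[OF T]) (rule mixed)
  then obtain n3 where large: "\<forall>n\<ge>n3. \<forall>f\<in>multilinear_polys n. word_count f (%w. True) = 0 -->
   (\<forall>M\<in>linear_family \<union> quadratic_family. T \<subseteq> identities M --> f \<in> identities M) --> f \<in> T"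
   by (elim exE) (rule that)
  \<comment> \<open>All models that satisfy \<open>T\<close>; the direct sum has to reproduce
    exactly the conditions that \<open>T\<close> imposes in large degrees.\<close>
  define S where "S = {M \<in> linear_family \<union> quadratic_family. T \<subseteq> identities M}"
  obtain M where M: "M \<in> quadratic_family" "T \<subseteq> identities M"
   using quadratic_summand[OF T ab(1) lower large] by blast
  \<comment> \<open>From degree \<open>n3\<close> on the models determine \<open>T\<close>, so the
    nilpotent summand has to supply the degrees below. The maximum with 1 is there because
    nilpotency refers to nonempty products.\<close>
  define k where "k = max n3 1"
  define N where "N = quot_alg \<iota> (plus_deg_ge T k)"
  note I = T_ideal_plus_deg_ge[OF T, of k]
  have N: "nilpotent_algebra N" unfolding N_def
   by (rule nilpotent_quot_alg[OF inj I plus_deg_ge_sub(2)[OF T]]) (simp add: k_def)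
  have idN: "identities N = plus_deg_ge T k" unfolding N_def by (rule identities_quot_alg[OF inj I])
  have aN: "assoc_algebra N" using N by (simp add: nilpotent_algebra_def)
  have aS: "assoc_algebra M" if "M \<in> S" for M using that assoc_models by (auto simp: S_def)
  have aDS: "assoc_algebra (direct_sum_set S)" by (rule assoc_direct_sum_set) (rule aS)
  have idDS: "identities (direct_sum_set S) = {f \<in> free_algebra. \<forall>M\<in>S. f \<in> identities M}"
   by (rule identities_direct_sum_set) (rule aS)
  let ?D = "direct_sum2 N (direct_sum_set S)"
  have idD: "identities ?D = plus_deg_ge T k \<inter> {f \<in> free_algebra. \<forall>M\<in>S. f \<in> identities M}"
   unfolding identities_direct_sum2[OF aN aDS] idDS idN ..
  have "identities ?D = T"
  proof
   show "T \<subseteq> identities ?D" unfolding idD using plus_deg_ge_sub(1)[OF T] T_idealD(1)[OF T] by (auto simp: S_def)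
   have TD: "T_ideal (identities ?D)" by (rule T_ideal_identities[OF assoc_direct_sum2[OF aN aDS]])
   show "identities ?D \<subseteq> T"
   proof (rule T_ideal_eqI[OF TD T])
    fix n
    show "identities ?D \<inter> multilinear_polys n \<subseteq> T"
    proof
     fix f :: "'f nc_poly" assume "f \<in> identities ?D \<inter> multilinear_polys n"
     then have f: "f \<in> plus_deg_ge T k" "\<And>M. M \<in> S ==> f \<in> identities M" "f \<in> multilinear_polys n" by (simp_all add: idD)
     show "f \<in> T"
     proof (cases "n < k")
      case True
      then show ?thesis by (rule plus_deg_ge_multilinear[OF T f(1,3)])
     next
      case False
      then have "n3 <= n" by (simp add: k_def)
      moreover have "f \<in> identities M" using M f(2) by (simp add: S_def)
      \<comment> \<open>Every quadratic model sees the total of the coefficients, and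
        \<open>S\<close> contains one. This provides the hypothesis on the total in
        \<open>large\<close>.\<close>
      then have "word_count f (%w. True) = 0"
       using M(1) identities_A2[OF f(3)] identities_A4[OF f(3)] identities_A4_star[OF f(3)]
        identities_A5[OF f(3)] identities_A6[OF f(3)] by (auto simp: quadratic_family_def)
      moreover have "\<forall>M\<in>linear_family \<union> quadratic_family. T \<subseteq> identities M --> f \<in> identities M"
       using f(2) by (simp add: S_def)
      ultimately show ?thesis using large f(3) by blast
     qed
    qed
   qed
  qed
  then have "V = variety_gen ?D" by (simp add: V variety_gen_def)
  moreover have "S \<subseteq> linear_family \<union> quadratic_family" "S \<inter> quadratic_family ~= {}" using M by (auto simp: S_def)
  ultimately show "\<exists>(N :: ('f, 'u) module) (S :: ('f, 'f mat) module set). nilpotent_algebra N &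
    S \<subseteq> linear_family \<union> quadratic_family & S \<inter> quadratic_family ~= {} &
    V = variety_gen (direct_sum2 N (direct_sum_set S))"
   using N by (intro exI[of _ N] exI[of _ S] conjI)
 }
 assume "\<exists>(N :: ('f, 'u) module) (S :: ('f, 'f mat) module set). nilpotent_algebra N &
    S \<subseteq> linear_family \<union> quadratic_family & S \<inter> quadratic_family ~= {} &
    V = variety_gen (direct_sum2 N (direct_sum_set S))"
 then obtain N :: "('f, 'u) module" and S :: "('f, 'f mat) module set" where N: "nilpotent_algebra N"
  and S: "S \<subseteq> linear_family \<union> quadratic_family" "S \<inter> quadratic_family ~= {}"
  and gen: "V = variety_gen (direct_sum2 N (direct_sum_set S))"
  by (elim exE conjE) (rule that)
 let ?D = "direct_sum2 N (direct_sum_set S)"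
 define T where "T = identities ?D"
 have aN: "assoc_algebra N" using N by (simp add: nilpotent_algebra_def)
 have aS: "assoc_algebra M" if "M \<in> S" for M using that S(1) assoc_models by blast
 have aDS: "assoc_algebra (direct_sum_set S)" by (rule assoc_direct_sum_set) (rule aS)
 have idDS: "identities (direct_sum_set S) = {f \<in> free_algebra. \<forall>M\<in>S. f \<in> identities M}"
  by (rule identities_direct_sum_set) (rule aS)
 have T: "T_ideal T" unfolding T_def by (rule T_ideal_identities[OF assoc_direct_sum2[OF aN aDS]])
 have TS: "T = identities N \<inter> {f \<in> free_algebra. \<forall>M\<in>S. f \<in> identities M}"
  unfolding T_def identities_direct_sum2[OF aN aDS] idDS ..
 have V: "V = {B. assoc_algebra B & T \<subseteq> identities B}" unfolding gen variety_gen_def T_def ..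
 obtain k where k: "\<forall>n\<ge>k. multilinear_polys n \<subseteq> identities N"
  using nilpotent_multilinear[OF N] by (elim exE) (rule that)
 obtain M where M: "M \<in> S" "M \<in> quadratic_family" using S(2) by blast
 \<comment> \<open>From degree \<open>k\<close> on every multilinear polynomial is an identity of
   the nilpotent summand, so only the statistics of the models count.\<close>
 have upper: "codim_T T n <= 1 + 2 * n + 5 * n ^ 2" if "k <= n" for n
 proof -
  have "codim_T T n <= card (quadratic_index n)"
  proof (rule codim_T_upper[OF T_idealD(2)[OF T] card_quadratic_index(1), of _ _ "%t w. of_bool (model_functional t w)"])
   fix f :: "'f nc_poly" assume f: "f \<in> multilinear_polys n"
    and "\<And>t. t \<in> quadratic_index n ==> ev (%w. of_bool (model_functional t w)) f = 0"
   then have z: "\<And>t. t \<in> quadratic_index n ==> word_count f (model_functional t) = 0" by (simp add: ev_model)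
   have "f \<in> identities M" if "M \<in> S" for M
    by (rule quadratic_functionals_suffice[OF f z]) (use that S(1) in auto)
   moreover have "f \<in> identities N" "f \<in> free_algebra" using k \<open>k <= n\<close> f by (auto simp: multilinear_polys_def)
   ultimately show "f \<in> T" by (simp add: TS)
  qed
  then show ?thesis using card_quadratic_index(2)[of n] by simp
 qed
 have lower: "(n div 2) ^ 2 <= codim_T T n" for n
  by (rule quadratic_lower_bound[OF T_idealD(2)[OF T] _ M(2)]) (use M(1) in \<open>auto simp: TS\<close>)
 show "quadratic_growth V"
  unfolding quadratic_growth_def growth_of_degree_def codim_variety_eq[OF inj T V]
 \<comment> \<open>For \<open>n >= 2\<close> one has \<open>n <= 4 * (n div 2)\<close>, which gives
   the factor 1/16, and \<open>1 + 2 * n + 5 * n ^ 2 <= 8 * n ^ 2\<close>.\<close>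
 proof (rule exI[of _ "1 / 16"], rule exI[of _ 8], rule exI[of _ "k + 2"], intro conjI allI impI)
  fix n assume n: "k + 2 <= n"
  have "n <= 4 * (n div 2)" using n by simp
  then have "n ^ 2 <= (4 * (n div 2)) ^ 2" by (intro power_mono) auto
  also have "\<dots> <= 16 * codim_T T n" using lower[of n] by (simp add: power_mult_distrib)
  finally have "real (n ^ 2) <= real (16 * codim_T T n)" by (simp only: of_nat_le_iff)
  then show "1 / 16 * real n ^ 2 <= real (codim_T T n)" by simp
  have "1 <= n ^ 2" "n <= n ^ 2" using n by (simp_all add: power2_eq_square)
  then have "codim_T T n <= 8 * n ^ 2" using upper[of n] n by simp
  then have "real (codim_T T n) <= real (8 * n ^ 2)" by (simp only: of_nat_le_iff)
  then show "real (codim_T T n) <= 8 * real n ^ 2" by simp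
 qed simp_all
qed

end
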